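(* Suppose there exist a post-quantum injective one-way function and a private-key unclonable bit encryption scheme. Then any quantum state indistinguishability obfuscation scheme $(\mathsf{Obf},\mathsf{Eval})$ is also an unclonable puncturable obfuscation scheme satisfying generalized UPO security with respect to $\mathsf{Id}_{\mathcal U}$, for any generalized puncturable keyed circuit class $\mathcal{W}=\{\{W_s\}_{s\in\mathcal{K}_\lambda}\}_\lambda$ in $\mathsf{P/poly}$.
   Context: QPT means quantum polynomial time. **Quantum state indistinguishability obfuscation (qsiO).** A pair $(C,\rho)$ of a quantum circuit and a quantum state is a $(1-\varepsilon)$-implementation of a classical function $f$ if for every input $x$, running $C$ on $(\rho,x)$ outputs $f(x)$ with probability at least $1-\varepsilon$. A qsiO scheme consists of QPT $\mathsf{Obf}(1^\lambda,(C,\rho))$, outputting a quantum state $\tilde\rho$, and $\mathsf{Eval}(\tilde\rho,x)$, such that: (correctness) if $(C,\rho)$ is a $(1-\mathsf{negl}(\lambda))$-implementation of $f$, then $\mathsf{Eval}(\tilde\rho,x)$ outputs $f(x)$ except with negligible probability for every $x$; (security) for any two same-size $(1-\mathsf{negl}(\lambda))$-implementations $(C_0,\rho_0)$, $(C_1,\rho_1)$ of the same function, $\mathsf{Obf}(1^\lambda,(C_0,\rho_0))$ and $\mathsf{Obf}(1^\lambda,(C_1,\rho_1))$ are indistinguishable to QPT adversaries. A classical circuit is obfuscated by taking $\rho$ trivial. **Private-key unclonable bit encryption.** QPT algorithms $\mathsf{Gen}(1^\lambda)\to sk$, $\mathsf{Enc}(sk,m)\to\rho$ (quantum ciphertext,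 $m\in\{0,1\}$), $\mathsf{Dec}(sk,\rho)\to m'$; correctness: $m'=m$ except with negligible probability. Security (unclonable indistinguishability): for every QPT $(\mathcal{A},\mathcal{B},\mathcal{C})$ the following outputs 1 with probability at most $\frac12+\mathsf{negl}(\lambda)$: $sk\leftarrow\mathsf{Gen}(1^\lambda)$; $\mathcal{A}$ sends $(m_0,m_1)$; the challenger picks uniform $b$ and sends $\mathsf{Enc}(sk,m_b)$ to $\mathcal{A}$; $\mathcal{A}$ outputs a bipartite state $\sigma$; $(\mathcal{B}(sk,\cdot)\otimes\mathcal{C}(sk,\cdot))(\sigma)$ gives $(b^{\mathcal B},b^{\mathcal C})$; output 1 iff $b^{\mathcal B}=b^{\mathcal C}=b$. **Keyed circuit class.** $\mathcal{W}=\{\mathcal{W}_\lambda\}$, $\mathcal{W}_\lambda=\{W_s:s\in\mathcal{K}_\lambda\}$, polynomial-size classical circuits of the same size, input length $n(\lambda)$, output length $m(\lambda)$. It is *generalized puncturable* if equipped with an efficient $\mathsf{GenPuncture}$ which on $s$, points $x^{\mathcal B},x^{\mathcal C}$ and poly-size circuits $\mu_{\mathcal B},\mu_{\mathcal C}:\{0,1\}^n\to\{0,1\}^m$ outputs a circuit $G$ (of the same size as $W_s$) with $G(x)=W_s(x)$ for $x\notin\{x^{\mathcal B},x^{\mathcal C}\}$, $G(x^{\mathcal B})=\mu_{\mathcal B}(x^{\mathcal B})$ and, if $x^{\mathcal C}\neq x^{\mathcal B}$, $G(x^{\mathcal C})=\mu_{\mathcal C}(x^{\mathcal C})$. **UPO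 and generalized UPO security.** QPT algorithms $\mathsf{Obf}(1^\lambda,W)\to\rho_W$ and $\mathsf{Eval}(\rho_W,x)$ returning $W(x)$ except with negligible probability. Generalized security with respect to $\mathcal{D}_{\mathcal X}$: for every QPT $(\mathcal{A},\mathcal{B},\mathcal{C})$ the following with uniform $b\in\{0,1\}$ outputs 1 with probability at most $\frac12+\mathsf{negl}(\lambda)$: $\mathcal{A}$ sends $(s,\mu_{\mathcal B},\mu_{\mathcal C})$; $(x^{\mathcal B},x^{\mathcal C})\leftarrow\mathcal{D}_{\mathcal X}(1^\lambda)$, $G\leftarrow\mathsf{GenPuncture}(s,x^{\mathcal B},x^{\mathcal C},\mu_{\mathcal B},\mu_{\mathcal C})$; $\mathcal{A}$ receives $\mathsf{Obf}(1^\lambda,W_s)$ if $b=0$, $\mathsf{Obf}(1^\lambda,G)$ if $b=1$, and outputs a bipartite state $\sigma$; $(\mathcal{B}(x^{\mathcal B},\cdot)\otimes\mathcal{C}(x^{\mathcal C},\cdot))(\sigma)$ gives $(b_{\mathcal B},b_{\mathcal C})$; output 1 iff $b_{\mathcal B}=b_{\mathcal C}=b$. $\mathsf{Id}_{\mathcal U}$ samples $x$ uniformly in $\{0,1\}^n$ and outputs $(x,x)$. (As usual, circuits are assumed padded to the size required.)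
   Formalization: Proved for input lengths n(λ) that are eventually at least λ^c for some c > 0; for n(λ) = O(log λ) the claim fails, since A can test every input and learn b. QPT adversaries are non-uniform with quantum advice throughout, and GenPuncture is deterministic. *)

theory Defs
  imports "HOL-Probability.Probability"
begin

section \<open>Asymptotics\<close>

definition negligible :: "(nat \<Rightarrow> real) \<Rightarrow> bool" where
  "negligible \<epsilon> \<longleftrightarrow> (\<forall>c. \<forall>\<^sub>F n in sequentially. \<bar>\<epsilon> n\<bar> \<le> 1 / real n ^ c)"

definition poly_bounded :: "(nat \<Rightarrow> nat) \<Rightarrow> bool" where
  "poly_bounded p \<longleftrightarrow> (\<exists>k. \<forall>n. p n \<le> n ^ k + k)"

text \<open>
  Lower bound \<open>n\<^sup>c\<close>, \<open>c > 0\<close>, required of input lengths: if \<open>{0,1}\<^sup>n\<close> has polynomial size, \<open>\<A>\<close> can compare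
  its obfuscation with \<open>W\<^sub>s\<close> on every point and learn the challenge bit.
\<close>

definition poly_growing :: "(nat \<Rightarrow> nat) \<Rightarrow> bool" where
  "poly_growing p \<longleftrightarrow> (\<exists>c>0. \<forall>\<^sub>F n in sequentially. real (p n) \<ge> real n powr c)"

definition bits :: "nat \<Rightarrow> bool list set" where
  "bits n = {x. length x = n}"


section \<open>Circuits\<close>

text \<open>
  One syntax serves classical and quantum circuits. \<^term>\<open>Idle\<close> is the identity (used for
  padding); \<^term>\<open>NotG\<close>, \<^term>\<open>CNot\<close>, \<^term>\<open>Toffoli\<close> are universal for classical
  computation with ancillas, and together with the Hadamard gate and the \<open>\<pi>/8\<close> gate
  \<^term>\<open>TGate\<close> they are universal for quantum computation. A classical circuit is a circuit
  containing only the former gates, so it literally is a quantum circuit.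

  A circuit has \<open>nin + nanc\<close> wires: the input wires come first, the ancillas start as 0, and the
  output consists of the first \<open>nout\<close> wires after all gates have been applied; the remaining
  wires are discarded.
\<close>

datatype gate =
    Idle | NotG nat | CNot nat nat | Toffoli nat nat nat | Hadamard nat | TGate nat

datatype circ = Circ (nin: nat) (nanc: nat) (nout: nat) (gates: "gate list")

definition wires :: "circ \<Rightarrow> nat" where
  "wires C = nin C + nanc C"

definition csize :: "circ \<Rightarrow> nat" where
  "csize C = nin C + nanc C + nout C + length (gates C)"

fun wf_gate :: "nat \<Rightarrow> gate \<Rightarrow> bool" where
  "wf_gate N Idle = True"
| "wf_gate N (NotG i) = (i < N)"
| "wf_gate N (CNot i j) = (i < N \<and> j < N \<and> i \<noteq> j)"
| "wf_gate N (Toffoli i j k) = (i < N \<and> j < N \<and> k < N \<and> distinct [i, j, k])"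
| "wf_gate N (Hadamard i) = (i < N)"
| "wf_gate N (TGate i) = (i < N)"

definition wf_circ :: "circ \<Rightarrow> bool" where
  "wf_circ C \<longleftrightarrow> nout C \<le> wires C \<and> (\<forall>g\<in>set (gates C). wf_gate (wires C) g)"

fun classical_gate :: "gate \<Rightarrow> bool" where
  "classical_gate (Hadamard i) = False"
| "classical_gate (TGate i) = False"
| "classical_gate g = True"

definition classical :: "circ \<Rightarrow> bool" where
  "classical C \<longleftrightarrow> (\<forall>g\<in>set (gates C). classical_gate g)"

fun gate_map :: "gate \<Rightarrow> bool list \<Rightarrow> bool list" where
  "gate_map (NotG i) x = x[i := \<not> x ! i]"
| "gate_map (CNot i j) x = x[j := (x ! i \<noteq> x ! j)]"
| "gate_map (Toffoli i j k) x = x[k := ((x ! i \<and> x ! j) \<noteq> x ! k)]"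
| "gate_map g x = x"

definition ceval :: "circ \<Rightarrow> bool list \<Rightarrow> bool list" where
  "ceval C x = take (nout C) (fold gate_map (gates C) (x @ replicate (nanc C) False))"

definition classical_circs :: "nat \<Rightarrow> nat \<Rightarrow> nat \<Rightarrow> nat \<Rightarrow> circ set" where
  "classical_circs n a m g =
     {C. wf_circ C \<and> classical C \<and> nin C = n \<and> nanc C = a \<and> nout C = m \<and> length (gates C) = g}"

definition same_size :: "circ \<Rightarrow> circ \<Rightarrow> bool" where
  "same_size C D \<longleftrightarrow> nin C = nin D \<and> nanc C = nanc D \<and> nout C = nout D
     \<and> length (gates C) = length (gates D)"


subsection \<open>Descriptions of circuits as bit strings\<close>

text \<open>
  Gate kind and wires are written in one-hot form (an unused wire slot is all 0), so the length of
  a description depends only on the size parameters of the circuit.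
\<close>

definition onehot :: "nat \<Rightarrow> nat \<Rightarrow> bool list" where
  "onehot N i = map (\<lambda>j. j = i) [0..<N]"

definition gate_code :: "nat \<Rightarrow> nat \<Rightarrow> nat \<Rightarrow> nat \<Rightarrow> nat \<Rightarrow> bool list" where
  "gate_code N t i j k = onehot 6 t @ onehot N i @ onehot N j @ onehot N k"

fun gate_bits :: "nat \<Rightarrow> gate \<Rightarrow> bool list" where
  "gate_bits N Idle = gate_code N 0 N N N"
| "gate_bits N (NotG i) = gate_code N 1 i N N"
| "gate_bits N (CNot i j) = gate_code N 2 i j N"
| "gate_bits N (Toffoli i j k) = gate_code N 3 i j k"
| "gate_bits N (Hadamard i) = gate_code N 4 i N N"
| "gate_bits N (TGate i) = gate_code N 5 i N N"

definition desc :: "circ \<Rightarrow> bool list" where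
  "desc C = concat (map (gate_bits (wires C)) (gates C))"

definition desc_length :: "nat \<Rightarrow> nat \<Rightarrow> nat" where
  "desc_length N g = g * (6 + 3 * N)"

definition unary :: "nat \<Rightarrow> bool list" where
  "unary n = replicate n True @ [False]"

definition full_desc :: "circ \<Rightarrow> bool list" where
  "full_desc C = unary (nin C) @ unary (nanc C) @ unary (nout C) @ unary (length (gates C)) @ desc C"


section \<open>Turing machines and uniform circuit families\<close>

text \<open>
  Deterministic one-tape machines with control states \<open>{0..<Q}\<close>, start state 0, halting state 1,
  and tape symbols blank (\<^term>\<open>None\<close>), 0 and 1. The input is written from cell 0 on; the output is
  read from cell 0 up to the first blank.
\<close>

type_synonym tm = "nat \<times> (nat \<Rightarrow> bool option \<Rightarrow> nat \<times> bool option \<times> int)"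
type_synonym tm_config = "nat \<times> int \<times> (int \<Rightarrow> bool option)"

definition wf_tm :: "tm \<Rightarrow> bool" where
  "wf_tm M \<longleftrightarrow> (case M of (Q, \<delta>) \<Rightarrow> 1 < Q \<and>
     (\<forall>p<Q. \<forall>a. case \<delta> p a of (p', a', d) \<Rightarrow> p' < Q \<and> d \<in> {-1, 0, 1}))"

definition tm_step :: "tm \<Rightarrow> tm_config \<Rightarrow> tm_config" where
  "tm_step M c = (case c of (p, h, tape) \<Rightarrow>
     if p = 1 then c
     else (case snd M p (tape h) of (p', a', d) \<Rightarrow> (p', h + d, tape(h := a'))))"

definition tm_init :: "bool list \<Rightarrow> tm_config" where
  "tm_init x = (0, 0, \<lambda>i. if 0 \<le> i \<and> i < int (length x) then Some (x ! nat i) else None)"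

definition tm_output :: "tm_config \<Rightarrow> bool list \<Rightarrow> bool" where
  "tm_output c y \<longleftrightarrow> (case c of (p, h, tape) \<Rightarrow> p = 1 \<and>
     (\<forall>i<length y. tape (int i) = Some (y ! i)) \<and> tape (int (length y)) = None)"

text \<open>
  A family of circuits indexed by \<open>d\<close>-tuples of size parameters (the first being the security
  parameter) is efficient if it has polynomial size and a polynomial-time Turing machine prints the
  circuit when given the parameters in unary. This is the model of a (uniform) quantum
  polynomial-time algorithm and, for classical circuits, of a classical polynomial-time algorithm.
\<close>

definition efficient :: "nat \<Rightarrow> (nat list \<Rightarrow> circ) \<Rightarrow> bool" where
  "efficient d F \<longleftrightarrow>
     (\<forall>ns. length ns = d \<longrightarrow> wf_circ (F ns)) \<and>
     (\<exists>k. \<forall>ns. length ns = d \<longrightarrow> csize (F ns) \<le> sum_list ns ^ k + k) \<and>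
     (\<exists>M k. wf_tm M \<and> (\<forall>ns. length ns = d \<longrightarrow>
        (\<exists>t \<le> sum_list ns ^ k + k.
           tm_output ((tm_step M ^^ t) (tm_init (concat (map unary ns)))) (full_desc (F ns)))))"

definition efficient1 :: "(nat \<Rightarrow> circ) \<Rightarrow> bool" where
  "efficient1 F \<longleftrightarrow> efficient 1 (\<lambda>ns. F (hd ns))"

text \<open>
  Adversaries are non-uniform: polynomial-size circuit families, which in the definitions below
  additionally receive an arbitrary quantum advice state.
\<close>

definition poly_family :: "(nat \<Rightarrow> circ) \<Rightarrow> bool" where
  "poly_family F \<longleftrightarrow> (\<forall>\<kappa>. wf_circ (F \<kappa>)) \<and> poly_bounded (\<lambda>\<kappa>. csize (F \<kappa>))"


section \<open>Quantum states and the semantics of quantum circuits\<close>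

text \<open>
  An operator on \<open>n\<close> qubits is given by its matrix entries, with rows and columns indexed by
  bit strings of length \<open>n\<close>.
\<close>

type_synonym qop = "bool list \<Rightarrow> bool list \<Rightarrow> complex"

definition density :: "nat \<Rightarrow> qop \<Rightarrow> bool" where
  "density n \<rho> \<longleftrightarrow>
     (\<forall>x y. \<rho> x y \<noteq> 0 \<longrightarrow> x \<in> bits n \<and> y \<in> bits n) \<and>
     (\<forall>v. (\<Sum>x\<in>bits n. \<Sum>y\<in>bits n. cnj (v x) * \<rho> x y * v y) \<in> \<real>\<^sub>\<ge>\<^sub>0) \<and>
     (\<Sum>x\<in>bits n. \<rho> x x) = 1"

definition basis :: "bool list \<Rightarrow> qop" where
  "basis x u v = of_bool (u = x \<and> v = x)"

text \<open>Tensor product whose left factor has \<open>k\<close> qubits.\<close>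

definition tensor :: "nat \<Rightarrow> qop \<Rightarrow> qop \<Rightarrow> qop" where
  "tensor k \<rho> \<sigma> x y = \<rho> (take k x) (take k y) * \<sigma> (drop k x) (drop k y)"

text \<open>\<open>gate_entry g y x\<close> is the matrix entry \<open>\<langle>y|g|x\<rangle>\<close>, for \<open>x\<close>, \<open>y\<close> of the same length.\<close>

fun gate_entry :: "gate \<Rightarrow> bool list \<Rightarrow> bool list \<Rightarrow> complex" where
  "gate_entry (Hadamard i) y x =
     (if y = x[i := y ! i] then (if x ! i \<and> y ! i then -1 else 1) / complex_of_real (sqrt 2) else 0)"
| "gate_entry (TGate i) y x = (if y = x then (if x ! i then cis (pi / 4) else 1) else 0)"
| "gate_entry g y x = of_bool (y = gate_map g x)"

fun amplitude :: "nat \<Rightarrow> gate list \<Rightarrow> bool list \<Rightarrow> bool list \<Rightarrow> complex" where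
  "amplitude N [] y x = of_bool (y = x)"
| "amplitude N (g # gs) y x = (\<Sum>z\<in>bits N. amplitude N gs y z * gate_entry g z x)"

text \<open>
  The channel computed by \<open>C\<close>: adjoin ancillas in state 0, apply the unitary, and trace out all but
  the first \<open>nout C\<close> qubits. Classical output is obtained by measuring the output qubits in the
  computational basis.
\<close>

definition run :: "circ \<Rightarrow> qop \<Rightarrow> qop" where
  "run C \<rho> y y' =
     (\<Sum>t\<in>bits (wires C - nout C). \<Sum>x\<in>bits (nin C). \<Sum>x'\<in>bits (nin C).
        amplitude (wires C) (gates C) (y @ t) (x @ replicate (nanc C) False) * \<rho> x x' *
        cnj (amplitude (wires C) (gates C) (y' @ t) (x' @ replicate (nanc C) False)))"

definition prob_out :: "qop \<Rightarrow> bool list \<Rightarrow> real" where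
  "prob_out \<rho> y = Re (\<rho> y y)"

text \<open>
  Unnormalised state of the remaining qubits after measuring the first qubits with outcome \<open>y\<close>; its
  trace is the probability of that outcome.
\<close>

definition post_meas :: "bool list \<Rightarrow> qop \<Rightarrow> qop" where
  "post_meas y \<rho> u v = \<rho> (y @ u) (y @ v)"

text \<open>
  Probability of the outcomes \<open>y1\<close>, \<open>y2\<close> when \<open>E1 \<otimes> E2\<close> is applied to a bipartite operator and
  both outputs are measured: \<open>E1\<close> acts on each block of \<open>\<sigma>\<close> belonging to a fixed pair \<open>v, v'\<close> of
  indices of the second register.
\<close>

definition joint_prob :: "(qop \<Rightarrow> qop) \<Rightarrow> (qop \<Rightarrow> qop) \<Rightarrow> qop \<Rightarrow> bool list \<Rightarrow> bool list \<Rightarrow> real" where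
  "joint_prob E1 E2 \<sigma> y1 y2 =
     Re (E2 (\<lambda>v v'. E1 (\<lambda>u u'. \<sigma> (u @ v) (u' @ v')) y1 y1) y2 y2)"


section \<open>Post-quantum injective one-way functions\<close>

definition pq_injective_owf :: "(nat \<Rightarrow> circ) \<Rightarrow> bool" where
  "pq_injective_owf F \<longleftrightarrow>
     efficient1 F \<and> (\<forall>\<kappa>. classical (F \<kappa>) \<and> nin (F \<kappa>) = \<kappa>) \<and>
     (\<forall>\<kappa>. inj_on (ceval (F \<kappa>)) (bits \<kappa>)) \<and>
     (\<forall>A t \<tau>. poly_family A \<and> (\<forall>\<kappa>. density (t \<kappa>) (\<tau> \<kappa>)) \<and>
        (\<forall>\<kappa>. nin (A \<kappa>) = nout (F \<kappa>) + t \<kappa> \<and> nout (A \<kappa>) = \<kappa>) \<longrightarrow>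
        negligible (\<lambda>\<kappa>. (\<Sum>x\<in>bits \<kappa>. \<Sum>x'\<in>{x'\<in>bits \<kappa>. ceval (F \<kappa>) x' = ceval (F \<kappa>) x}.
          prob_out (run (A \<kappa>) (tensor (nout (F \<kappa>)) (basis (ceval (F \<kappa>) x)) (\<tau> \<kappa>))) x') / 2 ^ \<kappa>))"


section \<open>Cloning adversaries\<close>

text \<open>
  The two cloning games share the same format: the adversary \<open>\<A>\<close> (started on its advice) first sends a
  classical message and keeps a quantum state (\<open>stage1\<close>), then receives the challenge state and
  outputs a bipartite state (\<open>stage2\<close>), whose halves go to \<open>\<B>\<close> and \<open>\<C>\<close> together with a classical
  string each. Advice for \<open>\<B>\<close> and \<open>\<C>\<close> can be passed on by \<open>\<A>\<close>.
\<close>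

record cloning_adversary =
  advice_len :: "nat \<Rightarrow> nat"
  advice :: "nat \<Rightarrow> qop"
  stage1 :: "nat \<Rightarrow> circ"
  stage2 :: "nat \<Rightarrow> circ"
  partyB :: "nat \<Rightarrow> circ"
  partyC :: "nat \<Rightarrow> circ"

text \<open>\<open>ml\<close>, \<open>cl\<close>, \<open>al\<close>: lengths of the message, of the challenge, and of the strings given to \<open>\<B>\<close>, \<open>\<C>\<close>.\<close>

definition qpt_cloning_adversary ::
  "(nat \<Rightarrow> nat) \<Rightarrow> (nat \<Rightarrow> nat) \<Rightarrow> (nat \<Rightarrow> nat) \<Rightarrow> cloning_adversary \<Rightarrow> bool" where
  "qpt_cloning_adversary ml cl al \<A> \<longleftrightarrow>
     poly_family (stage1 \<A>) \<and> poly_family (stage2 \<A>) \<and>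
     poly_family (partyB \<A>) \<and> poly_family (partyC \<A>) \<and>
     (\<forall>\<kappa>. density (advice_len \<A> \<kappa>) (advice \<A> \<kappa>)) \<and>
     (\<forall>\<kappa>. nin (stage1 \<A> \<kappa>) = advice_len \<A> \<kappa> \<and>
        (\<exists>st rB rC. nout (stage1 \<A> \<kappa>) = ml \<kappa> + st \<and>
           nin (stage2 \<A> \<kappa>) = cl \<kappa> + st \<and> nout (stage2 \<A> \<kappa>) = rB + rC \<and>
           nin (partyB \<A> \<kappa>) = al \<kappa> + rB \<and> nin (partyC \<A> \<kappa>) = al \<kappa> + rC \<and>
           nout (partyB \<A> \<kappa>) = 1 \<and> nout (partyC \<A> \<kappa>) = 1))"

text \<open>
  Probability that \<open>\<A>\<close> sends \<open>msg\<close> and then, the challenge being the \<open>cl\<close>-qubit state \<open>ch\<close>, both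
  \<open>\<B>\<close> (given \<open>yB\<close>) and \<open>\<C>\<close> (given \<open>yC\<close>) output \<open>b\<close>.
\<close>

definition cloning_prob ::
  "cloning_adversary \<Rightarrow> nat \<Rightarrow> bool list \<Rightarrow> nat \<Rightarrow> qop \<Rightarrow> bool list \<Rightarrow> bool list \<Rightarrow> bool \<Rightarrow> real" where
  "cloning_prob \<A> \<kappa> msg cl ch yB yC b =
     joint_prob
       (\<lambda>\<sigma>. run (partyB \<A> \<kappa>) (tensor (length yB) (basis yB) \<sigma>))
       (\<lambda>\<sigma>. run (partyC \<A> \<kappa>) (tensor (length yC) (basis yC) \<sigma>))
       (run (stage2 \<A> \<kappa>) (tensor cl ch (post_meas msg (run (stage1 \<A> \<kappa>) (advice \<A> \<kappa>)))))
       [b] [b]"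


section \<open>Private-key unclonable bit encryption\<close>

definition ue_correct :: "(nat \<Rightarrow> circ) \<Rightarrow> (nat \<Rightarrow> circ) \<Rightarrow> (nat \<Rightarrow> circ) \<Rightarrow> bool" where
  "ue_correct Gen Enc Dec \<longleftrightarrow> (\<exists>\<epsilon>. negligible \<epsilon> \<and> (\<forall>\<kappa> m.
     (\<Sum>sk\<in>bits (nout (Gen \<kappa>)). prob_out (run (Gen \<kappa>) (basis [])) sk *
        prob_out (run (Dec \<kappa>) (tensor (nout (Gen \<kappa>)) (basis sk) (run (Enc \<kappa>) (basis (sk @ [m]))))) [m])
     \<ge> 1 - \<epsilon> \<kappa>))"

definition ue_win ::
  "(nat \<Rightarrow> circ) \<Rightarrow> (nat \<Rightarrow> circ) \<Rightarrow> cloning_adversary \<Rightarrow> nat \<Rightarrow> real" where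
  "ue_win Gen Enc \<A> \<kappa> =
     (\<Sum>sk\<in>bits (nout (Gen \<kappa>)). prob_out (run (Gen \<kappa>) (basis [])) sk *
        (\<Sum>m0\<in>UNIV. \<Sum>m1\<in>UNIV. \<Sum>b\<in>UNIV. 1 / 2 *
           cloning_prob \<A> \<kappa> [m0, m1] (nout (Enc \<kappa>))
             (run (Enc \<kappa>) (basis (sk @ [if b then m1 else m0]))) sk sk b))"

definition unclonable_bit_encryption ::
  "(nat \<Rightarrow> circ) \<Rightarrow> (nat \<Rightarrow> circ) \<Rightarrow> (nat \<Rightarrow> circ) \<Rightarrow> bool" where
  "unclonable_bit_encryption Gen Enc Dec \<longleftrightarrow>
     efficient1 Gen \<and> efficient1 Enc \<and> efficient1 Dec \<and>
     (\<forall>\<kappa>. nin (Gen \<kappa>) = 0 \<and> nin (Enc \<kappa>) = nout (Gen \<kappa>) + 1 \<and>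
        nin (Dec \<kappa>) = nout (Gen \<kappa>) + nout (Enc \<kappa>) \<and> nout (Dec \<kappa>) = 1) \<and>
     ue_correct Gen Enc Dec \<and>
     (\<forall>\<A>. qpt_cloning_adversary (\<lambda>\<kappa>. 2) (\<lambda>\<kappa>. nout (Enc \<kappa>)) (\<lambda>\<kappa>. nout (Gen \<kappa>)) \<A> \<longrightarrow>
        (\<exists>\<epsilon>. negligible \<epsilon> \<and> (\<forall>\<kappa>. ue_win Gen Enc \<A> \<kappa> \<le> 1 / 2 + \<epsilon> \<kappa>)))"


section \<open>Quantum state indistinguishability obfuscation\<close>

text \<open>
  A program is a circuit \<open>C\<close> together with a \<open>q\<close>-qubit state \<open>\<rho>\<close>; the input wires of \<open>C\<close> are the
  classical input \<open>x\<close> followed by the \<open>q\<close> qubits of \<open>\<rho>\<close>.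
\<close>

definition implementation ::
  "real \<Rightarrow> nat \<Rightarrow> circ \<Rightarrow> qop \<Rightarrow> (bool list \<Rightarrow> bool list) \<Rightarrow> bool" where
  "implementation \<epsilon> q C \<rho> f \<longleftrightarrow> (\<forall>x\<in>bits (nin C - q).
     prob_out (run C (tensor (nin C - q) (basis x) \<rho>)) (f x) \<ge> 1 - \<epsilon>)"

definition program_family :: "(nat \<Rightarrow> nat) \<Rightarrow> (nat \<Rightarrow> circ) \<Rightarrow> (nat \<Rightarrow> qop) \<Rightarrow> bool" where
  "program_family q C \<rho> \<longleftrightarrow> poly_family C \<and> (\<forall>\<kappa>. q \<kappa> \<le> nin (C \<kappa>) \<and> density (q \<kappa>) (\<rho> \<kappa>))"

definition negl_implementation ::
  "(nat \<Rightarrow> nat) \<Rightarrow> (nat \<Rightarrow> circ) \<Rightarrow> (nat \<Rightarrow> qop) \<Rightarrow> (nat \<Rightarrow> bool list \<Rightarrow> bool list) \<Rightarrow> bool" where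
  "negl_implementation q C \<rho> f \<longleftrightarrow> program_family q C \<rho> \<and>
     (\<exists>\<epsilon>. negligible \<epsilon> \<and> (\<forall>\<kappa>. implementation (\<epsilon> \<kappa>) (q \<kappa>) (C \<kappa>) (\<rho> \<kappa>) (f \<kappa>)))"

text \<open>
  The obfuscator and the evaluator are circuit families indexed by the security parameter and the
  public size parameters of the obfuscated program: input length, state qubits, ancillas, output
  length, number of gates.
\<close>

definition obf_index :: "nat \<Rightarrow> nat \<Rightarrow> circ \<Rightarrow> nat list" where
  "obf_index \<kappa> q C = [\<kappa>, nin C - q, q, nanc C, nout C, length (gates C)]"

definition obf_interface :: "(nat list \<Rightarrow> circ) \<Rightarrow> (nat list \<Rightarrow> circ) \<Rightarrow> bool" where
  "obf_interface Obf Eval \<longleftrightarrow> (\<forall>\<kappa> n q a m g.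
     nin (Obf [\<kappa>, n, q, a, m, g]) = desc_length (n + q + a) g + q \<and>
     nin (Eval [\<kappa>, n, q, a, m, g]) = n + nout (Obf [\<kappa>, n, q, a, m, g]) \<and>
     nout (Eval [\<kappa>, n, q, a, m, g]) = m)"

definition obf_state :: "(nat list \<Rightarrow> circ) \<Rightarrow> nat \<Rightarrow> nat \<Rightarrow> circ \<Rightarrow> qop \<Rightarrow> qop" where
  "obf_state Obf \<kappa> q C \<rho> =
     run (Obf (obf_index \<kappa> q C)) (tensor (length (desc C)) (basis (desc C)) \<rho>)"

definition eval_prob ::
  "(nat list \<Rightarrow> circ) \<Rightarrow> (nat list \<Rightarrow> circ) \<Rightarrow> nat \<Rightarrow> nat \<Rightarrow> circ \<Rightarrow> qop \<Rightarrow> bool list \<Rightarrow> bool list \<Rightarrow> real"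
  where
  "eval_prob Obf Eval \<kappa> q C \<rho> x y =
     prob_out (run (Eval (obf_index \<kappa> q C)) (tensor (length x) (basis x) (obf_state Obf \<kappa> q C \<rho>))) y"

definition qsio_correct :: "(nat list \<Rightarrow> circ) \<Rightarrow> (nat list \<Rightarrow> circ) \<Rightarrow> bool" where
  "qsio_correct Obf Eval \<longleftrightarrow> (\<forall>q C \<rho> f. negl_implementation q C \<rho> f \<longrightarrow>
     (\<exists>\<epsilon>. negligible \<epsilon> \<and> (\<forall>\<kappa>. \<forall>x\<in>bits (nin (C \<kappa>) - q \<kappa>).
        eval_prob Obf Eval \<kappa> (q \<kappa>) (C \<kappa>) (\<rho> \<kappa>) x (f \<kappa> x) \<ge> 1 - \<epsilon> \<kappa>)))"

definition qsio_secure :: "(nat list \<Rightarrow> circ) \<Rightarrow> bool" where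
  "qsio_secure Obf \<longleftrightarrow> (\<forall>q C0 \<rho>0 C1 \<rho>1 f.
     negl_implementation q C0 \<rho>0 f \<and> negl_implementation q C1 \<rho>1 f \<and>
     (\<forall>\<kappa>. same_size (C0 \<kappa>) (C1 \<kappa>)) \<longrightarrow>
     (\<forall>D t \<tau>. poly_family D \<and> (\<forall>\<kappa>. density (t \<kappa>) (\<tau> \<kappa>)) \<and>
        (\<forall>\<kappa>. nin (D \<kappa>) = nout (Obf (obf_index \<kappa> (q \<kappa>) (C0 \<kappa>))) + t \<kappa> \<and> nout (D \<kappa>) = 1) \<longrightarrow>
        negligible (\<lambda>\<kappa>. let r = nout (Obf (obf_index \<kappa> (q \<kappa>) (C0 \<kappa>))) in
          \<bar>prob_out (run (D \<kappa>) (tensor r (obf_state Obf \<kappa> (q \<kappa>) (C0 \<kappa>) (\<rho>0 \<kappa>)) (\<tau> \<kappa>))) [True] -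
           prob_out (run (D \<kappa>) (tensor r (obf_state Obf \<kappa> (q \<kappa>) (C1 \<kappa>) (\<rho>1 \<kappa>)) (\<tau> \<kappa>))) [True]\<bar>)))"

definition qsio_scheme :: "(nat list \<Rightarrow> circ) \<Rightarrow> (nat list \<Rightarrow> circ) \<Rightarrow> bool" where
  "qsio_scheme Obf Eval \<longleftrightarrow> efficient 6 Obf \<and> efficient 6 Eval \<and> obf_interface Obf Eval \<and>
     qsio_correct Obf Eval \<and> qsio_secure Obf"


section \<open>Generalized puncturable keyed circuit classes\<close>

text \<open>\<open>kc_anc\<close> and \<open>kc_gates\<close> are the ancilla and gate counts common to all circuits of the class.\<close>

record keyed_class =
  key_len :: "nat \<Rightarrow> nat"
  keys :: "nat \<Rightarrow> bool list set"
  kc_in :: "nat \<Rightarrow> nat"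
  kc_out :: "nat \<Rightarrow> nat"
  kc_anc :: "nat \<Rightarrow> nat"
  kc_gates :: "nat \<Rightarrow> nat"
  kc_circ :: "nat \<Rightarrow> bool list \<Rightarrow> circ"

definition kc_shape :: "keyed_class \<Rightarrow> nat \<Rightarrow> circ set" where
  "kc_shape W \<kappa> = classical_circs (kc_in W \<kappa>) (kc_anc W \<kappa>) (kc_out W \<kappa>) (kc_gates W \<kappa>)"

definition keyed_circuit_class :: "keyed_class \<Rightarrow> bool" where
  "keyed_circuit_class W \<longleftrightarrow>
     poly_bounded (key_len W) \<and> poly_bounded (kc_in W) \<and> poly_bounded (kc_out W) \<and>
     poly_bounded (kc_anc W) \<and> poly_bounded (kc_gates W) \<and>
     (\<forall>\<kappa>. keys W \<kappa> \<subseteq> bits (key_len W \<kappa>) \<and> (\<forall>s\<in>keys W \<kappa>. kc_circ W \<kappa> s \<in> kc_shape W \<kappa>))"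

text \<open>The circuits \<open>\<mu>\<close> are padded to \<open>ua \<kappa>\<close> ancillas and \<open>ug \<kappa>\<close> gates.\<close>

definition mu_circs :: "keyed_class \<Rightarrow> (nat \<Rightarrow> nat) \<Rightarrow> (nat \<Rightarrow> nat) \<Rightarrow> nat \<Rightarrow> circ set" where
  "mu_circs W ua ug \<kappa> = classical_circs (kc_in W \<kappa>) (ua \<kappa>) (kc_out W \<kappa>) (ug \<kappa>)"

type_synonym puncture_alg =
  "nat \<Rightarrow> bool list \<Rightarrow> bool list \<Rightarrow> bool list \<Rightarrow> circ \<Rightarrow> circ \<Rightarrow> circ"

definition puncture_correct ::
  "keyed_class \<Rightarrow> (nat \<Rightarrow> nat) \<Rightarrow> (nat \<Rightarrow> nat) \<Rightarrow> puncture_alg \<Rightarrow> bool" where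
  "puncture_correct W ua ug GP \<longleftrightarrow>
     (\<forall>\<kappa>. \<forall>s\<in>keys W \<kappa>. \<forall>xB\<in>bits (kc_in W \<kappa>). \<forall>xC\<in>bits (kc_in W \<kappa>).
      \<forall>\<mu>B\<in>mu_circs W ua ug \<kappa>. \<forall>\<mu>C\<in>mu_circs W ua ug \<kappa>.
        let G = GP \<kappa> s xB xC \<mu>B \<mu>C in
        G \<in> kc_shape W \<kappa> \<and>
        (\<forall>x\<in>bits (kc_in W \<kappa>). x \<notin> {xB, xC} \<longrightarrow> ceval G x = ceval (kc_circ W \<kappa> s) x) \<and>
        ceval G xB = ceval \<mu>B xB \<and>
        (xC \<noteq> xB \<longrightarrow> ceval G xC = ceval \<mu>C xC))"

definition puncture_efficient ::
  "keyed_class \<Rightarrow> (nat \<Rightarrow> nat) \<Rightarrow> (nat \<Rightarrow> nat) \<Rightarrow> puncture_alg \<Rightarrow> bool" where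
  "puncture_efficient W ua ug GP \<longleftrightarrow> (\<exists>P. efficient1 P \<and> (\<forall>\<kappa>. classical (P \<kappa>)) \<and>
     (\<forall>\<kappa>. nin (P \<kappa>) = key_len W \<kappa> + 2 * kc_in W \<kappa> + 2 * desc_length (kc_in W \<kappa> + ua \<kappa>) (ug \<kappa>)) \<and>
     (\<forall>\<kappa>. \<forall>s\<in>keys W \<kappa>. \<forall>xB\<in>bits (kc_in W \<kappa>). \<forall>xC\<in>bits (kc_in W \<kappa>).
      \<forall>\<mu>B\<in>mu_circs W ua ug \<kappa>. \<forall>\<mu>C\<in>mu_circs W ua ug \<kappa>.
        ceval (P \<kappa>) (s @ xB @ xC @ desc \<mu>B @ desc \<mu>C) = desc (GP \<kappa> s xB xC \<mu>B \<mu>C)))"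

definition generalized_puncturable ::
  "keyed_class \<Rightarrow> (nat \<Rightarrow> nat) \<Rightarrow> (nat \<Rightarrow> nat) \<Rightarrow> puncture_alg \<Rightarrow> bool" where
  "generalized_puncturable W ua ug GP \<longleftrightarrow> keyed_circuit_class W \<and>
     poly_bounded ua \<and> poly_bounded ug \<and> puncture_correct W ua ug GP \<and> puncture_efficient W ua ug GP"


section \<open>Unclonable puncturable obfuscation\<close>

text \<open>
  A classical circuit is obfuscated with the trivial state \<open>|0\<dots>0\<rangle>\<close>. It is padded to \<open>\<kappa> ^ k + k\<close>
  gates, state qubits and ancillas; the state qubits, being 0, can serve as ancillas of the circuit.
\<close>

definition pad_size :: "nat \<Rightarrow> nat \<Rightarrow> nat" where
  "pad_size k \<kappa> = \<kappa> ^ k + k"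

definition pad_circ :: "nat \<Rightarrow> circ \<Rightarrow> circ" where
  "pad_circ p C = Circ (nin C + p) p (nout C) (gates C @ replicate (p - length (gates C)) Idle)"

definition zero_state :: "nat \<Rightarrow> qop" where
  "zero_state q = basis (replicate q False)"

definition upo_obf :: "nat \<Rightarrow> (nat list \<Rightarrow> circ) \<Rightarrow> nat \<Rightarrow> circ \<Rightarrow> qop" where
  "upo_obf k Obf \<kappa> C =
     obf_state Obf \<kappa> (pad_size k \<kappa>) (pad_circ (pad_size k \<kappa>) C) (zero_state (pad_size k \<kappa>))"

definition upo_correct ::
  "keyed_class \<Rightarrow> nat \<Rightarrow> (nat list \<Rightarrow> circ) \<Rightarrow> (nat list \<Rightarrow> circ) \<Rightarrow> bool" where
  "upo_correct W k Obf Eval \<longleftrightarrow> (\<exists>\<epsilon>. negligible \<epsilon> \<and>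
     (\<forall>\<kappa>. \<forall>C\<in>kc_shape W \<kappa>. \<forall>x\<in>bits (kc_in W \<kappa>).
        eval_prob Obf Eval \<kappa> (pad_size k \<kappa>) (pad_circ (pad_size k \<kappa>) C) (zero_state (pad_size k \<kappa>))
          x (ceval C x) \<ge> 1 - \<epsilon> \<kappa>))"

definition upo_scheme ::
  "keyed_class \<Rightarrow> nat \<Rightarrow> (nat list \<Rightarrow> circ) \<Rightarrow> (nat list \<Rightarrow> circ) \<Rightarrow> bool" where
  "upo_scheme W k Obf Eval \<longleftrightarrow>
     efficient 6 Obf \<and> efficient 6 Eval \<and> obf_interface Obf Eval \<and> upo_correct W k Obf Eval"

definition upo_len :: "keyed_class \<Rightarrow> nat \<Rightarrow> (nat list \<Rightarrow> circ) \<Rightarrow> nat \<Rightarrow> nat" where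
  "upo_len W k Obf \<kappa> = (let p = pad_size k \<kappa> in
     nout (Obf [\<kappa>, kc_in W \<kappa>, p, p, kc_out W \<kappa>, p]))"

definition upo_win ::
  "keyed_class \<Rightarrow> (nat \<Rightarrow> nat) \<Rightarrow> (nat \<Rightarrow> nat) \<Rightarrow> puncture_alg \<Rightarrow>
   (nat \<Rightarrow> (bool list \<times> bool list) pmf) \<Rightarrow> nat \<Rightarrow> (nat list \<Rightarrow> circ) \<Rightarrow> cloning_adversary \<Rightarrow> nat \<Rightarrow> real"
  where
  "upo_win W ua ug GP D k Obf \<A> \<kappa> =
     (\<Sum>s\<in>keys W \<kappa>. \<Sum>\<mu>B\<in>mu_circs W ua ug \<kappa>. \<Sum>\<mu>C\<in>mu_circs W ua ug \<kappa>.
        measure_pmf.expectation (D \<kappa>) (\<lambda>(xB, xC). \<Sum>b\<in>UNIV. 1 / 2 *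
          cloning_prob \<A> \<kappa> (s @ desc \<mu>B @ desc \<mu>C) (upo_len W k Obf \<kappa>)
            (upo_obf k Obf \<kappa> (if b then GP \<kappa> s xB xC \<mu>B \<mu>C else kc_circ W \<kappa> s)) xB xC b))"

definition generalized_upo_secure ::
  "keyed_class \<Rightarrow> (nat \<Rightarrow> nat) \<Rightarrow> (nat \<Rightarrow> nat) \<Rightarrow> puncture_alg \<Rightarrow>
   (nat \<Rightarrow> (bool list \<times> bool list) pmf) \<Rightarrow> nat \<Rightarrow> (nat list \<Rightarrow> circ) \<Rightarrow> bool" where
  "generalized_upo_secure W ua ug GP D k Obf \<longleftrightarrow>
     (\<forall>\<A>. qpt_cloning_adversary
            (\<lambda>\<kappa>. key_len W \<kappa> + 2 * desc_length (kc_in W \<kappa> + ua \<kappa>) (ug \<kappa>))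
            (upo_len W k Obf) (kc_in W) \<A> \<longrightarrow>
        (\<exists>\<epsilon>. negligible \<epsilon> \<and> (\<forall>\<kappa>. upo_win W ua ug GP D k Obf \<A> \<kappa> \<le> 1 / 2 + \<epsilon> \<kappa>)))"

definition Id_U :: "keyed_class \<Rightarrow> nat \<Rightarrow> (bool list \<times> bool list) pmf" where
  "Id_U W \<kappa> = map_pmf (\<lambda>x. (x, x)) (pmf_of_set (bits (kc_in W \<kappa>)))"

end

theory Submission
  imports Defs "HOL-Computational_Algebra.Nth_Powers"
begin

text \<open>
  Let \<open>l\<close> be the key length of the encryption scheme, and split the challenge input as
  \<open>x\<^sup>* = u\<^sup>* @ v\<^sub>1 @ \<dots> @ v\<^sub>l @ rest\<close> with \<open>l\<close> bits \<open>u\<^sup>*\<close>. Consider a quantum program whose state consists of an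
  encryption of the challenge bit \<open>b\<close> under a key \<open>sk\<close>, the masked key \<open>sk \<oplus> u\<^sup>*\<close>, and, for every \<open>i\<close> and
  both possible values of the \<open>i\<close>-th bit of the input, an image under the one-way function with a
  hard-core bit of its preimage. The hard-core bit is flipped unless the value is that of \<open>u\<^sup>*\<close>. The program
  recognises \<open>x\<^sup>*\<close> by these values, and on \<open>x\<^sup>*\<close> it decrypts \<open>b\<close>; so it implements \<open>W\<^sub>s\<close> or the punctured
  circuit, according to \<open>b\<close>, and its obfuscation may be used as the challenge. By the quantum
  Goldreich--Levin theorem nobody notices if no hard-core bit is flipped. Afterwards the masked key \<open>z\<close>
  and the images are independent of \<open>sk\<close>, and \<open>x\<^sup>*\<close> is a function of \<open>sk\<close>, \<open>z\<close> and the preimages. Hence \<open>\<B>\<close>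
  and \<open>\<C>\<close>, who receive \<open>x\<^sup>*\<close>, can be simulated by parties that receive \<open>sk\<close>, and the game has
  become the one of unclonable encryption. As adversaries are non-uniform, all other random choices
  can be fixed.
\<close>

section \<open>Bit strings\<close>

text \<open>The encryption game reveals \<open>sk\<close> to \<B> and \<C> only after the split, and
  nothing else, while a plain point test would tie the program state to one input. Hence there are
  tests for both values of every selector bit, half of them spoiled by flips. A flip on a dead value
  can be removed because its preimage is no part of the input given to \<B> and \<C>; live tests
  stay as they are. Injectivity makes equality of images a test for equality of blocks. Obfuscation
  security is invoked only while the flips are present: without them wrong selector bits pass the
  tests and unmask a wrong key, so the program need not compute a definite function, but from then
  on only the preparation of its state matters. The key is averaged inside that state because
  decryption is correct only on average over keys. Input lengths may be as small as a small power of
  \<kappa>, so encryption and one-way function run at a parameter \<open>m\<close>, the integer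
  \<open>d\<close>-th root of \<kappa>, chosen so that \<open>l + l * m\<close> fits into the input;
  polynomial and negligible mean the same in \<open>m\<close> and in \<kappa>.\<close>

lemma bits_iff [simp]: "x \<in> bits n \<longleftrightarrow> length x = n"
  by (simp add: bits_def)

lemma bits_0: "bits 0 = {[]}"
  by (auto simp: bits_def)

lemma bits_eq_lists: "bits n = {xs. set xs \<subseteq> UNIV \<and> length xs = n}"
  by (auto simp: bits_def)

lemma finite_bits [simp, intro]: "finite (bits n)"
  unfolding bits_eq_lists by (rule finite_lists_length_eq) auto

lemma card_bits: "card (bits n) = 2 ^ n"
  unfolding bits_eq_lists by (subst card_lists_length_eq) (auto simp: card_UNIV_bool)

lemma bits_nonempty: "bits n \<noteq> {}"
  by (metis bits_iff empty_iff length_replicate)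

lemma sum_bits_add:
  fixes f :: "bool list \<Rightarrow> 'a::comm_monoid_add"
  shows "(\<Sum>x\<in>bits (a + b). f x) = (\<Sum>u\<in>bits a. \<Sum>v\<in>bits b. f (u @ v))"
proof -
  have "(\<Sum>x\<in>bits (a + b). f x) = (\<Sum>(u, v)\<in>bits a \<times> bits b. f (u @ v))"
    by (rule sum.reindex_bij_witness[where j = "\<lambda>x. (take a x, drop a x)" and i = "\<lambda>(u, v). u @ v"]) auto
  then show ?thesis by (simp add: sum.cartesian_product)
qed

lemma sum_bits_Suc:
  fixes f :: "bool list \<Rightarrow> 'a::comm_monoid_add"
  shows "(\<Sum>x\<in>bits (Suc n). f x) = (\<Sum>x\<in>bits n. f (False # x) + f (True # x))"
proof -
  have "bits (Suc 0) = {[False], [True]}"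
    by (auto simp: bits_def length_Suc_conv)
  then show ?thesis
    using sum_bits_add[of f "Suc 0" n] by (simp add: sum.distrib)
qed

lemma sum_bits_1:
  fixes f :: "bool list \<Rightarrow> 'a::comm_monoid_add"
  shows "(\<Sum>x\<in>bits (Suc 0). f x) = f [False] + f [True]"
  by (simp add: sum_bits_Suc bits_0)

lemma cnj_of_bool [simp]: "cnj (of_bool P) = of_bool P"
  by (cases P) auto

text \<open>Kronecker deltas are written with \<open>of_bool\<close> throughout; the four
  orientations let matrix computations eliminate them by rewriting.\<close>

lemma sum_of_bool_pick:
  fixes f :: "'b \<Rightarrow> 'a::semiring_1"
  assumes "finite A" "a \<in> A"
  shows "(\<Sum>x\<in>A. of_bool (x = a) * f x) = f a" "(\<Sum>x\<in>A. f x * of_bool (x = a)) = f a"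
    "(\<Sum>x\<in>A. of_bool (a = x) * f x) = f a" "(\<Sum>x\<in>A. f x * of_bool (a = x)) = f a"
proof -
  have "(\<Sum>x\<in>A. of_bool (x = a) * f x) = (\<Sum>x\<in>A. if a = x then f x else 0)"
    by (rule sum.cong) auto
  then show *: "(\<Sum>x\<in>A. of_bool (x = a) * f x) = f a"
    using assms by simp
  have "(\<Sum>x\<in>A. f x * of_bool (x = a)) = (\<Sum>x\<in>A. of_bool (x = a) * f x)"
    by (rule sum.cong) auto
  with * show **: "(\<Sum>x\<in>A. f x * of_bool (x = a)) = f a" by simp
  show "(\<Sum>x\<in>A. of_bool (a = x) * f x) = f a" "(\<Sum>x\<in>A. f x * of_bool (a = x)) = f a"
    using * ** by (simp_all add: eq_commute[of a])
qed


section \<open>Amplitudes\<close>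

lemma length_gate_map [simp]: "length (gate_map g x) = length x"
  by (cases g) auto

lemma length_fold_gate_map [simp]: "length (fold gate_map gs x) = length x"
  by (induction gs arbitrary: x) auto

lemma gate_entry_classical: "classical_gate g \<Longrightarrow> gate_entry g y x = of_bool (y = gate_map g x)"
  by (cases g) auto

lemma amplitude_length: "x \<in> bits N \<Longrightarrow> y \<notin> bits N \<Longrightarrow> amplitude N gs y x = 0"
proof (induction gs arbitrary: x)
  case (Cons g gs)
  have "amplitude N gs y z = 0" if "z \<in> bits N" for z
    using Cons that by blast
  then show ?case by simp
qed auto

lemma amplitude_append:
  assumes "x \<in> bits N"
  shows "amplitude N (gs @ hs) y x = (\<Sum>z\<in>bits N. amplitude N hs y z * amplitude N gs z x)"
  using assms
proof (induction gs arbitrary: x)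
  case Nil
  then show ?case by (simp add: sum_of_bool_pick)
next
  case (Cons g gs)
  have "amplitude N ((g # gs) @ hs) y x =
      (\<Sum>w\<in>bits N. (\<Sum>z\<in>bits N. amplitude N hs y z * amplitude N gs z w) * gate_entry g w x)"
    using Cons.IH by simp
  also have "\<dots> = (\<Sum>w\<in>bits N. \<Sum>z\<in>bits N. amplitude N hs y z * amplitude N gs z w * gate_entry g w x)"
    by (simp add: sum_distrib_right)
  also have "\<dots> = (\<Sum>z\<in>bits N. \<Sum>w\<in>bits N. amplitude N hs y z * amplitude N gs z w * gate_entry g w x)"
    by (rule sum.swap)
  also have "\<dots> = (\<Sum>z\<in>bits N. amplitude N hs y z * amplitude N (g # gs) z x)"
    by (simp add: sum_distrib_left mult.assoc)
  finally show ?case .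
qed

lemma amplitude_classical:
  assumes "\<forall>g\<in>set gs. classical_gate g" "x \<in> bits N"
  shows "amplitude N gs y x = of_bool (y = fold gate_map gs x)"
  using assms
proof (induction gs arbitrary: x)
  case (Cons g gs)
  have "amplitude N (g # gs) y x = (\<Sum>z\<in>bits N. of_bool (y = fold gate_map gs z) * of_bool (z = gate_map g x))"
    using Cons.IH Cons.prems by (auto simp: gate_entry_classical intro!: sum.cong)
  also have "\<dots> = of_bool (y = fold gate_map gs (gate_map g x))"
    using Cons.prems by (subst sum_of_bool_pick) auto
  finally show ?case by simp
qed auto

lemma gate_map_append: "wf_gate w g \<Longrightarrow> length x = w \<Longrightarrow> gate_map g (x @ x2) = gate_map g x @ x2"
  by (cases g) (auto simp: list_update_append nth_append)

lemma fold_gate_map_append: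
  "\<forall>g\<in>set gs. wf_gate w g \<Longrightarrow> length x = w \<Longrightarrow> fold gate_map gs (x @ x2) = fold gate_map gs x @ x2"
  by (induction gs arbitrary: x) (auto simp: gate_map_append)

lemma gate_entry_append:
  assumes "wf_gate w g" "length x = w" "length z = w" "length x2 = length z2"
  shows "gate_entry g (z @ z2) (x @ x2) = gate_entry g z x * of_bool (z2 = x2)"
proof (cases g)
  case (Hadamard i)
  then have "i < w" using assms by simp
  with Hadamard assms show ?thesis
    by (auto simp: list_update_append nth_append)
next
  case (TGate i)
  with assms show ?thesis by (auto simp: nth_append)
qed (use assms in \<open>auto simp: list_update_append nth_append\<close>)

lemma amplitude_first:
  assumes "\<forall>g\<in>set gs. wf_gate w g" "x \<in> bits w" "x2 \<in> bits e" "y \<in> bits w" "y2 \<in> bits e"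
  shows "amplitude (w + e) gs (y @ y2) (x @ x2) = amplitude w gs y x * of_bool (y2 = x2)"
  using assms
proof (induction gs arbitrary: x)
  case (Cons g gs)
  have "amplitude (w + e) (g # gs) (y @ y2) (x @ x2) =
     (\<Sum>z\<in>bits w. \<Sum>z2\<in>bits e. amplitude (w + e) gs (y @ y2) (z @ z2) * gate_entry g (z @ z2) (x @ x2))"
    by (simp add: sum_bits_add)
  also have "\<dots> = (\<Sum>z\<in>bits w. \<Sum>z2\<in>bits e. (amplitude w gs y z * gate_entry g z x * of_bool (y2 = z2)) * of_bool (z2 = x2))"
    using Cons by (intro sum.cong refl) (auto simp: gate_entry_append)
  also have "\<dots> = (\<Sum>z\<in>bits w. amplitude w gs y z * gate_entry g z x * of_bool (y2 = x2))"
    using Cons.prems by (intro sum.cong refl) (subst sum_of_bool_pick, auto)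
  finally show ?case by (simp add: sum_distrib_right)
qed auto

lemma gate_map_involution: "wf_gate (length x) g \<Longrightarrow> gate_map g (gate_map g x) = x"
  by (cases g) (auto simp: list_eq_iff_nth_eq nth_list_update)

lemma inj_on_fold_gate_map:
  assumes "\<forall>g\<in>set gs. wf_gate N g"
  shows "inj_on (fold gate_map gs) (bits N)"
  using assms
proof (induction gs)
  case (Cons g gs)
  have "inj_on (gate_map g) (bits N)"
    by (rule inj_on_inverseI[where g = "gate_map g"]) (use Cons.prems in \<open>auto simp: gate_map_involution\<close>)
  moreover have "inj_on (fold gate_map gs) (gate_map g ` bits N)"
    by (rule inj_on_subset[OF Cons.IH]) (use Cons.prems in auto)
  ultimately show ?case using comp_inj_on by (fastforce simp: comp_def)
qed auto

lemma gate_isometry: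
  assumes "wf_gate N g" "x \<in> bits N" "x' \<in> bits N"
  shows "(\<Sum>z\<in>bits N. cnj (gate_entry g z x) * gate_entry g z x') = of_bool (x = x')"
proof (cases "classical_gate g")
  case True
  have "(\<Sum>z\<in>bits N. cnj (gate_entry g z x) * gate_entry g z x') =
        (\<Sum>z\<in>bits N. of_bool (z = gate_map g x) * of_bool (z = gate_map g x'))"
    using True by (simp only: gate_entry_classical cnj_of_bool)
  also have "\<dots> = of_bool (gate_map g x = gate_map g x')"
    using assms by (subst sum_of_bool_pick) auto
  also have "gate_map g x = gate_map g x' \<longleftrightarrow> x = x'"
    using assms by (metis bits_iff gate_map_involution)
  finally show ?thesis .
next
  case False
  then consider (H) i where "g = Hadamard i" | (T) i where "g = TGate i"
    by (cases g) auto
  then show ?thesis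
  proof cases
    case T
    have "(\<Sum>z\<in>bits N. cnj (gate_entry g z x) * gate_entry g z x') =
      (\<Sum>z\<in>bits N. of_bool (z = x) * (cnj (if x ! i then cis (pi / 4) else 1) *
         (if z = x' then if x' ! i then cis (pi / 4) else 1 else 0)))"
      unfolding T by (intro sum.cong) auto
    also have "\<dots> = of_bool (x = x')"
      using assms by (subst sum_of_bool_pick) (auto simp: cis_cnj cis_mult)
    finally show ?thesis .
  next
    case H
    then have i: "i < N" using assms by simp
    let ?h = "\<lambda>z. cnj (gate_entry g z x) * gate_entry g z x'"
    let ?F = "x[i := False]" and ?T = "x[i := True]"
    \<comment> \<open>The column of a Hadamard gate at \<open>x\<close> is supported on the two
      strings that agree with \<open>x\<close> off wire \<open>i\<close>.\<close>
    have "(\<Sum>z\<in>bits N. ?h z) = (\<Sum>z\<in>{?F, ?T}. ?h z)"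
    proof (rule sum.mono_neutral_right)
      show "{?F, ?T} \<subseteq> bits N" using assms by auto
      show "\<forall>z\<in>bits N - {?F, ?T}. ?h z = 0"
        unfolding H by (metis (full_types) DiffD2 complex_cnj_zero gate_entry.simps(1) insertCI mult_zero_left)
    qed auto
    also have "?F \<noteq> ?T"
      using i assms by (metis bits_iff nth_list_update_eq)
    then have "(\<Sum>z\<in>{?F, ?T}. ?h z) = ?h ?F + ?h ?T" by simp
    also have "\<dots> = of_bool (x = x')"
    proof (cases "x[i := False] = x'[i := False]")
      case True
      then have eq: "x' = x[i := x' ! i]"
        by (metis list_update_id list_update_overwrite)
      have e: "?F = x'[i := False]" "?T = x'[i := True]"
        using True by (metis list_update_overwrite)+
      have v: "gate_entry g ?F x' = 1 / complex_of_real (sqrt 2)"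
        "gate_entry g ?T x' = (if x' ! i then -1 else 1) / complex_of_real (sqrt 2)"
        unfolding e H using i assms by auto
      have v': "gate_entry g ?F x = 1 / complex_of_real (sqrt 2)"
        "gate_entry g ?T x = (if x ! i then -1 else 1) / complex_of_real (sqrt 2)"
        unfolding H using i assms by auto
      have xx: "x = x' \<longleftrightarrow> x ! i = x' ! i"
      proof
        assume "x ! i = x' ! i"
        with eq have "x' = x[i := x ! i]" by simp
        then show "x = x'" by simp
      qed simp
      have s2: "complex_of_real (sqrt 2) * complex_of_real (sqrt 2) = 2"
        by (metis abs_numeral of_real_mult of_real_numeral real_sqrt_abs2 real_sqrt_mult)
      show ?thesis
        unfolding v v' xx by (auto simp: s2 divide_simps)
    next
      case False
      have "gate_entry g z x' = 0" if "z = ?F \<or> z = ?T" for z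
      proof -
        have "z \<noteq> x'[i := z ! i]"
          using that False by (metis list_update_overwrite)
        then show ?thesis unfolding H by simp
      qed
      moreover have "x \<noteq> x'" using False by auto
      ultimately show ?thesis by simp
    qed
    finally show ?thesis .
  qed
qed

lemma amplitude_isometry:
  assumes "\<forall>g\<in>set gs. wf_gate N g" "x \<in> bits N" "x' \<in> bits N"
  shows "(\<Sum>y\<in>bits N. cnj (amplitude N gs y x) * amplitude N gs y x') = of_bool (x = x')"
  using assms
proof (induction gs arbitrary: x x')
  case Nil
  have "(\<Sum>y\<in>bits N. cnj (amplitude N [] y x) * amplitude N [] y x') = (\<Sum>y\<in>bits N. of_bool (y = x) * of_bool (y = x'))"
    by (simp only: amplitude.simps cnj_of_bool)
  also have "\<dots> = of_bool (x = x')" using Nil by (subst sum_of_bool_pick) auto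
  finally show ?case .
next
  case (Cons g gs)
  let ?A = "amplitude N gs" and ?g = "gate_entry g"
  have "(\<Sum>y\<in>bits N. cnj (amplitude N (g # gs) y x) * amplitude N (g # gs) y x') =
     (\<Sum>y\<in>bits N. \<Sum>z\<in>bits N. \<Sum>z'\<in>bits N. cnj (?A y z) * ?A y z' * (cnj (?g z x) * ?g z' x'))"
    by (simp only: amplitude.simps cnj_sum complex_cnj_mult sum_product) (simp add: mult_ac)
  also have "\<dots> = (\<Sum>z\<in>bits N. \<Sum>y\<in>bits N. \<Sum>z'\<in>bits N. cnj (?A y z) * ?A y z' * (cnj (?g z x) * ?g z' x'))"
    by (rule sum.swap)
  also have "\<dots> = (\<Sum>z\<in>bits N. \<Sum>z'\<in>bits N. \<Sum>y\<in>bits N. cnj (?A y z) * ?A y z' * (cnj (?g z x) * ?g z' x'))"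
    by (intro sum.cong refl sum.swap)
  also have "\<dots> = (\<Sum>z\<in>bits N. \<Sum>z'\<in>bits N. of_bool (z = z') * (cnj (?g z x) * ?g z' x'))"
    using Cons.IH Cons.prems by (simp flip: sum_distrib_right)
  also have "\<dots> = (\<Sum>z\<in>bits N. cnj (?g z x) * ?g z x')"
    by (intro sum.cong refl) (subst sum_of_bool_pick, auto)
  also have "\<dots> = of_bool (x = x')"
    using Cons.prems by (intro gate_isometry) auto
  finally show ?case .
qed

section \<open>Channels computed by circuits\<close>

text \<open>\<open>density\<close> without the trace condition, since operators after a measurement
  are not normalised.\<close>

definition psd :: "nat \<Rightarrow> qop \<Rightarrow> bool" where
  "psd n \<rho> \<longleftrightarrow> (\<forall>x y. \<rho> x y \<noteq> 0 \<longrightarrow> x \<in> bits n \<and> y \<in> bits n) \<and>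
     (\<forall>v. (\<Sum>x\<in>bits n. \<Sum>y\<in>bits n. cnj (v x) * \<rho> x y * v y) \<in> \<real>\<^sub>\<ge>\<^sub>0)"

definition op_trace :: "nat \<Rightarrow> qop \<Rightarrow> complex" where
  "op_trace n \<rho> = (\<Sum>x\<in>bits n. \<rho> x x)"

lemma density_iff: "density n \<rho> \<longleftrightarrow> psd n \<rho> \<and> op_trace n \<rho> = 1"
  by (simp add: density_def psd_def op_trace_def)

lemma psd_outside: "psd n \<rho> \<Longrightarrow> x \<notin> bits n \<or> y \<notin> bits n \<Longrightarrow> \<rho> x y = 0"
  unfolding psd_def by blast

lemma psd_form: "psd n \<rho> \<Longrightarrow> (\<Sum>x\<in>bits n. \<Sum>y\<in>bits n. cnj (v x) * \<rho> x y * v y) \<in> \<real>\<^sub>\<ge>\<^sub>0"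
  unfolding psd_def by blast

lemma sum_nonneg_Reals: "(\<And>i. i \<in> I \<Longrightarrow> f i \<in> \<real>\<^sub>\<ge>\<^sub>0) \<Longrightarrow> sum f I \<in> (\<real>\<^sub>\<ge>\<^sub>0 :: complex set)"
  by (induction I rule: infinite_finite_induct) (auto intro: nonneg_Reals_add_I)

lemma psd_diag: assumes "psd n \<rho>" shows "\<rho> x x \<in> \<real>\<^sub>\<ge>\<^sub>0"
proof (cases "x \<in> bits n")
  case True
  have "(\<Sum>z\<in>bits n. \<Sum>y\<in>bits n. cnj (of_bool (z = x)) * \<rho> z y * of_bool (y = x)) =
        (\<Sum>z\<in>bits n. \<Sum>y\<in>bits n. of_bool (z = x) * (\<rho> z y * of_bool (y = x)))"
    by (simp only: cnj_of_bool mult.assoc)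
  also have "\<dots> = (\<Sum>z\<in>bits n. of_bool (z = x) * (\<Sum>y\<in>bits n. \<rho> z y * of_bool (y = x)))"
    by (simp only: sum_distrib_left)
  also have "\<dots> = \<rho> x x"
    using True by (subst sum_of_bool_pick; simp only: sum_of_bool_pick finite_bits)
  finally show ?thesis
    using psd_form[OF assms, of "\<lambda>z. of_bool (z = x)"] by simp
next
  case False
  then show ?thesis using psd_outside[OF assms] by simp
qed

lemma prob_out_nonneg: "psd n \<rho> \<Longrightarrow> 0 \<le> prob_out \<rho> y"
  using psd_diag[of n \<rho> y] by (auto simp: prob_out_def nonneg_Reals_def)

lemma sum_prob_out: "(\<Sum>y\<in>bits n. prob_out \<rho> y) = Re (op_trace n \<rho>)"
  by (simp add: prob_out_def op_trace_def)

lemma run_cong: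
  assumes "\<And>x x'. x \<in> bits (nin C) \<Longrightarrow> x' \<in> bits (nin C) \<Longrightarrow> \<rho> x x' = \<rho>' x x'"
  shows "run C \<rho> = run C \<rho>'"
  unfolding run_def fun_eq_iff using assms by (auto intro!: sum.cong)

lemma run_outside:
  assumes "wf_circ C" "y \<notin> bits (nout C) \<or> y' \<notin> bits (nout C)"
  shows "run C \<rho> y y' = 0"
proof -
  have le: "nout C \<le> wires C" using assms by (simp add: wf_circ_def)
  have "amplitude (wires C) (gates C) (z @ t) (x @ replicate (nanc C) False) = 0"
    if "z \<notin> bits (nout C)" "t \<in> bits (wires C - nout C)" "x \<in> bits (nin C)" for z t x
    using that le by (intro amplitude_length) (auto simp: wires_def)
  with assms show ?thesis
    unfolding run_def by (intro sum.neutral ballI) (metis complex_cnj_zero_iff mult_zero_left mult_zero_right)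
qed

lemma run_sum:
  "run C (\<lambda>x x'. \<Sum>i\<in>I. c i * \<rho> i x x') y y' = (\<Sum>i\<in>I. c i * run C (\<rho> i) y y')"
proof -
  let ?A = "\<lambda>y t x. amplitude (wires C) (gates C) (y @ t) (x @ replicate (nanc C) False)"
  have "run C (\<lambda>x x'. \<Sum>i\<in>I. c i * \<rho> i x x') y y' =
    (\<Sum>t\<in>bits (wires C - nout C). \<Sum>x\<in>bits (nin C). \<Sum>x'\<in>bits (nin C). \<Sum>i\<in>I.
       c i * (?A y t x * \<rho> i x x' * cnj (?A y' t x')))"
    unfolding run_def by (simp add: sum_distrib_left sum_distrib_right mult_ac)
  also have "\<dots> = (\<Sum>t\<in>bits (wires C - nout C). \<Sum>x\<in>bits (nin C). \<Sum>i\<in>I. \<Sum>x'\<in>bits (nin C).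
       c i * (?A y t x * \<rho> i x x' * cnj (?A y' t x')))"
    by (intro sum.cong refl sum.swap)
  also have "\<dots> = (\<Sum>t\<in>bits (wires C - nout C). \<Sum>i\<in>I. \<Sum>x\<in>bits (nin C). \<Sum>x'\<in>bits (nin C).
       c i * (?A y t x * \<rho> i x x' * cnj (?A y' t x')))"
    by (intro sum.cong refl sum.swap)
  also have "\<dots> = (\<Sum>i\<in>I. \<Sum>t\<in>bits (wires C - nout C). \<Sum>x\<in>bits (nin C). \<Sum>x'\<in>bits (nin C).
       c i * (?A y t x * \<rho> i x x' * cnj (?A y' t x')))"
    by (rule sum.swap)
  finally show ?thesis by (simp only: run_def sum_distrib_left)
qed

lemma run_scale: "run C (\<lambda>x x'. c * \<rho> x x') y y' = c * run C \<rho> y y'"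
  using run_sum[where I = "{()}" and c = "\<lambda>_. c" and \<rho> = "\<lambda>_. \<rho>"] by simp

text \<open>For each discarded string \<open>t\<close> the circuit applies one Kraus operator; the
  quadratic form of the output at \<open>v\<close> is the sum over \<open>t\<close> of the form of
  the input at the vector \<open>?g t\<close>, the adjoint Kraus operator applied to
  \<open>v\<close>.\<close>

lemma run_psd:
  assumes "wf_circ C" "psd (nin C) \<rho>"
  shows "psd (nout C) (run C \<rho>)"
  unfolding psd_def
proof (intro conjI allI impI)
  fix x y assume "run C \<rho> x y \<noteq> 0"
  then show "x \<in> bits (nout C)" "y \<in> bits (nout C)" using run_outside[OF assms(1)] by blast+
next
  fix v :: "bool list \<Rightarrow> complex"
  let ?A = "\<lambda>y t x. amplitude (wires C) (gates C) (y @ t) (x @ replicate (nanc C) False)"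
  let ?g = "\<lambda>t x. \<Sum>y\<in>bits (nout C). v y * cnj (?A y t x)"
  let ?T = "bits (wires C - nout C)" and ?X = "bits (nin C)" and ?Y = "bits (nout C)"
  have "(\<Sum>y\<in>?Y. \<Sum>y'\<in>?Y. cnj (v y) * run C \<rho> y y' * v y') =
    (\<Sum>y\<in>?Y. \<Sum>y'\<in>?Y. \<Sum>t\<in>?T. \<Sum>x\<in>?X. \<Sum>x'\<in>?X. cnj (v y) * ?A y t x * \<rho> x x' * (v y' * cnj (?A y' t x')))"
    unfolding run_def by (simp add: sum_distrib_left sum_distrib_right mult_ac)
  also have "\<dots> = (\<Sum>(y,y',t,x,x')\<in>?Y \<times> ?Y \<times> ?T \<times> ?X \<times> ?X. cnj (v y) * ?A y t x * \<rho> x x' * (v y' * cnj (?A y' t x')))"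
    by (simp add: sum.cartesian_product)
  also have "\<dots> = (\<Sum>(t,x,x',y,y')\<in>?T \<times> ?X \<times> ?X \<times> ?Y \<times> ?Y. cnj (v y) * ?A y t x * \<rho> x x' * (v y' * cnj (?A y' t x')))"
    by (rule sum.reindex_bij_witness[where i = "\<lambda>(t,x,x',y,y'). (y,y',t,x,x')" and j = "\<lambda>(y,y',t,x,x'). (t,x,x',y,y')"]) auto
  also have "\<dots> = (\<Sum>t\<in>?T. \<Sum>x\<in>?X. \<Sum>x'\<in>?X. \<Sum>y\<in>?Y. \<Sum>y'\<in>?Y. cnj (v y) * ?A y t x * \<rho> x x' * (v y' * cnj (?A y' t x')))"
    by (simp add: sum.cartesian_product)
  also have "\<dots> = (\<Sum>t\<in>?T. \<Sum>x\<in>?X. \<Sum>x'\<in>?X. cnj (?g t x) * \<rho> x x' * ?g t x')"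
    by (simp add: sum_distrib_left sum_distrib_right mult_ac)
  also have "\<dots> \<in> \<real>\<^sub>\<ge>\<^sub>0"
  proof (rule sum_nonneg_Reals)
    show "(\<Sum>x\<in>?X. \<Sum>x'\<in>?X. cnj (?g t x) * \<rho> x x' * ?g t x') \<in> \<real>\<^sub>\<ge>\<^sub>0" for t
      by (rule psd_form[OF assms(2)])
  qed
  finally show "(\<Sum>y\<in>?Y. \<Sum>y'\<in>?Y. cnj (v y) * run C \<rho> y y' * v y') \<in> \<real>\<^sub>\<ge>\<^sub>0" .
qed

text \<open>Output and discarded wires summed together give inner products of columns of the
  unitary, which are orthonormal by \<open>amplitude_isometry\<close>.\<close>

lemma run_trace:
  assumes "wf_circ C"
  shows "op_trace (nout C) (run C \<rho>) = op_trace (nin C) \<rho>"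
proof -
  let ?A = "\<lambda>y x. amplitude (wires C) (gates C) y (x @ replicate (nanc C) False)"
  let ?X = "bits (nin C)"
  have w: "nout C + (wires C - nout C) = wires C" using assms by (simp add: wf_circ_def)
  have "op_trace (nout C) (run C \<rho>) =
     (\<Sum>y\<in>bits (nout C). \<Sum>t\<in>bits (wires C - nout C). \<Sum>x\<in>?X. \<Sum>x'\<in>?X. ?A (y @ t) x * \<rho> x x' * cnj (?A (y @ t) x'))"
    by (simp add: op_trace_def run_def)
  also have "\<dots> = (\<Sum>y\<in>bits (wires C). \<Sum>x\<in>?X. \<Sum>x'\<in>?X. ?A y x * \<rho> x x' * cnj (?A y x'))"
    using sum_bits_add[of "\<lambda>y. \<Sum>x\<in>?X. \<Sum>x'\<in>?X. ?A y x * \<rho> x x' * cnj (?A y x')" "nout C" "wires C - nout C"]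
    unfolding w by (rule sym)
  also have "\<dots> = (\<Sum>x\<in>?X. \<Sum>y\<in>bits (wires C). \<Sum>x'\<in>?X. ?A y x * \<rho> x x' * cnj (?A y x'))"
    by (rule sum.swap)
  also have "\<dots> = (\<Sum>x\<in>?X. \<Sum>x'\<in>?X. \<Sum>y\<in>bits (wires C). ?A y x * \<rho> x x' * cnj (?A y x'))"
    by (intro sum.cong refl sum.swap)
  also have "\<dots> = (\<Sum>x\<in>?X. \<Sum>x'\<in>?X. \<rho> x x' * (\<Sum>y\<in>bits (wires C). cnj (?A y x') * ?A y x))"
    by (simp add: sum_distrib_left mult_ac)
  also have "\<dots> = (\<Sum>x\<in>?X. \<Sum>x'\<in>?X. \<rho> x x' * of_bool (x' = x))"
    using assms by (intro sum.cong refl) (subst amplitude_isometry, auto simp: wf_circ_def wires_def)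
  also have "\<dots> = op_trace (nin C) \<rho>"
    unfolding op_trace_def by (intro sum.cong refl) (subst sum_of_bool_pick, auto)
  finally show ?thesis .
qed

lemma run_density: "wf_circ C \<Longrightarrow> density (nin C) \<rho> \<Longrightarrow> density (nout C) (run C \<rho>)"
  by (simp add: density_iff run_psd run_trace)

text \<open>Classical gates permute the basis strings. Output wires together with discarded wires
  determine the input, so off-diagonal entries of \<rho> do not reach the diagonal of the output,
  and a basis state stays a basis state.\<close>

lemma run_classical:
  assumes "wf_circ C" "classical C" "length y = nout C"
  shows "run C \<rho> y y = (\<Sum>x\<in>{x \<in> bits (nin C). ceval C x = y}. \<rho> x x)"
    and "x0 \<in> bits (nin C) \<Longrightarrow> run C (basis x0) = basis (ceval C x0)"
proof -
  let ?E = "\<lambda>x. fold gate_map (gates C) (x @ replicate (nanc C) False)"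
  have len: "length (?E x) = wires C" if "x \<in> bits (nin C)" for x using that by (simp add: wires_def)
  have le: "nout C \<le> wires C" using assms by (simp add: wf_circ_def)
  have A: "amplitude (wires C) (gates C) z (x @ replicate (nanc C) False) = of_bool (z = ?E x)" if "x \<in> bits (nin C)" for x z
    using assms that by (intro amplitude_classical) (auto simp: classical_def wires_def)
  have inj: "?E x = ?E x' \<longleftrightarrow> x = x'" if "x \<in> bits (nin C)" "x' \<in> bits (nin C)" for x x'
    using inj_onD[OF inj_on_fold_gate_map, of "gates C" "wires C" "x @ replicate (nanc C) False" "x' @ replicate (nanc C) False"]
      assms that by (auto simp: wf_circ_def wires_def)
  have pick: "(\<Sum>t\<in>bits (wires C - nout C). of_bool (z @ t = ?E x) :: complex) = of_bool (z = ceval C x)"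
    if "x \<in> bits (nin C)" "length z = nout C" for x z
  proof -
    have "(\<Sum>t\<in>bits (wires C - nout C). of_bool (z @ t = ?E x) :: complex) =
          (\<Sum>t\<in>bits (wires C - nout C). of_bool (z = ceval C x) * of_bool (t = drop (nout C) (?E x)))"
    proof (rule sum.cong[OF refl])
      fix t
      have "z @ t = ?E x \<longleftrightarrow> z = ceval C x \<and> t = drop (nout C) (?E x)"
        using that(2) unfolding ceval_def by (metis append_eq_conv_conj)
      then show "of_bool (z @ t = ?E x) = (of_bool (z = ceval C x) * of_bool (t = drop (nout C) (?E x)) :: complex)" by simp
    qed
    also have "\<dots> = of_bool (z = ceval C x)"
      using len[OF that(1)] by (subst sum_of_bool_pick) auto
    finally show ?thesis .
  qed
  have "run C \<rho> y y = (\<Sum>t\<in>bits (wires C - nout C). \<Sum>x\<in>bits (nin C). \<Sum>x'\<in>bits (nin C).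
          of_bool (y @ t = ?E x) * \<rho> x x * of_bool (x' = x))"
    unfolding run_def by (intro sum.cong refl) (use A inj in auto)
  also have "\<dots> = (\<Sum>t\<in>bits (wires C - nout C). \<Sum>x\<in>bits (nin C). of_bool (y @ t = ?E x) * \<rho> x x)"
    by (intro sum.cong refl) (subst sum_of_bool_pick, auto)
  also have "\<dots> = (\<Sum>x\<in>bits (nin C). (\<Sum>t\<in>bits (wires C - nout C). of_bool (y @ t = ?E x)) * \<rho> x x)"
    by (subst sum.swap) (simp only: sum_distrib_right)
  also have "\<dots> = (\<Sum>x\<in>bits (nin C). of_bool (y = ceval C x) * \<rho> x x)"
    by (intro sum.cong refl) (subst pick, use assms(3) in auto)
  also have "\<dots> = (\<Sum>x\<in>{x \<in> bits (nin C). ceval C x = y}. \<rho> x x)"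
    by (rule sum.mono_neutral_cong_right) auto
  finally show "run C \<rho> y y = (\<Sum>x\<in>{x \<in> bits (nin C). ceval C x = y}. \<rho> x x)" .
  assume x0: "x0 \<in> bits (nin C)"
  show "run C (basis x0) = basis (ceval C x0)"
  proof (intro ext)
    fix z z'
    show "run C (basis x0) z z' = basis (ceval C x0) z z'"
    proof (cases "length z = nout C \<and> length z' = nout C")
      case False
      have "length (ceval C x0) = nout C" using len[OF x0] le by (simp add: ceval_def)
      with False show ?thesis using run_outside[OF assms(1)] by (auto simp: basis_def)
    next
      case True
      have "run C (basis x0) z z' = (\<Sum>t\<in>bits (wires C - nout C). \<Sum>x\<in>bits (nin C). \<Sum>x'\<in>bits (nin C).
          of_bool (x = x0) * (of_bool (z @ t = ?E x) * (of_bool (z' @ t = ?E x') * of_bool (x' = x0))))"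
        unfolding run_def basis_def by (intro sum.cong refl) (use A in auto)
      also have "\<dots> = (\<Sum>t\<in>bits (wires C - nout C). \<Sum>x\<in>bits (nin C).
          of_bool (x = x0) * (of_bool (z @ t = ?E x) * (\<Sum>x'\<in>bits (nin C). of_bool (z' @ t = ?E x') * of_bool (x' = x0))))"
        by (simp only: sum_distrib_left)
      also have "\<dots> = (\<Sum>t\<in>bits (wires C - nout C). of_bool (z @ t = ?E x0) * of_bool (z' @ t = ?E x0))"
        using x0 by (simp only: sum_of_bool_pick finite_bits)
      also have "\<dots> = (\<Sum>t\<in>bits (wires C - nout C). of_bool (z = z') * of_bool (z @ t = ?E x0))"
      proof (rule sum.cong[OF refl])
        fix t
        have "(z @ t = ?E x0 \<and> z' @ t = ?E x0) = (z = z' \<and> z @ t = ?E x0)" by (metis append_same_eq)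
        then show "of_bool (z @ t = ?E x0) * of_bool (z' @ t = ?E x0) = (of_bool (z = z') * of_bool (z @ t = ?E x0) :: complex)"
          by (simp flip: of_bool_conj)
      qed
      also have "\<dots> = basis (ceval C x0) z z'"
        using pick[OF x0, of z] True by (auto simp: basis_def simp flip: sum_distrib_left)
      finally show ?thesis .
    qed
  qed
qed

lemma run_classical_basis:
  "wf_circ C \<Longrightarrow> classical C \<Longrightarrow> x \<in> bits (nin C) \<Longrightarrow> run C (basis x) = basis (ceval C x)"
  by (rule run_classical(2)[of C "replicate (nout C) False"]) auto

subsection \<open>Wire permutations\<close>

lemma swap_gates:
  assumes "i < length x" "j < length x" "i \<noteq> j"
  shows "fold gate_map [CNot i j, CNot j i, CNot i j] x = x[i := x ! j, j := x ! i]"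
  using assms by (auto simp: list_eq_iff_nth_eq nth_list_update)

text \<open>Selection sort: after \<open>k\<close> rounds the first \<open>k\<close> positions are
  right, and each round needs at most one transposition, made of three \<open>CNot\<close>
  gates.\<close>

lemma ex_permutation_gates:
  assumes "bij_betw \<pi> {..<N} {..<N}"
  shows "\<exists>gs. length gs \<le> 3 * N \<and> (\<forall>g\<in>set gs. wf_gate N g \<and> classical_gate g) \<and>
    (\<forall>x\<in>bits N. fold gate_map gs x = map (\<lambda>i. x ! \<pi> i) [0..<N])"
proof -
  have "\<exists>gs \<sigma>. length gs \<le> 3 * k \<and> (\<forall>g\<in>set gs. wf_gate N g \<and> classical_gate g) \<and>
     bij_betw \<sigma> {..<N} {..<N} \<and> (\<forall>i<k. \<sigma> i = \<pi> i) \<and>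
     (\<forall>x\<in>bits N. fold gate_map gs x = map (\<lambda>i. x ! \<sigma> i) [0..<N])" if "k \<le> N" for k
    using that
  proof (induction k)
    case 0
    show ?case
      by (rule exI[of _ "[]"], rule exI[of _ id]) (auto simp: list_eq_iff_nth_eq bij_betw_def)
  next
    case (Suc k)
    then obtain gs \<sigma> where gs: "length gs \<le> 3 * k" "\<forall>g\<in>set gs. wf_gate N g \<and> classical_gate g"
      "bij_betw \<sigma> {..<N} {..<N}" "\<forall>i<k. \<sigma> i = \<pi> i"
      "\<forall>x\<in>bits N. fold gate_map gs x = map (\<lambda>i. x ! \<sigma> i) [0..<N]" by auto
    have "k < N" using Suc by simp
    then have "\<pi> k \<in> \<sigma> ` {..<N}" using assms gs(3) by (auto simp: bij_betw_def)
    then obtain j where j: "j < N" "\<sigma> j = \<pi> k" by auto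
    have "\<not> j < k" using gs(4) j assms \<open>k < N\<close> by (metis bij_betw_def inj_on_eq_iff lessThan_iff order.irrefl)
    show ?case
    proof (cases "j = k")
      case True
      with gs j show ?thesis by (intro exI[of _ gs] exI[of _ \<sigma>]) (auto simp: less_Suc_eq)
    next
      case False
      let ?\<sigma> = "\<sigma> \<circ> Transposition.transpose k j"
      have "bij_betw (Transposition.transpose k j) {..<N} {..<N}"
        by (rule bij_betwI[where g = "Transposition.transpose k j"])
          (use \<open>k < N\<close> j in \<open>auto simp: Transposition.transpose_def\<close>)
      then have b: "bij_betw ?\<sigma> {..<N} {..<N}" using gs(3) by (rule bij_betw_trans)
      have "fold gate_map (gs @ [CNot k j, CNot j k, CNot k j]) x = map (\<lambda>i. x ! ?\<sigma> i) [0..<N]"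
        if "x \<in> bits N" for x
      proof -
        have "fold gate_map (gs @ [CNot k j, CNot j k, CNot k j]) x =
           fold gate_map [CNot k j, CNot j k, CNot k j] (map (\<lambda>i. x ! \<sigma> i) [0..<N])"
          using gs(5) that by simp
        also have "\<dots> = map (\<lambda>i. x ! ?\<sigma> i) [0..<N]"
          using \<open>k < N\<close> j False
          by (subst swap_gates) (auto simp: list_eq_iff_nth_eq nth_list_update Transposition.transpose_def)
        finally show ?thesis .
      qed
      moreover have "\<forall>i<Suc k. ?\<sigma> i = \<pi> i"
        using gs(4) j \<open>\<not> j < k\<close> by (auto simp: Transposition.transpose_def less_Suc_eq)
      ultimately show ?thesis
        using gs(1,2) b \<open>k < N\<close> j False
        by (intro exI[of _ "gs @ [CNot k j, CNot j k, CNot k j]"] exI[of _ ?\<sigma>] conjI) (auto simp del: o_apply)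
    qed
  qed
  from this[of N] obtain gs \<sigma> where "length gs \<le> 3 * N" "\<forall>g\<in>set gs. wf_gate N g \<and> classical_gate g"
     "\<forall>i<N. \<sigma> i = \<pi> i" "\<forall>x\<in>bits N. fold gate_map gs x = map (\<lambda>i. x ! \<sigma> i) [0..<N]" by auto
  then show ?thesis by (intro exI[of _ gs]) (auto intro!: map_cong)
qed

text \<open>The rewiring behind all circuit constructions below: input comes first, ancillas last,
  output first again, so ancillas and discarded wires have to be moved past other blocks.\<close>

lemma ex_block_swap_gates:
  "\<exists>gs. length gs \<le> 3 * (p + a + b + q) \<and> (\<forall>g\<in>set gs. wf_gate (p + a + b + q) g \<and> classical_gate g) \<and>
    (\<forall>u\<in>bits p. \<forall>v\<in>bits a. \<forall>w\<in>bits b. \<forall>t\<in>bits q. fold gate_map gs (u @ v @ w @ t) = u @ w @ v @ t)"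
proof -
  define \<pi> where "\<pi> i = (if i < p then i else if i < p + b then i + a else if i < p + b + a then i - b else i)" for i
  have "bij_betw \<pi> {..<p + a + b + q} {..<p + a + b + q}"
    by (rule bij_betwI[where g = "\<lambda>i. if i < p then i else if i < p + a then i + b else if i < p + a + b then i - a else i"])
      (auto simp: \<pi>_def)
  from ex_permutation_gates[OF this] obtain gs where gs: "length gs \<le> 3 * (p + a + b + q)"
    "\<forall>g\<in>set gs. wf_gate (p + a + b + q) g \<and> classical_gate g"
    "\<forall>x\<in>bits (p + a + b + q). fold gate_map gs x = map (\<lambda>i. x ! \<pi> i) [0..<p + a + b + q]" by blast
  have "fold gate_map gs (u @ v @ w @ t) = u @ w @ v @ t"
    if l: "u\<in>bits p" "v\<in>bits a" "w\<in>bits b" "t\<in>bits q" for u v w t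
  proof -
    have "fold gate_map gs (u @ v @ w @ t) = map (\<lambda>i. (u @ v @ w @ t) ! \<pi> i) [0..<p + a + b + q]"
      using gs(3) l by simp
    also have "\<dots> = u @ w @ v @ t"
    proof (rule nth_equalityI)
      fix i assume "i < length (map (\<lambda>i. (u @ v @ w @ t) ! \<pi> i) [0..<p + a + b + q])"
      then have i: "i < p + a + b + q" by simp
      consider "i < p" | j where "i = p + j" "j < b" | j where "i = p + b + j" "j < a"
        | j where "i = p + b + a + j"
        by (metis (no_types) add.assoc le_Suc_ex nat_add_left_cancel_less not_le_imp_less)
      then have "(u @ v @ w @ t) ! \<pi> i = (u @ w @ v @ t) ! i"
        using l by cases (simp_all add: \<pi>_def nth_append)
      with i show "map (\<lambda>i. (u @ v @ w @ t) ! \<pi> i) [0..<p + a + b + q] ! i = (u @ w @ v @ t) ! i" by simp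
    qed (use l in simp)
    finally show ?thesis .
  qed
  with gs show ?thesis by blast
qed

subsection \<open>Composition, tensoring with the identity, padding\<close>

lemma wf_gate_mono: "wf_gate n g \<Longrightarrow> n \<le> m \<Longrightarrow> wf_gate m g"
  by (cases g) auto

text \<open>After \<open>C1\<close> the wires are its output, its \<open>g\<close> discarded wires,
  and the zero ancillas reserved for \<open>C2\<close>. The last two blocks are exchanged so that
  \<open>C2\<close> finds its ancillas behind its input; the \<open>g\<close> wires stay idle until
  the final partial trace, which therefore also performs the one of \<open>C1\<close>.\<close>

lemma ex_seq:
  assumes "wf_circ C1" "wf_circ C2" "nout C1 = nin C2"
  shows "\<exists>C. wf_circ C \<and> nin C = nin C1 \<and> nout C = nout C2 \<and>
     csize C \<le> 4 * (csize C1 + csize C2) \<and>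
     (\<forall>\<rho>. run C \<rho> = run C2 (run C1 \<rho>))"
proof -
  define b g e1 e2 c where "b = nin C2" and "g = wires C1 - nin C2" and "e1 = nanc C1" and "e2 = nanc C2" and "c = nout C2"
  have w1: "wires C1 = b + g" and w2: "wires C2 = b + e2" and c2: "c \<le> b + e2" and ae: "nin C1 + e1 = b + g" "nin C2 = b"
    using assms by (auto simp: wf_circ_def wires_def b_def g_def e1_def e2_def c_def)
  obtain pm where pm: "length pm \<le> 3 * (b + g + e2 + 0)" "\<forall>h\<in>set pm. wf_gate (b + g + e2 + 0) h \<and> classical_gate h"
    "\<forall>u\<in>bits b. \<forall>v\<in>bits g. \<forall>w\<in>bits e2. \<forall>t\<in>bits 0. fold gate_map pm (u @ v @ w @ t) = u @ w @ v @ t"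
    using ex_block_swap_gates by blast
  define C where "C = Circ (nin C1) (e1 + e2) c (gates C1 @ pm @ gates C2)"
  have wC: "wires C = b + g + e2" by (simp add: C_def wires_def ae flip: add.assoc)
  have wf: "wf_circ C"
    unfolding wf_circ_def wC
  proof (intro conjI ballI)
    show "nout C \<le> b + g + e2" using c2 by (simp add: C_def)
    fix h assume "h \<in> set (gates C)"
    then consider "h \<in> set (gates C1)" | "h \<in> set pm" | "h \<in> set (gates C2)" by (auto simp: C_def)
    then show "wf_gate (b + g + e2) h"
    proof cases
      case 1 then show ?thesis using assms(1) w1 by (auto simp: wf_circ_def intro: wf_gate_mono[of "b + g"])
    next
      case 2 then show ?thesis using pm by simp
    next
      case 3 then show ?thesis using assms(2) w2 by (auto simp: wf_circ_def intro: wf_gate_mono[of "b + e2"])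
    qed
  qed
  let ?A1 = "\<lambda>z t x. amplitude (b + g) (gates C1) (z @ t) (x @ replicate e1 False)"
  let ?A2 = "\<lambda>y t z. amplitude (b + e2) (gates C2) (y @ t) (z @ replicate e2 False)"
  have amp: "amplitude (b + g + e2) (gates C) (y @ t @ s) (x @ replicate (e1 + e2) False) = (\<Sum>z\<in>bits b. ?A2 y t z * ?A1 z s x)"
    if y: "y \<in> bits c" and t: "t \<in> bits (b + e2 - c)" and s: "s \<in> bits g" and x: "x \<in> bits (nin C1)" for y t s x
  proof -
    let ?x = "x @ replicate e1 False"
    have X: "x @ replicate (e1 + e2) False = ?x @ replicate e2 False" by (simp add: replicate_add)
    have lx: "?x \<in> bits (b + g)" using x ae by simp
    have gw: "\<forall>h\<in>set (gates C1). wf_gate (b + g) h" "\<forall>h\<in>set (gates C2). wf_gate (b + e2) h"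
      using assms w1 w2 by (auto simp: wf_circ_def)
    have inner: "amplitude (b + g + e2) (pm @ gates C2) (y @ t @ s) (zb @ zg @ ze) = amplitude (b + e2) (gates C2) (y @ t) (zb @ ze) * of_bool (zg = s)"
      if "zb \<in> bits b" "zg \<in> bits g" "ze \<in> bits e2" for zb zg ze
    proof -
      have "amplitude (b + g + e2) (pm @ gates C2) (y @ t @ s) (zb @ zg @ ze) =
        (\<Sum>z\<in>bits (b + g + e2). amplitude (b + g + e2) (gates C2) (y @ t @ s) z * of_bool (z = zb @ ze @ zg))"
        using pm that by (subst amplitude_append) (auto simp: amplitude_classical dest!: bspec[of _ _ "[]"] bspec[of _ _ zb] intro!: sum.cong)
      also have "\<dots> = amplitude (b + g + e2) (gates C2) (y @ t @ s) (zb @ ze @ zg)"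
        using that by (subst sum_of_bool_pick) auto
      also have "\<dots> = amplitude (b + e2 + g) (gates C2) ((y @ t) @ s) ((zb @ ze) @ zg)"
        by (simp add: ac_simps)
      also have "\<dots> = amplitude (b + e2) (gates C2) (y @ t) (zb @ ze) * of_bool (s = zg)"
        using that y t s c2 gw by (intro amplitude_first) auto
      finally show ?thesis by (simp add: eq_commute)
    qed
    have "amplitude (b + g + e2) (gates C) (y @ t @ s) (x @ replicate (e1 + e2) False) =
      (\<Sum>z\<in>bits (b + g + e2). amplitude (b + g + e2) (pm @ gates C2) (y @ t @ s) z * amplitude (b + g + e2) (gates C1) z (?x @ replicate e2 False))"
      unfolding X using x ae by (simp add: C_def amplitude_append)
    also have "\<dots> = (\<Sum>zb\<in>bits b. \<Sum>zg\<in>bits g. \<Sum>ze\<in>bits e2. amplitude (b + g + e2) (pm @ gates C2) (y @ t @ s) (zb @ zg @ ze) *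
         amplitude (b + g + e2) (gates C1) ((zb @ zg) @ ze) (?x @ replicate e2 False))"
      by (simp add: sum_bits_add)
    also have "\<dots> = (\<Sum>zb\<in>bits b. \<Sum>zg\<in>bits g. \<Sum>ze\<in>bits e2.
        (amplitude (b + e2) (gates C2) (y @ t) (zb @ ze) * of_bool (zg = s) *
         amplitude (b + g) (gates C1) (zb @ zg) ?x) * of_bool (ze = replicate e2 False))"
      using inner lx gw by (intro sum.cong refl, subst amplitude_first) auto
    also have "\<dots> = (\<Sum>zb\<in>bits b. \<Sum>zg\<in>bits g. ?A2 y t zb * of_bool (zg = s) * amplitude (b + g) (gates C1) (zb @ zg) ?x)"
      by (intro sum.cong refl, subst sum_of_bool_pick) auto
    also have "\<dots> = (\<Sum>zb\<in>bits b. \<Sum>zg\<in>bits g. of_bool (zg = s) * (?A2 y t zb * amplitude (b + g) (gates C1) (zb @ zg) ?x))"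
      by (simp add: mult_ac)
    also have "\<dots> = (\<Sum>z\<in>bits b. ?A2 y t z * ?A1 z s x)"
      using s by (intro sum.cong refl, subst sum_of_bool_pick) auto
    finally show ?thesis .
  qed
  let ?X = "bits (nin C1)" and ?T = "bits (b + e2 - c)" and ?S = "bits g" and ?B = "bits b"
  have "run C \<rho> = run C2 (run C1 \<rho>)" for \<rho>
  proof (intro ext)
    fix y y'
    show "run C \<rho> y y' = run C2 (run C1 \<rho>) y y'"
    proof (cases "y \<in> bits c \<and> y' \<in> bits c")
      case False
      then show ?thesis using run_outside[OF wf, of y y'] run_outside[OF assms(2), of y y'] by (auto simp: C_def c_def)
    next
      case True
      have nC: "nin C = nin C1" "nanc C = e1 + e2" "nout C = c" by (auto simp: C_def)
      have wl: "b + g + e2 - c = (b + e2 - c) + g" using c2 by simp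
      have "run C \<rho> y y' = (\<Sum>t\<in>?T. \<Sum>s\<in>?S. \<Sum>x\<in>?X. \<Sum>x'\<in>?X.
          (\<Sum>z\<in>?B. ?A2 y t z * ?A1 z s x) * \<rho> x x' * cnj (\<Sum>z\<in>?B. ?A2 y' t z * ?A1 z s x'))"
        unfolding run_def wC nC wl sum_bits_add using True amp by (intro sum.cong refl) auto
      also have "\<dots> = (\<Sum>t\<in>?T. \<Sum>s\<in>?S. \<Sum>x\<in>?X. \<Sum>x'\<in>?X. \<Sum>z\<in>?B. \<Sum>z'\<in>?B.
          ?A2 y t z * (?A1 z s x * \<rho> x x' * cnj (?A1 z' s x')) * cnj (?A2 y' t z'))"
        by (simp add: sum_distrib_left sum_distrib_right mult_ac)
      also have "\<dots> = (\<Sum>(t,s,x,x',z,z')\<in>?T\<times>?S\<times>?X\<times>?X\<times>?B\<times>?B.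
          ?A2 y t z * (?A1 z s x * \<rho> x x' * cnj (?A1 z' s x')) * cnj (?A2 y' t z'))"
        by (simp add: sum.cartesian_product)
      also have "\<dots> = (\<Sum>(t,z,z',s,x,x')\<in>?T\<times>?B\<times>?B\<times>?S\<times>?X\<times>?X.
          ?A2 y t z * (?A1 z s x * \<rho> x x' * cnj (?A1 z' s x')) * cnj (?A2 y' t z'))"
        by (rule sum.reindex_bij_witness[where i = "\<lambda>(t,z,z',s,x,x'). (t,s,x,x',z,z')" and j = "\<lambda>(t,s,x,x',z,z'). (t,z,z',s,x,x')"]) auto
      also have "\<dots> = (\<Sum>t\<in>?T. \<Sum>z\<in>?B. \<Sum>z'\<in>?B. \<Sum>s\<in>?S. \<Sum>x\<in>?X. \<Sum>x'\<in>?X.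
          ?A2 y t z * (?A1 z s x * \<rho> x x' * cnj (?A1 z' s x')) * cnj (?A2 y' t z'))"
        by (simp add: sum.cartesian_product)
      also have "\<dots> = run C2 (run C1 \<rho>) y y'"
        unfolding run_def w1 w2 assms(3) ae(2) e1_def[symmetric] e2_def[symmetric] c_def[symmetric]
        by (simp add: sum_distrib_left sum_distrib_right mult_ac)
      finally show ?thesis .
    qed
  qed
  moreover have "csize C \<le> 4 * (csize C1 + csize C2)"
    using pm(1) ae assms(3) by (simp add: csize_def C_def e1_def e2_def c_def)
  ultimately show ?thesis using wf by (intro exI[of _ C]) (auto simp: C_def c_def)
qed

text \<open>This is \<open>C1\<close> tensored with the identity. It is stated block by block in the
  \<open>k\<close> idle qubits so that it covers entangled inputs, in the format of
  \<open>joint_prob\<close>. The idle block is moved behind the ancillas before \<open>C1\<close>,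
  and in front of the discarded wires afterwards.\<close>

lemma ex_lift:
  assumes "wf_circ C1"
  shows "\<exists>C. wf_circ C \<and> nin C = nin C1 + k \<and> nout C = nout C1 + k \<and>
     csize C \<le> 8 * (csize C1 + k) \<and>
     (\<forall>\<rho>. \<forall>u\<in>bits (nout C1). \<forall>u'\<in>bits (nout C1). \<forall>v\<in>bits k. \<forall>v'\<in>bits k.
        run C \<rho> (u @ v) (u' @ v') = run C1 (\<lambda>x x'. \<rho> (x @ v) (x' @ v')) u u')"
proof -
  define a b e g where "a = nin C1" and "b = nout C1" and "e = nanc C1" and "g = wires C1 - nout C1"
  have w1: "wires C1 = b + g" and ae: "a + e = b + g"
    using assms by (auto simp: wf_circ_def wires_def b_def g_def e_def a_def)
  obtain pm where pm: "length pm \<le> 3 * (a + k + e + 0)" "\<forall>h\<in>set pm. wf_gate (a + k + e + 0) h \<and> classical_gate h"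
    "\<forall>u\<in>bits a. \<forall>v\<in>bits k. \<forall>w\<in>bits e. \<forall>t\<in>bits 0. fold gate_map pm (u @ v @ w @ t) = u @ w @ v @ t"
    using ex_block_swap_gates by blast
  obtain qm where qm: "length qm \<le> 3 * (b + g + k + 0)" "\<forall>h\<in>set qm. wf_gate (b + g + k + 0) h \<and> classical_gate h"
    "\<forall>u\<in>bits b. \<forall>v\<in>bits g. \<forall>w\<in>bits k. \<forall>t\<in>bits 0. fold gate_map qm (u @ v @ w @ t) = u @ w @ v @ t"
    using ex_block_swap_gates by blast
  define C where "C = Circ (a + k) e (b + k) (pm @ gates C1 @ qm)"
  have wC: "wires C = b + g + k" and akeq: "a + k + e = b + g + k" using ae by (simp_all add: C_def wires_def)
  have wf: "wf_circ C"
    unfolding wf_circ_def wC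
  proof (intro conjI ballI)
    show "nout C \<le> b + g + k" by (simp add: C_def)
    fix h assume "h \<in> set (gates C)"
    then consider "h \<in> set (gates C1)" | "h \<in> set pm" | "h \<in> set qm" by (auto simp: C_def)
    then show "wf_gate (b + g + k) h"
    proof cases
      case 1 then show ?thesis using assms(1) w1 by (auto simp: wf_circ_def intro: wf_gate_mono[of "b + g"])
    next
      case 2 then show ?thesis using pm(2) akeq by simp
    next
      case 3 then show ?thesis using qm(2) by simp
    qed
  qed
  let ?A = "\<lambda>y t x. amplitude (b + g) (gates C1) (y @ t) (x @ replicate e False)"
  let ?N = "b + g + k"
  have amp: "amplitude ?N (gates C) ((y @ v) @ t) ((x @ v') @ replicate e False) = ?A y t x * of_bool (v' = v)"
    if l: "y \<in> bits b" "v \<in> bits k" "t \<in> bits g" "x \<in> bits a" "v' \<in> bits k" for y v t x v'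
  proof -
    let ?x = "x @ replicate e False"
    have lx: "?x \<in> bits (b + g)" using l ae by simp
    have gw: "\<forall>h\<in>set (gates C1). wf_gate (b + g) h" using assms w1 by (auto simp: wf_circ_def)
    have P: "fold gate_map pm (x @ v' @ replicate e False) = x @ replicate e False @ v'"
      using pm(3)[rule_format, of x v' "replicate e False" "[]"] l by simp
    have Q: "fold gate_map qm (zb @ zg @ zk) = y @ v @ t \<longleftrightarrow> zb @ zg = y @ t \<and> zk = v"
      if "zb \<in> bits b" "zg \<in> bits g" "zk \<in> bits k" for zb zg zk
      using qm(3)[rule_format, of zb zg zk "[]"] that l by auto
    have "amplitude ?N (gates C) ((y @ v) @ t) ((x @ v') @ replicate e False) =
       (\<Sum>z\<in>bits ?N. amplitude ?N (gates C1 @ qm) (y @ v @ t) z * of_bool (z = ?x @ v'))"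
      using l ae pm(2) P by (simp add: C_def amplitude_append amplitude_classical)
    also have "\<dots> = amplitude ?N (gates C1 @ qm) (y @ v @ t) (?x @ v')"
      using lx l by (subst sum_of_bool_pick) auto
    also have "\<dots> = (\<Sum>z\<in>bits ?N. amplitude ?N qm (y @ v @ t) z * amplitude ?N (gates C1) z (?x @ v'))"
      using lx l by (subst amplitude_append) auto
    also have "\<dots> = (\<Sum>zb\<in>bits b. \<Sum>zg\<in>bits g. \<Sum>zk\<in>bits k. amplitude ?N qm (y @ v @ t) (zb @ zg @ zk) *
        amplitude ?N (gates C1) ((zb @ zg) @ zk) (?x @ v'))"
      by (simp add: sum_bits_add)
    also have "\<dots> = (\<Sum>zb\<in>bits b. \<Sum>zg\<in>bits g. \<Sum>zk\<in>bits k. 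
        (of_bool (zb @ zg = y @ t) * (amplitude (b + g) (gates C1) (zb @ zg) ?x * of_bool (zk = v'))) * of_bool (zk = v))"
    proof (intro sum.cong refl)
      fix zb zg zk assume z: "zb \<in> bits b" "zg \<in> bits g" "zk \<in> bits k"
      have "amplitude ?N qm (y @ v @ t) (zb @ zg @ zk) = of_bool (y @ v @ t = fold gate_map qm (zb @ zg @ zk))"
        using qm(2) z by (intro amplitude_classical) auto
      also have "\<dots> = of_bool (zb @ zg = y @ t \<and> zk = v)"
        using Q[OF z] by (simp add: eq_commute[of "y @ v @ t"])
      finally show "amplitude ?N qm (y @ v @ t) (zb @ zg @ zk) * amplitude ?N (gates C1) ((zb @ zg) @ zk) (?x @ v')
         = (of_bool (zb @ zg = y @ t) * (amplitude (b + g) (gates C1) (zb @ zg) ?x * of_bool (zk = v'))) * of_bool (zk = v)"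
        using z gw lx l by (subst amplitude_first) auto
    qed
    also have "\<dots> = (\<Sum>zb\<in>bits b. \<Sum>zg\<in>bits g. of_bool (zb @ zg = y @ t) * (amplitude (b + g) (gates C1) (zb @ zg) ?x * of_bool (v = v')))"
      using l by (intro sum.cong refl, subst sum_of_bool_pick) auto
    also have "\<dots> = (\<Sum>z\<in>bits (b + g). of_bool (z = y @ t) * (amplitude (b + g) (gates C1) z ?x * of_bool (v = v')))"
      by (simp only: sum_bits_add)
    also have "\<dots> = ?A y t x * of_bool (v = v')"
      using l by (subst sum_of_bool_pick) auto
    finally show ?thesis by (simp add: eq_commute)
  qed
  have "run C \<rho> (u @ v) (u' @ v') = run C1 (\<lambda>x x'. \<rho> (x @ v) (x' @ v')) u u'"
    if l: "u \<in> bits b" "u' \<in> bits b" "v \<in> bits k" "v' \<in> bits k" for \<rho> u u' v v'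
  proof -
    have nC: "nin C = a + k" "nanc C = e" "nout C = b + k" by (auto simp: C_def)
    have wl: "b + g + k - (b + k) = g" by simp
    have "run C \<rho> (u @ v) (u' @ v') = (\<Sum>t\<in>bits g. \<Sum>x\<in>bits a. \<Sum>s\<in>bits k. \<Sum>x'\<in>bits a. \<Sum>s'\<in>bits k.
       of_bool (s = v) * (?A u t x * \<rho> (x @ s) (x' @ s') * cnj (?A u' t x') * of_bool (s' = v')))"
      unfolding run_def wC nC wl sum_bits_add using l by (intro sum.cong refl) (simp add: amp del: append_assoc)
    also have "\<dots> = (\<Sum>t\<in>bits g. \<Sum>x\<in>bits a. \<Sum>s\<in>bits k. of_bool (s = v) * (\<Sum>x'\<in>bits a. \<Sum>s'\<in>bits k.
       ?A u t x * \<rho> (x @ s) (x' @ s') * cnj (?A u' t x') * of_bool (s' = v')))"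
      by (simp only: sum_distrib_left)
    also have "\<dots> = (\<Sum>t\<in>bits g. \<Sum>x\<in>bits a. \<Sum>x'\<in>bits a. ?A u t x * \<rho> (x @ v) (x' @ v') * cnj (?A u' t x'))"
      using l by (simp only: sum_of_bool_pick finite_bits)
    finally show ?thesis by (simp add: run_def w1 a_def b_def e_def)
  qed
  moreover have "csize C \<le> 8 * (csize C1 + k)"
    using pm(1) qm(1) ae by (simp add: csize_def C_def a_def b_def e_def)
  ultimately show ?thesis using wf by (intro exI[of _ C]) (auto simp: C_def a_def b_def)
qed

lemma ex_swap:
  "\<exists>C. wf_circ C \<and> nin C = a + b \<and> nout C = b + a \<and> csize C \<le> 5 * (a + b) \<and>
     (\<forall>\<rho>. \<forall>u\<in>bits a. \<forall>u'\<in>bits a. \<forall>v\<in>bits b. \<forall>v'\<in>bits b. run C \<rho> (v @ u) (v' @ u') = \<rho> (u @ v) (u' @ v'))"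
proof -
  obtain pm where pm: "length pm \<le> 3 * (0 + a + b + 0)" "\<forall>h\<in>set pm. wf_gate (0 + a + b + 0) h \<and> classical_gate h"
    "\<forall>u\<in>bits 0. \<forall>v\<in>bits a. \<forall>w\<in>bits b. \<forall>t\<in>bits 0. fold gate_map pm (u @ v @ w @ t) = u @ w @ v @ t"
    using ex_block_swap_gates by blast
  define C where "C = Circ (a + b) 0 (b + a) pm"
  have wf: "wf_circ C" using pm by (auto simp: wf_circ_def C_def wires_def add.commute)
  have P: "fold gate_map pm (u @ v) = v @ u" if "u \<in> bits a" "v \<in> bits b" for u v
    using pm(3)[rule_format, of "[]" u v "[]"] that by simp
  have "run C \<rho> (v @ u) (v' @ u') = \<rho> (u @ v) (u' @ v')"
    if l: "u \<in> bits a" "u' \<in> bits a" "v \<in> bits b" "v' \<in> bits b" for \<rho> u u' v v'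
  proof -
    have A: "amplitude (a + b) pm (y @ x) s = of_bool (s = x @ y)" if "s \<in> bits (a + b)" "x \<in> bits a" "y \<in> bits b" for s x y
    proof -
      have "fold gate_map pm (take a s @ drop a s) = drop a s @ take a s" using that by (intro P) auto
      then have "amplitude (a + b) pm (y @ x) s = of_bool (y @ x = drop a s @ take a s)"
        using pm that by (subst amplitude_classical) auto
      also have "y @ x = drop a s @ take a s \<longleftrightarrow> s = x @ y"
        using that by (metis append_eq_append_conv append_eq_conv_conj append_take_drop_id bits_iff length_drop diff_add_inverse)
      finally show ?thesis .
    qed
    have "run C \<rho> (v @ u) (v' @ u') = (\<Sum>x\<in>bits (a + b). \<Sum>x'\<in>bits (a + b).
        amplitude (a + b) pm (v @ u) x * \<rho> x x' * cnj (amplitude (a + b) pm (v' @ u') x'))"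
      by (simp add: run_def C_def wires_def bits_0 add.commute[of b])
    also have "\<dots> = (\<Sum>x\<in>bits (a + b). \<Sum>x'\<in>bits (a + b). of_bool (x = u @ v) * (\<rho> x x' * of_bool (x' = u' @ v')))"
      using l by (intro sum.cong refl) (simp add: A)
    also have "\<dots> = (\<Sum>x\<in>bits (a + b). of_bool (x = u @ v) * (\<Sum>x'\<in>bits (a + b). \<rho> x x' * of_bool (x' = u' @ v')))"
      by (simp only: sum_distrib_left)
    also have "\<dots> = \<rho> (u @ v) (u' @ v')"
      using l by (subst sum_of_bool_pick; auto simp: sum_of_bool_pick)
    finally show ?thesis .
  qed
  moreover have "csize C \<le> 5 * (a + b)" using pm(1) by (simp add: csize_def C_def)
  ultimately show ?thesis using wf by (intro exI[of _ C]) (auto simp: C_def)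
qed

text \<open>The zero qubits may serve as ancillas.\<close>

lemma run_padded:
  fixes e p j :: nat
  assumes "wf_circ C" "nanc C \<le> e + p"
  defines "Q \<equiv> Circ (nin C + e) p (nout C) (gates C @ replicate j Idle)"
  shows "wf_circ Q" "run Q (tensor (nin C) \<rho> (basis (replicate e False))) = run C \<rho>"
proof -
  define d where "d = e + p - nanc C"
  have wQ: "wires Q = wires C + d" and wQ': "nin C + e + p = wires C + d" using assms(2) by (auto simp: Q_def wires_def d_def)
  have gw: "\<forall>g\<in>set (gates Q). wf_gate (wires C) g" using assms(1) by (auto simp: Q_def wf_circ_def)
  show wf: "wf_circ Q"
    using gw assms(1) unfolding wf_circ_def wQ by (auto simp: Q_def intro: wf_gate_mono[of "wires C"])
  have idle: "amplitude N (gs @ replicate j Idle) y x = amplitude N gs y x" if "x \<in> bits N" "y \<in> bits N" for N gs y x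
  proof -
    have "amplitude N (replicate j Idle) y z = of_bool (y = z)" if "z \<in> bits N" for z
    proof -
      have "fold gate_map (replicate j Idle) z = z" by (induction j arbitrary: z) auto
      with that show ?thesis by (subst amplitude_classical) auto
    qed
    then have "amplitude N (gs @ replicate j Idle) y x = (\<Sum>z\<in>bits N. of_bool (y = z) * amplitude N gs z x)"
      using that by (simp only: amplitude_append cong: sum.cong)
    then show ?thesis using that by (simp only: sum_of_bool_pick finite_bits)
  qed
  let ?A = "\<lambda>y t x. amplitude (wires C) (gates C) (y @ t) (x @ replicate (nanc C) False)"
  have le: "nout C \<le> wires C" using assms by (simp add: wf_circ_def)
  have amp: "amplitude (wires C + d) (gates Q) (y @ t @ s) ((x @ replicate e False) @ replicate p False) = ?A y t x * of_bool (s = replicate d False)"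
    if l: "y \<in> bits (nout C)" "t \<in> bits (wires C - nout C)" "s \<in> bits d" "x \<in> bits (nin C)" for y t s x
  proof -
    have "(x @ replicate e False) @ replicate p False = (x @ replicate (nanc C) False) @ replicate d False"
      using assms(2) by (simp add: d_def flip: replicate_add)
    then have "amplitude (wires C + d) (gates Q) (y @ t @ s) ((x @ replicate e False) @ replicate p False) =
      amplitude (wires C + d) (gates C @ replicate j Idle) ((y @ t) @ s) ((x @ replicate (nanc C) False) @ replicate d False)"
      by (simp add: Q_def)
    also have "\<dots> = amplitude (wires C + d) (gates C) ((y @ t) @ s) ((x @ replicate (nanc C) False) @ replicate d False)"
      using l le by (intro idle) (auto simp: wires_def)
    also have "\<dots> = ?A y t x * of_bool (s = replicate d False)"
      using l le assms(1) by (intro amplitude_first) (auto simp: wf_circ_def wires_def)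
    finally show ?thesis .
  qed
  show "run Q (tensor (nin C) \<rho> (basis (replicate e False))) = run C \<rho>"
  proof (intro ext)
    fix y y'
    show "run Q (tensor (nin C) \<rho> (basis (replicate e False))) y y' = run C \<rho> y y'"
    proof (cases "y \<in> bits (nout C) \<and> y' \<in> bits (nout C)")
      case False
      then show ?thesis using run_outside[OF wf, of y y'] run_outside[OF assms(1), of y y'] by (auto simp: Q_def)
    next
      case True
      let ?Z = "replicate e False"
      have wl: "wires C + d - nout C = (wires C - nout C) + d" using le by simp
      have nQ: "nin Q = nin C + e" "nanc Q = p" "nout Q = nout C" by (auto simp: Q_def)
      have "run Q (tensor (nin C) \<rho> (basis ?Z)) y y' = (\<Sum>t\<in>bits (wires C - nout C). \<Sum>s\<in>bits d.
          \<Sum>x\<in>bits (nin C). \<Sum>z\<in>bits e. \<Sum>x'\<in>bits (nin C). \<Sum>z'\<in>bits e.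
          amplitude (wires C + d) (gates Q) (y @ t @ s) ((x @ z) @ replicate p False) * (\<rho> x x' * of_bool (z = ?Z \<and> z' = ?Z)) *
          cnj (amplitude (wires C + d) (gates Q) (y' @ t @ s) ((x' @ z') @ replicate p False)))"
        unfolding run_def wQ nQ wl sum_bits_add by (intro sum.cong refl) (simp add: tensor_def basis_def)
      also have "\<dots> = (\<Sum>t\<in>bits (wires C - nout C). \<Sum>s\<in>bits d.
          \<Sum>x\<in>bits (nin C). \<Sum>z\<in>bits e. of_bool (z = ?Z) * (\<Sum>x'\<in>bits (nin C). \<Sum>z'\<in>bits e. of_bool (z' = ?Z) *
          (amplitude (wires C + d) (gates Q) (y @ t @ s) ((x @ z) @ replicate p False) * \<rho> x x' *
          cnj (amplitude (wires C + d) (gates Q) (y' @ t @ s) ((x' @ z') @ replicate p False)))))"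
        unfolding sum_distrib_left by (intro sum.cong refl) auto
      also have "\<dots> = (\<Sum>t\<in>bits (wires C - nout C). \<Sum>s\<in>bits d. \<Sum>x\<in>bits (nin C). \<Sum>x'\<in>bits (nin C).
          (amplitude (wires C + d) (gates Q) (y @ t @ s) ((x @ ?Z) @ replicate p False) * \<rho> x x' *
          cnj (amplitude (wires C + d) (gates Q) (y' @ t @ s) ((x' @ ?Z) @ replicate p False))))"
        by (simp only: sum_of_bool_pick finite_bits bits_iff length_replicate)
      also have "\<dots> = (\<Sum>t\<in>bits (wires C - nout C). \<Sum>s\<in>bits d. (\<Sum>x\<in>bits (nin C). \<Sum>x'\<in>bits (nin C). ?A y t x * \<rho> x x' * cnj (?A y' t x')) * of_bool (s = replicate d False))"
        using True unfolding sum_distrib_right by (intro sum.cong refl) (simp only: amp, auto)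
      also have "\<dots> = run C \<rho> y y'"
        unfolding run_def by (rule sum.cong[OF refl], subst sum_of_bool_pick) auto
      finally show ?thesis .
    qed
  qed
qed

section \<open>Compiling straight-line programs\<close>

text \<open>
  A straight-line program is represented by the list of Boolean functions that its instructions
  compute, so that renaming of instructions never has to be made explicit.
\<close>

inductive slp :: "nat \<Rightarrow> (bool list \<Rightarrow> bool) list \<Rightarrow> bool" for a where
  slp_Nil: "slp a []"
| slp_const: "slp a fs \<Longrightarrow> slp a (fs @ [\<lambda>_. c])"
| slp_proj: "slp a fs \<Longrightarrow> i < a \<Longrightarrow> slp a (fs @ [\<lambda>x. x ! i])"
| slp_and: "slp a fs \<Longrightarrow> f \<in> set fs \<Longrightarrow> g \<in> set fs \<Longrightarrow> slp a (fs @ [\<lambda>x. f x \<and> g x])"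
| slp_xor: "slp a fs \<Longrightarrow> f \<in> set fs \<Longrightarrow> g \<in> set fs \<Longrightarrow> slp a (fs @ [\<lambda>x. f x \<noteq> g x])"

lemma slp_compose:
  assumes "slp a fs" "\<And>i. i < b \<Longrightarrow> h i \<in> set fs" "slp b gs"
  shows "slp a (fs @ map (\<lambda>g x. g (map (\<lambda>i. h i x) [0..<b])) gs)"
  using assms(3)
proof (induction rule: slp.induct)
  case slp_Nil
  then show ?case using assms(1) by simp
next
  case (slp_const gs c)
  then show ?case using slp.slp_const[OF slp_const.IH] by simp
next
  case (slp_proj gs i)
  let ?p = "\<lambda>f g x. f x \<and> g x"
  \<comment> \<open>A projection becomes a function already present in \<open>fs\<close>, but the
    list must still grow by one entry; conjoining the function with itself provides it.\<close>
  have "slp a ((fs @ map (\<lambda>g x. g (map (\<lambda>i. h i x) [0..<b])) gs) @ [\<lambda>x. h i x \<and> h i x])"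
    using slp_proj.IH assms(2)[OF slp_proj.hyps(2)] by (intro slp.slp_and) auto
  moreover have "(\<lambda>x. h i x \<and> h i x) = (\<lambda>x. map (\<lambda>i. h i x) [0..<b] ! i)"
    using slp_proj.hyps(2) by simp
  ultimately show ?case by simp
next
  case (slp_and gs f g)
  then show ?case using slp.slp_and[OF slp_and.IH, of "\<lambda>x. f (map (\<lambda>i. h i x) [0..<b])" "\<lambda>x. g (map (\<lambda>i. h i x) [0..<b])"] by simp
next
  case (slp_xor gs f g)
  then show ?case using slp.slp_xor[OF slp_xor.IH, of "\<lambda>x. f (map (\<lambda>i. h i x) [0..<b])" "\<lambda>x. g (map (\<lambda>i. h i x) [0..<b])"] by simp
qed

lemma slp_append: "slp a fs \<Longrightarrow> slp a gs \<Longrightarrow> slp a (fs @ gs)"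
proof (rotate_tac, induction gs rule: slp.induct)
  case (slp_const gs c) then show ?case using slp.slp_const[of a "fs @ gs"] by simp
next
  case (slp_proj gs i) then show ?case using slp.slp_proj[of a "fs @ gs"] by simp
next
  case (slp_and gs f g) then show ?case using slp.slp_and[of a "fs @ gs"] by simp
next
  case (slp_xor gs f g) then show ?case using slp.slp_xor[of a "fs @ gs"] by simp
qed simp

text \<open>Circuit complexity of one Boolean function. The result may be any entry of the program,
  so programs can be concatenated without renumbering.\<close>

definition steps :: "nat \<Rightarrow> nat \<Rightarrow> (bool list \<Rightarrow> bool) \<Rightarrow> bool" where
  "steps a S h \<longleftrightarrow> (\<exists>fs. slp a fs \<and> length fs \<le> S \<and> (\<exists>f\<in>set fs. \<forall>x\<in>bits a. f x = h x))"

lemma steps_mono: "steps a S h \<Longrightarrow> S \<le> T \<Longrightarrow> steps a T h"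
  unfolding steps_def using le_trans by blast

lemma steps_cong: "steps a S h \<Longrightarrow> (\<And>x. x \<in> bits a \<Longrightarrow> h x = h' x) \<Longrightarrow> steps a S h'"
  unfolding steps_def by (metis (no_types, lifting))

lemma steps_const: "steps a 1 (\<lambda>_. c)"
  unfolding steps_def using slp_const[OF slp_Nil] by (intro exI[of _ "[\<lambda>_. c]"]) auto

lemma steps_proj: "i < a \<Longrightarrow> steps a 1 (\<lambda>x. x ! i)"
  unfolding steps_def using slp_proj[OF slp_Nil] by (intro exI[of _ "[\<lambda>x. x ! i]"]) auto

lemma steps_and:
  assumes "steps a S f" "steps a T g"
  shows "steps a (S + T + 1) (\<lambda>x. f x \<and> g x)"
proof -
  obtain fs f' gs g' where "slp a fs" "length fs \<le> S" "f' \<in> set fs" "\<forall>x\<in>bits a. f' x = f x"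
    "slp a gs" "length gs \<le> T" "g' \<in> set gs" "\<forall>x\<in>bits a. g' x = g x"
    using assms unfolding steps_def by blast
  then show ?thesis
    unfolding steps_def
    by (intro exI[of _ "(fs @ gs) @ [\<lambda>x. f' x \<and> g' x]"] conjI slp_and slp_append) auto
qed

lemma steps_xor:
  assumes "steps a S f" "steps a T g"
  shows "steps a (S + T + 1) (\<lambda>x. f x \<noteq> g x)"
proof -
  obtain fs f' gs g' where "slp a fs" "length fs \<le> S" "f' \<in> set fs" "\<forall>x\<in>bits a. f' x = f x"
    "slp a gs" "length gs \<le> T" "g' \<in> set gs" "\<forall>x\<in>bits a. g' x = g x"
    using assms unfolding steps_def by blast
  then show ?thesis
    unfolding steps_def
    by (intro exI[of _ "(fs @ gs) @ [\<lambda>x. f' x \<noteq> g' x]"] conjI slp_xor slp_append) auto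
qed

lemma steps_not: "steps a S f \<Longrightarrow> steps a (S + 2) (\<lambda>x. \<not> f x)"
  using steps_xor[of a S f 1 "\<lambda>_. True"] steps_const[of a True] by simp

lemma steps_iff: "steps a S f \<Longrightarrow> steps a T g \<Longrightarrow> steps a (S + T + 3) (\<lambda>x. f x \<longleftrightarrow> g x)"
  using steps_not[OF steps_xor, of a S f T g] by (simp add: numeral_3_eq_3)

lemma steps_if:
  assumes "steps a R c" "steps a S f" "steps a T g"
  shows "steps a (2 * R + S + T + 5) (\<lambda>x. if c x then f x else g x)"
proof -
  have "steps a ((R + S + 1) + ((R + 2) + T + 1) + 1) (\<lambda>x. (c x \<and> f x) \<noteq> (\<not> c x \<and> g x))"
    using assms by (intro steps_xor steps_and steps_not)
  then show ?thesis
    by (rule steps_mono[OF steps_cong]) auto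
qed

lemma steps_all_less:
  assumes "\<And>i. i < n \<Longrightarrow> steps a S (h i)"
  shows "steps a (n * (S + 1) + 1) (\<lambda>x. \<forall>i<n. h i x)"
  using assms
proof (induction n)
  case 0
  then show ?case using steps_const[of a True] by simp
next
  case (Suc n)
  have "steps a ((n * (S + 1) + 1) + S + 1) (\<lambda>x. (\<forall>i<n. h i x) \<and> h n x)"
    using Suc by (intro steps_and) auto
  moreover have "(\<lambda>x. (\<forall>i<n. h i x) \<and> h n x) = (\<lambda>x. \<forall>i<Suc n. h i x)"
    by (auto simp: fun_eq_iff less_Suc_eq)
  ultimately show ?case by (auto intro: steps_mono)
qed

text \<open>From reversible circuits back to straight-line programs: a gate changes one wire only,
  and the new function of that wire costs at most two instructions.\<close>

lemma fold_gate_map_slp: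
  assumes "\<forall>g\<in>set gs. wf_gate (a + e) g \<and> classical_gate g"
  shows "\<exists>fs. slp a fs \<and> length fs \<le> a + e + 2 * length gs \<and>
    (\<forall>w<a + e. \<exists>f\<in>set fs. \<forall>x\<in>bits a. f x = fold gate_map gs (x @ replicate e False) ! w)"
  using assms
proof (induction gs rule: rev_induct)
  case Nil
  have 1: "slp a (map (\<lambda>i x. x ! i) [0..<n])" if "n \<le> a" for n
    using that
  proof (induction n)
    case (Suc n)
    then show ?case using slp_proj[of a "map (\<lambda>i x. x ! i) [0..<n]" n] by simp
  qed (simp add: slp_Nil)
  have 2: "slp a (fs @ replicate n (\<lambda>_. False))" if "slp a fs" for fs n
    using that
  proof (induction n)
    case (Suc n)
    then show ?case using slp_const[of a "fs @ replicate n (\<lambda>_. False)" False]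
      by (simp add: replicate_append_same)
  qed simp
  show ?case
  proof (rule exI[of _ "map (\<lambda>i x. x ! i) [0..<a] @ replicate e (\<lambda>_. False)"], intro conjI allI impI)
    show "slp a (map (\<lambda>i x. x ! i) [0..<a] @ replicate e (\<lambda>_. False))" by (rule 2[OF 1]) simp
    fix w assume w: "w < a + e"
    show "\<exists>f\<in>set (map (\<lambda>i x. x ! i) [0..<a] @ replicate e (\<lambda>_. False)). \<forall>x\<in>bits a. f x = fold gate_map [] (x @ replicate e False) ! w"
    proof (cases "w < a")
      case True
      then show ?thesis by (intro bexI[of _ "\<lambda>x. x ! w"]) (auto simp: nth_append)
    next
      case False
      with w show ?thesis by (intro bexI[of _ "\<lambda>_. False"]) (auto simp: nth_append)
    qed
  qed simp
next
  case (snoc g gs)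
  let ?v = "\<lambda>x. fold gate_map gs (x @ replicate e False)"
  let ?v' = "\<lambda>x. fold gate_map (gs @ [g]) (x @ replicate e False)"
  obtain fs where fs: "slp a fs" "length fs \<le> a + e + 2 * length gs"
    "\<And>w. w < a + e \<Longrightarrow> \<exists>f\<in>set fs. \<forall>x\<in>bits a. f x = ?v x ! w"
    using snoc by auto
  have len: "length (?v x) = a + e" if "x \<in> bits a" for x using that by simp
  \<comment> \<open>Wire \<open>t\<close> gets its new function from \<open>hs\<close>; all other
    wires keep the entries they had in \<open>fs\<close>.\<close>
  have ext: ?case if hs: "slp a (fs @ hs)" "length hs \<le> 2" and t: "t < a + e"
    and f: "f \<in> set hs" "\<forall>x\<in>bits a. f x = ?v' x ! t" and same: "\<And>w x. w < a + e \<Longrightarrow> w \<noteq> t \<Longrightarrow> x \<in> bits a \<Longrightarrow> ?v' x ! w = ?v x ! w" for hs t f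
  proof (intro exI[of _ "fs @ hs"] conjI allI impI)
    show "slp a (fs @ hs)" by fact
    show "length (fs @ hs) \<le> a + e + 2 * length (gs @ [g])" using hs(2) fs(2) by simp
    fix w assume w: "w < a + e"
    show "\<exists>f\<in>set (fs @ hs). \<forall>x\<in>bits a. f x = ?v' x ! w"
    proof (cases "w = t")
      case True
      then show ?thesis using f by auto
    next
      case False
      obtain f0 where f0: "f0 \<in> set fs" "\<forall>x\<in>bits a. f0 x = ?v x ! w"
        using fs(3)[OF w] by blast
      show ?thesis
        by (rule bexI[of _ f0]) (use f0 same[OF w False] in \<open>simp_all del: fold_append\<close>)
    qed
  qed
  have wfg: "wf_gate (a + e) g" "classical_gate g" using snoc.prems by auto
  show ?case
  proof (cases g)
    case Idle
    with fs show ?thesis by (intro exI[of _ fs]) auto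
  next
    case (NotG i)
    then have i: "i < a + e" using wfg by simp
    obtain f where f: "f \<in> set fs" "\<forall>x\<in>bits a. f x = ?v x ! i" using fs(3)[OF i] by blast
    have "slp a ((fs @ [\<lambda>_. True]) @ [\<lambda>x. f x \<noteq> True])"
      using f(1) by (intro slp_xor[of _ _ f "\<lambda>_. True"] slp_const fs(1)) auto
    then show ?thesis
      using i f NotG len by (intro ext[of "[\<lambda>_. True, \<lambda>x. f x \<noteq> True]" i "\<lambda>x. f x \<noteq> True"]) auto
  next
    case (CNot i j)
    then have i: "i < a + e" and j: "j < a + e" using wfg by auto
    obtain f1 f2 where f: "f1 \<in> set fs" "\<forall>x\<in>bits a. f1 x = ?v x ! i" "f2 \<in> set fs" "\<forall>x\<in>bits a. f2 x = ?v x ! j"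
      using fs(3)[OF i] fs(3)[OF j] by blast
    have "slp a (fs @ [\<lambda>x. f1 x \<noteq> f2 x])"
      using f by (intro slp_xor fs(1)) auto
    then show ?thesis
      using i j f CNot len by (intro ext[of "[\<lambda>x. f1 x \<noteq> f2 x]" j "\<lambda>x. f1 x \<noteq> f2 x"]) auto
  next
    case (Toffoli i j k)
    then have i: "i < a + e" and j: "j < a + e" and k: "k < a + e" using wfg by auto
    obtain f1 f2 f3 where f: "f1 \<in> set fs" "\<forall>x\<in>bits a. f1 x = ?v x ! i" "f2 \<in> set fs" "\<forall>x\<in>bits a. f2 x = ?v x ! j"
        "f3 \<in> set fs" "\<forall>x\<in>bits a. f3 x = ?v x ! k"
      using fs(3)[OF i] fs(3)[OF j] fs(3)[OF k] by blast
    have "slp a ((fs @ [\<lambda>x. f1 x \<and> f2 x]) @ [\<lambda>x. (\<lambda>x. f1 x \<and> f2 x) x \<noteq> f3 x])"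
      using f by (intro slp_xor[where f = "\<lambda>x. f1 x \<and> f2 x" and g = f3] slp_and fs(1)) auto
    then show ?thesis
      using i j k f Toffoli len by (intro ext[of "[\<lambda>x. f1 x \<and> f2 x, \<lambda>x. (f1 x \<and> f2 x) \<noteq> f3 x]" k "\<lambda>x. (f1 x \<and> f2 x) \<noteq> f3 x"]) auto
  qed (use wfg in auto)
qed

lemma slp_family:
  assumes "\<And>i. i < n \<Longrightarrow> steps a S (h i)"
  shows "\<exists>fs h'. slp a fs \<and> length fs \<le> n * S \<and> (\<forall>i<n. h' i \<in> set fs \<and> (\<forall>x\<in>bits a. h' i x = h i x))"
  using assms
proof (induction n)
  case 0
  then show ?case using slp_Nil by (intro exI[of _ "[]"]) auto
next
  case (Suc n)
  then obtain fs h' where "slp a fs" "length fs \<le> n * S" "\<forall>i<n. h' i \<in> set fs \<and> (\<forall>x\<in>bits a. h' i x = h i x)"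
    by auto
  moreover obtain gs g where "slp a gs" "length gs \<le> S" "g \<in> set gs" "\<forall>x\<in>bits a. g x = h n x"
    using Suc.prems[of n] unfolding steps_def by auto
  ultimately show ?case
    by (intro exI[of _ "fs @ gs"] exI[of _ "h'(n := g)"]) (auto simp: slp_append less_Suc_eq)
qed

text \<open>Substituting the functions \<open>h i\<close> into a program for \<open>C\<close> shares
  them: each is computed once, so their costs add to the cost of \<open>C\<close> instead of
  multiplying it. This keeps nested constructions polynomial.\<close>

lemma steps_ceval:
  assumes C: "wf_circ C" "classical C" "j < nout C" and h: "\<And>i. i < nin C \<Longrightarrow> steps a S (h i)"
  shows "steps a (nin C * S + 2 * csize C) (\<lambda>x. ceval C (map (\<lambda>i. h i x) [0..<nin C]) ! j)"
proof -
  let ?b = "nin C"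
  obtain gs where gs: "slp ?b gs" "length gs \<le> ?b + nanc C + 2 * length (gates C)"
    "\<And>w. w < ?b + nanc C \<Longrightarrow> \<exists>f\<in>set gs. \<forall>x\<in>bits ?b. f x = fold gate_map (gates C) (x @ replicate (nanc C) False) ! w"
    using fold_gate_map_slp[of "gates C" ?b "nanc C"] C unfolding wf_circ_def classical_def wires_def by blast
  have j: "j < ?b + nanc C" using C by (simp add: wf_circ_def wires_def)
  obtain g where g: "g \<in> set gs" "\<And>x. x \<in> bits ?b \<Longrightarrow> g x = ceval C x ! j"
    using gs(3)[OF j] C(3) by (auto simp: ceval_def)
  obtain fs h' where fs: "slp a fs" "length fs \<le> ?b * S" "\<And>i. i < ?b \<Longrightarrow> h' i \<in> set fs"
      "\<And>i x. i < ?b \<Longrightarrow> x \<in> bits a \<Longrightarrow> h' i x = h i x"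
    using slp_family[of ?b a S h, OF h] by blast
  let ?F = "fs @ map (\<lambda>g x. g (map (\<lambda>i. h' i x) [0..<?b])) gs"
  show ?thesis
    unfolding steps_def
  proof (intro exI[of _ ?F] conjI)
    show "slp a ?F" by (rule slp_compose[OF fs(1) fs(3) gs(1)])
    show "length ?F \<le> ?b * S + 2 * csize C" using gs(2) fs(2) by (simp add: csize_def)
    show "\<exists>f\<in>set ?F. \<forall>x\<in>bits a. f x = ceval C (map (\<lambda>i. h i x) [0..<?b]) ! j"
    proof (rule bexI[of _ "\<lambda>x. g (map (\<lambda>i. h' i x) [0..<?b])"])
      show "\<forall>x\<in>bits a. g (map (\<lambda>i. h' i x) [0..<?b]) = ceval C (map (\<lambda>i. h i x) [0..<?b]) ! j"
      proof
        fix x assume "x \<in> bits a"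
        then have "map (\<lambda>i. h' i x) [0..<?b] = map (\<lambda>i. h i x) [0..<?b]" using fs(4) by auto
        moreover have "g (map (\<lambda>i. h i x) [0..<?b]) = ceval C (map (\<lambda>i. h i x) [0..<?b]) ! j"
          by (rule g(2)) simp
        ultimately show "g (map (\<lambda>i. h' i x) [0..<?b]) = ceval C (map (\<lambda>i. h i x) [0..<?b]) ! j"
          by (simp only:)
      qed
    qed (use g(1) in auto)
  qed
qed

text \<open>Each instruction writes its value by exclusive or onto a fresh zero wire, so earlier
  values survive and the computation is reversible.\<close>

lemma compile_slp:
  assumes "slp a fs"
  shows "\<exists>gs. length gs \<le> 2 * length fs \<and> (\<forall>g\<in>set gs. wf_gate (a + length fs) g \<and> classical_gate g) \<and>
    (\<forall>x\<in>bits a. fold gate_map gs (x @ replicate (length fs) False) = x @ map (\<lambda>f. f x) fs)"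
  using assms
proof (induction rule: slp.induct)
  case slp_Nil
  then show ?case by (intro exI[of _ "[]"]) auto
next
  case (slp_const fs c)
  then obtain gs where gs: "length gs \<le> 2 * length fs" "\<forall>g\<in>set gs. wf_gate (a + length fs) g \<and> classical_gate g"
    "\<forall>x\<in>bits a. fold gate_map gs (x @ replicate (length fs) False) = x @ map (\<lambda>f. f x) fs" by blast
  have E: "fold gate_map gs (x @ replicate (Suc (length fs)) False) = (x @ map (\<lambda>f. f x) fs) @ [False]" if "x \<in> bits a" for x
    using fold_gate_map_append[of gs "a + length fs" "x @ replicate (length fs) False" "[False]"] gs that
    by (simp add: replicate_append_same)
  show ?case
    by (rule exI[of _ "gs @ (if c then [NotG (a + length fs)] else [])"])
      (use gs E in \<open>auto intro: wf_gate_mono[of "a + length fs"] simp: nth_append list_update_append\<close>)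
next
  case (slp_proj fs i)
  then obtain gs where gs: "length gs \<le> 2 * length fs" "\<forall>g\<in>set gs. wf_gate (a + length fs) g \<and> classical_gate g"
    "\<forall>x\<in>bits a. fold gate_map gs (x @ replicate (length fs) False) = x @ map (\<lambda>f. f x) fs" by blast
  have E: "fold gate_map gs (x @ replicate (Suc (length fs)) False) = (x @ map (\<lambda>f. f x) fs) @ [False]" if "x \<in> bits a" for x
    using fold_gate_map_append[of gs "a + length fs" "x @ replicate (length fs) False" "[False]"] gs that
    by (simp add: replicate_append_same)
  show ?case
    by (rule exI[of _ "gs @ [CNot i (a + length fs)]"])
      (use gs E slp_proj.hyps in \<open>auto intro: wf_gate_mono[of "a + length fs"] simp: nth_append list_update_append\<close>)
next
  case (slp_and fs f g)
  then obtain gs where gs: "length gs \<le> 2 * length fs" "\<forall>g\<in>set gs. wf_gate (a + length fs) g \<and> classical_gate g"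
    "\<forall>x\<in>bits a. fold gate_map gs (x @ replicate (length fs) False) = x @ map (\<lambda>f. f x) fs" by blast
  have E: "fold gate_map gs (x @ replicate (Suc (length fs)) False) = (x @ map (\<lambda>f. f x) fs) @ [False]" if "x \<in> bits a" for x
    using fold_gate_map_append[of gs "a + length fs" "x @ replicate (length fs) False" "[False]"] gs that
    by (simp add: replicate_append_same)
  obtain p q where pq: "p < length fs" "fs ! p = f" "q < length fs" "fs ! q = g"
    using slp_and.hyps by (metis in_set_conv_nth)
  show ?case
    \<comment> \<open>A \<open>Toffoli\<close> gate needs three distinct wires; if both arguments
      are the same entry, the conjunction is a copy.\<close>
    by (rule exI[of _ "gs @ [if p = q then CNot (a + p) (a + length fs) else Toffoli (a + p) (a + q) (a + length fs)]"])
      (use gs E pq in \<open>auto intro: wf_gate_mono[of "a + length fs"] simp: nth_append list_update_append\<close>)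
next
  case (slp_xor fs f g)
  then obtain gs where gs: "length gs \<le> 2 * length fs" "\<forall>g\<in>set gs. wf_gate (a + length fs) g \<and> classical_gate g"
    "\<forall>x\<in>bits a. fold gate_map gs (x @ replicate (length fs) False) = x @ map (\<lambda>f. f x) fs" by blast
  have E: "fold gate_map gs (x @ replicate (Suc (length fs)) False) = (x @ map (\<lambda>f. f x) fs) @ [False]" if "x \<in> bits a" for x
    using fold_gate_map_append[of gs "a + length fs" "x @ replicate (length fs) False" "[False]"] gs that
    by (simp add: replicate_append_same)
  obtain p q where pq: "p < length fs" "fs ! p = f" "q < length fs" "fs ! q = g"
    using slp_xor.hyps by (metis in_set_conv_nth)
  show ?case
    by (rule exI[of _ "gs @ [CNot (a + p) (a + length fs), CNot (a + q) (a + length fs)]"])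
      (use gs E pq in \<open>auto intro: wf_gate_mono[of "a + length fs"] simp: nth_append list_update_append\<close>)
qed

text \<open>The program is compiled, the wanted entries are copied to \<open>b\<close> fresh wires
  (several outputs may share one entry, so moving wires would not do), and these wires are brought
  to the front.\<close>

lemma ex_classical:
  assumes "\<And>j. j < b \<Longrightarrow> steps a S (h j)"
  shows "\<exists>C. wf_circ C \<and> classical C \<and> nin C = a \<and> nout C = b \<and> csize C \<le> 6 * (a + b * (S + 1)) \<and>
    (\<forall>x\<in>bits a. ceval C x = map (\<lambda>j. h j x) [0..<b])"
proof -
  obtain fs h' where fs: "slp a fs" "length fs \<le> b * S" "\<And>i. i < b \<Longrightarrow> h' i \<in> set fs"
      "\<And>i x. i < b \<Longrightarrow> x \<in> bits a \<Longrightarrow> h' i x = h i x"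
    using slp_family[of b a S h, OF assms] by blast
  define L where "L = length fs"
  obtain gs where gs: "length gs \<le> 2 * L" "\<forall>g\<in>set gs. wf_gate (a + L) g \<and> classical_gate g"
    "\<forall>x\<in>bits a. fold gate_map gs (x @ replicate L False) = x @ map (\<lambda>f. f x) fs"
    using compile_slp[OF fs(1)] unfolding L_def by blast
  have "\<forall>j. \<exists>p. j < b \<longrightarrow> p < L \<and> fs ! p = h' j"
    using fs(3) unfolding L_def by (metis in_set_conv_nth)
  then obtain pos where pos: "\<And>j. j < b \<Longrightarrow> pos j < L \<and> fs ! pos j = h' j" by metis
  define cp where "cp k = map (\<lambda>j. CNot (a + pos j) (a + L + j)) [0..<k]" for k
  have cp: "fold gate_map (cp k) ((x @ map (\<lambda>f. f x) fs) @ replicate b False) =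
     (x @ map (\<lambda>f. f x) fs) @ map (\<lambda>j. h' j x) [0..<k] @ replicate (b - k) False" if "x \<in> bits a" "k \<le> b" for x k
    using that(2)
  proof (induction k)
    case (Suc k)
    have "fold gate_map (cp (Suc k)) ((x @ map (\<lambda>f. f x) fs) @ replicate b False) =
      gate_map (CNot (a + pos k) (a + L + k)) ((x @ map (\<lambda>f. f x) fs) @ map (\<lambda>j. h' j x) [0..<k] @ replicate (b - k) False)"
      using Suc by (simp add: cp_def)
    also have "\<dots> = (x @ map (\<lambda>f. f x) fs) @ map (\<lambda>j. h' j x) [0..<Suc k] @ replicate (b - Suc k) False"
    proof -
      have "b - k = Suc (b - Suc k)" using Suc.prems by simp
      then have r: "replicate (b - k) False = False # replicate (b - Suc k) False" by simp
      show ?thesis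
        unfolding r using pos[of k] Suc.prems that(1) by (simp add: nth_append list_update_append L_def)
    qed
    finally show ?case .
  qed (simp add: cp_def)
  obtain pm where pm: "length pm \<le> 3 * (0 + (a + L) + b + 0)" "\<forall>g\<in>set pm. wf_gate (0 + (a + L) + b + 0) g \<and> classical_gate g"
    "\<forall>u\<in>bits 0. \<forall>v\<in>bits (a + L). \<forall>w\<in>bits b. \<forall>t\<in>bits 0. fold gate_map pm (u @ v @ w @ t) = u @ w @ v @ t"
    using ex_block_swap_gates by blast
  define C where "C = Circ a (L + b) b (gs @ cp b @ pm)"
  have pos': "pos j < L + b" "pos j \<noteq> L + j" if "j < b" for j
    using pos[OF that] by auto
  have "\<forall>g\<in>set (gates C). wf_gate (a + L + b) g \<and> classical_gate g"
    using gs(2) pm(2) pos' by (auto simp: C_def cp_def intro: wf_gate_mono[of "a + L"])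
  then have "wf_circ C" "classical C" by (auto simp: wf_circ_def classical_def C_def wires_def add.assoc)
  moreover have "ceval C x = map (\<lambda>j. h j x) [0..<b]" if x: "x \<in> bits a" for x
  proof -
    have "fold gate_map (gates C) (x @ replicate (L + b) False) = fold gate_map (cp b @ pm) (fold gate_map gs ((x @ replicate L False) @ replicate b False))"
      by (simp add: C_def replicate_add)
    also have "fold gate_map gs ((x @ replicate L False) @ replicate b False) = (x @ map (\<lambda>f. f x) fs) @ replicate b False"
      using fold_gate_map_append[of gs "a + L" "x @ replicate L False" "replicate b False"] gs x by simp
    also have "fold gate_map (cp b @ pm) \<dots> = fold gate_map pm ([] @ (x @ map (\<lambda>f. f x) fs) @ map (\<lambda>j. h' j x) [0..<b] @ [])"
      using cp[OF x, of b] by simp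
    also have "\<dots> = map (\<lambda>j. h' j x) [0..<b] @ x @ map (\<lambda>f. f x) fs"
      using pm(3)[rule_format, of "[]" "x @ map (\<lambda>f. f x) fs" "map (\<lambda>j. h' j x) [0..<b]" "[]"] x by (simp add: L_def)
    finally show ?thesis using fs(4) x by (simp add: ceval_def C_def)
  qed
  moreover have "csize C \<le> 6 * (a + b * (S + 1))"
    using gs(1) pm(1) fs(2) by (simp add: csize_def C_def cp_def L_def)
  ultimately show ?thesis by (intro exI[of _ C]) (auto simp: C_def)
qed

section \<open>Product operators\<close>

lemma split_bits: "x \<in> bits (a + b) \<Longrightarrow> \<exists>u v. u \<in> bits a \<and> v \<in> bits b \<and> x = u @ v"
  by (rule exI[of _ "take a x"], rule exI[of _ "drop a x"]) auto

lemma tensor_append [simp]: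
  "length u = a \<Longrightarrow> length u' = a \<Longrightarrow> tensor a \<rho> \<sigma> (u @ v) (u' @ v') = \<rho> u u' * \<sigma> v v'"
  by (simp add: tensor_def)

lemma run_cong_append:
  assumes "nin C = a + b"
    and "\<And>u v u' v'. u \<in> bits a \<Longrightarrow> v \<in> bits b \<Longrightarrow> u' \<in> bits a \<Longrightarrow> v' \<in> bits b \<Longrightarrow> \<rho> (u @ v) (u' @ v') = \<rho>' (u @ v) (u' @ v')"
  shows "run C \<rho> = run C \<rho>'"
proof (rule run_cong)
  fix x x' assume "x \<in> bits (nin C)" "x' \<in> bits (nin C)"
  then show "\<rho> x x' = \<rho>' x x'"
    unfolding assms(1) using assms(2) by (metis split_bits)
qed

text \<open>Operators are functions on all pairs of bit strings. Vanishing outside length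
  \<open>n\<close> turns agreement on \<open>bits n\<close> into equality, which is what rewriting
  under \<open>run\<close> and \<open>tensor\<close> needs.\<close>

definition supported :: "nat \<Rightarrow> qop \<Rightarrow> bool" where
  "supported n \<rho> \<longleftrightarrow> (\<forall>x y. x \<notin> bits n \<or> y \<notin> bits n \<longrightarrow> \<rho> x y = 0)"

lemma supported_psd: "psd n \<rho> \<Longrightarrow> supported n \<rho>"
  using psd_outside unfolding supported_def by blast

lemma supported_density: "density n \<rho> \<Longrightarrow> supported n \<rho>"
  by (simp add: density_iff supported_psd)

lemma supported_run: "wf_circ C \<Longrightarrow> supported (nout C) (run C \<rho>)"
  using run_outside unfolding supported_def by blast

lemma supported_basis: "x \<in> bits n \<Longrightarrow> supported n (basis x)"
  by (auto simp: supported_def basis_def)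

lemma supported_tensor:
  assumes "supported a \<rho>" "supported b \<sigma>"
  shows "supported (a + b) (tensor a \<rho> \<sigma>)"
  unfolding supported_def tensor_def
proof (intro allI impI)
  fix x y :: "bool list"
  assume xy: "x \<notin> bits (a + b) \<or> y \<notin> bits (a + b)"
  have "take a z \<notin> bits a \<or> drop a z \<notin> bits b" if "z \<notin> bits (a + b)" for z :: "bool list" using that by auto
  then have "(take a x \<notin> bits a \<or> take a y \<notin> bits a) \<or> (drop a x \<notin> bits b \<or> drop a y \<notin> bits b)"
    using xy by blast
  then have "\<rho> (take a x) (take a y) = 0 \<or> \<sigma> (drop a x) (drop a y) = 0"
    using assms unfolding supported_def by blast
  then show "\<rho> (take a x) (take a y) * \<sigma> (drop a x) (drop a y) = 0" by auto
qed

lemma supported_eqI: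
  assumes "supported n \<rho>" "supported n \<sigma>" "\<And>x y. x \<in> bits n \<Longrightarrow> y \<in> bits n \<Longrightarrow> \<rho> x y = \<sigma> x y"
  shows "\<rho> = \<sigma>"
proof (intro ext)
  fix x y show "\<rho> x y = \<sigma> x y"
    using assms unfolding supported_def by (cases "x \<in> bits n \<and> y \<in> bits n") metis+
qed

lemma supported_eq_appendI:
  assumes "supported (a + b) \<rho>" "supported (a + b) \<sigma>"
    "\<And>u v u' v'. u \<in> bits a \<Longrightarrow> v \<in> bits b \<Longrightarrow> u' \<in> bits a \<Longrightarrow> v' \<in> bits b \<Longrightarrow> \<rho> (u @ v) (u' @ v') = \<sigma> (u @ v) (u' @ v')"
  shows "\<rho> = \<sigma>"
proof (rule supported_eqI[OF assms(1,2)])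
  fix x y assume "x \<in> bits (a + b)" "y \<in> bits (a + b)"
  then show "\<rho> x y = \<sigma> x y" using assms(3) by (metis split_bits)
qed

lemma basis_append: "length u = a \<Longrightarrow> tensor a (basis u) (basis v) = basis (u @ v)"
proof (intro ext)
  fix x y
  assume a: "length u = a"
  have *: "take a z = u \<and> drop a z = v \<longleftrightarrow> z = u @ v" for z
    using a by (metis append_eq_conv_conj)
  have "tensor a (basis u) (basis v) x y = of_bool ((take a x = u \<and> drop a x = v) \<and> (take a y = u \<and> drop a y = v))"
    by (auto simp: tensor_def basis_def)
  also have "\<dots> = basis (u @ v) x y"
    unfolding * basis_def by simp
  finally show "tensor a (basis u) (basis v) x y = basis (u @ v) x y" .
qed

lemma density_basis: "x \<in> bits n \<Longrightarrow> density n (basis x)"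
proof -
  assume x: "x \<in> bits n"
  have tr: "(\<Sum>z\<in>bits n. basis x z z) = 1"
  proof -
    have "(\<Sum>z\<in>bits n. basis x z z) = (\<Sum>z\<in>bits n. of_bool (z = x) * 1)" by (simp add: basis_def)
    also have "\<dots> = 1" using x by (subst sum_of_bool_pick) auto
    finally show ?thesis .
  qed
  have "(\<Sum>z\<in>bits n. \<Sum>y\<in>bits n. cnj (v z) * basis x z y * v y) \<in> \<real>\<^sub>\<ge>\<^sub>0" for v
  proof -
    have "(\<Sum>z\<in>bits n. \<Sum>y\<in>bits n. cnj (v z) * basis x z y * v y) =
      (\<Sum>z\<in>bits n. of_bool (z = x) * (\<Sum>y\<in>bits n. of_bool (y = x) * (cnj (v z) * v y)))"
      unfolding sum_distrib_left by (intro sum.cong refl) (auto simp: basis_def)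
    also have "\<dots> = cnj (v x) * v x"
      using x by (simp only: sum_of_bool_pick finite_bits)
    also have "\<dots> = of_real ((norm (v x))\<^sup>2)"
      by (metis complex_norm_square mult.commute)
    finally show ?thesis by simp
  qed
  with x tr show ?thesis by (auto simp: density_def basis_def)
qed

lemma density_mixture:
  assumes "finite I" "\<And>i. i \<in> I \<Longrightarrow> 0 \<le> p i" "sum p I = 1" "\<And>i. i \<in> I \<Longrightarrow> density n (\<rho> i)"
  shows "density n (\<lambda>x y. \<Sum>i\<in>I. of_real (p i) * \<rho> i x y)"
  unfolding density_def
proof (intro conjI allI impI)
  fix x y assume *: "(\<Sum>i\<in>I. of_real (p i) * \<rho> i x y) \<noteq> 0"
  then obtain i where "i \<in> I" "\<rho> i x y \<noteq> 0"
    by (metis (no_types, lifting) mult_zero_right sum.neutral)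
  with assms(4) show "x \<in> bits n" "y \<in> bits n" unfolding density_def by blast+
next
  fix v
  have "(\<Sum>x\<in>bits n. \<Sum>y\<in>bits n. cnj (v x) * (\<Sum>i\<in>I. of_real (p i) * \<rho> i x y) * v y) =
    (\<Sum>x\<in>bits n. \<Sum>y\<in>bits n. \<Sum>i\<in>I. of_real (p i) * (cnj (v x) * \<rho> i x y * v y))"
    by (simp add: sum_distrib_left sum_distrib_right mult_ac)
  also have "\<dots> = (\<Sum>x\<in>bits n. \<Sum>i\<in>I. \<Sum>y\<in>bits n. of_real (p i) * (cnj (v x) * \<rho> i x y * v y))"
    by (intro sum.cong refl sum.swap)
  also have "\<dots> = (\<Sum>i\<in>I. \<Sum>x\<in>bits n. \<Sum>y\<in>bits n. of_real (p i) * (cnj (v x) * \<rho> i x y * v y))"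
    by (rule sum.swap)
  also have "\<dots> = (\<Sum>i\<in>I. of_real (p i) * (\<Sum>x\<in>bits n. \<Sum>y\<in>bits n. cnj (v x) * \<rho> i x y * v y))"
    by (simp add: sum_distrib_left)
  also have "\<dots> \<in> \<real>\<^sub>\<ge>\<^sub>0"
  proof (rule sum_nonneg_Reals)
    fix i assume "i \<in> I"
    with assms have "(\<Sum>x\<in>bits n. \<Sum>y\<in>bits n. cnj (v x) * \<rho> i x y * v y) \<in> \<real>\<^sub>\<ge>\<^sub>0" "complex_of_real (p i) \<in> \<real>\<^sub>\<ge>\<^sub>0"
      by (auto simp: density_def)
    then show "of_real (p i) * (\<Sum>x\<in>bits n. \<Sum>y\<in>bits n. cnj (v x) * \<rho> i x y * v y) \<in> \<real>\<^sub>\<ge>\<^sub>0"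
      by (rule nonneg_Reals_mult_I[rotated])
  qed
  finally show "(\<Sum>x\<in>bits n. \<Sum>y\<in>bits n. cnj (v x) * (\<Sum>i\<in>I. of_real (p i) * \<rho> i x y) * v y) \<in> \<real>\<^sub>\<ge>\<^sub>0" .
next
  have "(\<Sum>x\<in>bits n. \<Sum>i\<in>I. of_real (p i) * \<rho> i x x) = (\<Sum>i\<in>I. of_real (p i) * (\<Sum>x\<in>bits n. \<rho> i x x))"
    by (subst sum.swap) (simp add: sum_distrib_left)
  also have "\<dots> = (\<Sum>i\<in>I. of_real (p i))"
    using assms(4) by (intro sum.cong refl) (auto simp: density_def)
  also have "\<dots> = 1" using assms(3) by (metis of_real_1 of_real_sum)
  finally show "(\<Sum>x\<in>bits n. \<Sum>i\<in>I. of_real (p i) * \<rho> i x x) = 1" .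
qed

lemma ex_lift_tensor:
  assumes "wf_circ C1"
  shows "\<exists>C. wf_circ C \<and> nin C = nin C1 + k \<and> nout C = nout C1 + k \<and>
     csize C \<le> 8 * (csize C1 + k) \<and>
     (\<forall>\<rho> \<sigma>. supported k \<sigma> \<longrightarrow> run C (tensor (nin C1) \<rho> \<sigma>) = tensor (nout C1) (run C1 \<rho>) \<sigma>) \<and>
     (\<forall>\<rho>. \<forall>u\<in>bits (nout C1). \<forall>u'\<in>bits (nout C1). \<forall>v\<in>bits k. \<forall>v'\<in>bits k.
        run C \<rho> (u @ v) (u' @ v') = run C1 (\<lambda>x x'. \<rho> (x @ v) (x' @ v')) u u')"
proof -
  obtain C where C: "wf_circ C" "nin C = nin C1 + k" "nout C = nout C1 + k" "csize C \<le> 8 * (csize C1 + k)"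
    "\<forall>\<rho>. \<forall>u\<in>bits (nout C1). \<forall>u'\<in>bits (nout C1). \<forall>v\<in>bits k. \<forall>v'\<in>bits k.
        run C \<rho> (u @ v) (u' @ v') = run C1 (\<lambda>x x'. \<rho> (x @ v) (x' @ v')) u u'"
    using ex_lift[OF assms] by blast
  have "run C (tensor (nin C1) \<rho> \<sigma>) = tensor (nout C1) (run C1 \<rho>) \<sigma>" if "supported k \<sigma>" for \<rho> \<sigma>
  proof (rule supported_eq_appendI)
    show "supported (nout C1 + k) (run C (tensor (nin C1) \<rho> \<sigma>))" using supported_run[OF C(1)] C(3) by simp
    show "supported (nout C1 + k) (tensor (nout C1) (run C1 \<rho>) \<sigma>)"
      using supported_run[OF assms] that by (intro supported_tensor)
    fix u v u' v' assume l: "u \<in> bits (nout C1)" "v \<in> bits k" "u' \<in> bits (nout C1)" "v' \<in> bits k"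
    have "run C (tensor (nin C1) \<rho> \<sigma>) (u @ v) (u' @ v') = run C1 (\<lambda>x x'. \<sigma> v v' * \<rho> x x') u u'"
      using C(5) l by (auto intro!: fun_cong[OF fun_cong[OF run_cong]])
    then show "run C (tensor (nin C1) \<rho> \<sigma>) (u @ v) (u' @ v') = tensor (nout C1) (run C1 \<rho>) \<sigma> (u @ v) (u' @ v')"
      using l by (simp add: run_scale)
  qed
  with C show ?thesis by blast
qed

text \<open>A circuit without inputs prepares \<open>x\<close> and is lifted over the remaining
  wires; adversaries are non-uniform, so any fixed string may be built in this way.\<close>

lemma ex_hardwire:
  assumes "wf_circ C" "length x \<le> nin C"
  shows "\<exists>D. wf_circ D \<and> nin D = nin C - length x \<and> nout D = nout C \<and> csize D \<le> 1000 * csize C \<and>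
    (\<forall>\<rho>. run D \<rho> = run C (tensor (length x) (basis x) \<rho>))"
proof -
  define k where "k = nin C - length x"
  have nC: "nin C = length x + k" using assms by (simp add: k_def)
  obtain X where X: "wf_circ X" "classical X" "nin X = 0" "nout X = length x" "csize X \<le> 6 * (0 + length x * (1 + 1))"
    "\<forall>z\<in>bits 0. ceval X z = map (\<lambda>j. x ! j) [0..<length x]"
    using ex_classical[of "length x" 0 1 "\<lambda>j _. x ! j", OF steps_const] by blast
  have X0: "run X (basis []) = basis x" using run_classical_basis[OF X(1,2), of "[]"] X by (simp add: map_nth)
  obtain L where L: "wf_circ L" "nin L = k" "nout L = length x + k" "csize L \<le> 8 * (csize X + k)"
    "\<forall>\<rho>. \<forall>u\<in>bits (length x). \<forall>u'\<in>bits (length x). \<forall>v\<in>bits k. \<forall>v'\<in>bits k.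
        run L \<rho> (u @ v) (u' @ v') = run X (\<lambda>x x'. \<rho> (x @ v) (x' @ v')) u u'"
    using ex_lift[OF X(1), of k] X by auto
  obtain D where D: "wf_circ D" "nin D = k" "nout D = nout C" "csize D \<le> 4 * (csize L + csize C)" "\<forall>\<rho>. run D \<rho> = run C (run L \<rho>)"
    using ex_seq[OF L(1) assms(1)] L nC by auto
  have "run D \<rho> = run C (tensor (length x) (basis x) \<rho>)" for \<rho>
    unfolding D(5)[rule_format]
  proof (rule run_cong_append[OF nC])
    fix u v u' v' assume l: "u \<in> bits (length x)" "v \<in> bits k" "u' \<in> bits (length x)" "v' \<in> bits k"
    have "run X (\<lambda>x x'. \<rho> (x @ v) (x' @ v')) = run X (\<lambda>x x'. \<rho> v v' * basis [] x x')"
      using X(3) by (intro run_cong) (auto simp: basis_def)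
    then have "run L \<rho> (u @ v) (u' @ v') = run X (\<lambda>x x'. \<rho> v v' * basis [] x x') u u'"
      using L(5) l by simp
    then show "run L \<rho> (u @ v) (u' @ v') = tensor (length x) (basis x) \<rho> (u @ v) (u' @ v')"
      using l by (simp add: run_scale X0)
  qed
  moreover have "csize D \<le> 1000 * csize C"
    using D(4) L(4) X(5) assms(2) nC by (simp add: csize_def)
  ultimately show ?thesis using D k_def by blast
qed

lemma run_identity:
  assumes "supported k \<sigma>"
  shows "run (Circ k 0 k []) \<sigma> = \<sigma>"
proof (rule supported_eqI[OF _ assms])
  have "wf_circ (Circ k 0 k [])" by (simp add: wf_circ_def wires_def)
  from supported_run[OF this] show "supported k (run (Circ k 0 k []) \<sigma>)" by simp
  fix z y assume zy: "z \<in> bits k" "y \<in> bits k"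
  have "run (Circ k 0 k []) \<sigma> z y = (\<Sum>u\<in>bits k. \<Sum>v\<in>bits k. of_bool (z = u) * \<sigma> u v * of_bool (y = v))"
    unfolding run_def wires_def circ.sel by (simp only: add_0_right diff_self_eq_0 bits_0 sum.insert finite.emptyI
        empty_iff not_False_eq_True sum.empty replicate_0 append_Nil2 amplitude.simps cnj_of_bool)
  also have "\<dots> = (\<Sum>u\<in>bits k. of_bool (z = u) * (\<Sum>v\<in>bits k. \<sigma> u v * of_bool (y = v)))"
    by (simp only: mult.assoc sum_distrib_left)
  also have "\<dots> = \<sigma> z y"
    using zy by (simp only: sum_of_bool_pick finite_bits)
  finally show "run (Circ k 0 k []) \<sigma> z y = \<sigma> z y" .
qed

text \<open>The product is the output of a channel applied to \<rho>, namely of the identity circuit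
  with \<open>x\<close> hardwired, so positivity and trace are inherited from
  \<open>run_density\<close>.\<close>

lemma density_tensor_basis:
  assumes "density k \<rho>"
  shows "density (length x + k) (tensor (length x) (basis x) \<rho>)"
proof -
  define I where "I = Circ (length x + k) 0 (length x + k) []"
  have I: "wf_circ I" "nin I = length x + k" "nout I = length x + k" by (auto simp: I_def wf_circ_def wires_def)
  obtain D where D: "wf_circ D" "nin D = k" "nout D = length x + k" "\<forall>\<rho>. run D \<rho> = run I (tensor (length x) (basis x) \<rho>)"
    using ex_hardwire[of I x] I by auto
  have "density (length x + k) (run D \<rho>)" using run_density[OF D(1)] D assms by simp
  moreover have "run D \<rho> = tensor (length x) (basis x) \<rho>"
    unfolding D(4)[rule_format]
    unfolding I_def by (rule run_identity, rule supported_tensor) (use assms in \<open>auto intro: supported_basis supported_density\<close>)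
  ultimately show ?thesis by simp
qed

lemma tensor_assoc:
  "tensor (a + b) (tensor a \<rho> \<sigma>) \<tau> = tensor a \<rho> (tensor b \<sigma> \<tau>)"
  unfolding fun_eq_iff tensor_def by (simp add: min_def drop_take add.commute mult.assoc)

lemma ex_swap_tensor:
  "\<exists>C. wf_circ C \<and> nin C = a + b \<and> nout C = b + a \<and> csize C \<le> 5 * (a + b) \<and>
     (\<forall>\<rho>. \<forall>u\<in>bits a. \<forall>u'\<in>bits a. \<forall>v\<in>bits b. \<forall>v'\<in>bits b. run C \<rho> (v @ u) (v' @ u') = \<rho> (u @ v) (u' @ v')) \<and>
     (\<forall>\<rho> \<sigma>. supported a \<rho> \<longrightarrow> supported b \<sigma> \<longrightarrow> run C (tensor a \<rho> \<sigma>) = tensor b \<sigma> \<rho>)"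
proof -
  obtain C where C: "wf_circ C" "nin C = a + b" "nout C = b + a" "csize C \<le> 5 * (a + b)"
     "\<forall>\<rho>. \<forall>u\<in>bits a. \<forall>u'\<in>bits a. \<forall>v\<in>bits b. \<forall>v'\<in>bits b. run C \<rho> (v @ u) (v' @ u') = \<rho> (u @ v) (u' @ v')"
    using ex_swap by blast
  have "run C (tensor a \<rho> \<sigma>) = tensor b \<sigma> \<rho>" if "supported a \<rho>" "supported b \<sigma>" for \<rho> \<sigma>
  proof (rule supported_eq_appendI)
    show "supported (b + a) (run C (tensor a \<rho> \<sigma>))" using supported_run[OF C(1)] C by simp
    show "supported (b + a) (tensor b \<sigma> \<rho>)" using that by (intro supported_tensor)
  qed (use C(5) in auto)
  with C show ?thesis by blast
qed

lemma density_tensor_basis_right: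
  assumes "density k \<rho>"
  shows "density (k + length x) (tensor k \<rho> (basis x))"
proof -
  obtain C where C: "wf_circ C" "nin C = length x + k" "nout C = k + length x"
     "\<forall>\<rho> \<sigma>. supported (length x) \<rho> \<longrightarrow> supported k \<sigma> \<longrightarrow> run C (tensor (length x) \<rho> \<sigma>) = tensor k \<sigma> \<rho>"
    using ex_swap_tensor[of "length x" k] by blast
  have "density (nout C) (run C (tensor (length x) (basis x) \<rho>))"
    using C density_tensor_basis[OF assms] by (intro run_density) simp_all
  then show ?thesis using C supported_density[OF assms] by (simp add: supported_basis)
qed

lemma density_tensor_run:
  assumes "wf_circ C" "density (nin C + k) (tensor (nin C) \<rho> \<sigma>)" "supported k \<sigma>"
  shows "density (nout C + k) (tensor (nout C) (run C \<rho>) \<sigma>)"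
  using ex_lift_tensor[OF assms(1), of k] assms run_density by metis

section \<open>Testing the outputs of two parties\<close>

lemma run_classical_prob:
  assumes "wf_circ C" "classical C" "length y = nout C"
  shows "prob_out (run C \<rho>) y = (\<Sum>x\<in>{x \<in> bits (nin C). ceval C x = y}. prob_out \<rho> x)"
  by (simp add: prob_out_def run_classical(1)[OF assms])

text \<open>Turns joint success of two parties into the acceptance probability of one circuit, the
  format of distinguishers and predictors. After \<open>B\<close> its output bit is swapped behind
  the register of \<open>C\<close>, so that \<open>C\<close> can be applied to the front.\<close>

lemma ex_joint:
  assumes B: "wf_circ B" "nin B = rB" "nout B = 1" and C: "wf_circ C" "nin C = rC" "nout C = 1"
  shows "\<exists>D. wf_circ D \<and> nin D = rB + rC \<and> nout D = 1 \<and> csize D \<le> 2000 * (csize B + csize C) \<and>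
    (\<forall>\<sigma>. prob_out (run D \<sigma>) [True] = joint_prob (run B) (run C) \<sigma> [b] [b])"
proof -
  obtain L where L: "wf_circ L" "nin L = rB + rC" "nout L = 1 + rC" "csize L \<le> 8 * (csize B + rC)"
    "\<forall>\<rho>. \<forall>u\<in>bits 1. \<forall>u'\<in>bits 1. \<forall>v\<in>bits rC. \<forall>v'\<in>bits rC.
        run L \<rho> (u @ v) (u' @ v') = run B (\<lambda>x x'. \<rho> (x @ v) (x' @ v')) u u'"
    using ex_lift[OF B(1), of rC] B by auto
  obtain S where S: "wf_circ S" "nin S = 1 + rC" "nout S = rC + 1" "csize S \<le> 5 * (1 + rC)"
    "\<forall>\<rho>. \<forall>u\<in>bits 1. \<forall>u'\<in>bits 1. \<forall>v\<in>bits rC. \<forall>v'\<in>bits rC. run S \<rho> (v @ u) (v' @ u') = \<rho> (u @ v) (u' @ v')"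
    using ex_swap[of 1 rC] by auto
  obtain M where M: "wf_circ M" "nin M = rC + 1" "nout M = 1 + 1" "csize M \<le> 8 * (csize C + 1)"
    "\<forall>\<rho>. \<forall>u\<in>bits 1. \<forall>u'\<in>bits 1. \<forall>v\<in>bits 1. \<forall>v'\<in>bits 1.
        run M \<rho> (u @ v) (u' @ v') = run C (\<lambda>x x'. \<rho> (x @ v) (x' @ v')) u u'"
    using ex_lift[OF C(1), of 1] C by auto
  have st: "steps 2 9 (\<lambda>x. (x ! 0 \<longleftrightarrow> b) \<and> (x ! 1 \<longleftrightarrow> b))"
  proof -
    have i: "steps 2 4 (\<lambda>x. x ! i \<longleftrightarrow> b)" if "i < 2" for i
    proof (cases b)
      case True
      then show ?thesis using steps_mono[OF steps_proj[OF that], of 4] by simp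
    next
      case False
      then show ?thesis using steps_mono[OF steps_not[OF steps_proj[OF that]], of 4] by simp
    qed
    show ?thesis by (rule steps_mono[OF steps_and[OF i i]]) auto
  qed
  obtain E where E: "wf_circ E" "classical E" "nin E = 2" "nout E = 1" "csize E \<le> 6 * (2 + 1 * (9 + 1))"
    "\<forall>x\<in>bits 2. ceval E x = map (\<lambda>j. (x ! 0 \<longleftrightarrow> b) \<and> (x ! 1 \<longleftrightarrow> b)) [0..<1]"
    using ex_classical[of 1 2 9 "\<lambda>_ x. (x ! 0 \<longleftrightarrow> b) \<and> (x ! 1 \<longleftrightarrow> b)", OF st] by blast
  obtain D1 where D1: "wf_circ D1" "nin D1 = rB + rC" "nout D1 = rC + 1" "csize D1 \<le> 4 * (csize L + csize S)" "\<forall>\<rho>. run D1 \<rho> = run S (run L \<rho>)"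
    using ex_seq[OF L(1) S(1)] L S by auto
  obtain D2 where D2: "wf_circ D2" "nin D2 = rB + rC" "nout D2 = 2" "csize D2 \<le> 4 * (csize D1 + csize M)" "\<forall>\<rho>. run D2 \<rho> = run M (run D1 \<rho>)"
    using ex_seq[OF D1(1) M(1)] D1 M by auto
  obtain D where D: "wf_circ D" "nin D = rB + rC" "nout D = 1" "csize D \<le> 4 * (csize D2 + csize E)" "\<forall>\<rho>. run D \<rho> = run E (run D2 \<rho>)"
    using ex_seq[OF D2(1) E(1)] D2 E by auto
  have "prob_out (run D \<sigma>) [True] = joint_prob (run B) (run C) \<sigma> [b] [b]" for \<sigma>
  proof -
    have set: "{x \<in> bits (nin E). ceval E x = [True]} = {[b, b]}"
      using E by (auto simp: numeral_2_eq_2 length_Suc_conv)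
    have "prob_out (run D \<sigma>) [True] = (\<Sum>x\<in>{x \<in> bits (nin E). ceval E x = [True]}. prob_out (run M (run S (run L \<sigma>))) x)"
      unfolding D(5)[rule_format] D2(5)[rule_format] D1(5)[rule_format]
      by (rule run_classical_prob) (use E in simp_all)
    also have "\<dots> = prob_out (run M (run S (run L \<sigma>))) [b, b]"
      unfolding set by simp
    also have "\<dots> = Re (run M (run S (run L \<sigma>)) ([b] @ [b]) ([b] @ [b]))" by (simp add: prob_out_def)
    also have "\<dots> = Re (run C (\<lambda>x x'. run S (run L \<sigma>) (x @ [b]) (x' @ [b])) [b] [b])"
      by (subst M(5)[rule_format]) auto
    also have "run C (\<lambda>x x'. run S (run L \<sigma>) (x @ [b]) (x' @ [b])) = run C (\<lambda>v v'. run B (\<lambda>u u'. \<sigma> (u @ v) (u' @ v')) [b] [b])"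
    proof (rule run_cong)
      fix v v' assume "v \<in> bits (nin C)" "v' \<in> bits (nin C)"
      then show "run S (run L \<sigma>) (v @ [b]) (v' @ [b]) = run B (\<lambda>u u'. \<sigma> (u @ v) (u' @ v')) [b] [b]"
        using S(5)[rule_format, of "[b]" "[b]" v v' "run L \<sigma>"] L(5)[rule_format, of "[b]" "[b]" v v' \<sigma>] C(2) by simp
    qed
    finally show ?thesis by (simp add: joint_prob_def)
  qed
  moreover have "csize D \<le> 2000 * (csize B + csize C)"
  proof -
    have "rC \<le> csize C" "rB \<le> csize B" "1 \<le> csize C" "1 \<le> csize B" using B C by (auto simp: csize_def)
    then show ?thesis using D(4) D2(4) D1(4) L(4) S(4) M(4) E(5) by simp
  qed
  ultimately show ?thesis using D by blast
qed

section \<open>The quantum Goldreich--Levin theorem\<close>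

subsection \<open>A Cauchy--Schwarz inequality for density operators\<close>

text \<open>Test vectors with two nonzero entries; used with coefficients 1, 1 and 1,
  \<open>\<i>\<close> for hermiticity, and with 1, \<open>t\<close> for
  \<open>psd_trace_zero\<close>.\<close>

lemma form_sparse:
  assumes "a \<in> bits n" "b \<in> bits n" "a \<noteq> b"
  shows "(\<Sum>x\<in>bits n. \<Sum>y\<in>bits n. cnj (s * of_bool (x = a) + t * of_bool (x = b)) * \<rho> x y * (s * of_bool (y = a) + t * of_bool (y = b)))
     = cnj s * s * \<rho> a a + cnj s * t * \<rho> a b + cnj t * s * \<rho> b a + cnj t * t * \<rho> b b"
proof -
  have 1: "(\<Sum>y\<in>bits n. f y * (s * of_bool (y = a) + t * of_bool (y = b))) = f a * s + f b * t" for f :: "bool list \<Rightarrow> complex"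
  proof -
    have "(\<Sum>y\<in>bits n. f y * (s * of_bool (y = a) + t * of_bool (y = b))) =
       (\<Sum>y\<in>bits n. (f y * s) * of_bool (y = a)) + (\<Sum>y\<in>bits n. (f y * t) * of_bool (y = b))"
      by (simp only: distrib_left mult.assoc sum.distrib)
    then show ?thesis using assms by (simp only: sum_of_bool_pick finite_bits)
  qed
  have 2: "(\<Sum>x\<in>bits n. cnj (s * of_bool (x = a) + t * of_bool (x = b)) * f x) = cnj s * f a + cnj t * f b" for f :: "bool list \<Rightarrow> complex"
  proof -
    have "(\<Sum>x\<in>bits n. cnj (s * of_bool (x = a) + t * of_bool (x = b)) * f x) =
       (\<Sum>x\<in>bits n. of_bool (x = a) * (cnj s * f x)) + (\<Sum>x\<in>bits n. of_bool (x = b) * (cnj t * f x))"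
      unfolding sum.distrib[symmetric] by (intro sum.cong refl) (simp add: algebra_simps)
    then show ?thesis using assms by (simp only: sum_of_bool_pick finite_bits)
  qed
  show ?thesis unfolding 1 mult.assoc[of "cnj _"]
    by (simp only: 1 2 flip: sum_distrib_left) (simp add: algebra_simps)
qed

text \<open>Polarisation: reality of the form at the vector with entries 1, 1 compares imaginary
  parts, at the one with entries 1, \<open>\<i>\<close> real parts.\<close>

lemma psd_hermitian:
  assumes "psd n \<rho>"
  shows "\<rho> b a = cnj (\<rho> a b)"
proof (cases "a \<in> bits n \<and> b \<in> bits n \<and> a \<noteq> b")
  case True
  have d: "Im (\<rho> x x) = 0" for x using psd_diag[OF assms, of x] by (auto simp: nonneg_Reals_def)
  have "1 * \<rho> a a + 1 * \<rho> a b + 1 * \<rho> b a + 1 * \<rho> b b \<in> \<real>\<^sub>\<ge>\<^sub>0"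
    using psd_form[OF assms, of "\<lambda>x. 1 * of_bool (x = a) + 1 * of_bool (x = b)"] True
    by (subst (asm) form_sparse) auto
  then have "Im (\<rho> a b) = - Im (\<rho> b a)" using d[of a] d[of b] by (auto simp: complex_nonneg_Reals_iff)
  moreover have "\<rho> a a + \<i> * \<rho> a b - \<i> * \<rho> b a + \<rho> b b \<in> \<real>\<^sub>\<ge>\<^sub>0"
    using psd_form[OF assms, of "\<lambda>x. 1 * of_bool (x = a) + \<i> * of_bool (x = b)"] True
    by (subst (asm) form_sparse) auto
  then have "Re (\<rho> a b) = Re (\<rho> b a)" using d[of a] d[of b] by (auto simp: complex_nonneg_Reals_iff)
  ultimately show ?thesis by (simp add: complex_eq_iff)
next
  case False
  show ?thesis
  proof (cases "a = b")
    case True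
    then show ?thesis using psd_diag[OF assms, of a] by (auto simp: nonneg_Reals_def)
  next
    case False
    then show ?thesis using \<open>\<not> (a \<in> bits n \<and> b \<in> bits n \<and> a \<noteq> b)\<close> psd_outside[OF assms] by auto
  qed
qed

text \<open>Here \<mu> is the trace of \<open>X\<close> \<tau>, and the claim bounds its squared
  modulus by the trace of \<open>X\<close> \<tau> \<open>X\<close>*. It follows from expanding the
  nonnegative trace of (\<open>X\<close> - \<mu>) \<tau> (\<open>X\<close> - \<mu>)*, as \<tau> has
  trace 1.\<close>

lemma density_cauchy_schwarz:
  fixes X :: "bool list \<Rightarrow> bool list \<Rightarrow> complex"
  assumes "density n \<tau>"
  defines "\<mu> \<equiv> \<Sum>b\<in>bits n. \<Sum>a\<in>bits n. X b a * \<tau> a b"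
  shows "(norm \<mu>)\<^sup>2 \<le> Re (\<Sum>b\<in>bits n. \<Sum>a\<in>bits n. \<Sum>a'\<in>bits n. X b a * \<tau> a a' * cnj (X b a'))"
proof -
  let ?F = "\<Sum>b\<in>bits n. \<Sum>a\<in>bits n. \<Sum>a'\<in>bits n. X b a * \<tau> a a' * cnj (X b a')"
  have psd: "psd n \<tau>" and tr: "(\<Sum>b\<in>bits n. \<tau> b b) = 1" using assms(1) by (auto simp: density_iff op_trace_def)
  have "(\<Sum>a\<in>bits n. \<Sum>a'\<in>bits n. (X b a - \<mu> * of_bool (a = b)) * \<tau> a a' * cnj (X b a' - \<mu> * of_bool (a' = b)))
      = (\<Sum>a\<in>bits n. \<Sum>a'\<in>bits n. X b a * \<tau> a a' * cnj (X b a')) - cnj \<mu> * (\<Sum>a\<in>bits n. X b a * \<tau> a b)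
        - \<mu> * cnj (\<Sum>a\<in>bits n. X b a * \<tau> a b) + \<mu> * cnj \<mu> * \<tau> b b" if b: "b \<in> bits n" for b
  proof -
    have r: "(\<Sum>a'\<in>bits n. f a' * cnj (X b a' - \<mu> * of_bool (a' = b))) = (\<Sum>a'\<in>bits n. f a' * cnj (X b a')) - cnj \<mu> * f b" for f
    proof -
      have "(\<Sum>a'\<in>bits n. f a' * cnj (X b a' - \<mu> * of_bool (a' = b))) =
         (\<Sum>a'\<in>bits n. f a' * cnj (X b a')) - (\<Sum>a'\<in>bits n. (cnj \<mu> * f a') * of_bool (a' = b))"
        unfolding sum_subtractf[symmetric] by (intro sum.cong refl) (simp add: algebra_simps)
      then show ?thesis using b by (simp only: sum_of_bool_pick finite_bits)
    qed
    have l: "(\<Sum>a\<in>bits n. (X b a - \<mu> * of_bool (a = b)) * f a) = (\<Sum>a\<in>bits n. X b a * f a) - \<mu> * f b" for f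
    proof -
      have "(\<Sum>a\<in>bits n. (X b a - \<mu> * of_bool (a = b)) * f a) =
         (\<Sum>a\<in>bits n. X b a * f a) - (\<Sum>a\<in>bits n. (\<mu> * f a) * of_bool (a = b))"
        unfolding sum_subtractf[symmetric] by (intro sum.cong refl) (simp add: algebra_simps)
      then show ?thesis using b by (simp only: sum_of_bool_pick finite_bits)
    qed
    have h: "(\<Sum>a'\<in>bits n. \<tau> b a' * cnj (X b a')) = cnj (\<Sum>a\<in>bits n. X b a * \<tau> a b)"
      unfolding cnj_sum using psd_hermitian[OF psd] by (intro sum.cong refl) (metis complex_cnj_mult mult.commute)
    have "(\<Sum>a\<in>bits n. \<Sum>a'\<in>bits n. (X b a - \<mu> * of_bool (a = b)) * \<tau> a a' * cnj (X b a' - \<mu> * of_bool (a' = b)))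
      = (\<Sum>a\<in>bits n. (X b a - \<mu> * of_bool (a = b)) * ((\<Sum>a'\<in>bits n. \<tau> a a' * cnj (X b a')) - cnj \<mu> * \<tau> a b))"
      by (simp only: mult.assoc r flip: sum_distrib_left)
    also have "\<dots> = (\<Sum>a\<in>bits n. X b a * ((\<Sum>a'\<in>bits n. \<tau> a a' * cnj (X b a')) - cnj \<mu> * \<tau> a b))
        - \<mu> * ((\<Sum>a'\<in>bits n. \<tau> b a' * cnj (X b a')) - cnj \<mu> * \<tau> b b)"
      by (rule l)
    also have "\<dots> = (\<Sum>a\<in>bits n. \<Sum>a'\<in>bits n. X b a * \<tau> a a' * cnj (X b a')) - cnj \<mu> * (\<Sum>a\<in>bits n. X b a * \<tau> a b)
        - \<mu> * cnj (\<Sum>a\<in>bits n. X b a * \<tau> a b) + \<mu> * cnj \<mu> * \<tau> b b"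
      unfolding h by (simp add: algebra_simps sum_subtractf sum_distrib_left)
    finally show ?thesis .
  qed
  then have "(\<Sum>b\<in>bits n. \<Sum>a\<in>bits n. \<Sum>a'\<in>bits n. (X b a - \<mu> * of_bool (a = b)) * \<tau> a a' * cnj (X b a' - \<mu> * of_bool (a' = b)))
     = ?F - cnj \<mu> * \<mu> - \<mu> * cnj \<mu> + \<mu> * cnj \<mu> * (\<Sum>b\<in>bits n. \<tau> b b)"
    by (simp add: sum.distrib sum_subtractf \<mu>_def flip: sum_distrib_left)
  also have "\<dots> = ?F - \<mu> * cnj \<mu>" by (simp add: tr)
  finally have eq: "(\<Sum>b\<in>bits n. \<Sum>a\<in>bits n. \<Sum>a'\<in>bits n. (X b a - \<mu> * of_bool (a = b)) * \<tau> a a' * cnj (X b a' - \<mu> * of_bool (a' = b))) = ?F - \<mu> * cnj \<mu>" .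
  have "(\<Sum>b\<in>bits n. \<Sum>a\<in>bits n. \<Sum>a'\<in>bits n. (X b a - \<mu> * of_bool (a = b)) * \<tau> a a' * cnj (X b a' - \<mu> * of_bool (a' = b))) \<in> \<real>\<^sub>\<ge>\<^sub>0"
  proof (rule sum_nonneg_Reals)
    fix b
    show "(\<Sum>a\<in>bits n. \<Sum>a'\<in>bits n. (X b a - \<mu> * of_bool (a = b)) * \<tau> a a' * cnj (X b a' - \<mu> * of_bool (a' = b))) \<in> \<real>\<^sub>\<ge>\<^sub>0"
      using psd_form[OF psd, of "\<lambda>a. cnj (X b a - \<mu> * of_bool (a = b))"] by simp
  qed
  then have "0 \<le> Re (?F - \<mu> * cnj \<mu>)" unfolding eq using complex_nonneg_Reals_iff by blast
  moreover have "Re (\<mu> * cnj \<mu>) = (norm \<mu>)\<^sup>2"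
    by (metis complex_norm_square Re_complex_of_real)
  ultimately show ?thesis by simp
qed

subsection \<open>Inverse circuits and layers of gates\<close>

text \<open>The eighth power of \<open>TGate\<close> is the identity, hence the seven copies; the
  other gates are involutions.\<close>

fun inverse_gate :: "gate \<Rightarrow> gate list" where
  "inverse_gate (TGate i) = replicate 7 (TGate i)"
| "inverse_gate g = [g]"

definition inverse_gates :: "gate list \<Rightarrow> gate list" where
  "inverse_gates gs = concat (map inverse_gate (rev gs))"

lemma length_inverse_gates: "length (inverse_gates gs) \<le> 7 * length gs"
proof (induction gs)
  case (Cons g gs)
  have "length (inverse_gate g) \<le> 7" by (cases g) auto
  with Cons show ?case by (simp add: inverse_gates_def)
qed (simp add: inverse_gates_def)

lemma wf_inverse_gates: "\<forall>g\<in>set gs. wf_gate N g \<Longrightarrow> \<forall>g\<in>set (inverse_gates gs). wf_gate N g"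
proof -
  have "\<forall>h\<in>set (inverse_gate g). wf_gate N h" if "wf_gate N g" for g using that by (cases g) auto
  then show "\<forall>g\<in>set gs. wf_gate N g \<Longrightarrow> \<forall>g\<in>set (inverse_gates gs). wf_gate N g"
    by (auto simp: inverse_gates_def)
qed

definition sign :: "bool \<Rightarrow> complex" where
  "sign b = (if b then -1 else 1)"

lemma amplitude_TGates:
  assumes "x \<in> bits N"
  shows "amplitude N (replicate k (TGate i)) y x = of_bool (y = x) * (if x ! i then cis (real k * pi / 4) else 1)"
proof (induction k)
  case (Suc k)
  have "amplitude N (replicate (Suc k) (TGate i)) y x =
     (\<Sum>z\<in>bits N. of_bool (z = x) * (amplitude N (replicate k (TGate i)) y z * (if x ! i then cis (pi / 4) else 1)))"
    by (simp add: if_distrib cong: if_cong) (intro sum.cong, auto)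
  also have "\<dots> = amplitude N (replicate k (TGate i)) y x * (if x ! i then cis (pi / 4) else 1)"
    using assms by (subst sum_of_bool_pick) auto
  also have "\<dots> = of_bool (y = x) * (if x ! i then cis (real (Suc k) * pi / 4) else 1)"
    unfolding Suc by (auto simp: cis_mult ring_distribs add_divide_distrib add.commute)
  finally show ?case .
qed simp

lemma amplitude_inverse_gate:
  assumes "wf_gate N g" "x \<in> bits N" "y \<in> bits N"
  shows "amplitude N (inverse_gate g) y x = cnj (gate_entry g x y)"
proof -
  have single: "amplitude N [g] y x = gate_entry g y x"
    using assms by (simp add: sum_of_bool_pick)
  consider (C) "classical_gate g" | (H) i where "g = Hadamard i" | (T) i where "g = TGate i"
    by (cases g) auto
  then show ?thesis
  proof cases
    case C
    then have "inverse_gate g = [g]" by (cases g) auto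
    moreover have "y = gate_map g x \<longleftrightarrow> x = gate_map g y"
      using assms gate_map_involution by (metis bits_iff)
    ultimately show ?thesis using C single by (simp add: gate_entry_classical)
  next
    case H
    have "y = x[i := y ! i] \<longleftrightarrow> x = y[i := x ! i]"
      using assms by (metis list_update_id list_update_overwrite)
    then show ?thesis unfolding H inverse_gate.simps using single[unfolded H] by (auto simp: conj_commute)
  next
    case T
    have "cis (7 * pi / 4) = cnj (cis (pi / 4))"
    proof -
      have "7 * pi / 4 = 2 * pi + - (pi / 4)" by simp
      then have "cis (7 * pi / 4) = cis (2 * pi) * cis (- (pi / 4))" by (simp only: cis_mult)
      then show ?thesis by (simp add: cis_cnj)
    qed
    then show ?thesis
      unfolding T inverse_gate.simps using amplitude_TGates[OF assms(2), of 7 i y] by auto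
  qed
qed

lemma amplitude_inverse_gates:
  assumes "\<forall>g\<in>set gs. wf_gate N g" "x \<in> bits N" "y \<in> bits N"
  shows "amplitude N (inverse_gates gs) y x = cnj (amplitude N gs x y)"
  using assms
proof (induction gs arbitrary: y)
  case Nil
  then show ?case by (auto simp: inverse_gates_def)
next
  case (Cons g gs)
  have "amplitude N (inverse_gates (g # gs)) y x = (\<Sum>z\<in>bits N. amplitude N (inverse_gate g) y z * amplitude N (inverse_gates gs) z x)"
    using Cons.prems by (simp add: inverse_gates_def amplitude_append)
  also have "\<dots> = (\<Sum>z\<in>bits N. cnj (amplitude N gs x z * gate_entry g z y))"
    using Cons by (intro sum.cong refl) (simp add: amplitude_inverse_gate mult.commute)
  finally show ?case by simp
qed

lemma amplitude_pre:
  assumes "\<forall>g\<in>set gs. classical_gate g" "x \<in> bits N"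
  shows "amplitude N (gs @ hs) y x = amplitude N hs y (fold gate_map gs x)"
  using assms by (simp only: amplitude_append amplitude_classical) (subst sum_of_bool_pick, auto)

lemma amplitude_post:
  assumes "\<forall>g\<in>set hs. classical_gate g \<and> wf_gate N g" "x \<in> bits N" "z \<in> bits N"
  shows "amplitude N (gs @ hs) (fold gate_map hs z) x = amplitude N gs z x"
proof -
  have "amplitude N (gs @ hs) (fold gate_map hs z) x = (\<Sum>u\<in>bits N. of_bool (u = z) * amplitude N gs u x)"
    unfolding amplitude_append[OF assms(2)]
  proof (intro sum.cong refl)
    fix u assume u: "u \<in> bits N"
    then have "amplitude N hs (fold gate_map hs z) u = of_bool (fold gate_map hs z = fold gate_map hs u)"
      using assms(1) by (intro amplitude_classical) auto
    also have "fold gate_map hs z = fold gate_map hs u \<longleftrightarrow> u = z"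
      using inj_on_fold_gate_map[of hs N] assms u by (auto dest: inj_onD)
    finally show "amplitude N hs (fold gate_map hs z) u * amplitude N gs u x = of_bool (u = z) * amplitude N gs u x" by simp
  qed
  then show ?thesis using assms(3) by (simp only: sum_of_bool_pick finite_bits)
qed

text \<open>Inner product over the field with two elements; for a random mask \<open>r\<close> it is
  the hard-core bit.\<close>

fun ip :: "bool list \<Rightarrow> bool list \<Rightarrow> bool" where
  "ip (r # rs) (v # vs) = ((r \<and> v) \<noteq> ip rs vs)"
| "ip _ _ = False"

lemma ip_append: "length r = length v \<Longrightarrow> ip (r @ r') (v @ v') = (ip r v \<noteq> ip r' v')"
  by (induction r v rule: list_induct2) auto

lemma ip_zero: "ip (replicate n False) v = False"
proof (induction n arbitrary: v)
  case (Suc n) then show ?case by (cases v) auto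
qed simp

definition hadamards :: "nat \<Rightarrow> nat \<Rightarrow> gate list" where
  "hadamards w n = map (\<lambda>j. Hadamard (w + j)) [0..<n]"

lemma hadamards_Suc: "hadamards w (Suc n) = Hadamard w # hadamards (Suc w) n"
  unfolding hadamards_def by (simp add: map_upt_Suc del: upt_Suc)

text \<open>The Walsh-Hadamard matrix on the last \<open>n\<close> wires. In the induction the wire
  just treated joins the idle prefix, so the prefix length has to vary.\<close>

lemma amplitude_hadamards:
  assumes "s \<in> bits w" "s' \<in> bits w" "y \<in> bits n" "x \<in> bits n"
  shows "amplitude (w + n) (hadamards w n) (s @ y) (s' @ x) = of_bool (s = s') * sign (ip x y) / complex_of_real (sqrt 2) ^ n"
  using assms
proof (induction n arbitrary: w s s' y x)
  case 0
  then show ?case by (simp add: hadamards_def sign_def)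
next
  case (Suc n)
  obtain y0 y' x0 x' where yx: "y = y0 # y'" "x = x0 # x'" using Suc.prems by (auto simp: length_Suc_conv)
  have l: "length y' = n" "length x' = n" using Suc.prems yx by auto
  let ?N = "w + Suc n" and ?q = "complex_of_real (sqrt 2)"
  let ?z = "\<lambda>b. s' @ b # x'"
  have N: "?N = Suc w + n" by simp
  have "amplitude ?N (hadamards w (Suc n)) (s @ y) (s' @ x) =
    (\<Sum>z\<in>bits ?N. amplitude ?N (hadamards (Suc w) n) (s @ y) z * gate_entry (Hadamard w) z (s' @ x))"
    by (simp add: hadamards_Suc)
  also have "\<dots> = (\<Sum>z\<in>{?z False, ?z True}. amplitude ?N (hadamards (Suc w) n) (s @ y) z * gate_entry (Hadamard w) z (s' @ x))"
  proof (rule sum.mono_neutral_right)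
    show "{?z False, ?z True} \<subseteq> bits ?N" using Suc.prems l by auto
    show "\<forall>z\<in>bits ?N - {?z False, ?z True}. amplitude ?N (hadamards (Suc w) n) (s @ y) z * gate_entry (Hadamard w) z (s' @ x) = 0"
    proof
      fix z assume z: "z \<in> bits ?N - {?z False, ?z True}"
      have "z \<noteq> ?z (z ! w)" using z by (metis (full_types) DiffD2 insertCI)
      moreover have "(s' @ x)[w := z ! w] = ?z (z ! w)" using Suc.prems yx by (simp add: list_update_append)
      ultimately have "z \<noteq> (s' @ x)[w := z ! w]" by simp
      then show "amplitude ?N (hadamards (Suc w) n) (s @ y) z * gate_entry (Hadamard w) z (s' @ x) = 0" by simp
    qed
  qed auto
  also have "\<dots> = (\<Sum>b\<in>UNIV. amplitude ?N (hadamards (Suc w) n) (s @ y) (?z b) * gate_entry (Hadamard w) (?z b) (s' @ x))"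
    by (simp add: UNIV_bool)
  also have "\<dots> = (\<Sum>b\<in>UNIV. (of_bool (s @ [y0] = s' @ [b]) * sign (ip x' y') / ?q ^ n) * (sign (x0 \<and> b) / ?q))"
  proof (intro sum.cong refl)
    fix b
    have "amplitude (Suc w + n) (hadamards (Suc w) n) ((s @ [y0]) @ y') ((s' @ [b]) @ x') =
      of_bool (s @ [y0] = s' @ [b]) * sign (ip x' y') / ?q ^ n"
      using Suc.prems l by (intro Suc.IH) auto
    moreover have "gate_entry (Hadamard w) (?z b) (s' @ x) = sign (x0 \<and> b) / ?q"
      using Suc.prems yx by (simp add: sign_def list_update_append nth_append)
    ultimately show "amplitude ?N (hadamards (Suc w) n) (s @ y) (?z b) * gate_entry (Hadamard w) (?z b) (s' @ x) =
       (of_bool (s @ [y0] = s' @ [b]) * sign (ip x' y') / ?q ^ n) * (sign (x0 \<and> b) / ?q)"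
      using yx N by simp
  qed
  also have "\<dots> = of_bool (s = s') * sign (ip x y) / ?q ^ Suc n"
    using yx by (cases y0; cases x0; cases "ip x' y'") (auto simp: UNIV_bool sign_def)
  finally show ?case .
qed

text \<open>Serves both to copy a basis string into a zero register and, being its own inverse, to
  erase the copy.\<close>

definition xor_copy :: "nat \<Rightarrow> nat \<Rightarrow> nat \<Rightarrow> gate list" where
  "xor_copy w p n = map (\<lambda>j. CNot (w + j) (p + j)) [0..<n]"

lemma fold_xor_copy:
  assumes "length pre = p" "length t = n" "length (pre @ t @ post) = w" "length x = n"
  shows "fold gate_map (xor_copy w p n) ((pre @ t @ post) @ x) = (pre @ map2 (\<noteq>) t x @ post) @ x"
proof -
  have "fold gate_map (xor_copy w p k) ((pre @ t @ post) @ x) = (pre @ (map2 (\<noteq>) (take k t) (take k x) @ drop k t) @ post) @ x"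
    if "k \<le> n" for k
    using that
  proof (induction k)
    case (Suc k)
    have "fold gate_map (xor_copy w p (Suc k)) ((pre @ t @ post) @ x) =
      gate_map (CNot (w + k) (p + k)) ((pre @ (map2 (\<noteq>) (take k t) (take k x) @ drop k t) @ post) @ x)"
      using Suc by (simp add: xor_copy_def)
    also have "\<dots> = (pre @ (map2 (\<noteq>) (take (Suc k) t) (take (Suc k) x) @ drop (Suc k) t) @ post) @ x"
    proof -
      have k: "k < n" using Suc by simp
      have d: "drop k t = t ! k # drop (Suc k) t" using k assms by (simp add: Cons_nth_drop_Suc)
      have t: "take (Suc k) t = take k t @ [t ! k]" "take (Suc k) x = take k x @ [x ! k]"
        using k assms by (auto simp: take_Suc_conv_app_nth)
      have lw: "length ((pre @ (map2 (\<noteq>) (take k t) (take k x) @ drop k t) @ post)) = w" using assms k by auto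
      have n1: "((pre @ (map2 (\<noteq>) (take k t) (take k x) @ drop k t) @ post) @ x) ! (w + k) = x ! k"
        using lw by (metis nth_append_length_plus)
      have n2: "((pre @ (map2 (\<noteq>) (take k t) (take k x) @ drop k t) @ post) @ x) ! (p + k) = t ! k"
        using assms k by (simp add: nth_append d)
      show ?thesis
        unfolding gate_map.simps n1 n2 unfolding t d
        using assms k by (auto simp: list_update_append)
    qed
    finally show ?case .
  qed (simp add: xor_copy_def)
  from this[of n] show ?thesis using assms by simp
qed

subsection \<open>Recovering a string from a predictor of its inner products\<close>

lemma xor_same: "length t = length x \<Longrightarrow> map2 (\<noteq>) t x = replicate (length x) False \<longleftrightarrow> t = x"
  by (induction t x rule: list_induct2) auto

lemma xor_zero: "length x = n \<Longrightarrow> map2 (\<noteq>) (replicate n False) x = x"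
  by (induction x arbitrary: n) auto

lemma amplitude_phase:
  assumes E: "\<forall>g\<in>set gs. wf_gate w g" and a: "a \<in> bits w" "b \<in> bits w"
  shows "amplitude w (gs @ replicate 4 (TGate 0) @ inverse_gates gs) b a =
    (\<Sum>z\<in>bits w. cnj (amplitude w gs z b) * sign (z ! 0) * amplitude w gs z a)"
proof -
  have "amplitude w (gs @ replicate 4 (TGate 0) @ inverse_gates gs) b a =
    (\<Sum>z\<in>bits w. amplitude w (replicate 4 (TGate 0) @ inverse_gates gs) b z * amplitude w gs z a)"
    using a by (simp only: amplitude_append)
  also have "\<dots> = (\<Sum>z\<in>bits w. (cnj (amplitude w gs z b) * sign (z ! 0)) * amplitude w gs z a)"
  proof (intro sum.cong refl)
    fix z assume z: "z \<in> bits w"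
    have "amplitude w (replicate 4 (TGate 0) @ inverse_gates gs) b z =
      (\<Sum>u\<in>bits w. (cnj (amplitude w gs u b) * sign (z ! 0)) * of_bool (u = z))"
      unfolding amplitude_append[OF z]
    proof (intro sum.cong refl)
      fix u assume u: "u \<in> bits w"
      have "amplitude w (replicate 4 (TGate 0)) u z = of_bool (u = z) * sign (z ! 0)"
        by (simp only: amplitude_TGates[OF z]) (simp add: sign_def)
      then show "amplitude w (inverse_gates gs) b u * amplitude w (replicate 4 (TGate 0)) u z = cnj (amplitude w gs u b) * sign (z ! 0) * of_bool (u = z)"
        using amplitude_inverse_gates[OF E u a(2)] by simp
    qed
    also have "\<dots> = cnj (amplitude w gs z b) * sign (z ! 0)"
      using z by (simp only: sum_of_bool_pick finite_bits)
    finally show "amplitude w (replicate 4 (TGate 0) @ inverse_gates gs) b z * amplitude w gs z a =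
       (cnj (amplitude w gs z b) * sign (z ! 0)) * amplitude w gs z a" by simp
  qed
  finally show ?thesis .
qed

text \<open>
  The inverter runs the predictor \<open>E\<close> with \<open>r\<close> in uniform superposition and records the predicted bit
  as a phase: four \<open>\<pi>/8\<close> gates on the output wire, between \<open>E\<close> and its inverse, act as the \<open>Z\<close> gate.
  Another layer of Hadamard gates then yields \<open>v\<close>. As \<open>E\<close> acts on a copy of \<open>r\<close> made by controlled
  negations, it may treat these input wires arbitrarily.
\<close>

lemma goldreich_levin:
  assumes E: "wf_circ E" "nin E = yl + (m + 1) + t" "nout E = 1"
  shows "\<exists>A. wf_circ A \<and> nin A = yl + (m + 1 + t) \<and> nout A = m \<and> csize A \<le> 100 * csize E \<and>
    (\<forall>y\<in>bits yl. \<forall>v\<in>bits m. \<forall>\<tau>. density t \<tau> \<longrightarrow>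
      (let P = (\<lambda>r c. prob_out (run E (tensor (yl + (m + 1)) (basis (y @ r @ [c])) \<tau>)) [True]) in
       ((\<Sum>r\<in>bits m. P r (\<not> ip r v) - P r (ip r v)) / 2 ^ m)\<^sup>2
       \<le> prob_out (run A (tensor yl (basis y) (tensor (m + 1) (basis (replicate (m + 1) False)) \<tau>))) v))"
proof -
  define e w n gs where "e = nanc E" and "w = wires E" and "n = m + 1" and "gs = gates E"
  have wE: "w = yl + n + t + e" using E by (simp add: w_def wires_def e_def n_def)
  have gsw: "\<forall>g\<in>set gs. wf_gate w g" using E by (simp add: wf_circ_def gs_def w_def)
  obtain pm where pm: "length pm \<le> 3 * (0 + w + n + 0)" "\<forall>h\<in>set pm. wf_gate (0 + w + n + 0) h \<and> classical_gate h"
    "\<forall>u\<in>bits 0. \<forall>v\<in>bits w. \<forall>x\<in>bits n. \<forall>t\<in>bits 0. fold gate_map pm (u @ v @ x @ t) = u @ x @ v @ t"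
    using ex_block_swap_gates by blast
  define U where "U = gs @ replicate 4 (TGate 0) @ inverse_gates gs"
  define CN where "CN = xor_copy w yl n"
  define H where "H = hadamards w n"
  \<comment> \<open>The register of \<open>n = m + 1\<close> wires holds the mask \<open>r\<close>
    and the claimed inner product \<open>c\<close>. The negation makes the first Hadamard layer
    attach the sign (-1)^\<open>c\<close>, so contributions with right and wrong \<open>c\<close>
    enter with opposite signs. \<open>CN\<close> copies the register into the input of the predictor
    and later erases the copy; \<open>pm\<close> brings the register to the front.\<close>
  define G where "G = [NotG (w + m)] @ H @ CN @ U @ CN @ H @ pm"
  define A where "A = Circ (yl + (n + t)) (e + n) m G"
  have w0: "0 < w" using wE n_def by simp
  have CNw: "\<forall>g\<in>set CN. wf_gate (w + n) g \<and> classical_gate g"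
    using wE by (auto simp: CN_def xor_copy_def)
  have Uw: "\<forall>g\<in>set U. wf_gate w g" using gsw wf_inverse_gates[OF gsw] w0 by (auto simp: U_def)
  have wA: "wires A = w + n" by (simp add: A_def wires_def wE)
  have wf: "wf_circ A"
    unfolding wf_circ_def wA
  proof (intro conjI ballI)
    show "nout A \<le> w + n" by (simp add: A_def n_def)
    fix g assume "g \<in> set (gates A)"
    then consider "g = NotG (w + m)" | "g \<in> set H" | "g \<in> set CN" | "g \<in> set U" | "g \<in> set pm"
      by (auto simp: A_def G_def)
    then show "wf_gate (w + n) g"
    proof cases
      case 1 then show ?thesis by (simp add: n_def)
    next
      case 2 then show ?thesis by (auto simp: H_def hadamards_def)
    next
      case 3 then show ?thesis using CNw by auto
    next
      case 4 then show ?thesis using Uw by (auto intro: wf_gate_mono[of w])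
    next
      case 5 then show ?thesis using pm by simp
    qed
  qed
  let ?q = "complex_of_real (sqrt 2) ^ n"
  let ?Z = "replicate e False"
  let ?Y = "\<lambda>y q x. y @ q @ x @ ?Z"
  let ?amp = "\<lambda>y b q a. amplitude w U (?Y y q b) (?Y y q a)"
  have qq: "1 / (?q * ?q) = 1 / 2 ^ n"
  proof -
    have "complex_of_real (sqrt 2) * complex_of_real (sqrt 2) = 2"
      by (metis abs_numeral of_real_mult of_real_numeral real_sqrt_abs2 real_sqrt_mult)
    then show ?thesis by (simp flip: power_mult_distrib)
  qed
  \<comment> \<open>Amplitude of one favourable outcome: the register reads \<open>v\<close>
    followed by 0, and the copy and the ancillas of the predictor are back at zero. Only the advice
    may have moved, from \<open>a\<close> to \<open>b\<close>.\<close>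
  have core: "amplitude (w + n) G ((v @ [False]) @ ?Y y (replicate n False) b) (?Y y (replicate n False) a @ replicate n False)
     = (\<Sum>q\<in>bits n. sign (q ! m) * sign (ip (take m q) v) * ?amp y b q a) / 2 ^ n"
    if l: "y \<in> bits yl" "v \<in> bits m" "a \<in> bits t" "b \<in> bits t" for y v a b
  proof -
    define x1 where "x1 = replicate m False @ [True]"
    define x2 where "x2 = v @ [False]"
    let ?S = "\<lambda>q x. ?Y y q x"
    let ?O = "replicate n False"
    have lx: "length x1 = n" "length x2 = n" using l by (auto simp: x1_def x2_def n_def)
    have lS: "length (?S q x) = w" if "length q = n" "length x = t" for q x using that l wE by simp
    have "amplitude (w + n) G (x2 @ ?S ?O b) (?S ?O a @ ?O) = amplitude (w + n) (([NotG (w + m)] @ H @ CN @ U @ CN @ H) @ pm) (fold gate_map pm (?S ?O b @ x2)) (?S ?O a @ ?O)"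
      using pm(3)[rule_format, of "[]" "?S ?O b" x2 "[]"] lS[of ?O b] lx l by (simp add: G_def)
    also have "\<dots> = amplitude (w + n) ([NotG (w + m)] @ H @ CN @ U @ CN @ H) (?S ?O b @ x2) (?S ?O a @ ?O)"
      using pm(2) lS[of ?O b] lS[of ?O a] lx l by (intro amplitude_post) auto
    also have "\<dots> = amplitude (w + n) (H @ CN @ U @ CN @ H) (?S ?O b @ x2) (fold gate_map [NotG (w + m)] (?S ?O a @ ?O))"
      using lS[of ?O a] l by (intro amplitude_pre) auto
    also have "fold gate_map [NotG (w + m)] (?S ?O a @ ?O) = ?S ?O a @ x1"
    proof -
      have "length (?S ?O a) = w" using lS[of ?O a] l by simp
      moreover have "?O[m := True] = x1"
        by (simp add: x1_def n_def replicate_append_same[symmetric] list_update_append del: replicate_append_same)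
      moreover have "(?S ?O a @ ?O) ! (w + m) = False"
        using calculation(1) by (metis less_add_one n_def nth_append_length_plus nth_replicate)
      ultimately show ?thesis by (simp add: list_update_append del: append_assoc)
    qed
    also have "amplitude (w + n) (H @ CN @ U @ CN @ H) (?S ?O b @ x2) (?S ?O a @ x1) =
      (\<Sum>z\<in>bits (w + n). amplitude (w + n) (CN @ U @ CN @ H) (?S ?O b @ x2) z * amplitude (w + n) H z (?S ?O a @ x1))"
      using lS[of ?O a] lx l by (intro amplitude_append) auto
    also have "\<dots> = (\<Sum>s\<in>bits w. \<Sum>q\<in>bits n. of_bool (s = ?S ?O a) * (amplitude (w + n) (CN @ U @ CN @ H) (?S ?O b @ x2) (s @ q) * (sign (ip x1 q) / ?q)))"
      unfolding sum_bits_add H_def using lS[of ?O a] lx l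
      by (intro sum.cong refl) (subst amplitude_hadamards[OF _ _ _ ], simp_all)
    also have "\<dots> = (\<Sum>q\<in>bits n. amplitude (w + n) (CN @ U @ CN @ H) (?S ?O b @ x2) (?S ?O a @ q) * (sign (ip x1 q) / ?q))"
      using lS[of ?O a] l by (simp only: sum_of_bool_pick finite_bits bits_iff length_replicate flip: sum_distrib_left)
    also have "\<dots> = (\<Sum>q\<in>bits n. sign (ip q x2) / ?q * ?amp y b q a * (sign (ip x1 q) / ?q))"
    proof (intro sum.cong refl)
      fix q assume q: "q \<in> bits n"
      have cp: "fold gate_map CN (?S s x @ q) = ?S (map2 (\<noteq>) s q) x @ q" if "length s = n" "length x = t" for s x
        unfolding CN_def using fold_xor_copy[of y yl s n "x @ ?Z" w q] that l q wE by simp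
      have "amplitude (w + n) (CN @ U @ CN @ H) (?S ?O b @ x2) (?S ?O a @ q) = amplitude (w + n) (U @ CN @ H) (?S ?O b @ x2) (fold gate_map CN (?S ?O a @ q))"
        using CNw lS[of ?O a] l q by (intro amplitude_pre) auto
      also have "fold gate_map CN (?S ?O a @ q) = ?S q a @ q"
        using cp[of ?O a] l unfolding xor_zero[OF q[unfolded bits_iff]] by simp
      also have "amplitude (w + n) (U @ CN @ H) (?S ?O b @ x2) (?S q a @ q) =
        (\<Sum>z\<in>bits (w + n). amplitude (w + n) (CN @ H) (?S ?O b @ x2) z * amplitude (w + n) U z (?S q a @ q))"
        using lS[of q a] l q by (intro amplitude_append) auto
      also have "\<dots> = (\<Sum>s\<in>bits w. \<Sum>q'\<in>bits n. (amplitude (w + n) (CN @ H) (?S ?O b @ x2) (s @ q') * amplitude w U s (?S q a)) * of_bool (q' = q))"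
        unfolding sum_bits_add using lS[of q a] Uw l q by (intro sum.cong refl) (subst amplitude_first, simp_all)
      also have "\<dots> = (\<Sum>s\<in>bits w. amplitude (w + n) (CN @ H) (?S ?O b @ x2) (s @ q) * amplitude w U s (?S q a))"
        using q by (simp only: sum_of_bool_pick finite_bits)
      also have "\<dots> = (\<Sum>s\<in>bits w. of_bool (s = ?S q b) * (sign (ip q x2) / ?q * amplitude w U s (?S q a)))"
      proof (intro sum.cong refl)
        fix s assume s: "s \<in> bits w"
        have "w = yl + (n + (t + e))" using wE by simp
        then obtain s1 s2 s3 s4 where ss: "s = s1 @ s2 @ s3 @ s4" "length s1 = yl" "length s2 = n" "length s3 = t" "length s4 = e"
          using s split_bits by (metis bits_iff)
        have "amplitude (w + n) (CN @ H) (?S ?O b @ x2) (s @ q) = amplitude (w + n) H (?S ?O b @ x2) (fold gate_map CN (s @ q))"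
          using CNw s q by (intro amplitude_pre) auto
        also have "fold gate_map CN (s @ q) = (s1 @ map2 (\<noteq>) s2 q @ s3 @ s4) @ q"
          unfolding CN_def using fold_xor_copy[of s1 yl s2 n "s3 @ s4" w q] ss s q by simp
        also have "amplitude (w + n) H (?S ?O b @ x2) \<dots> = of_bool (?S ?O b = s1 @ map2 (\<noteq>) s2 q @ s3 @ s4) * sign (ip q x2) / ?q"
          unfolding H_def using lS[of ?O b] ss s q l lx by (intro amplitude_hadamards) auto
        also have "?S ?O b = s1 @ map2 (\<noteq>) s2 q @ s3 @ s4 \<longleftrightarrow> s = ?S q b"
          using ss l q xor_same[of s2 q] by auto
        finally show "amplitude (w + n) (CN @ H) (?S ?O b @ x2) (s @ q) * amplitude w U s (?S q a) =
          of_bool (s = ?S q b) * (sign (ip q x2) / ?q * amplitude w U s (?S q a))" by simp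
      qed
      also have "\<dots> = sign (ip q x2) / ?q * ?amp y b q a"
        using lS[of q b] l q by (simp only: sum_of_bool_pick finite_bits bits_iff)
      finally show "amplitude (w + n) (CN @ U @ CN @ H) (?S ?O b @ x2) (?S ?O a @ q) * (sign (ip x1 q) / ?q) =
        sign (ip q x2) / ?q * ?amp y b q a * (sign (ip x1 q) / ?q)" by simp
    qed
    also have "\<dots> = (\<Sum>q\<in>bits n. (sign (q ! m) * sign (ip (take m q) v) * ?amp y b q a) * (1 / (?q * ?q)))"
    proof (intro sum.cong refl)
      fix q assume q: "q \<in> bits n"
      then have qs: "q = take m q @ [q ! m]" unfolding n_def by (simp add: take_Suc_conv_app_nth[symmetric])
      have "ip (take m q @ [q ! m]) x2 = ip (take m q) v"
        unfolding x2_def using l q n_def by (subst ip_append) auto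
      then have 1: "ip q x2 = ip (take m q) v" using qs by simp
      have "ip x1 (take m q @ [q ! m]) = q ! m"
        unfolding x1_def using q n_def by (subst ip_append) (auto simp: ip_zero)
      then have 2: "ip x1 q = q ! m" using qs by simp
      show "sign (ip q x2) / ?q * ?amp y b q a * (sign (ip x1 q) / ?q) = (sign (q ! m) * sign (ip (take m q) v) * ?amp y b q a) * (1 / (?q * ?q))"
        unfolding 1 2 by simp
    qed
    also have "\<dots> = (\<Sum>q\<in>bits n. sign (q ! m) * sign (ip (take m q) v) * ?amp y b q a) / 2 ^ n"
      unfolding qq by (simp add: sum_divide_distrib)
    finally show ?thesis by (simp add: x2_def)
  qed
  have main: "((\<Sum>r\<in>bits m. prob_out (run E (tensor (yl + (m + 1)) (basis (y @ r @ [\<not> ip r v])) \<tau>)) [True]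
        - prob_out (run E (tensor (yl + (m + 1)) (basis (y @ r @ [ip r v])) \<tau>)) [True]) / 2 ^ m)\<^sup>2
       \<le> prob_out (run A (tensor yl (basis y) (tensor (m + 1) (basis (replicate (m + 1) False)) \<tau>))) v"
    if l: "y \<in> bits yl" "v \<in> bits m" and dens: "density t \<tau>" for y v \<tau>
  proof -
    let ?O = "replicate n False"
    let ?P = "\<lambda>q c. prob_out (run E (tensor (yl + (m + 1)) (basis (y @ q)) \<tau>)) [c]"
    define X where "X b a = amplitude (w + n) G (v @ ([False] @ ?Y y ?O b)) (?Y y ?O a @ ?O)" for b a
    let ?B = "\<lambda>tt a. amplitude (w + n) G (v @ tt) (?Y y ?O a @ ?O)"
    let ?g = "\<lambda>tt. \<Sum>a\<in>bits t. \<Sum>a'\<in>bits t. ?B tt a * \<tau> a a' * cnj (?B tt a')"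
    have pick3: "(\<Sum>x\<in>bits (yl + (n + t)). (tensor yl (basis y) (tensor n (basis ?O) \<tau>)) x x' * f x) =
       (\<Sum>a\<in>bits t. tensor yl (basis y) (tensor n (basis ?O) \<tau>) (y @ ?O @ a) x' * f (y @ ?O @ a))" for f :: "bool list \<Rightarrow> complex" and x'
    proof -
      let ?R = "tensor yl (basis y) (tensor n (basis ?O) \<tau>)"
      have "(\<Sum>x\<in>bits (yl + (n + t)). ?R x x' * f x) =
        (\<Sum>u\<in>bits yl. \<Sum>s\<in>bits n. \<Sum>a\<in>bits t. of_bool (u = y) * (of_bool (s = ?O) * (?R (u @ s @ a) x' * f (u @ s @ a))))"
        unfolding sum_bits_add by (intro sum.cong refl) (auto simp: tensor_def basis_def)
      also have "\<dots> = (\<Sum>a\<in>bits t. ?R (y @ ?O @ a) x' * f (y @ ?O @ a))"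
        using l by (simp only: sum_of_bool_pick finite_bits bits_iff length_replicate flip: sum_distrib_left)
      finally show ?thesis .
    qed
    have pick3': "(\<Sum>x\<in>bits (yl + (n + t)). (tensor yl (basis y) (tensor n (basis ?O) \<tau>)) x' x * f x) =
       (\<Sum>a\<in>bits t. tensor yl (basis y) (tensor n (basis ?O) \<tau>) x' (y @ ?O @ a) * f (y @ ?O @ a))" for f :: "bool list \<Rightarrow> complex" and x'
    proof -
      let ?R = "tensor yl (basis y) (tensor n (basis ?O) \<tau>)"
      have "(\<Sum>x\<in>bits (yl + (n + t)). ?R x' x * f x) =
        (\<Sum>u\<in>bits yl. \<Sum>s\<in>bits n. \<Sum>a\<in>bits t. of_bool (u = y) * (of_bool (s = ?O) * (?R x' (u @ s @ a) * f (u @ s @ a))))"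
        unfolding sum_bits_add by (intro sum.cong refl) (auto simp: tensor_def basis_def)
      also have "\<dots> = (\<Sum>a\<in>bits t. ?R x' (y @ ?O @ a) * f (y @ ?O @ a))"
        using l by (simp only: sum_of_bool_pick finite_bits bits_iff length_replicate flip: sum_distrib_left)
      finally show ?thesis .
    qed
    have runA: "run A (tensor yl (basis y) (tensor n (basis ?O) \<tau>)) v v = (\<Sum>tt\<in>bits (w + n - m). ?g tt)"
    proof -
      let ?R = "tensor yl (basis y) (tensor n (basis ?O) \<tau>)"
      let ?C = "\<lambda>tt x. amplitude (w + n) G (v @ tt) (x @ replicate (e + n) False)"
      have nA: "nin A = yl + (n + t)" "nanc A = e + n" "nout A = m" "gates A = G" by (auto simp: A_def)
      have "run A ?R v v = (\<Sum>tt\<in>bits (w + n - m). \<Sum>x\<in>bits (yl + (n + t)). \<Sum>x'\<in>bits (yl + (n + t)). ?C tt x * ?R x x' * cnj (?C tt x'))"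
        unfolding run_def wA nA ..
      also have "\<dots> = (\<Sum>tt\<in>bits (w + n - m). \<Sum>x\<in>bits (yl + (n + t)). \<Sum>x'\<in>bits (yl + (n + t)). ?R x x' * (?C tt x * cnj (?C tt x')))"
        by (simp only: mult_ac)
      also have "\<dots> = (\<Sum>tt\<in>bits (w + n - m). \<Sum>x\<in>bits (yl + (n + t)). \<Sum>a'\<in>bits t. ?R x (y @ ?O @ a') * (?C tt x * cnj (?C tt (y @ ?O @ a'))))"
        by (simp only: pick3')
      also have "\<dots> = (\<Sum>tt\<in>bits (w + n - m). \<Sum>a'\<in>bits t. \<Sum>x\<in>bits (yl + (n + t)). ?R x (y @ ?O @ a') * (?C tt x * cnj (?C tt (y @ ?O @ a'))))"
        by (intro sum.cong refl sum.swap)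
      also have "\<dots> = (\<Sum>tt\<in>bits (w + n - m). \<Sum>a'\<in>bits t. \<Sum>a\<in>bits t. ?R (y @ ?O @ a) (y @ ?O @ a') * (?C tt (y @ ?O @ a) * cnj (?C tt (y @ ?O @ a'))))"
        by (simp only: pick3)
      also have "\<dots> = (\<Sum>tt\<in>bits (w + n - m). \<Sum>a'\<in>bits t. \<Sum>a\<in>bits t. ?B tt a * \<tau> a a' * cnj (?B tt a'))"
        using l by (intro sum.cong refl) (simp add: basis_def replicate_add)
      also have "\<dots> = (\<Sum>tt\<in>bits (w + n - m). ?g tt)"
        by (intro sum.cong refl sum.swap)
      finally show ?thesis .
    qed
    have g0: "?g tt \<in> \<real>\<^sub>\<ge>\<^sub>0" for tt
    proof -
      have "psd t \<tau>" using dens by (simp add: density_iff)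
      from psd_form[OF this, of "\<lambda>a. cnj (?B tt a)"] show ?thesis by simp
    qed
    \<comment> \<open>All other values of the discarded wires contribute nonnegatively, so dropping
      them leaves a lower bound.\<close>
    let ?J = "(\<lambda>b. [False] @ ?Y y ?O b) ` bits t"
    have "(\<Sum>b\<in>bits t. Re (?g ([False] @ ?Y y ?O b))) = (\<Sum>tt\<in>?J. Re (?g tt))"
      by (subst sum.reindex) (auto simp: inj_on_def)
    also have "\<dots> \<le> (\<Sum>tt\<in>bits (w + n - m). Re (?g tt))"
    proof (rule sum_mono2)
      show "?J \<subseteq> bits (w + n - m)" using l wE n_def by auto
      show "\<And>tt. tt \<in> bits (w + n - m) - ?J \<Longrightarrow> 0 \<le> Re (?g tt)"
        using g0 complex_nonneg_Reals_iff by blast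
    qed simp
    also have "\<dots> = prob_out (run A (tensor yl (basis y) (tensor n (basis ?O) \<tau>))) v"
      unfolding prob_out_def runA by simp
    finally have ge: "Re (\<Sum>b\<in>bits t. \<Sum>a\<in>bits t. \<Sum>a'\<in>bits t. X b a * \<tau> a a' * cnj (X b a')) \<le> prob_out (run A (tensor yl (basis y) (tensor n (basis ?O) \<tau>))) v"
      unfolding X_def by simp
    \<comment> \<open>The kept probability is the trace of \<open>X\<close> \<tau>
      \<open>X\<close>*, which is at least the squared modulus of \<mu>. It remains to recognise
      \<mu> as the average advantage of the predictor.\<close>
    define \<mu> where "\<mu> = (\<Sum>b\<in>bits t. \<Sum>a\<in>bits t. X b a * \<tau> a b)"
    have cs: "(norm \<mu>)\<^sup>2 \<le> prob_out (run A (tensor yl (basis y) (tensor n (basis ?O) \<tau>))) v"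
      using density_cauchy_schwarz[OF dens, of X] ge unfolding \<mu>_def by linarith
    \<comment> \<open>Undoing the predictor after a \<open>Z\<close> gate on its output leaves, in
      expectation over \<tau>, the probability of output 0 minus that of output 1.\<close>
    have tr: "(\<Sum>b\<in>bits t. \<Sum>a\<in>bits t. ?amp y b q a * \<tau> a b) = of_real (?P q False - ?P q True)"
      if q: "q \<in> bits n" for q
    proof -
      let ?E = "\<lambda>z a. amplitude w gs z (?Y y q a)"
      have "(\<Sum>b\<in>bits t. \<Sum>a\<in>bits t. ?amp y b q a * \<tau> a b) =
         (\<Sum>b\<in>bits t. \<Sum>a\<in>bits t. \<Sum>z\<in>bits w. sign (z ! 0) * (?E z a * \<tau> a b * cnj (?E z b)))"
        unfolding U_def using l q wE gsw
        by (intro sum.cong refl) (subst amplitude_phase, auto simp: sum_distrib_left sum_distrib_right mult_ac)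
      also have "\<dots> = (\<Sum>(b,a,z)\<in>bits t \<times> bits t \<times> bits w. sign (z ! 0) * (?E z a * \<tau> a b * cnj (?E z b)))"
        by (simp add: sum.cartesian_product)
      also have "\<dots> = (\<Sum>(z,a,b)\<in>bits w \<times> bits t \<times> bits t. sign (z ! 0) * (?E z a * \<tau> a b * cnj (?E z b)))"
        by (rule sum.reindex_bij_witness[where i = "\<lambda>(z,a,b). (b,a,z)" and j = "\<lambda>(b,a,z). (z,a,b)"]) auto
      also have "\<dots> = (\<Sum>z\<in>bits w. sign (z ! 0) * (\<Sum>a\<in>bits t. \<Sum>b\<in>bits t. ?E z a * \<tau> a b * cnj (?E z b)))"
        unfolding sum_distrib_left by (simp add: sum.cartesian_product)
      also have "\<dots> = (\<Sum>z\<in>bits (1 + (w - 1)). sign (z ! 0) * (\<Sum>a\<in>bits t. \<Sum>b\<in>bits t. ?E z a * \<tau> a b * cnj (?E z b)))"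
        using w0 by simp
      also have "\<dots> = (\<Sum>c\<in>bits 1. sign (c ! 0) * (\<Sum>tt\<in>bits (w - 1). \<Sum>a\<in>bits t. \<Sum>b\<in>bits t. ?E (c @ tt) a * \<tau> a b * cnj (?E (c @ tt) b)))"
        unfolding sum_bits_add sum_distrib_left by (intro sum.cong refl) (auto simp: nth_append)
      also have "\<dots> = (\<Sum>c\<in>bits 1. sign (c ! 0) * run E (tensor (yl + n) (basis (y @ q)) \<tau>) c c)"
      proof (intro sum.cong refl arg_cong2[of _ _ _ _ "(*)"])
        fix c :: "bool list"
        have nE: "nin E = yl + n + t" "nanc E = e" "nout E = 1" "gates E = gs" "wires E = w"
          using E by (auto simp: e_def gs_def n_def w_def)
        have "run E (tensor (yl + n) (basis (y @ q)) \<tau>) c c = (\<Sum>tt\<in>bits (w - 1).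
           \<Sum>u\<in>bits (yl + n). \<Sum>a\<in>bits t. \<Sum>u'\<in>bits (yl + n). \<Sum>b\<in>bits t.
             of_bool (u = y @ q) * (of_bool (u' = y @ q) * (amplitude w gs (c @ tt) ((u @ a) @ ?Z) * \<tau> a b * cnj (amplitude w gs (c @ tt) ((u' @ b) @ ?Z)))))"
          unfolding run_def nE sum_bits_add[of _ "yl + n"] by (intro sum.cong refl) (auto simp: basis_def)
        also have "\<dots> = (\<Sum>tt\<in>bits (w - 1). \<Sum>a\<in>bits t. \<Sum>b\<in>bits t. amplitude w gs (c @ tt) (((y @ q) @ a) @ ?Z) * \<tau> a b * cnj (amplitude w gs (c @ tt) (((y @ q) @ b) @ ?Z)))"
          using l q by (simp only: sum_of_bool_pick finite_bits bits_iff length_append flip: sum_distrib_left)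
        finally show "(\<Sum>tt\<in>bits (w - 1). \<Sum>a\<in>bits t. \<Sum>b\<in>bits t. ?E (c @ tt) a * \<tau> a b * cnj (?E (c @ tt) b)) = run E (tensor (yl + n) (basis (y @ q)) \<tau>) c c"
          by simp
      qed
      also have "\<dots> = of_real (?P q False - ?P q True)"
      proof -
        have "psd 1 (run E (tensor (yl + n) (basis (y @ q)) \<tau>))"
        proof -
          have "density (yl + n + t) (tensor (yl + n) (basis (y @ q)) \<tau>)"
            using density_tensor_basis[OF dens, of "y @ q"] l q by simp
          then show ?thesis using run_psd[OF E(1)] E unfolding density_iff by (simp add: n_def)
        qed
        then have "run E (tensor (yl + n) (basis (y @ q)) \<tau>) [c] [c] = of_real (?P q c)" for c
          using psd_diag[of 1 _ "[c]"] unfolding prob_out_def n_def by (fastforce simp: complex_nonneg_Reals_iff complex_eq_iff)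
        then show ?thesis by (simp add: sum_bits_1 sign_def)
      qed
      finally show ?thesis .
    qed
    have P1: "?P q False = 1 - ?P q True" if q: "q \<in> bits n" for q
    proof -
      have "density (yl + n + t) (tensor (yl + n) (basis (y @ q)) \<tau>)"
        using density_tensor_basis[OF dens, of "y @ q"] l q by simp
      then have "density 1 (run E (tensor (yl + n) (basis (y @ q)) \<tau>))" using run_density[OF E(1)] E by (simp add: n_def)
      then have "(\<Sum>c\<in>bits 1. prob_out (run E (tensor (yl + n) (basis (y @ q)) \<tau>)) c) = 1"
        unfolding sum_prob_out by (simp add: density_iff)
      then show ?thesis by (simp add: sum_bits_1 n_def)
    qed
    have "\<mu> = (\<Sum>b\<in>bits t. \<Sum>a\<in>bits t. (\<Sum>q\<in>bits n. sign (q ! m) * sign (ip (take m q) v) * ?amp y b q a) / 2 ^ n * \<tau> a b)"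
      unfolding \<mu>_def X_def using core[of y v] l by (intro sum.cong refl) simp
    also have "\<dots> = (\<Sum>b\<in>bits t. \<Sum>a\<in>bits t. \<Sum>q\<in>bits n. sign (q ! m) * sign (ip (take m q) v) / 2 ^ n * (?amp y b q a * \<tau> a b))"
      by (simp add: sum_divide_distrib sum_distrib_right mult.assoc)
    also have "\<dots> = (\<Sum>(b,a,q)\<in>bits t \<times> bits t \<times> bits n. sign (q ! m) * sign (ip (take m q) v) / 2 ^ n * (?amp y b q a * \<tau> a b))"
      by (simp add: sum.cartesian_product)
    also have "\<dots> = (\<Sum>(q,b,a)\<in>bits n \<times> bits t \<times> bits t. sign (q ! m) * sign (ip (take m q) v) / 2 ^ n * (?amp y b q a * \<tau> a b))"
      by (rule sum.reindex_bij_witness[where i = "\<lambda>(q,b,a). (b,a,q)" and j = "\<lambda>(b,a,q). (q,b,a)"]) auto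
    also have "\<dots> = (\<Sum>q\<in>bits n. sign (q ! m) * sign (ip (take m q) v) / 2 ^ n * (\<Sum>b\<in>bits t. \<Sum>a\<in>bits t. ?amp y b q a * \<tau> a b))"
      unfolding sum_distrib_left by (simp add: sum.cartesian_product)
    also have "\<dots> = (\<Sum>q\<in>bits n. sign (q ! m) * sign (ip (take m q) v) / 2 ^ n * of_real (1 - 2 * ?P q True))"
    proof (intro sum.cong refl arg_cong2[of _ _ _ _ "(*)"])
      fix q assume q: "q \<in> bits n"
      show "(\<Sum>b\<in>bits t. \<Sum>a\<in>bits t. ?amp y b q a * \<tau> a b) = of_real (1 - 2 * ?P q True)"
        unfolding tr[OF q] P1[OF q] by simp
    qed
    \<comment> \<open>The sum over \<open>c\<close> cancels the constant 1 and leaves twice the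
      difference between wrong and right claim, so the normalisation \<open>2 ^ n\<close> turns into
      \<open>2 ^ m\<close>.\<close>
    also have "\<dots> = (\<Sum>r\<in>bits m. \<Sum>c\<in>bits 1. sign (c ! 0) * sign (ip r v) / 2 ^ n * of_real (1 - 2 * ?P (r @ c) True))"
      unfolding n_def sum_bits_add by (intro sum.cong refl) (simp add: nth_append)
    also have "\<dots> = (\<Sum>r\<in>bits m. of_real (2 * (?P (r @ [\<not> ip r v]) True - ?P (r @ [ip r v]) True) / 2 ^ n))"
      unfolding One_nat_def sum_bits_1
      by (intro sum.cong refl) (auto simp: sign_def field_simps)
    also have "\<dots> = of_real (\<Sum>r\<in>bits m. 2 * (?P (r @ [\<not> ip r v]) True - ?P (r @ [ip r v]) True) / 2 ^ n)"
      by simp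
    also have "(\<Sum>r\<in>bits m. 2 * (?P (r @ [\<not> ip r v]) True - ?P (r @ [ip r v]) True) / 2 ^ n) =
       (\<Sum>r\<in>bits m. ?P (r @ [\<not> ip r v]) True - ?P (r @ [ip r v]) True) / 2 ^ m"
      unfolding sum_divide_distrib by (intro sum.cong refl) (simp add: n_def field_simps)
    finally have "(norm \<mu>)\<^sup>2 = ((\<Sum>r\<in>bits m. ?P (r @ [\<not> ip r v]) True - ?P (r @ [ip r v]) True) / 2 ^ m)\<^sup>2"
      by (simp only: norm_of_real power2_abs)
    with cs show ?thesis by (simp add: n_def)
  qed
  have "csize A \<le> 100 * csize E"
  proof -
    have "length U \<le> 8 * length gs + 4" using length_inverse_gates[of gs] by (simp add: U_def)
    then have "length G \<le> 1 + 2 * n + 2 * n + (8 * length gs + 4) + 3 * (w + n)"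
      using pm(1) by (simp add: G_def H_def hadamards_def CN_def xor_copy_def)
    moreover have "csize E = yl + n + t + e + 1 + length gs" using E by (simp add: csize_def e_def gs_def n_def)
    moreover have "csize A = yl + (n + t) + (e + n) + m + length G" by (simp add: csize_def A_def)
    ultimately show ?thesis using wE n_def by simp
  qed
  then show ?thesis
    using wf main unfolding Let_def by (intro exI[of _ A]) (simp add: A_def n_def)
qed

section \<open>Polynomial and negligible functions\<close>

text \<open>The right-hand form is visibly closed under sums and products, unlike
  \<open>n ^ k + k\<close>.\<close>

lemma poly_bounded_iff: "poly_bounded p \<longleftrightarrow> (\<exists>c k. \<forall>n. p n \<le> c * (n + 1) ^ k)"
proof
  assume "poly_bounded p"
  then obtain k where k: "\<And>n. p n \<le> n ^ k + k" unfolding poly_bounded_def by blast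
  have "p n \<le> (k + 1) * (n + 1) ^ k" for n
  proof -
    have "n ^ k \<le> (n + 1) ^ k" by (intro power_mono) auto
    moreover have "k * 1 \<le> k * (n + 1) ^ k" by (intro mult_le_mono2) simp
    ultimately show ?thesis using k[of n] unfolding distrib_right by linarith
  qed
  then show "\<exists>c k. \<forall>n. p n \<le> c * (n + 1) ^ k" by blast
next
  assume "\<exists>c k. \<forall>n. p n \<le> c * (n + 1) ^ k"
  then obtain c k where ck: "\<And>n. p n \<le> c * (n + 1) ^ k" by blast
  \<comment> \<open>For \<open>n\<close> at least 2, \<open>c\<close> is at most
    \<open>n ^ c\<close> and \<open>n + 1\<close> at most the square of \<open>n\<close>, giving the
    exponent \<open>c + 2 * k\<close>; for smaller \<open>n\<close> the summand
    \<open>c * 2 ^ k\<close> already suffices.\<close>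
  define K where "K = c * 2 ^ k + c + 2 * k"
  have "c * (n + 1) ^ k \<le> n ^ K + K" for n
  proof (cases "n \<ge> 2")
    case True
    have "c \<le> n ^ c"
      using True by (metis less_exp order.trans power_mono less_imp_le zero_le_numeral)
    moreover have "n + 1 \<le> n ^ 2"
    proof -
      have "n + 1 \<le> 2 * n" using True by simp
      also have "\<dots> \<le> n * n" using True by (intro mult_le_mono1)
      finally show ?thesis by (simp add: power2_eq_square)
    qed
    then have "(n + 1) ^ k \<le> n ^ (2 * k)" by (metis power_mono power_mult zero_le)
    ultimately have "c * (n + 1) ^ k \<le> n ^ c * n ^ (2 * k)" by (rule mult_le_mono)
    also have "\<dots> \<le> n ^ K" unfolding power_add[symmetric] K_def using True by (intro power_increasing) auto
    finally show ?thesis by simp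
  next
    case False
    then have "n + 1 \<le> 2" by simp
    then have "(n + 1) ^ k \<le> 2 ^ k" by (intro power_mono) auto
    then have "c * (n + 1) ^ k \<le> c * 2 ^ k" by (rule mult_le_mono2)
    then show ?thesis unfolding K_def by linarith
  qed
  then show "poly_bounded p" unfolding poly_bounded_def using ck le_trans by blast
qed

lemma poly_bounded_mono: "poly_bounded q \<Longrightarrow> (\<And>n. p n \<le> q n) \<Longrightarrow> poly_bounded p"
  unfolding poly_bounded_def using le_trans by blast

lemma poly_bounded_const: "poly_bounded (\<lambda>_. c)"
  unfolding poly_bounded_iff by (intro exI[of _ c] exI[of _ 0]) auto

lemma poly_bounded_id: "poly_bounded (\<lambda>n. n)"
  unfolding poly_bounded_iff by (intro exI[of _ 1] exI[of _ 1]) auto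

lemma poly_bounded_add:
  assumes "poly_bounded p" "poly_bounded q"
  shows "poly_bounded (\<lambda>n. p n + q n)"
proof -
  obtain c k d j where *: "\<And>n. p n \<le> c * (n + 1) ^ k" "\<And>n. q n \<le> d * (n + 1) ^ j"
    using assms unfolding poly_bounded_iff by blast
  have "p n + q n \<le> (c + d) * (n + 1) ^ (k + j)" for n
  proof -
    have "(n + 1) ^ k \<le> (n + 1) ^ (k + j)" "(n + 1) ^ j \<le> (n + 1) ^ (k + j)" by (auto intro!: power_increasing)
    then have "c * (n + 1) ^ k + d * (n + 1) ^ j \<le> c * (n + 1) ^ (k + j) + d * (n + 1) ^ (k + j)"
      by (intro add_mono mult_le_mono2)
    moreover have "p n + q n \<le> c * (n + 1) ^ k + d * (n + 1) ^ j" using * by (intro add_mono)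
    ultimately show ?thesis by (simp only: distrib_right)
  qed
  then show ?thesis unfolding poly_bounded_iff by blast
qed

lemma poly_bounded_mult:
  assumes "poly_bounded p" "poly_bounded q"
  shows "poly_bounded (\<lambda>n. p n * q n)"
proof -
  obtain c k d j where *: "\<And>n. p n \<le> c * (n + 1) ^ k" "\<And>n. q n \<le> d * (n + 1) ^ j"
    using assms unfolding poly_bounded_iff by blast
  have "p n * q n \<le> (c * d) * (n + 1) ^ (k + j)" for n
    using mult_le_mono[OF *, of n n] by (simp only: power_add mult_ac)
  then show ?thesis unfolding poly_bounded_iff by blast
qed

lemma poly_bounded_power: "poly_bounded p \<Longrightarrow> poly_bounded (\<lambda>n. p n ^ k)"
  by (induction k) (auto intro: poly_bounded_const poly_bounded_mult)

lemma poly_bounded_compose: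
  assumes "poly_bounded p" "poly_bounded q"
  shows "poly_bounded (\<lambda>n. p (q n))"
proof -
  obtain k where k: "\<And>n. p n \<le> n ^ k + k" using assms unfolding poly_bounded_def by blast
  have "poly_bounded (\<lambda>n. q n ^ k + k)"
    using assms by (intro poly_bounded_add poly_bounded_power poly_bounded_const)
  then show ?thesis by (rule poly_bounded_mono) (rule k)
qed

lemmas poly_bounded_intros =
  poly_bounded_const poly_bounded_id poly_bounded_add poly_bounded_mult poly_bounded_power

lemma poly_bounded_pad_size: "poly_bounded (pad_size k)"
  unfolding pad_size_def by (intro poly_bounded_intros)

lemma pad_size_mono:
  assumes "1 \<le> j" "j \<le> k"
  shows "pad_size j n \<le> pad_size k n"
proof (cases "n = 0")
  case True
  with assms show ?thesis by (simp add: pad_size_def power_0_left)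
next
  case False
  then have "n ^ j \<le> n ^ k" using assms by (intro power_increasing) auto
  with assms show ?thesis by (simp add: pad_size_def)
qed

lemma poly_bounded_pad_size_ge:
  assumes "poly_bounded p"
  shows "\<exists>k0. \<forall>k\<ge>k0. \<forall>n. p n \<le> pad_size k n"
proof -
  obtain j where j: "\<And>n. p n \<le> n ^ j + j" using assms unfolding poly_bounded_def by blast
  have "n ^ j + j \<le> pad_size (j + 1) n" for n
  proof (cases "n = 0")
    case False
    then have "n ^ j \<le> n ^ (j + 1)" by (intro power_increasing) auto
    then show ?thesis unfolding pad_size_def by linarith
  qed (simp add: pad_size_def power_0_left)
  then have "p n \<le> pad_size k n" if "k \<ge> j + 1" for k n
    using that j pad_size_mono[of "j + 1" k n] by (meson le_add2 le_trans)
  then show ?thesis by blast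
qed

section \<open>Integer roots of the security parameter\<close>

lemma Suc_le_nth_root_nat: "0 < d \<Longrightarrow> n + 1 \<le> (nth_root_nat d n + 1) ^ d"
  using nth_root_nat_ge[of d "nth_root_nat d n + 1" n] by (metis Suc_eq_plus1 Suc_n_not_le_n not_less_eq_eq)

lemma eventually_root_nat:
  assumes "0 < d" "\<forall>\<^sub>F m in sequentially. P m"
  shows "\<forall>\<^sub>F n in sequentially. P (nth_root_nat d n)"
proof -
  obtain N where N: "\<And>m. m \<ge> N \<Longrightarrow> P m" using assms(2) unfolding eventually_sequentially by blast
  have "P (nth_root_nat d n)" if "n \<ge> N ^ d" for n
    using nth_root_nat_ge[OF assms(1) that] N by blast
  then show ?thesis unfolding eventually_sequentially by blast
qed

text \<open>With \<open>m\<close> the root, \<open>n\<close> is below (\<open>m\<close> +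
  1)^\<open>d\<close>, and \<open>m\<close> + 1 is at most the square of \<open>m\<close> once
  \<open>m\<close> is at least 2. The factor \<open>2 * d\<close> in the exponent thus pays for both
  root and rounding.\<close>

lemma root_nat_inverse_power:
  assumes "0 < d" "2 \<le> nth_root_nat d n"
  shows "1 / real (nth_root_nat d n) ^ (2 * d * c) \<le> 1 / real n ^ c"
proof -
  let ?m = "nth_root_nat d n"
  have "?m + 1 \<le> ?m ^ 2"
  proof -
    have "?m + 1 \<le> 2 * ?m" using assms by simp
    also have "\<dots> \<le> ?m * ?m" using assms by (intro mult_le_mono1)
    finally show ?thesis by (simp add: power2_eq_square)
  qed
  then have "(?m + 1) ^ d \<le> ?m ^ (2 * d)" by (metis power_mono power_mult zero_le)
  then have "n \<le> ?m ^ (2 * d)" using Suc_le_nth_root_nat[OF assms(1), of n] by linarith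
  then have "n ^ c \<le> ?m ^ (2 * d * c)" by (metis power_mono power_mult zero_le)
  then have le: "real n ^ c \<le> real ?m ^ (2 * d * c)" by (metis of_nat_le_iff of_nat_power)
  have "n > 0"
  proof (rule ccontr)
    assume "\<not> n > 0"
    then show False using nth_root_nat_power_le[OF assms(1), of n] assms by simp
  qed
  then show ?thesis using le assms(2) by (intro divide_left_mono) auto
qed

lemma negligible_root_nat:
  assumes "0 < d" "negligible \<epsilon>"
  shows "negligible (\<lambda>n. \<epsilon> (nth_root_nat d n))"
  unfolding negligible_def
proof
  fix c
  have "\<forall>\<^sub>F m in sequentially. \<bar>\<epsilon> m\<bar> \<le> 1 / real m ^ (2 * d * c) \<and> 2 \<le> m"
    using assms(2) eventually_ge_at_top[of 2] unfolding negligible_def by (intro eventually_conj) auto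
  from eventually_root_nat[OF assms(1) this]
  show "\<forall>\<^sub>F n in sequentially. \<bar>\<epsilon> (nth_root_nat d n)\<bar> \<le> 1 / real n ^ c"
    by eventually_elim (use root_nat_inverse_power[OF assms(1)] in \<open>force intro: order.trans\<close>)
qed

section \<open>Concrete forms of the security assumptions\<close>

text \<open>
  Since adversaries are non-uniform, an asymptotic security statement bounds, at almost every
  security parameter, all adversaries of polynomial size simultaneously: otherwise violating
  adversaries at infinitely many parameters could be assembled to a family.
\<close>

lemma efficient_size:
  assumes "efficient d F" "\<And>n. length (ns n) = d" "\<And>i. i < d \<Longrightarrow> poly_bounded (\<lambda>n. ns n ! i)"
  shows "poly_bounded (\<lambda>n. csize (F (ns n)))"
proof -
  obtain k where k: "\<And>ns. length ns = d \<Longrightarrow> csize (F ns) \<le> sum_list ns ^ k + k"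
    using assms(1) unfolding efficient_def by blast
  have "poly_bounded (\<lambda>n. \<Sum>i<j. ns n ! i)" if "j \<le> d" for j
    using that
  proof (induction j)
    case (Suc j)
    then show ?case using assms(3)[of j] by (auto intro: poly_bounded_intros)
  qed (auto intro: poly_bounded_intros)
  from this[of d] have "poly_bounded (\<lambda>n. sum_list (ns n))"
    using assms(2) by (simp add: sum_list_sum_nth atLeast0LessThan)
  then have "poly_bounded (\<lambda>n. sum_list (ns n) ^ k + k)" by (intro poly_bounded_intros)
  then show ?thesis by (rule poly_bounded_mono) (use k assms(2) in auto)
qed

lemma efficient_wf: "efficient d F \<Longrightarrow> length ns = d \<Longrightarrow> wf_circ (F ns)"
  unfolding efficient_def by blast

lemma efficient1_size: "efficient1 F \<Longrightarrow> poly_bounded (\<lambda>n. csize (F n))"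
  unfolding efficient1_def
  using efficient_size[of 1 "\<lambda>ns. F (hd ns)" "\<lambda>n. [n]"] by (auto intro: poly_bounded_intros)

lemma efficient1_wf: "efficient1 F \<Longrightarrow> wf_circ (F n)"
  unfolding efficient1_def using efficient_wf[of 1 "\<lambda>ns. F (hd ns)" "[n]"] by simp

lemma csize_ge: "nin C \<le> csize C" "nanc C \<le> csize C" "nout C \<le> csize C" "length (gates C) \<le> csize C"
  by (auto simp: csize_def)

text \<open>At each \<open>m\<close> the family takes a counterexample to \<open>P\<close> if there
  is one and an arbitrary admissible object otherwise, which is why admissible objects must exist
  everywhere. Where \<open>P\<close> holds for the chosen object, it holds for all.\<close>

lemma eventually_all_choice:
  assumes ex: "\<And>m. \<exists>a. Q m a" and P: "\<And>A. (\<And>m. Q m (A m)) \<Longrightarrow> \<forall>\<^sub>F m in sequentially. P m (A m)"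
  shows "\<forall>\<^sub>F m in sequentially. \<forall>a. Q m a \<longrightarrow> P m a"
proof -
  have "\<forall>m. \<exists>a. Q m a \<and> (P m a \<longrightarrow> (\<forall>a. Q m a \<longrightarrow> P m a))" using ex by blast
  then obtain A where A: "\<And>m. Q m (A m)" "\<And>m a. P m (A m) \<Longrightarrow> Q m a \<Longrightarrow> P m a" unfolding choice_iff by blast
  from P[OF A(1)] show ?thesis by (rule eventually_mono) (use A(2) in blast)
qed

text \<open>Success means recovering \<open>x\<close> itself, which for injective \<open>F\<close>
  is the same as finding a preimage.\<close>

definition owf_bound :: "circ \<Rightarrow> nat \<Rightarrow> real \<Rightarrow> bool" where
  "owf_bound F s \<delta> \<longleftrightarrow> (\<forall>A t \<tau>. wf_circ A \<and> csize A \<le> s \<and> density t \<tau> \<and> nin A = nout F + t \<and> nout A = nin F \<longrightarrow>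
     (\<Sum>x\<in>bits (nin F). prob_out (run A (tensor (nout F) (basis (ceval F x)) \<tau>)) x / 2 ^ nin F) \<le> \<delta>)"

definition cloning_adversary_at :: "nat \<Rightarrow> nat \<Rightarrow> nat \<Rightarrow> nat \<Rightarrow> nat \<Rightarrow> cloning_adversary \<Rightarrow> bool" where
  "cloning_adversary_at \<kappa> s ml cl al \<A> \<longleftrightarrow>
     wf_circ (stage1 \<A> \<kappa>) \<and> wf_circ (stage2 \<A> \<kappa>) \<and> wf_circ (partyB \<A> \<kappa>) \<and> wf_circ (partyC \<A> \<kappa>) \<and>
     csize (stage1 \<A> \<kappa>) \<le> s \<and> csize (stage2 \<A> \<kappa>) \<le> s \<and> csize (partyB \<A> \<kappa>) \<le> s \<and> csize (partyC \<A> \<kappa>) \<le> s \<and>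
     density (advice_len \<A> \<kappa>) (advice \<A> \<kappa>) \<and> nin (stage1 \<A> \<kappa>) = advice_len \<A> \<kappa> \<and>
     (\<exists>st rB rC. nout (stage1 \<A> \<kappa>) = ml + st \<and> nin (stage2 \<A> \<kappa>) = cl + st \<and> nout (stage2 \<A> \<kappa>) = rB + rC \<and>
        nin (partyB \<A> \<kappa>) = al + rB \<and> nin (partyC \<A> \<kappa>) = al + rC \<and> nout (partyB \<A> \<kappa>) = 1 \<and> nout (partyC \<A> \<kappa>) = 1)"

definition ue_bound :: "(nat \<Rightarrow> circ) \<Rightarrow> (nat \<Rightarrow> circ) \<Rightarrow> nat \<Rightarrow> nat \<Rightarrow> real \<Rightarrow> bool" where
  "ue_bound Gen Enc m s \<delta> \<longleftrightarrow> (\<forall>\<A>. cloning_adversary_at m s 2 (nout (Enc m)) (nout (Gen m)) \<A> \<longrightarrow> ue_win Gen Enc \<A> m \<le> 1 / 2 + \<delta>)"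

definition qsio_bound :: "(nat list \<Rightarrow> circ) \<Rightarrow> nat \<Rightarrow> nat \<Rightarrow> real \<Rightarrow> real \<Rightarrow> bool" where
  "qsio_bound Obf \<kappa> s \<epsilon> \<delta> \<longleftrightarrow> (\<forall>q C0 \<rho>0 C1 \<rho>1 f D t \<tau>.
    wf_circ C0 \<and> wf_circ C1 \<and> wf_circ D \<and> csize C0 \<le> s \<and> csize C1 \<le> s \<and> csize D \<le> s \<and>
    q \<le> nin C0 \<and> density q \<rho>0 \<and> density q \<rho>1 \<and> density t \<tau> \<and>
    implementation \<epsilon> q C0 \<rho>0 f \<and> implementation \<epsilon> q C1 \<rho>1 f \<and> same_size C0 C1 \<and>
    nin D = nout (Obf (obf_index \<kappa> q C0)) + t \<and> nout D = 1 \<longrightarrow>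
    \<bar>prob_out (run D (tensor (nout (Obf (obf_index \<kappa> q C0))) (obf_state Obf \<kappa> q C0 \<rho>0) \<tau>)) [True] -
     prob_out (run D (tensor (nout (Obf (obf_index \<kappa> q C0))) (obf_state Obf \<kappa> q C1 \<rho>1) \<tau>)) [True]\<bar> \<le> \<delta>)"

lemma owf_bound_mono: "owf_bound F s \<delta> \<Longrightarrow> s' \<le> s \<Longrightarrow> \<delta> \<le> \<delta>' \<Longrightarrow> owf_bound F s' \<delta>'"
  unfolding owf_bound_def by (meson le_trans order_trans)

lemma ue_bound_mono: "ue_bound Gen Enc m s \<delta> \<Longrightarrow> s' \<le> s \<Longrightarrow> \<delta> \<le> \<delta>' \<Longrightarrow> ue_bound Gen Enc m s' \<delta>'"
  unfolding ue_bound_def cloning_adversary_at_def by (meson add_left_mono le_trans order_trans)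

lemma owf_concrete:
  assumes owf: "pq_injective_owf F" and B: "poly_bounded B"
  shows "\<forall>\<^sub>F m in sequentially. owf_bound (F m) (B m) (1 / real m ^ c)"
proof -
  have F: "nin (F m) = m" for m using owf by (simp add: pq_injective_owf_def)
  \<comment> \<open>The enlarged bound leaves room for a trivial adversary, the gate-free circuit of
    size \<open>nout (F m) + 2 * m\<close>, so that admissible adversaries exist at every
    \<open>m\<close>. The next two proofs enlarge their bounds for the same reason.\<close>
  define B' where "B' m = B m + csize (F m) + 2 * m" for m
  have pB': "poly_bounded B'"
    unfolding B'_def using owf B by (intro poly_bounded_intros efficient1_size) (auto simp: pq_injective_owf_def)
  have "\<forall>\<^sub>F m in sequentially. \<forall>a. (case a of (A, t, \<tau>) \<Rightarrow> wf_circ A \<and> csize A \<le> B' m \<and> density t \<tau> \<and> nin A = nout (F m) + t \<and> nout A = m) \<longrightarrow>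
     (case a of (A, t, \<tau>) \<Rightarrow> (\<Sum>x\<in>bits m. prob_out (run A (tensor (nout (F m)) (basis (ceval (F m) x)) \<tau>)) x / 2 ^ m) \<le> 1 / real m ^ c)"
    (is "eventually (\<lambda>m. \<forall>a. ?Q m a \<longrightarrow> ?P m a) _")
  proof (rule eventually_all_choice)
    fix m
    have "?Q m (Circ (nout (F m)) m m [], 0, basis [])"
      using csize_ge(3)[of "F m"] by (auto simp: wf_circ_def wires_def density_basis csize_def B'_def)
    then show "\<exists>a. ?Q m a" ..
  next
    fix a assume "\<And>m. ?Q m (a m)"
    moreover obtain A t \<tau> where a: "a = (\<lambda>m. (A m, t m, \<tau> m))" using that[of "fst \<circ> a" "fst \<circ> snd \<circ> a" "snd \<circ> snd \<circ> a"] by simp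
    ultimately have Q: "\<And>m. ?Q m (A m, t m, \<tau> m)" by simp
    then have "poly_family A" unfolding poly_family_def using pB' by (auto intro: poly_bounded_mono)
    then have "negligible (\<lambda>\<kappa>. (\<Sum>x\<in>bits \<kappa>. \<Sum>x'\<in>{x'\<in>bits \<kappa>. ceval (F \<kappa>) x' = ceval (F \<kappa>) x}.
          prob_out (run (A \<kappa>) (tensor (nout (F \<kappa>)) (basis (ceval (F \<kappa>) x)) (\<tau> \<kappa>))) x') / 2 ^ \<kappa>)" (is "negligible ?s")
      using owf Q[unfolded prod.case] unfolding pq_injective_owf_def by blast
    then have "\<forall>\<^sub>F m in sequentially. \<bar>?s m\<bar> \<le> 1 / real m ^ c" unfolding negligible_def by blast
    then show "\<forall>\<^sub>F m in sequentially. ?P m (a m)"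
    proof eventually_elim
      case (elim m)
      have "{x'\<in>bits m. ceval (F m) x' = ceval (F m) x} = {x}" if "x \<in> bits m" for x
        using owf that unfolding pq_injective_owf_def inj_on_def by blast
      then have "?s m = (\<Sum>x\<in>bits m. prob_out (run (A m) (tensor (nout (F m)) (basis (ceval (F m) x)) (\<tau> m))) x) / 2 ^ m"
        by (intro arg_cong[where f = "\<lambda>z. z / 2 ^ m"] sum.cong refl) simp
      then show ?case using elim unfolding a by (simp add: sum_divide_distrib)
    qed
  qed
  then have "\<forall>\<^sub>F m in sequentially. owf_bound (F m) (B' m) (1 / real m ^ c)"
    unfolding owf_bound_def F split_paired_All prod.case .
  then show ?thesis by (rule eventually_mono) (auto elim!: owf_bound_mono simp: B'_def)
qed

lemma ue_concrete:
  assumes ue: "unclonable_bit_encryption Gen Enc Dec" and B: "poly_bounded B"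
  shows "\<forall>\<^sub>F m in sequentially. ue_bound Gen Enc m (B m) (1 / real m ^ c)"
proof -
  define B' where "B' m = B m + csize (Enc m) + csize (Gen m) + 4" for m
  have pB': "poly_bounded B'"
    unfolding B'_def using ue B by (intro poly_bounded_intros efficient1_size) (auto simp: unclonable_bit_encryption_def)
  have "\<forall>\<^sub>F m in sequentially. \<forall>\<A>. cloning_adversary_at m (B' m) 2 (nout (Enc m)) (nout (Gen m)) \<A> \<longrightarrow> ue_win Gen Enc \<A> m \<le> 1 / 2 + 1 / real m ^ c"
  proof (rule eventually_all_choice)
    fix m
    let ?p = "\<lambda>_. Circ (nout (Gen m)) 1 1 []"
    have "cloning_adversary_at m (B' m) 2 (nout (Enc m)) (nout (Gen m))
      \<lparr>advice_len = \<lambda>_. 2, advice = \<lambda>_. basis [False, False], stage1 = \<lambda>_. Circ 2 0 2 [], stage2 = \<lambda>_. Circ (nout (Enc m)) 0 0 [], partyB = ?p, partyC = ?p\<rparr>"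
      unfolding cloning_adversary_at_def using csize_ge(3)[of "Enc m"] csize_ge(3)[of "Gen m"]
      by (auto simp: wf_circ_def wires_def density_basis csize_def B'_def)
    then show "\<exists>\<A>. cloning_adversary_at m (B' m) 2 (nout (Enc m)) (nout (Gen m)) \<A>" ..
  next
    fix \<A> assume \<A>: "\<And>m. cloning_adversary_at m (B' m) 2 (nout (Enc m)) (nout (Gen m)) (\<A> m)"
    \<comment> \<open>A \<open>cloning_adversary\<close> is itself a family; from the adversary
      chosen at \<open>m\<close> only the components at index \<open>m\<close> are used.\<close>
    let ?A = "\<lparr>advice_len = \<lambda>m. advice_len (\<A> m) m, advice = \<lambda>m. advice (\<A> m) m, stage1 = \<lambda>m. stage1 (\<A> m) m,
      stage2 = \<lambda>m. stage2 (\<A> m) m, partyB = \<lambda>m. partyB (\<A> m) m, partyC = \<lambda>m. partyC (\<A> m) m\<rparr>"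
    have "qpt_cloning_adversary (\<lambda>\<kappa>. 2) (\<lambda>\<kappa>. nout (Enc \<kappa>)) (\<lambda>\<kappa>. nout (Gen \<kappa>)) ?A"
      using \<A> pB' unfolding qpt_cloning_adversary_def poly_family_def cloning_adversary_at_def
      by (auto intro: poly_bounded_mono)
    then obtain \<epsilon> where \<epsilon>: "negligible \<epsilon>" "\<And>\<kappa>. ue_win Gen Enc ?A \<kappa> \<le> 1 / 2 + \<epsilon> \<kappa>"
      using ue unfolding unclonable_bit_encryption_def by blast
    have eq: "ue_win Gen Enc (\<A> m) m = ue_win Gen Enc ?A m" for m unfolding ue_win_def cloning_prob_def by simp
    have "\<forall>\<^sub>F m in sequentially. \<bar>\<epsilon> m\<bar> \<le> 1 / real m ^ c" using \<epsilon>(1) unfolding negligible_def by blast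
    then show "\<forall>\<^sub>F m in sequentially. ue_win Gen Enc (\<A> m) m \<le> 1 / 2 + 1 / real m ^ c"
    proof eventually_elim
      case (elim m)
      then show ?case using \<epsilon>(2)[of m] unfolding eq by linarith
    qed
  qed
  then have "\<forall>\<^sub>F m in sequentially. ue_bound Gen Enc m (B' m) (1 / real m ^ c)" unfolding ue_bound_def .
  then show ?thesis by (rule eventually_mono) (auto elim!: ue_bound_mono simp: B'_def)
qed

lemma qsio_concrete:
  assumes eff: "efficient 6 Obf" and sec: "qsio_secure Obf" and B: "poly_bounded B" and \<epsilon>: "negligible \<epsilon>" "\<And>\<kappa>. 0 \<le> \<epsilon> \<kappa>"
  shows "\<forall>\<^sub>F \<kappa> in sequentially. qsio_bound Obf \<kappa> (B \<kappa>) (\<epsilon> \<kappa>) (1 / real \<kappa> ^ c)"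
proof -
  have "poly_bounded (\<lambda>\<kappa>. csize (Obf [\<kappa>, 0, 0, 0, 0, 0]))"
    by (rule efficient_size[OF eff]) (auto simp: less_Suc_eq numeral_eq_Suc intro: poly_bounded_intros)
  moreover define B' where "B' \<kappa> = B \<kappa> + csize (Obf [\<kappa>, 0, 0, 0, 0, 0]) + 4" for \<kappa>
  ultimately have pB': "poly_bounded B'" using B unfolding B'_def by (intro poly_bounded_intros)
  have "\<forall>\<^sub>F \<kappa> in sequentially. \<forall>a. (case a of (q, C0, \<rho>0, C1, \<rho>1, f, D, t, \<tau>) \<Rightarrow>
    wf_circ C0 \<and> wf_circ C1 \<and> wf_circ D \<and> csize C0 \<le> B' \<kappa> \<and> csize C1 \<le> B' \<kappa> \<and> csize D \<le> B' \<kappa> \<and>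
    q \<le> nin C0 \<and> density q \<rho>0 \<and> density q \<rho>1 \<and> density t \<tau> \<and>
    implementation (\<epsilon> \<kappa>) q C0 \<rho>0 f \<and> implementation (\<epsilon> \<kappa>) q C1 \<rho>1 f \<and> same_size C0 C1 \<and>
    nin D = nout (Obf (obf_index \<kappa> q C0)) + t \<and> nout D = 1) \<longrightarrow> (case a of (q, C0, \<rho>0, C1, \<rho>1, f, D, t, \<tau>) \<Rightarrow>
    \<bar>prob_out (run D (tensor (nout (Obf (obf_index \<kappa> q C0))) (obf_state Obf \<kappa> q C0 \<rho>0) \<tau>)) [True] -
     prob_out (run D (tensor (nout (Obf (obf_index \<kappa> q C0))) (obf_state Obf \<kappa> q C1 \<rho>1) \<tau>)) [True]\<bar> \<le> 1 / real \<kappa> ^ c)"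
    (is "eventually (\<lambda>\<kappa>. \<forall>a. ?Q \<kappa> a \<longrightarrow> ?P \<kappa> a) _")
  proof (rule eventually_all_choice)
    fix \<kappa>
    let ?C = "Circ 0 0 0 []"
    have wfC: "wf_circ ?C" by (simp add: wf_circ_def)
    have "run ?C (tensor 0 (basis []) (basis [])) = basis []"
      using run_classical_basis[OF wfC, of "[]"] basis_append[of "[]" 0 "[]"] by (simp add: classical_def ceval_def)
    then have imp: "implementation (\<epsilon> \<kappa>) 0 ?C (basis []) (\<lambda>_. [])"
      using \<epsilon>(2)[of \<kappa>] by (simp add: implementation_def prob_out_def basis_def bits_0)
    have "?Q \<kappa> (0, ?C, basis [], ?C, basis [], \<lambda>_. [], Circ (nout (Obf (obf_index \<kappa> 0 ?C))) 1 1 [], 0, basis [])"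
      using wfC imp csize_ge(3)[of "Obf [\<kappa>, 0, 0, 0, 0, 0]"]
      by (auto simp: density_basis wf_circ_def wires_def same_size_def csize_def B'_def obf_index_def)
    then show "\<exists>a. ?Q \<kappa> a" ..
  next
    fix a assume "\<And>\<kappa>. ?Q \<kappa> (a \<kappa>)"
    moreover obtain q C0 \<rho>0 C1 \<rho>1 f D t \<tau> where a: "a = (\<lambda>\<kappa>. (q \<kappa>, C0 \<kappa>, \<rho>0 \<kappa>, C1 \<kappa>, \<rho>1 \<kappa>, f \<kappa>, D \<kappa>, t \<kappa>, \<tau> \<kappa>))"
      using that[of "fst \<circ> a" "fst \<circ> snd \<circ> a" "fst \<circ> snd \<circ> snd \<circ> a" "fst \<circ> snd \<circ> snd \<circ> snd \<circ> a" "fst \<circ> snd \<circ> snd \<circ> snd \<circ> snd \<circ> a"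
          "fst \<circ> snd \<circ> snd \<circ> snd \<circ> snd \<circ> snd \<circ> a" "fst \<circ> snd \<circ> snd \<circ> snd \<circ> snd \<circ> snd \<circ> snd \<circ> a"
          "fst \<circ> snd \<circ> snd \<circ> snd \<circ> snd \<circ> snd \<circ> snd \<circ> snd \<circ> a" "snd \<circ> snd \<circ> snd \<circ> snd \<circ> snd \<circ> snd \<circ> snd \<circ> snd \<circ> a"] by simp
    ultimately have A: "\<And>\<kappa>. ?Q \<kappa> (q \<kappa>, C0 \<kappa>, \<rho>0 \<kappa>, C1 \<kappa>, \<rho>1 \<kappa>, f \<kappa>, D \<kappa>, t \<kappa>, \<tau> \<kappa>)" by simp
    then have "poly_family C0" "poly_family C1" "poly_family D"
      using pB' unfolding poly_family_def by (auto intro: poly_bounded_mono)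
    moreover have "\<And>\<kappa>. nin (C1 \<kappa>) = nin (C0 \<kappa>)" using A unfolding same_size_def prod.case by metis
    ultimately have "negl_implementation q C0 \<rho>0 f" "negl_implementation q C1 \<rho>1 f" "\<forall>\<kappa>. same_size (C0 \<kappa>) (C1 \<kappa>)"
      "poly_family D" "\<forall>\<kappa>. density (t \<kappa>) (\<tau> \<kappa>)" "\<forall>\<kappa>. nin (D \<kappa>) = nout (Obf (obf_index \<kappa> (q \<kappa>) (C0 \<kappa>))) + t \<kappa> \<and> nout (D \<kappa>) = 1"
      using A \<epsilon>(1) unfolding negl_implementation_def program_family_def by auto
    then have "negligible (\<lambda>\<kappa>. let r = nout (Obf (obf_index \<kappa> (q \<kappa>) (C0 \<kappa>))) in
          \<bar>prob_out (run (D \<kappa>) (tensor r (obf_state Obf \<kappa> (q \<kappa>) (C0 \<kappa>) (\<rho>0 \<kappa>)) (\<tau> \<kappa>))) [True] -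
           prob_out (run (D \<kappa>) (tensor r (obf_state Obf \<kappa> (q \<kappa>) (C1 \<kappa>) (\<rho>1 \<kappa>)) (\<tau> \<kappa>))) [True]\<bar>)"
      using sec unfolding qsio_secure_def by blast
    then show "\<forall>\<^sub>F \<kappa> in sequentially. ?P \<kappa> (a \<kappa>)"
      unfolding negligible_def a Let_def prod.case abs_abs by (elim allE[of _ c])
  qed
  then show ?thesis
  proof eventually_elim
    case (elim \<kappa>)
    have "x \<le> B' \<kappa>" if "x \<le> B \<kappa>" for x using that by (simp add: B'_def)
    then show ?case using elim unfolding qsio_bound_def split_paired_All prod.case by blast
  qed
qed

section \<open>The hidden program\<close>

lemma nth_concat_blocks:
  assumes "\<And>i. i < l \<Longrightarrow> length (f i) = m" "i < l" "j < m"
  shows "concat (map f [0..<l]) ! (i * m + j) = f i ! j"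
  using assms
proof (induction l)
  case (Suc l)
  have len: "length (concat (map f [0..<k])) = k * m" if "k \<le> Suc l" for k
    using that
  proof (induction k)
    case (Suc k)
    then show ?case using Suc.prems \<open>\<And>i. i < Suc l \<Longrightarrow> length (f i) = m\<close> by simp
  qed simp
  show ?case
  proof (cases "i < l")
    case True
    then have "i * m + j < l * m"
      by (metis Suc.prems(3) add.commute add_less_le_mono mult_Suc mult_le_mono1 Suc_leI less_le_trans nat_add_left_cancel_less)
    with True Suc show ?thesis using len[of l] by (simp add: nth_append)
  next
    case False
    then have "i = l" using Suc.prems by simp
    then show ?thesis using len[of l] by (simp add: nth_append)
  qed
qed simp

lemma length_concat_blocks:
  "(\<And>i. i < l \<Longrightarrow> length (f i) = m) \<Longrightarrow> length (concat (map f [0..<l])) = l * m"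
  by (induction l) auto

lemma block_index: "i < l \<Longrightarrow> j < m \<Longrightarrow> i * m + j < l * (m::nat)"
proof -
  assume "i < l" "j < m"
  then have "i * m + j < (i + 1) * m" "(i + 1) * m \<le> l * m" by (simp, intro mult_le_mono1, simp)
  then show ?thesis by linarith
qed

lemma blocks_eqI:
  assumes "length x = l * m" "length y = l * m" "\<And>i j. i < l \<Longrightarrow> j < m \<Longrightarrow> x ! (i * m + j) = y ! (i * m + j)"
  shows "x = y"
proof (rule nth_equalityI)
  fix k assume "k < length x"
  then have k: "k < l * m" using assms by simp
  then have "m > 0" by (cases m) auto
  then have "k div m < l" "k mod m < m" using k by (simp_all add: less_mult_imp_div_less)
  from assms(3)[OF this] show "x ! k = y ! k" by simp
qed (use assms in simp)

definition xor_list :: "bool list \<Rightarrow> bool list \<Rightarrow> bool list" where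
  "xor_list u v = map2 (\<noteq>) u v"

lemma length_xor_list [simp]: "length (xor_list u v) = min (length u) (length v)"
  by (simp add: xor_list_def)

lemma nth_xor_list: "i < length u \<Longrightarrow> i < length v \<Longrightarrow> xor_list u v ! i = (u ! i \<noteq> v ! i)"
  by (simp add: xor_list_def)

lemma xor_list_cancel: "length u = length v \<Longrightarrow> xor_list (xor_list u v) v = u"
  by (rule nth_equalityI) (auto simp: nth_xor_list)

lemma steps_ip:
  assumes "\<And>j. j < k \<Longrightarrow> steps a S (r j)" "\<And>j. j < k \<Longrightarrow> steps a T (v j)"
  shows "steps a (k * (S + T + 2) + 1) (\<lambda>x. ip (map (\<lambda>j. r j x) [0..<k]) (map (\<lambda>j. v j x) [0..<k]))"
  using assms
proof (induction k)
  case 0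
  then show ?case using steps_const[of a False] by simp
next
  case (Suc k)
  have "steps a ((k * (S + T + 2) + 1) + (S + T + 1) + 1) (\<lambda>x. ip (map (\<lambda>j. r j x) [0..<k]) (map (\<lambda>j. v j x) [0..<k]) \<noteq> (r k x \<and> v k x))"
    using Suc by (intro steps_xor steps_and) auto
  then show ?case
    by (rule steps_mono[OF steps_cong]) (auto simp: ip_append)
qed

text \<open>
  An input \<open>x = u @ v @ rest\<close> consists of \<open>l\<close> selector bits, \<open>l\<close> blocks of \<open>m\<close> bits, and a constant
  part. The data contain for every \<open>i < l\<close> and both values of the selector bit a test of the block
  \<open>v\<^sub>i\<close>: the image under the one-way function \<open>F\<close> of the only block that can pass, and a possibly
  flipped inner product; a flip makes the test reject everything, and by the hardness of \<open>F\<close> this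
  is hard to notice. The blocks that can pass are taken from a string \<open>V\<close> of \<open>2 l\<close> blocks, of which
  block \<open>2 i + u\<^sub>i\<close> occurs in the input; the others are called dead.
\<close>

locale test_data =
  fixes l m n :: nat and F :: circ and rest :: "bool list"
  assumes F: "wf_circ F" "classical F" "nin F = m" "inj_on (ceval F) (bits m)"
    and ln: "l + l * m \<le> n" and length_rest: "length rest = n - (l + l * m)"
begin

definition yl where "yl = nout F"

definition dlen where "dlen = yl + m + 1"

definition block :: "nat \<Rightarrow> bool list \<Rightarrow> bool list" where
  "block e V = map (\<lambda>j. V ! (e * m + j)) [0..<m]"

definition item :: "bool list \<Rightarrow> bool list \<Rightarrow> bool \<Rightarrow> bool list" where
  "item A R \<beta> = ceval F A @ R @ [ip R A \<noteq> \<beta>]"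

definition items :: "bool list \<Rightarrow> bool list \<Rightarrow> (nat \<Rightarrow> bool) \<Rightarrow> bool list" where
  "items V R \<beta> = concat (map (\<lambda>e. item (block e V) (block e R) (\<beta> e)) [0..<2 * l])"

definition secret_input :: "bool list \<Rightarrow> bool list \<Rightarrow> bool list" where
  "secret_input u V = u @ concat (map (\<lambda>i. block (2 * i + of_bool (u ! i)) V) [0..<l]) @ rest"

text \<open>The string \<open>y\<close> starts with the \<open>n\<close> input bits, followed by the
  items; item \<open>2 * i + c\<close> belongs to value \<open>c\<close> of selector bit
  \<open>i\<close>.\<close>

definition selected :: "nat \<Rightarrow> nat \<Rightarrow> bool list \<Rightarrow> bool" where
  "selected i t y = (if y ! i then y ! (n + (2 * i + 1) * dlen + t) else y ! (n + (2 * i) * dlen + t))"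

definition test_block :: "nat \<Rightarrow> bool list \<Rightarrow> bool" where
  "test_block i y \<longleftrightarrow>
     (\<forall>t<yl. ceval F (map (\<lambda>j. y ! (l + i * m + j)) [0..<nin F]) ! t \<longleftrightarrow> selected i t y) \<and>
     (ip (map (\<lambda>j. selected i (yl + j) y) [0..<m]) (map (\<lambda>j. y ! (l + i * m + j)) [0..<m]) \<longleftrightarrow> selected i (yl + m) y)"

definition accepts :: "bool list \<Rightarrow> bool" where
  "accepts y \<longleftrightarrow> (\<forall>j<n - (l + l * m). y ! (l + l * m + j) \<longleftrightarrow> rest ! j) \<and> (\<forall>i<l. test_block i y)"

text \<open>Block \<open>e\<close> stands for selector bit \<open>e div 2\<close> with value
  \<open>odd e\<close>.\<close>

definition dead :: "bool list \<Rightarrow> nat \<Rightarrow> bool" where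
  "dead u e \<longleftrightarrow> u ! (e div 2) \<noteq> odd e"

lemma length_block [simp]: "length (block e V) = m"
  by (simp add: block_def)

lemma length_ceval_F [simp]: "length A = m \<Longrightarrow> length (ceval F A) = yl"
  using F by (simp add: ceval_def yl_def wf_circ_def wires_def)

lemma length_item [simp]: "length A = m \<Longrightarrow> length R = m \<Longrightarrow> length (item A R \<beta>) = dlen"
  by (simp add: item_def dlen_def)

lemma length_items [simp]: "length (items V R \<beta>) = 2 * l * dlen"
  unfolding items_def by (rule length_concat_blocks) simp

lemma nth_items: "e < 2 * l \<Longrightarrow> t < dlen \<Longrightarrow> items V R \<beta> ! (e * dlen + t) = item (block e V) (block e R) (\<beta> e) ! t"
  unfolding items_def by (rule nth_concat_blocks) simp_all

lemma length_secret_input [simp]: "length u = l \<Longrightarrow> length (secret_input u V) = n"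
  using ln length_rest unfolding secret_input_def by (simp add: length_concat_blocks[where m = m])

lemma secret_input_nth:
  assumes "length u = l"
  shows "i < l \<Longrightarrow> secret_input u V ! i = u ! i"
    "i < l \<Longrightarrow> j < m \<Longrightarrow> secret_input u V ! (l + i * m + j) = block (2 * i + of_bool (u ! i)) V ! j"
    "j < n - (l + l * m) \<Longrightarrow> secret_input u V ! (l + l * m + j) = rest ! j"
proof -
  let ?v = "concat (map (\<lambda>i. block (2 * i + of_bool (u ! i)) V) [0..<l])"
  have lv: "length ?v = l * m" by (rule length_concat_blocks) simp
  show "i < l \<Longrightarrow> secret_input u V ! i = u ! i" using assms by (simp add: secret_input_def nth_append)
  show "i < l \<Longrightarrow> j < m \<Longrightarrow> secret_input u V ! (l + i * m + j) = block (2 * i + of_bool (u ! i)) V ! j"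
    using block_index[of i l j m] assms lv nth_concat_blocks[of l "\<lambda>i. block (2 * i + of_bool (u ! i)) V" m i j]
    by (simp add: secret_input_def nth_append add.assoc)
  show "j < n - (l + l * m) \<Longrightarrow> secret_input u V ! (l + l * m + j) = rest ! j"
    using assms lv by (simp add: secret_input_def nth_append add.assoc)
qed

lemma secret_input_eqI:
  assumes u: "length u = l" and x: "length x = n"
    and eq: "\<And>i. i < l \<Longrightarrow> x ! i = u ! i" "\<And>i j. i < l \<Longrightarrow> j < m \<Longrightarrow> x ! (l + i * m + j) = block (2 * i + of_bool (u ! i)) V ! j"
    "\<And>j. j < n - (l + l * m) \<Longrightarrow> x ! (l + l * m + j) = rest ! j"
  shows "x = secret_input u V"
proof (rule nth_equalityI)
  show "length x = length (secret_input u V)" using u x by simp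
  fix k assume "k < length x"
  then have k: "k < n" using x by simp
  consider "k < l" | k' where "k = l + k'" "k' < l * m" | k' where "k = l + l * m + k'" "k' < n - (l + l * m)"
  proof -
    assume a: "k < l \<Longrightarrow> thesis" "\<And>k'. k = l + k' \<Longrightarrow> k' < l * m \<Longrightarrow> thesis" "\<And>k'. k = l + l * m + k' \<Longrightarrow> k' < n - (l + l * m) \<Longrightarrow> thesis"
    show thesis
      using a(1) a(2)[of "k - l"] a(3)[of "k - (l + l * m)"] k by linarith
  qed
  then show "x ! k = secret_input u V ! k"
  proof cases
    case 1
    then show ?thesis using eq(1) secret_input_nth(1)[OF u] by simp
  next
    case (2 k')
    then have "m > 0" by (cases m) auto
    then have "k' div m < l" "k' mod m < m" using 2 by (simp_all add: less_mult_imp_div_less)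
    moreover have "k = l + (k' div m) * m + k' mod m" using 2 by (simp add: add.assoc)
    ultimately show ?thesis using eq(2) secret_input_nth(2)[OF u] by metis
  next
    case 3
    then show ?thesis using eq(3) secret_input_nth(3)[OF u] by simp
  qed
qed

text \<open>Injectivity of \<open>F\<close> turns the comparison of images into equality with the
  selected block; once that holds, the inner product agrees exactly if the test is not flipped. With
  the dead tests flipped this forces the selector bits to be \<open>u\<close>.\<close>

lemma accepts_iff:
  assumes l: "length u = l" "length x = n" and \<beta>: "\<And>e. e < 2 * l \<Longrightarrow> \<beta> e \<longleftrightarrow> dead u e"
  shows "accepts (x @ items V R \<beta> @ z) \<longleftrightarrow> x = secret_input u V"
proof -
  let ?y = "x @ items V R \<beta> @ z"
  let ?e = "\<lambda>i. 2 * i + of_bool (x ! i)"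
  have sel: "selected i t ?y = item (block (?e i) V) (block (?e i) R) (\<beta> (?e i)) ! t" if i: "i < l" and t: "t < dlen" for i t
  proof -
    have e: "2 * i < 2 * l" "2 * i + 1 < 2 * l" using i by auto
    have il: "2 * i * dlen + t < 2 * l * dlen" "(2 * i + 1) * dlen + t < 2 * l * dlen"
      using block_index[OF e(1) t] block_index[OF e(2) t] .
    have xi: "?y ! i = x ! i" using i ln l by (simp add: nth_append)
    have "?y ! (n + k) = items V R \<beta> ! k" if "k < 2 * l * dlen" for k
      using l that by (simp add: nth_append)
    with il nth_items[OF e(1) t] nth_items[OF e(2) t] show ?thesis
      unfolding selected_def xi by (auto simp: add.assoc)
  qed
  have v: "map (\<lambda>j. ?y ! (l + i * m + j)) [0..<m] = map (\<lambda>j. x ! (l + i * m + j)) [0..<m]" if "i < l" for i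
    using block_index[OF that] ln l by (fastforce simp: nth_append add.assoc)
  have tb: "test_block i ?y \<longleftrightarrow> map (\<lambda>j. x ! (l + i * m + j)) [0..<m] = block (?e i) V \<and> \<not> \<beta> (?e i)" if i: "i < l" for i
  proof -
    let ?v = "map (\<lambda>j. x ! (l + i * m + j)) [0..<m]" and ?A = "block (?e i) V" and ?R = "block (?e i) R"
    have 1: "(\<forall>t<yl. ceval F ?v ! t \<longleftrightarrow> selected i t ?y) \<longleftrightarrow> ?v = ?A"
    proof -
      have "(\<forall>t<yl. ceval F ?v ! t \<longleftrightarrow> selected i t ?y) \<longleftrightarrow> (\<forall>t<yl. ceval F ?v ! t = ceval F ?A ! t)"
        using sel[OF i] by (auto simp: dlen_def item_def nth_append)
      also have "\<dots> \<longleftrightarrow> ceval F ?v = ceval F ?A"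
        by (auto simp: list_eq_iff_nth_eq)
      also have "\<dots> \<longleftrightarrow> ?v = ?A" using inj_on_eq_iff[OF F(4), of ?v ?A] by simp
      finally show ?thesis .
    qed
    have 2: "map (\<lambda>j. selected i (yl + j) ?y) [0..<m] = ?R"
      using sel[OF i] by (auto simp: list_eq_iff_nth_eq dlen_def item_def nth_append)
    have 3: "selected i (yl + m) ?y \<longleftrightarrow> (ip ?R ?A \<noteq> \<beta> (?e i))"
      using sel[OF i, of "yl + m"] by (simp add: dlen_def item_def nth_append)
    show ?thesis unfolding test_block_def F(3) v[OF i] 1 2 3 by auto
  qed
  have be: "\<beta> (?e i) \<longleftrightarrow> x ! i \<noteq> u ! i" if "i < l" for i
    using \<beta>[of "?e i"] that by (auto simp: dead_def)
  have r: "?y ! (l + l * m + j) = x ! (l + l * m + j)" if "j < n - (l + l * m)" for j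
  proof -
    have "l + l * m + j < n" using that by linarith
    with l show ?thesis by (simp add: nth_append)
  qed
  have "accepts ?y \<longleftrightarrow> (\<forall>j<n - (l + l * m). x ! (l + l * m + j) = rest ! j) \<and>
     (\<forall>i<l. x ! i = u ! i \<and> map (\<lambda>j. x ! (l + i * m + j)) [0..<m] = block (2 * i + of_bool (u ! i)) V)"
    unfolding accepts_def using tb be r by auto
  also have "\<dots> \<longleftrightarrow> x = secret_input u V"
  proof
    assume a: "(\<forall>j<n - (l + l * m). x ! (l + l * m + j) = rest ! j) \<and>
     (\<forall>i<l. x ! i = u ! i \<and> map (\<lambda>j. x ! (l + i * m + j)) [0..<m] = block (2 * i + of_bool (u ! i)) V)"
    show "x = secret_input u V"
    proof (rule secret_input_eqI[OF l(1,2)])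
      fix i j assume "i < l" "j < m"
      with a have "map (\<lambda>j. x ! (l + i * m + j)) [0..<m] ! j = block (2 * i + of_bool (u ! i)) V ! j" by simp
      then show "x ! (l + i * m + j) = block (2 * i + of_bool (u ! i)) V ! j" using \<open>j < m\<close> by simp
    qed (use a in auto)
  next
    assume x: "x = secret_input u V"
    show "(\<forall>j<n - (l + l * m). x ! (l + l * m + j) = rest ! j) \<and>
     (\<forall>i<l. x ! i = u ! i \<and> map (\<lambda>j. x ! (l + i * m + j)) [0..<m] = block (2 * i + of_bool (u ! i)) V)"
      unfolding x by (intro conjI allI impI nth_equalityI) (auto simp: secret_input_nth[OF l(1)])
  qed
  finally show ?thesis .
qed

text \<open>The costs from \<open>steps_accepts\<close> added up; \<open>F\<close> is charged anew
  for each of its output bits.\<close>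

definition accept_steps :: nat where
  "accept_steps = n * 4 + l * (yl * (m + 2 * csize F + 13) + m * 12 + 19) + 20"

text \<open>The \<open>k\<close> surplus inputs make room for the masked key, which the program
  receives behind the test data.\<close>

lemma steps_accepts: "steps (n + 2 * l * dlen + k) accept_steps accepts"
proof -
  let ?a = "n + 2 * l * dlen + k"
  have sel: "steps ?a 9 (selected i t)" if "i < l" "t < dlen" for i t
  proof -
    have e: "2 * i < 2 * l" "2 * i + 1 < 2 * l" using that by auto
    have "2 * i * dlen + t < 2 * l * dlen" "(2 * i + 1) * dlen + t < 2 * l * dlen"
      using block_index[OF e(1) that(2)] block_index[OF e(2) that(2)] .
    then have "steps ?a (2 * 1 + 1 + 1 + 5) (selected i t)"
      unfolding selected_def using that ln by (intro steps_if steps_proj) auto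
    then show ?thesis by simp
  qed
  have inp: "steps ?a 1 (\<lambda>y. y ! (l + i * m + j))" if "i < l" "j < m" for i j
    using block_index[OF that] ln by (intro steps_proj) linarith
  have tb: "steps ?a (yl * ((m * 1 + 2 * csize F) + 9 + 3 + 1) + 1 + ((m * (9 + 1 + 2) + 1) + 9 + 3) + 1) (test_block i)" if i: "i < l" for i
    unfolding test_block_def
  proof (intro steps_and steps_all_less steps_iff steps_ip)
    fix t assume t: "t < yl"
    show "steps ?a (m * 1 + 2 * csize F) (\<lambda>x. ceval F (map (\<lambda>j. x ! (l + i * m + j)) [0..<nin F]) ! t)"
      using steps_ceval[OF F(1,2), of t ?a 1 "\<lambda>j x. x ! (l + i * m + j)"] t inp[OF i] F(3) by (simp add: yl_def)
    show "steps ?a 9 (selected i t)" using sel[OF i, of t] t by (simp add: dlen_def)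
  next
    fix j assume j: "j < m"
    show "steps ?a 9 (selected i (yl + j))" using sel[OF i] j by (simp add: dlen_def)
    show "steps ?a 1 (\<lambda>y. y ! (l + i * m + j))" using inp[OF i j] .
  next
    show "steps ?a 9 (selected i (yl + m))" using sel[OF i] by (simp add: dlen_def)
  qed
  have r: "steps ?a 3 (\<lambda>y. y ! (l + l * m + j) \<longleftrightarrow> rest ! j)" if "j < n - (l + l * m)" for j
  proof -
    have p: "steps ?a 1 (\<lambda>y. y ! (l + l * m + j))" using that by (intro steps_proj) simp
    show ?thesis
      by (cases "rest ! j") (use steps_mono[OF p, of 3] steps_mono[OF steps_not[OF p], of 3] in simp_all)
  qed
  have "steps ?a (((n - (l + l * m)) * (3 + 1) + 1) + (l * ((yl * ((m * 1 + 2 * csize F) + 9 + 3 + 1) + 1 + ((m * (9 + 1 + 2) + 1) + 9 + 3) + 1) + 1) + 1) + 1) accepts"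
    unfolding accepts_def by (intro steps_and steps_all_less r tb)
  then show ?thesis
    by (rule steps_mono) (simp add: accept_steps_def algebra_simps)
qed

end

text \<open>The only quantum part is \<open>Dec\<close>. A classical circuit \<open>K1\<close> first
  computes the test result and the unmasked key; \<open>x\<close> and the test result wait beside
  \<open>Dec\<close>; then \<open>K2\<close> selects between \<open>M\<close> and \<open>W\<close>.
  As \<open>K2\<close> is classical, its output distribution is read off from the measured plaintext
  bit.\<close>

lemma ex_program:
  assumes Dec: "wf_circ Dec" "nin Dec = l + cl" "nout Dec = 1"
    and W: "wf_circ W" "classical W" "nin W = n" "nout W = mo"
    and M: "wf_circ M" "classical M" "nin M = n" "nout M = mo"
    and acc: "steps (n + dl + l) S acc" and ln: "l \<le> n"
  shows "\<exists>P. wf_circ P \<and> nin P = n + (dl + l + cl) \<and> nout P = mo \<and>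
    csize P \<le> 10000 * (n + dl + l + cl + mo + (n + 1 + l) * (S + 4) + mo * (n + csize W + csize M + 10) + csize Dec) \<and>
    (\<forall>x\<in>bits n. \<forall>d\<in>bits dl. \<forall>z\<in>bits l. \<forall>ct. supported cl ct \<longrightarrow> (\<forall>out\<in>bits mo.
      prob_out (run P (tensor n (basis x) (tensor dl (basis d) (tensor l (basis z) ct)))) out =
      (\<Sum>c\<in>UNIV. prob_out (run Dec (tensor l (basis (xor_list z (take l x))) ct)) [c] *
         of_bool ((if c \<and> acc (x @ d @ z) then ceval M x else ceval W x) = out))))"
proof -
  let ?a = "n + dl + l"
  \<comment> \<open>Output layout: the input \<open>x\<close>, one bit for the test, and the key,
    that is the masked key xored with the first \<open>l\<close> bits of \<open>x\<close>.\<close>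
  define h1 where "h1 j y = (if j < n then y ! j else if j = n then acc y else (y ! (n + dl + (j - (n + 1))) \<noteq> y ! (j - (n + 1))))" for j y
  have "steps ?a (S + 3) (h1 j)" if j: "j < n + 1 + l" for j
  proof -
    consider "j < n" | "j = n" | "j > n" by linarith
    then show ?thesis
    proof cases
      case 1
      then have "h1 j = (\<lambda>y. y ! j)" by (auto simp: h1_def)
      with 1 show ?thesis using steps_mono[OF steps_proj[of j ?a], of "S + 3"] by simp
    next
      case 2
      then have "h1 j = acc" by (auto simp: h1_def)
      with acc show ?thesis using steps_mono[OF acc, of "S + 3"] by simp
    next
      case 3
      then have "h1 j = (\<lambda>y. y ! (n + dl + (j - (n + 1))) \<noteq> y ! (j - (n + 1)))" by (auto simp: h1_def)
      moreover have "steps ?a (1 + 1 + 1) (\<lambda>y. y ! (n + dl + (j - (n + 1))) \<noteq> y ! (j - (n + 1)))"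
        using 3 j ln by (intro steps_xor steps_proj) auto
      ultimately have "steps ?a (1 + 1 + 1) (h1 j)" by (simp only:)
      then show ?thesis by (rule steps_mono) simp
    qed
  qed
  then obtain K1 where K1: "wf_circ K1" "classical K1" "nin K1 = ?a" "nout K1 = n + 1 + l"
     "csize K1 \<le> 6 * (?a + (n + 1 + l) * (S + 3 + 1))" "\<forall>x\<in>bits ?a. ceval K1 x = map (\<lambda>j. h1 j x) [0..<n + 1 + l]"
    using ex_classical[of "n + 1 + l" ?a "S + 3" h1] by blast
  \<comment> \<open>Input layout: the plaintext bit from \<open>Dec\<close>, then \<open>x\<close>,
    then the test result at position \<open>n + 1\<close>.\<close>
  define h2 where "h2 j y = (if y ! 0 \<and> y ! (n + 1) then ceval M (map (\<lambda>i. y ! (1 + i)) [0..<nin M]) ! j else ceval W (map (\<lambda>i. y ! (1 + i)) [0..<nin W]) ! j)" for j y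
  have "steps (n + 2) (2 * 3 + (n * 1 + 2 * csize M) + (n * 1 + 2 * csize W) + 5) (h2 j)" if j: "j < mo" for j
    unfolding h2_def
  proof (intro steps_if)
    show "steps (n + 2) 3 (\<lambda>y. y ! 0 \<and> y ! (n + 1))"
      using steps_and[of "n + 2" 1 "\<lambda>y. y ! 0" 1 "\<lambda>y. y ! (n + 1)"] steps_proj[of _ "n + 2"] by (simp add: numeral_3_eq_3)
    show "steps (n + 2) (n * 1 + 2 * csize M) (\<lambda>y. ceval M (map (\<lambda>i. y ! (1 + i)) [0..<nin M]) ! j)"
      using steps_ceval[OF M(1,2), of j "n + 2" 1 "\<lambda>i y. y ! (1 + i)"] j M steps_proj[of _ "n + 2"] by simp
    show "steps (n + 2) (n * 1 + 2 * csize W) (\<lambda>y. ceval W (map (\<lambda>i. y ! (1 + i)) [0..<nin W]) ! j)"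
      using steps_ceval[OF W(1,2), of j "n + 2" 1 "\<lambda>i y. y ! (1 + i)"] j W steps_proj[of _ "n + 2"] by simp
  qed
  then obtain K2 where K2: "wf_circ K2" "classical K2" "nin K2 = n + 2" "nout K2 = mo"
     "csize K2 \<le> 6 * ((n + 2) + mo * ((2 * 3 + (n * 1 + 2 * csize M) + (n * 1 + 2 * csize W) + 5) + 1))" "\<forall>x\<in>bits (n + 2). ceval K2 x = map (\<lambda>j. h2 j x) [0..<mo]"
    using ex_classical[of mo "n + 2" _ h2] by blast
  obtain L1 where L1: "wf_circ L1" "nin L1 = ?a + cl" "nout L1 = n + 1 + l + cl" "csize L1 \<le> 8 * (csize K1 + cl)"
    "\<And>\<rho> \<sigma>. supported cl \<sigma> \<Longrightarrow> run L1 (tensor ?a \<rho> \<sigma>) = tensor (n + 1 + l) (run K1 \<rho>) \<sigma>"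
    using ex_lift_tensor[OF K1(1), of cl] K1(3,4) by auto
  obtain S1 where S1: "wf_circ S1" "nin S1 = (n + 1) + (l + cl)" "nout S1 = (l + cl) + (n + 1)" "csize S1 \<le> 5 * ((n + 1) + (l + cl))"
    "\<And>\<rho> \<sigma>. supported (n + 1) \<rho> \<Longrightarrow> supported (l + cl) \<sigma> \<Longrightarrow> run S1 (tensor (n + 1) \<rho> \<sigma>) = tensor (l + cl) \<sigma> \<rho>"
    using ex_swap_tensor[of "n + 1" "l + cl"] by blast
  obtain L2 where L2: "wf_circ L2" "nin L2 = l + cl + (n + 1)" "nout L2 = 1 + (n + 1)" "csize L2 \<le> 8 * (csize Dec + (n + 1))"
    "\<And>\<rho> \<sigma>. supported (n + 1) \<sigma> \<Longrightarrow> run L2 (tensor (l + cl) \<rho> \<sigma>) = tensor 1 (run Dec \<rho>) \<sigma>"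
    using ex_lift_tensor[OF Dec(1), of "n + 1"] Dec(2,3) by auto
  obtain P1 where P1: "wf_circ P1" "nin P1 = ?a + cl" "nout P1 = (l + cl) + (n + 1)" "csize P1 \<le> 4 * (csize L1 + csize S1)" "\<forall>\<rho>. run P1 \<rho> = run S1 (run L1 \<rho>)"
    using ex_seq[OF L1(1) S1(1)] L1 S1 by auto
  obtain P2 where P2: "wf_circ P2" "nin P2 = ?a + cl" "nout P2 = 1 + (n + 1)" "csize P2 \<le> 4 * (csize P1 + csize L2)" "\<forall>\<rho>. run P2 \<rho> = run L2 (run P1 \<rho>)"
    using ex_seq[OF P1(1) L2(1)] P1 L2 by auto
  obtain P where P: "wf_circ P" "nin P = ?a + cl" "nout P = mo" "csize P \<le> 4 * (csize P2 + csize K2)" "\<forall>\<rho>. run P \<rho> = run K2 (run P2 \<rho>)"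
    using ex_seq[OF P2(1) K2(1)] P2 K2 by auto
  have "prob_out (run P (tensor n (basis x) (tensor dl (basis d) (tensor l (basis z) ct)))) out =
      (\<Sum>c\<in>UNIV. prob_out (run Dec (tensor l (basis (xor_list z (take l x))) ct)) [c] *
         of_bool ((if c \<and> acc (x @ d @ z) then ceval M x else ceval W x) = out))"
    if len: "x \<in> bits n" "d \<in> bits dl" "z \<in> bits l" "out \<in> bits mo" and ct: "supported cl ct" for x d z ct out
  proof -
    define key ac where "key = xor_list z (take l x)" and "ac = acc (x @ d @ z)"
    have lk: "length key = l" using len ln by (simp add: key_def)
    have "ceval K1 (x @ d @ z) = map (\<lambda>j. h1 j (x @ d @ z)) [0..<n + 1 + l]" using K1(6) len by simp
    also have "\<dots> = (x @ [ac]) @ key"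
    proof (rule nth_equalityI)
      fix j assume "j < length (map (\<lambda>j. h1 j (x @ d @ z)) [0..<n + 1 + l])"
      then have j: "j < n + 1 + l" by simp
      consider "j < n" | "j = n" | i where "j = n + 1 + i" "i < l"
        using j by (metis add_diff_inverse_nat less_Suc_eq Suc_eq_plus1 nat_add_left_cancel_less not_less_eq)
      then have "h1 j (x @ d @ z) = ((x @ [ac]) @ key) ! j"
      proof cases
        case 3
        then show ?thesis using len ln by (simp add: h1_def nth_append key_def nth_xor_list)
      qed (use len in \<open>auto simp: h1_def nth_append ac_def\<close>)
      with j show "map (\<lambda>j. h1 j (x @ d @ z)) [0..<n + 1 + l] ! j = ((x @ [ac]) @ key) ! j" by (simp del: upt_Suc)
    qed (use len lk in simp)
    finally have k1: "run K1 (basis (x @ d @ z)) = basis ((x @ [ac]) @ key)"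
      using run_classical_basis[OF K1(1,2)] K1(3) len by simp
    have "tensor n (basis x) (tensor dl (basis d) (tensor l (basis z) ct)) = tensor ?a (basis (x @ d @ z)) ct"
      using len by (simp add: tensor_assoc add.assoc flip: basis_append[of x n] basis_append[of d dl])
    then have r1: "run L1 (tensor n (basis x) (tensor dl (basis d) (tensor l (basis z) ct))) = tensor (n + 1 + l) (basis ((x @ [ac]) @ key)) ct"
      using L1(5)[OF ct] k1 by simp
    have r2: "tensor (n + 1 + l) (basis ((x @ [ac]) @ key)) ct = tensor (n + 1) (basis (x @ [ac])) (tensor l (basis key) ct)"
    proof -
      have "basis ((x @ [ac]) @ key) = tensor (n + 1) (basis (x @ [ac])) (basis key)"
        using len by (intro basis_append[symmetric]) simp
      then show ?thesis by (simp only: tensor_assoc)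
    qed
    have r3: "run S1 (tensor (n + 1) (basis (x @ [ac])) (tensor l (basis key) ct)) = tensor (l + cl) (tensor l (basis key) ct) (basis (x @ [ac]))"
      using len lk ct by (intro S1(5) supported_tensor supported_basis) auto
    have r4: "run L2 (tensor (l + cl) (tensor l (basis key) ct) (basis (x @ [ac]))) = tensor 1 (run Dec (tensor l (basis key) ct)) (basis (x @ [ac]))"
      using len by (intro L2(5) supported_basis) auto
    have fin: "run P (tensor n (basis x) (tensor dl (basis d) (tensor l (basis z) ct))) = run K2 (tensor 1 (run Dec (tensor l (basis key) ct)) (basis (x @ [ac])))"
      by (simp only: P(5)[rule_format] P2(5)[rule_format] P1(5)[rule_format] r1 r2 r3 r4)
    let ?D = "run Dec (tensor l (basis key) ct)"
    have ck: "ceval K2 ([c] @ x @ [ac]) = (if c \<and> ac then ceval M x else ceval W x)" for c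
    proof -
      have xs: "map (\<lambda>i. ([c] @ x @ [ac]) ! (1 + i)) [0..<n] = x"
        using len by (simp add: list_eq_iff_nth_eq nth_append)
      have ends: "([c] @ x @ [ac]) ! 0 = c" "([c] @ x @ [ac]) ! (n + 1) = ac" using len by (auto simp: nth_append)
      have lo: "length (ceval M x) = mo" "length (ceval W x) = mo"
        using len M W by (simp_all add: ceval_def wf_circ_def wires_def)
      have "ceval K2 ([c] @ x @ [ac]) = map (\<lambda>j. h2 j ([c] @ x @ [ac])) [0..<mo]" using K2(6) len by simp
      also have "\<dots> = (if c \<and> ac then ceval M x else ceval W x)"
        unfolding h2_def ends M(3) W(3) xs using lo by (auto simp: list_eq_iff_nth_eq)
      finally show ?thesis .
    qed
    have "prob_out (run K2 (tensor 1 ?D (basis (x @ [ac])))) out =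
       (\<Sum>y\<in>{y \<in> bits (n + 2). ceval K2 y = out}. prob_out (tensor 1 ?D (basis (x @ [ac]))) y)"
      using run_classical_prob[OF K2(1,2)] K2 len by simp
    also have "\<dots> = (\<Sum>y\<in>bits (1 + (n + 1)). prob_out (tensor 1 ?D (basis (x @ [ac]))) y * of_bool (ceval K2 y = out))"
      by (rule sum.mono_neutral_cong_left) auto
    also have "\<dots> = (\<Sum>c\<in>bits 1. \<Sum>y\<in>bits (n + 1). (prob_out ?D c * of_bool (ceval K2 (c @ y) = out)) * of_bool (y = x @ [ac]))"
      unfolding sum_bits_add by (intro sum.cong refl) (auto simp: prob_out_def basis_def)
    also have "\<dots> = (\<Sum>c\<in>bits 1. prob_out ?D c * of_bool (ceval K2 (c @ x @ [ac]) = out))"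
      using len by (intro sum.cong refl, subst sum_of_bool_pick) auto
    also have "\<dots> = (\<Sum>c\<in>UNIV. prob_out ?D [c] * of_bool (ceval K2 ([c] @ x @ [ac]) = out))"
      by (simp add: sum_bits_1 UNIV_bool)
    finally show ?thesis unfolding fin ck unfolding ac_def key_def .
  qed
  moreover have "csize P \<le> 10000 * (n + dl + l + cl + mo + (n + 1 + l) * (S + 4) + mo * (n + csize W + csize M + 10) + csize Dec)"
  proof -
    define X Y where "X = (n + 1 + l) * (S + 4)" and "Y = mo * (n + csize W + csize M + 10)"
    have e: "S + 3 + 1 = S + 4" by simp
    have k1: "csize K1 \<le> 6 * (?a + X)" using K1(5) unfolding X_def e .
    have "mo * ((2 * 3 + (n * 1 + 2 * csize M) + (n * 1 + 2 * csize W) + 5) + 1) \<le> mo * (2 * (n + csize W + csize M + 10))"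
      by (intro mult_le_mono2) simp
    also have "\<dots> = 2 * Y" by (simp add: Y_def)
    finally have k2: "csize K2 \<le> 6 * (n + 2 + 2 * Y)"
      by (intro order_trans[OF K2(5)] mult_le_mono2 add_mono order_refl)
    have "1 \<le> csize Dec" using Dec by (simp add: csize_def)
    then show ?thesis
      using P(4) P2(4) P1(4) L1(4) S1(4) L2(4) k1 k2 unfolding X_def[symmetric] Y_def[symmetric] by simp
  qed
  ultimately show ?thesis using P(1,2,3) by (intro exI[of _ P]) (auto simp: add.assoc)
qed

section \<open>The hybrid argument\<close>

text \<open>For a fixed input \<open>x\<close> the end of the game, from the challenge on, becomes
  one circuit. The factor covers 4 * 2000 * 1000 from composing, joining and hardwiring.\<close>

lemma ex_test:
  assumes S: "wf_circ S" "nout S = rB + rC" and B: "wf_circ B" "nin B = length x + rB" "nout B = 1"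
    and C: "wf_circ C" "nin C = length x + rC" "nout C = 1"
  shows "\<exists>D. wf_circ D \<and> nin D = nin S \<and> nout D = 1 \<and> csize D \<le> 10000000 * (csize S + csize B + csize C) \<and>
    (\<forall>\<rho>. prob_out (run D \<rho>) [True] =
      joint_prob (\<lambda>\<sigma>. run B (tensor (length x) (basis x) \<sigma>)) (\<lambda>\<sigma>. run C (tensor (length x) (basis x) \<sigma>)) (run S \<rho>) [b] [b])"
proof -
  obtain B' where B': "wf_circ B'" "nin B' = rB" "nout B' = 1" "csize B' \<le> 1000 * csize B" "\<forall>\<rho>. run B' \<rho> = run B (tensor (length x) (basis x) \<rho>)"
    using ex_hardwire[of B x] B by auto
  obtain C' where C': "wf_circ C'" "nin C' = rC" "nout C' = 1" "csize C' \<le> 1000 * csize C" "\<forall>\<rho>. run C' \<rho> = run C (tensor (length x) (basis x) \<rho>)"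
    using ex_hardwire[of C x] C by auto
  obtain J where J: "wf_circ J" "nin J = rB + rC" "nout J = 1" "csize J \<le> 2000 * (csize B' + csize C')"
    "\<forall>\<sigma>. prob_out (run J \<sigma>) [True] = joint_prob (run B') (run C') \<sigma> [b] [b]"
    using ex_joint[OF B'(1-3) C'(1-3)] by blast
  obtain D where D: "wf_circ D" "nin D = nin S" "nout D = 1" "csize D \<le> 4 * (csize S + csize J)" "\<forall>\<rho>. run D \<rho> = run J (run S \<rho>)"
    using ex_seq[OF S(1) J(1)] S J by auto
  have "run B' = (\<lambda>\<rho>. run B (tensor (length x) (basis x) \<rho>))" "run C' = (\<lambda>\<rho>. run C (tensor (length x) (basis x) \<rho>))"
    using B'(5) C'(5) by auto
  then show ?thesis using D J(4,5) B'(4) C'(4) by (intro exI[of _ D]) auto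
qed

text \<open>An external challenge of \<open>d\<close> qubits arrives first, whereas the obfuscator
  expects it in the middle of its input, between \<open>pl\<close> and \<open>q\<close> qubits
  prepared as advice. Used with a test item as challenge against the one-way function, and with a
  ciphertext against the encryption.\<close>

lemma ex_insert:
  assumes Ob: "wf_circ Ob" "nin Ob = pl + d + q" and D: "wf_circ D" "nin D = nout Ob + st"
  shows "\<exists>E. wf_circ E \<and> nin E = d + (pl + (q + st)) \<and> nout E = nout D \<and> csize E \<le> 100000 * (csize Ob + csize D) \<and>
    (\<forall>\<rho> \<pi> \<sigma> \<phi>. supported d \<rho> \<longrightarrow> supported pl \<pi> \<longrightarrow> supported q \<sigma> \<longrightarrow> supported st \<phi> \<longrightarrow>
      run E (tensor d \<rho> (tensor pl \<pi> (tensor q \<sigma> \<phi>))) = run D (tensor (nout Ob) (run Ob (tensor pl \<pi> (tensor d \<rho> \<sigma>))) \<phi>))"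
proof -
  obtain S where S: "wf_circ S" "nin S = d + pl" "nout S = pl + d" "csize S \<le> 5 * (d + pl)"
    "\<And>\<rho> \<sigma>. supported d \<rho> \<Longrightarrow> supported pl \<sigma> \<Longrightarrow> run S (tensor d \<rho> \<sigma>) = tensor pl \<sigma> \<rho>"
    using ex_swap_tensor[of d pl] by blast
  obtain L1 where L1: "wf_circ L1" "nin L1 = d + pl + (q + st)" "nout L1 = pl + d + (q + st)" "csize L1 \<le> 8 * (csize S + (q + st))"
    "\<And>\<rho> \<sigma>. supported (q + st) \<sigma> \<Longrightarrow> run L1 (tensor (d + pl) \<rho> \<sigma>) = tensor (pl + d) (run S \<rho>) \<sigma>"
    using ex_lift_tensor[OF S(1), of "q + st"] S by auto
  obtain L2 where L2: "wf_circ L2" "nin L2 = pl + d + q + st" "nout L2 = nout Ob + st" "csize L2 \<le> 8 * (csize Ob + st)"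
    "\<And>\<rho> \<sigma>. supported st \<sigma> \<Longrightarrow> run L2 (tensor (pl + d + q) \<rho> \<sigma>) = tensor (nout Ob) (run Ob \<rho>) \<sigma>"
    using ex_lift_tensor[OF Ob(1), of st] Ob by auto
  obtain E1 where E1: "wf_circ E1" "nin E1 = nin L1" "nout E1 = nout L2" "csize E1 \<le> 4 * (csize L1 + csize L2)" "\<forall>\<rho>. run E1 \<rho> = run L2 (run L1 \<rho>)"
    using ex_seq[OF L1(1) L2(1)] L1 L2 by (auto simp: add.assoc)
  obtain E where E: "wf_circ E" "nin E = nin L1" "nout E = nout D" "csize E \<le> 4 * (csize E1 + csize D)" "\<forall>\<rho>. run E \<rho> = run D (run E1 \<rho>)"
    using ex_seq[OF E1(1) D(1)] E1 L2 D by auto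
  have "run E (tensor d \<rho> (tensor pl \<pi> (tensor q \<sigma> \<phi>))) = run D (tensor (nout Ob) (run Ob (tensor pl \<pi> (tensor d \<rho> \<sigma>))) \<phi>)"
    if s: "supported d \<rho>" "supported pl \<pi>" "supported q \<sigma>" "supported st \<phi>" for \<rho> \<pi> \<sigma> \<phi>
  proof -
    have "run L1 (tensor (d + pl) (tensor d \<rho> \<pi>) (tensor q \<sigma> \<phi>)) = tensor (pl + d) (tensor pl \<pi> \<rho>) (tensor q \<sigma> \<phi>)"
      using s S(5) by (subst L1(5)) (auto intro: supported_tensor)
    moreover have "run L2 (tensor (pl + d + q) (tensor pl \<pi> (tensor d \<rho> \<sigma>)) \<phi>) = tensor (nout Ob) (run Ob (tensor pl \<pi> (tensor d \<rho> \<sigma>))) \<phi>"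
      using s L2(5) by simp
    ultimately show ?thesis
      unfolding E(5)[rule_format] E1(5)[rule_format] by (simp add: tensor_assoc add.assoc)
  qed
  moreover have "csize E \<le> 100000 * (csize Ob + csize D)"
    using E(4) E1(4) L1(4) L2(4) S(4) csize_ge(1)[of Ob] csize_ge(1)[of D] Ob(2) D(2) by simp
  ultimately show ?thesis using E L1 by (intro exI[of _ E]) (auto simp: add.assoc)
qed

lemma length_gate_bits: "length (gate_bits N g) = 6 + 3 * N"
  by (cases g) (auto simp: gate_code_def onehot_def)

lemma length_desc: "length (desc C) = desc_length (wires C) (length (gates C))"
proof -
  have "length (concat (map (gate_bits N) gs)) = length gs * (6 + 3 * N)" for N gs
    by (induction gs) (auto simp: length_gate_bits)
  then show ?thesis by (simp add: desc_def desc_length_def)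
qed

context test_data
begin

lemma block_append: "length V1 = j * m \<Longrightarrow> length a = m \<Longrightarrow> block j (V1 @ a @ V2) = a"
  by (rule nth_equalityI) (auto simp: block_def nth_append)

lemma block_append_other:
  assumes l: "length V1 = j * m" "length a = m" "length a' = m" "e \<noteq> j"
  shows "block e (V1 @ a @ V2) = block e (V1 @ a' @ V2)"
proof (cases "e < j")
  case True
  then show ?thesis using block_index[of e j _ m] l by (auto simp: block_def nth_append)
next
  case False
  then have "j * m + m \<le> e * m" using l by (metis add.commute mult_Suc mult_le_mono1 linorder_neqE_nat Suc_leI)
  then show ?thesis using l by (auto simp: block_def nth_append)
qed

text \<open>The surrounding strings \<open>pre\<close> and \<open>post\<close> are independent of
  block \<open>j\<close> and its flip, so item \<open>j\<close> can come from an outside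
  challenge.\<close>

lemma items_split:
  assumes j: "j < 2 * l" and V: "length V1 = j * m" and R: "length R1 = j * m"
  shows "\<exists>pre post. length pre = j * dlen \<and> length post = (2 * l - j - 1) * dlen \<and>
    (\<forall>a r \<beta>. length a = m \<longrightarrow> length r = m \<longrightarrow> (\<forall>e. e \<noteq> j \<longrightarrow> \<beta> e = \<beta>0 e) \<longrightarrow>
       items (V1 @ a @ V2) (R1 @ r @ R2) \<beta> = pre @ item a r (\<beta> j) @ post)"
proof -
  let ?z = "replicate m False"
  let ?it = "\<lambda>a r \<beta> e. item (block e (V1 @ a @ V2)) (block e (R1 @ r @ R2)) (\<beta> e)"
  let ?pre = "concat (map (?it ?z ?z \<beta>0) [0..<j])" and ?post = "concat (map (?it ?z ?z \<beta>0) [Suc j..<2 * l])"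
  have lc: "length (concat (map (?it a r \<beta>) xs)) = length xs * dlen" for a r \<beta> xs
    by (induction xs) auto
  show ?thesis
  proof (rule exI[of _ ?pre], rule exI[of _ ?post], intro conjI allI impI)
    show "length ?pre = j * dlen" "length ?post = (2 * l - j - 1) * dlen" unfolding lc by auto
    fix a r :: "bool list" and \<beta> assume h: "length a = m" "length r = m" "\<forall>e. e \<noteq> j \<longrightarrow> \<beta> e = \<beta>0 e"
    have eq: "?it a r \<beta> e = ?it ?z ?z \<beta>0 e" if "e \<noteq> j" for e
      using block_append_other[OF V h(1) _ that, of ?z] block_append_other[OF R h(2) _ that, of ?z] h(3) that by simp
    have "[0..<2 * l] = [0..<j] @ j # [Suc j..<2 * l]"
      using j by (metis upt_add_eq_append upt_conv_Cons le_add_diff_inverse less_imp_le zero_le)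
    then have "items (V1 @ a @ V2) (R1 @ r @ R2) \<beta> = concat (map (?it a r \<beta>) [0..<j]) @ ?it a r \<beta> j @ concat (map (?it a r \<beta>) [Suc j..<2 * l])"
      unfolding items_def by simp
    also have "map (?it a r \<beta>) [0..<j] = map (?it ?z ?z \<beta>0) [0..<j]" using eq by (intro map_cong refl) auto
    also have "map (?it a r \<beta>) [Suc j..<2 * l] = map (?it ?z ?z \<beta>0) [Suc j..<2 * l]" using eq by (intro map_cong refl) auto
    also have "?it a r \<beta> j = item a r (\<beta> j)" using block_append V R h by simp
    finally show "items (V1 @ a @ V2) (R1 @ r @ R2) \<beta> = ?pre @ item a r (\<beta> j) @ ?post" .
  qed
qed

text \<open>The inverter knows only the image of a dead block, yet it has to hand the secret input
  to \<B> and \<C>; this makes that possible.\<close>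

lemma secret_input_dead:
  assumes "length V1 = j * m" "length a = m" "length a' = m" "dead u j"
  shows "secret_input u (V1 @ a @ V2) = secret_input u (V1 @ a' @ V2)"
proof -
  have "2 * i + of_bool (u ! i) \<noteq> j" for i
    using assms(4) by (auto simp: dead_def)
  then have "block (2 * i + of_bool (u ! i)) (V1 @ a @ V2) = block (2 * i + of_bool (u ! i)) (V1 @ a' @ V2)" for i
    by (rule block_append_other[OF assms(1-3)])
  then show ?thesis unfolding secret_input_def by simp
qed

text \<open>A string \<open>V\<close> of \<open>2 * l\<close> blocks splits bijectively into the
  live blocks, which enter the secret input, and the dead ones. So uniform \<open>V\<close> makes
  the middle part of the secret input uniform, and every value is hit once per choice of dead
  blocks.\<close>

lemma sum_selected:
  fixes g :: "bool list \<Rightarrow> real"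
  assumes u: "length u = l"
  shows "(\<Sum>V\<in>bits (2 * l * m). g (secret_input u V)) = 2 ^ (l * m) * (\<Sum>v\<in>bits (l * m). g (u @ v @ rest))"
proof -
  define sel where "sel w V = concat (map (\<lambda>i. block (2 * i + of_bool (w ! i)) V) [0..<l])" for w V
  \<comment> \<open>The dead blocks are those selected by the complement of
    \<open>u\<close>.\<close>
  let ?h = "\<lambda>V. (sel u V, sel (map Not u) V)"
  have len: "length (sel w V) = l * m" for w V unfolding sel_def by (rule length_concat_blocks) simp
  have nth: "sel w V ! (i * m + j) = V ! ((2 * i + of_bool (w ! i)) * m + j)" if "i < l" "j < m" for w V i j
    unfolding sel_def using nth_concat_blocks[of l "\<lambda>i. block (2 * i + of_bool (w ! i)) V" m i j] that by (simp add: block_def)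
  have inj: "inj_on ?h (bits (2 * l * m))"
  proof (rule inj_onI)
    fix V V' assume V: "V \<in> bits (2 * l * m)" "V' \<in> bits (2 * l * m)" and eq: "?h V = ?h V'"
    show "V = V'"
    proof (rule blocks_eqI[of _ "2 * l" m])
      fix e j assume e: "e < 2 * l" and j: "j < m"
      have i: "e div 2 < l" using e by auto
      have "e = 2 * (e div 2) + of_bool (u ! (e div 2)) \<or> e = 2 * (e div 2) + of_bool (map Not u ! (e div 2))"
        using i u by (cases "u ! (e div 2)"; cases "even e") (auto elim!: oddE)
      then show "V ! (e * m + j) = V' ! (e * m + j)"
        using nth[OF i j, of u V] nth[OF i j, of u V'] nth[OF i j, of "map Not u" V] nth[OF i j, of "map Not u" V'] eq by auto
    qed (use V in auto)
  qed
  have im: "?h ` bits (2 * l * m) = bits (l * m) \<times> bits (l * m)"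
  proof (rule card_subset_eq)
    show "?h ` bits (2 * l * m) \<subseteq> bits (l * m) \<times> bits (l * m)" using len by auto
    have "card (?h ` bits (2 * l * m)) = 2 ^ (2 * l * m)" using card_image[OF inj] by (simp add: card_bits)
    also have "\<dots> = card (bits (l * m) \<times> bits (l * m))" by (simp add: card_cartesian_product card_bits flip: power_add mult_2)
    finally show "card (?h ` bits (2 * l * m)) = card (bits (l * m) \<times> bits (l * m))" .
  qed simp
  have "(\<Sum>V\<in>bits (2 * l * m). g (secret_input u V)) = (\<Sum>V\<in>bits (2 * l * m). (\<lambda>(v, w). g (u @ v @ rest)) (?h V))"
    by (simp add: secret_input_def sel_def)
  also have "\<dots> = (\<Sum>(v, w)\<in>bits (l * m) \<times> bits (l * m). g (u @ v @ rest))"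
    unfolding im[symmetric] by (subst sum.reindex[OF inj]) (simp add: o_def)
  also have "\<dots> = 2 ^ (l * m) * (\<Sum>v\<in>bits (l * m). g (u @ v @ rest))"
    by (simp add: sum.cartesian_product[symmetric] card_bits sum_distrib_left)
  finally show ?thesis .
qed

end

text \<open>Goldreich-Levin bounds the mean of squared advantages over preimages; Cauchy-Schwarz
  turns this into a bound for the mean advantage.\<close>

lemma sum_abs_le_sqrt:
  fixes f :: "'a \<Rightarrow> real"
  assumes "finite A" "(\<Sum>x\<in>A. (f x)\<^sup>2) \<le> real (card A) * \<eta>\<^sup>2" "0 \<le> \<eta>"
  shows "\<bar>\<Sum>x\<in>A. f x\<bar> \<le> real (card A) * \<eta>"
proof -
  have "(\<Sum>x\<in>A. f x)\<^sup>2 \<le> (\<Sum>x\<in>A. (f x)\<^sup>2) * real (card A)"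
    using sum_squared_le_sum_of_squares[of f A] by simp
  also have "\<dots> \<le> (real (card A) * \<eta>)\<^sup>2"
    using assms(2) mult_right_mono[OF assms(2), of "real (card A)"] by (simp add: power2_eq_square mult_ac)
  finally show ?thesis using assms(3) by (simp add: abs_le_square_iff[symmetric])
qed

lemma tensor_sum_left: "tensor a (\<lambda>x y. \<Sum>i\<in>I. c i * \<rho> i x y) \<sigma> = (\<lambda>x y. \<Sum>i\<in>I. c i * tensor a (\<rho> i) \<sigma> x y)"
  unfolding tensor_def fun_eq_iff by (simp add: sum_distrib_right mult.assoc)

lemma tensor_sum_right: "tensor a \<sigma> (\<lambda>x y. \<Sum>i\<in>I. c i * \<rho> i x y) = (\<lambda>x y. \<Sum>i\<in>I. c i * tensor a \<sigma> (\<rho> i) x y)"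
  unfolding tensor_def fun_eq_iff by (simp add: sum_distrib_left mult_ac)

lemma run_sum_fun: "run C (\<lambda>x x'. \<Sum>i\<in>I. c i * \<rho> i x x') = (\<lambda>y y'. \<Sum>i\<in>I. c i * run C (\<rho> i) y y')"
  by (intro ext run_sum)

lemma xor_list_cancel_left: "length u = length v \<Longrightarrow> xor_list u (xor_list u v) = v"
  by (rule nth_equalityI) (auto simp: nth_xor_list)

lemma abs_sum_le:
  fixes f g :: "'a \<Rightarrow> real"
  shows "(\<And>x. x \<in> A \<Longrightarrow> \<bar>f x\<bar> \<le> g x) \<Longrightarrow> \<bar>sum f A\<bar> \<le> sum g A"
  by (rule order_trans[OF sum_abs sum_mono])

text \<open>
  The program \<open>P\<close> reads an input \<open>x\<close>, the data of the tests, a masked key and a ciphertext. It unmasks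
  the key with the selector bits of \<open>x\<close>, decrypts, and outputs \<open>M(x)\<close> if \<open>x\<close> passes all tests and the
  plaintext is 1, and \<open>W(x)\<close> otherwise. In \<open>win b u V R \<beta>\<close> the game is played with the
  obfuscation of \<open>P\<close>, where \<open>\<beta>\<close> marks the flipped tests.
\<close>

locale reduction = test_data l m n F rest
  for l m n :: nat and F :: circ and rest :: "bool list" +
  fixes W M P Enc Dec Ob S2 B C :: circ and pr :: "bool list \<Rightarrow> real" and \<phi> :: qop and mo cl p st rB rC :: nat
  assumes W: "wf_circ W" "classical W" "nin W = n" "nout W = mo"
    and M: "wf_circ M" "classical M" "nin M = n" "nout M = mo"
    and Enc: "wf_circ Enc" "nin Enc = l + 1" "nout Enc = cl"
    and Dec: "wf_circ Dec" "nin Dec = l + cl" "nout Dec = 1"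
    and pr: "\<And>sk. 0 \<le> pr sk" "(\<Sum>sk\<in>bits l. pr sk) = 1"
    and P: "wf_circ P" "nin P = n + (2 * l * dlen + l + cl)" "nout P = mo" "csize P \<le> p"
    and run_P: "\<And>x d z ct out. x \<in> bits n \<Longrightarrow> d \<in> bits (2 * l * dlen) \<Longrightarrow> z \<in> bits l \<Longrightarrow> supported cl ct \<Longrightarrow> out \<in> bits mo \<Longrightarrow>
      prob_out (run P (tensor n (basis x) (tensor (2 * l * dlen) (basis d) (tensor l (basis z) ct)))) out =
      (\<Sum>c\<in>UNIV. prob_out (run Dec (tensor l (basis (xor_list z (take l x))) ct)) [c] *
         of_bool ((if c \<and> accepts (x @ d @ z) then ceval M x else ceval W x) = out))"
    and \<phi>: "density st \<phi>"
    and S2: "wf_circ S2" "nin S2 = nout Ob + st" "nout S2 = rB + rC"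
    and B: "wf_circ B" "nin B = n + rB" "nout B = 1"
    and C: "wf_circ C" "nin C = n + rC" "nout C = 1"
    and Ob: "wf_circ Ob" "nin Ob = desc_length (n + p + p) p + p"
begin

definition ez where "ez = p - (2 * l * dlen + l + cl)"

text \<open>Gives \<open>P\<close> the shape that \<open>pad_circ\<close> gives to a class circuit:
  \<open>n\<close> inputs, \<open>p\<close> state qubits, \<open>p\<close> ancillas and
  \<open>p\<close> gates. Obfuscation security compares only programs of the same size; the
  \<open>ez\<close> zero qubits fill up the state.\<close>

definition padded where "padded = Circ (nin P + ez) p (nout P) (gates P @ replicate (p - length (gates P)) Idle)"

definition key_state :: "bool \<Rightarrow> bool list \<Rightarrow> bool list \<Rightarrow> qop" where
  "key_state b z sk = tensor l (basis z) (tensor cl (run Enc (basis (sk @ [b]))) (basis (replicate ez False)))"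

text \<open>The key is drawn inside the program state: a single key may decrypt badly, and only the
  average over keys is a good implementation.\<close>

definition key_mixture :: "bool \<Rightarrow> bool list \<Rightarrow> qop" where
  "key_mixture b u = (\<lambda>x y. \<Sum>sk\<in>bits l. of_real (pr sk) * key_state b (xor_list sk u) sk x y)"

definition program_state :: "bool list \<Rightarrow> qop \<Rightarrow> qop" where
  "program_state d \<sigma> = tensor (2 * l * dlen) (basis d) \<sigma>"

definition obfuscated :: "bool list \<Rightarrow> qop \<Rightarrow> qop" where
  "obfuscated d \<sigma> = run Ob (tensor (length (desc padded)) (basis (desc padded)) (program_state d \<sigma>))"

text \<open>The end of the game with everything before the challenge fixed; \<phi> is the state that
  \<A> keeps after sending its message.\<close>

definition both_output :: "bool \<Rightarrow> bool list \<Rightarrow> qop \<Rightarrow> real" where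
  "both_output b x ch = joint_prob (\<lambda>\<sigma>. run B (tensor (length x) (basis x) \<sigma>)) (\<lambda>\<sigma>. run C (tensor (length x) (basis x) \<sigma>))
     (run S2 (tensor (nout Ob) ch \<phi>)) [b] [b]"

definition win :: "bool \<Rightarrow> bool list \<Rightarrow> bool list \<Rightarrow> bool list \<Rightarrow> (nat \<Rightarrow> bool) \<Rightarrow> real" where
  "win b u V R \<beta> = both_output b (secret_input u V) (obfuscated (items V R \<beta>) (key_mixture b u))"

definition test_size where "test_size = 10000000 * (csize S2 + csize B + csize C)"

lemma p_eq: "p = 2 * l * dlen + (l + (cl + ez))"
  using P(2,4) csize_ge(1)[of P] by (simp add: ez_def)

lemma length_desc_padded: "length (desc padded) = desc_length (n + p + p) p"
proof -
  have "length (gates padded) = p" using P(4) csize_ge(4)[of P] by (simp add: padded_def)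
  moreover have "wires padded = n + p + p" using P(2) p_eq by (simp add: padded_def wires_def)
  ultimately show ?thesis by (simp add: length_desc)
qed

text \<open>Positivity is built from the inside: basis states are put in front of \<psi>, then
  \<open>Enc\<close> acts on the part \<open>sk @ [b]\<close>, and finally \<open>z\<close> is
  prepended.\<close>

lemma key_state_phi_density:
  assumes "length z = l" "length sk = l" "density k \<psi>"
  shows "density (l + (cl + (ez + k))) (tensor (l + (cl + ez)) (key_state b z sk) \<psi>)"
proof -
  have 1: "density (ez + k) (tensor ez (basis (replicate ez False)) \<psi>)"
    using density_tensor_basis[OF assms(3), of "replicate ez False"] by simp
  have "density (l + 1 + (ez + k)) (tensor (l + 1) (basis (sk @ [b])) (tensor ez (basis (replicate ez False)) \<psi>))"
    using density_tensor_basis[OF 1, of "sk @ [b]"] assms by simp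
  then have "density (cl + (ez + k)) (tensor cl (run Enc (basis (sk @ [b]))) (tensor ez (basis (replicate ez False)) \<psi>))"
    using density_tensor_run[OF Enc(1), of "ez + k"] Enc(2,3) supported_density[OF 1] by simp
  from density_tensor_basis[OF this, of z] show ?thesis
    using assms by (simp add: key_state_def tensor_assoc)
qed

lemma key_state_density:
  assumes "length z = l" "length sk = l"
  shows "density (l + (cl + ez)) (key_state b z sk)"
proof -
  have "density cl (run Enc (basis (sk @ [b])))"
    using run_density[OF Enc(1), of "basis (sk @ [b])"] density_basis[of "sk @ [b]" "l + 1"] Enc assms by simp
  from density_tensor_basis_right[OF this, of "replicate ez False"]
  have "density (cl + ez) (tensor cl (run Enc (basis (sk @ [b]))) (basis (replicate ez False)))" by simp
  from density_tensor_basis[OF this, of z] show ?thesis using assms by (simp add: key_state_def)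
qed

lemma key_mixture_density: "length u = l \<Longrightarrow> density (l + (cl + ez)) (key_mixture b u)"
  unfolding key_mixture_def using pr key_state_density by (intro density_mixture) auto

lemma key_mixture_phi_density:
  assumes "length u = l" "density k \<psi>"
  shows "density (l + (cl + ez) + k) (tensor (l + (cl + ez)) (key_mixture b u) \<psi>)"
  unfolding key_mixture_def tensor_sum_left
  using pr key_state_phi_density[OF _ _ assms(2)] assms(1) by (intro density_mixture) (auto simp: add.assoc)

lemma ex_both_output:
  assumes "length x = n"
  shows "\<exists>D. wf_circ D \<and> nin D = nout Ob + st \<and> nout D = 1 \<and> csize D \<le> test_size \<and>
    (\<forall>ch. prob_out (run D (tensor (nout Ob) ch \<phi>)) [True] = both_output b x ch)"
  using ex_test[OF S2(1,3) B(1) _ B(3) C(1) _ C(3), of x b] B(2) C(2) S2(2) assms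
  unfolding both_output_def test_size_def by metis

text \<open>Linearity in the challenge is read off from the single circuit that computes both
  answers.\<close>

lemma both_output_mixture:
  assumes "length x = n"
  shows "both_output b x (obfuscated d (key_mixture b u)) = (\<Sum>sk\<in>bits l. pr sk * both_output b x (obfuscated d (key_state b (xor_list sk u) sk)))"
proof -
  obtain D where D: "\<And>ch. prob_out (run D (tensor (nout Ob) ch \<phi>)) [True] = both_output b x ch"
    using ex_both_output[OF assms, of b] by blast
  have "obfuscated d (key_mixture b u) = (\<lambda>x y. \<Sum>sk\<in>bits l. of_real (pr sk) * obfuscated d (key_state b (xor_list sk u) sk) x y)"
    unfolding obfuscated_def program_state_def key_mixture_def tensor_sum_right run_sum_fun ..
  then show ?thesis
    unfolding D[symmetric] by (simp only: tensor_sum_left run_sum_fun prob_out_def) simp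
qed

text \<open>At the secret input the selector bits are \<open>u\<close>, unmasking yields
  \<open>sk\<close>, and the average decryption guarantee gives the plaintext \<open>b\<close>.
  Everywhere else the tests reject, and \<open>W\<close> is evaluated whatever the decryption
  returns.\<close>

lemma implementation_padded:
  assumes u: "length u = l" and VR: "V \<in> bits (2 * l * m)" "R \<in> bits (2 * l * m)" and \<epsilon>: "0 \<le> \<epsilon>"
    and dec: "1 - \<epsilon> \<le> (\<Sum>sk\<in>bits l. pr sk * prob_out (run Dec (tensor l (basis sk) (run Enc (basis (sk @ [b]))))) [b])"
    and f: "\<And>x. x \<in> bits n \<Longrightarrow> f x = (if x = secret_input u V \<and> b then ceval M x else ceval W x)"
  shows "implementation \<epsilon> p padded (program_state (items V R (dead u)) (key_mixture b u)) f"
  unfolding implementation_def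
proof
  have nP: "nin padded - p = n" using P(2) p_eq by (simp add: padded_def)
  fix x assume "x \<in> bits (nin padded - p)"
  then have x: "length x = n" unfolding nP by simp
  let ?d = "items V R (dead u)" and ?x = "secret_input u V"
  let ?ct = "\<lambda>sk. run Enc (basis (sk @ [b]))"
  have ct: "supported cl (?ct sk)" for sk using supported_run[OF Enc(1)] Enc(3) by simp
  have fx: "f x \<in> bits mo"
    using f[of x] x M W by (auto simp: ceval_def wf_circ_def wires_def)
  have run1: "prob_out (run padded (tensor n (basis x) (program_state ?d (key_state b (xor_list sk u) sk)))) (f x) =
      (\<Sum>c\<in>UNIV. prob_out (run Dec (tensor l (basis (xor_list (xor_list sk u) (take l x))) (?ct sk))) [c] *
         of_bool ((if c \<and> x = ?x then ceval M x else ceval W x) = f x))" if sk: "sk \<in> bits l" for sk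
  proof -
    have "tensor n (basis x) (program_state ?d (key_state b (xor_list sk u) sk)) =
      tensor (nin P) (tensor n (basis x) (tensor (2 * l * dlen) (basis ?d) (tensor l (basis (xor_list sk u)) (?ct sk)))) (basis (replicate ez False))"
      unfolding program_state_def key_state_def P(2) by (simp add: tensor_assoc add.assoc)
    moreover have "nanc P \<le> ez + p" using P(4) csize_ge(2)[of P] by simp
    ultimately have "run padded (tensor n (basis x) (program_state ?d (key_state b (xor_list sk u) sk))) =
      run P (tensor n (basis x) (tensor (2 * l * dlen) (basis ?d) (tensor l (basis (xor_list sk u)) (?ct sk))))"
      unfolding padded_def using run_padded(2)[OF P(1)] by simp
    then show ?thesis
      using run_P[of x ?d "xor_list sk u" "?ct sk" "f x"] accepts_iff[OF u x, of "dead u" V R "xor_list sk u"] x u sk ct fx by simp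
  qed
  have sum1: "(\<Sum>c\<in>UNIV. prob_out (run Dec (tensor l (basis z) (?ct sk))) [c]) = 1" and pos: "0 \<le> prob_out (run Dec (tensor l (basis z) (?ct sk))) y"
    if "sk \<in> bits l" "z \<in> bits l" for sk z y
  proof -
    have "density cl (?ct sk)"
      using run_density[OF Enc(1), of "basis (sk @ [b])"] density_basis[of "sk @ [b]" "l + 1"] Enc that by simp
    then have "density (l + cl) (tensor l (basis z) (?ct sk))" using density_tensor_basis[of cl "?ct sk" z] that by simp
    then have d: "density 1 (run Dec (tensor l (basis z) (?ct sk)))" using run_density[OF Dec(1)] Dec by simp
    then show "0 \<le> prob_out (run Dec (tensor l (basis z) (?ct sk))) y"
      using prob_out_nonneg by (auto simp: density_iff)
    show "(\<Sum>c\<in>UNIV. prob_out (run Dec (tensor l (basis z) (?ct sk))) [c]) = 1"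
      using sum_prob_out[of "run Dec (tensor l (basis z) (?ct sk))" 1] d by (simp add: density_iff sum_bits_1 UNIV_bool)
  qed
  have ge: "pr sk * prob_out (run padded (tensor n (basis x) (program_state ?d (key_state b (xor_list sk u) sk)))) (f x)
     \<ge> (if x = ?x then pr sk * prob_out (run Dec (tensor l (basis sk) (?ct sk))) [b] else pr sk)" if sk: "sk \<in> bits l" for sk
  proof (cases "x = ?x")
    case True
    have tk: "take l ?x = u" using u by (simp add: secret_input_def)
    have key: "xor_list (xor_list sk u) (take l x) = sk" unfolding True tk using sk u by (intro xor_list_cancel) simp
    have "prob_out (run Dec (tensor l (basis sk) (?ct sk))) [b] * of_bool ((if b \<and> x = ?x then ceval M x else ceval W x) = f x)
      \<le> (\<Sum>c\<in>UNIV. prob_out (run Dec (tensor l (basis sk) (?ct sk))) [c] * of_bool ((if c \<and> x = ?x then ceval M x else ceval W x) = f x))"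
      using pos[OF sk] sk by (intro member_le_sum) auto
    moreover have "f x = (if b \<and> x = ?x then ceval M x else ceval W x)" using f[of x] x by auto
    ultimately show ?thesis using run1[OF sk] key True pr(1)[of sk] by (simp add: mult_left_mono)
  next
    case False
    then have "f x = ceval W x" using f[of x] x by auto
    then have "prob_out (run padded (tensor n (basis x) (program_state ?d (key_state b (xor_list sk u) sk)))) (f x) = 1"
      using run1[OF sk] sum1[OF sk, of "xor_list (xor_list sk u) (take l x)"] False sk u x ln by simp
    with False show ?thesis by simp
  qed
  have "1 - \<epsilon> \<le> (\<Sum>sk\<in>bits l. if x = ?x then pr sk * prob_out (run Dec (tensor l (basis sk) (?ct sk))) [b] else pr sk)"
    using dec pr(2) \<epsilon> by (cases "x = ?x") auto
  also have "\<dots> \<le> (\<Sum>sk\<in>bits l. pr sk * prob_out (run padded (tensor n (basis x) (program_state ?d (key_state b (xor_list sk u) sk)))) (f x))"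
    by (intro sum_mono ge)
  also have "\<dots> = prob_out (run padded (tensor n (basis x) (program_state ?d (key_mixture b u)))) (f x)"
    unfolding program_state_def key_mixture_def tensor_sum_right run_sum_fun prob_out_def by simp
  finally show "prob_out (run padded (tensor (nin padded - p) (basis x) (program_state ?d (key_mixture b u)))) (f x) \<ge> 1 - \<epsilon>"
    unfolding nP .
qed

lemma program_state_density:
  "length u = l \<Longrightarrow> density p (program_state (items V R \<beta>) (key_mixture b u))"
  using density_tensor_basis[OF key_mixture_density, of u "items V R \<beta>" b] p_eq by (simp add: program_state_def)

text \<open>An adversary that notices the flip predicts the inner product, hence inverts \<open>F\<close> by the Goldreich--Levin theorem.\<close>

lemma hybrid_step:
  assumes owf: "owf_bound F (10000000 * (csize Ob + test_size)) (\<eta>\<^sup>2)" and \<eta>: "0 \<le> \<eta>"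
    and u: "length u = l" and j: "j < 2 * l" and dj: "dead u j"
    and V: "length V1 = j * m" and R: "length R1 = j * m"
  shows "\<bar>\<Sum>a\<in>bits m. \<Sum>r\<in>bits m. win b u (V1 @ a @ V2) (R1 @ r @ R2) (\<lambda>e. j \<le> e \<and> dead u e)
     - win b u (V1 @ a @ V2) (R1 @ r @ R2) (\<lambda>e. Suc j \<le> e \<and> dead u e)\<bar> \<le> 2 ^ m * 2 ^ m * \<eta>"
proof -
  obtain pre post where it: "length pre = j * dlen" "length post = (2 * l - j - 1) * dlen"
    "\<And>a r \<beta>. length a = m \<Longrightarrow> length r = m \<Longrightarrow> (\<forall>e. e \<noteq> j \<longrightarrow> \<beta> e = (j \<le> e \<and> dead u e)) \<Longrightarrow>
       items (V1 @ a @ V2) (R1 @ r @ R2) \<beta> = pre @ item a r (\<beta> j) @ post"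
    using items_split[OF j V R, of "\<lambda>e. j \<le> e \<and> dead u e" V2 R2] by blast
  \<comment> \<open>Block \<open>j\<close> is dead, so the secret input does not change with the
    unknown preimage \<open>a\<close> and can be hardwired.\<close>
  define x0 where "x0 = secret_input u (V1 @ replicate m False @ V2)"
  have x0: "secret_input u (V1 @ a @ V2) = x0" if "length a = m" for a
    unfolding x0_def using secret_input_dead[OF V that _ dj, of "replicate m False"] by simp
  obtain D where D: "wf_circ D" "nin D = nout Ob + st" "nout D = 1" "csize D \<le> test_size"
    "\<And>ch. prob_out (run D (tensor (nout Ob) ch \<phi>)) [True] = both_output b x0 ch"
    using ex_both_output[of x0 b] u by (auto simp: x0_def)
  define dsc where "dsc = desc padded"
  \<comment> \<open>Lengths of the obfuscator input to the left and to the right of item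
    \<open>j\<close>.\<close>
  define pl q where "pl = length dsc + j * dlen" and "q = (2 * l - j - 1) * dlen + (l + (cl + ez))"
  have dl: "2 * l * dlen = j * dlen + (dlen + (2 * l - j - 1) * dlen)"
  proof -
    have "2 * l = j + (1 + (2 * l - j - 1))" using j by simp
    then have "2 * l * dlen = (j + (1 + (2 * l - j - 1))) * dlen" by simp
    then show ?thesis by (simp only: distrib_right mult_1)
  qed
  have "nin Ob = pl + dlen + q"
    using Ob(2) length_desc_padded p_eq dl unfolding pl_def q_def dsc_def by linarith
  from ex_insert[OF Ob(1) this D(1,2)]
  obtain E where E: "wf_circ E" "nin E = dlen + (pl + (q + st))" "nout E = 1" "csize E \<le> 100000 * (csize Ob + csize D)"
    "\<And>\<rho> \<pi> \<sigma> \<phi>. supported dlen \<rho> \<Longrightarrow> supported pl \<pi> \<Longrightarrow> supported q \<sigma> \<Longrightarrow> supported st \<phi> \<Longrightarrow>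
      run E (tensor dlen \<rho> (tensor pl \<pi> (tensor q \<sigma> \<phi>))) = run D (tensor (nout Ob) (run Ob (tensor pl \<pi> (tensor dlen \<rho> \<sigma>))) \<phi>)"
    unfolding D(3) by blast
  define t where "t = pl + (q + st)"
  \<comment> \<open>Everything but item \<open>j\<close> is fixed and becomes advice of the
    predictor, including the mixed key state and \<phi>.\<close>
  define \<tau> where "\<tau> = tensor pl (basis (dsc @ pre)) (tensor q (tensor (length post) (basis post) (key_mixture b u)) \<phi>)"
  have "nin E = yl + (m + 1) + t" using E(2) by (simp add: dlen_def t_def)
  from goldreich_levin[OF E(1) this E(3)]
  obtain A where A: "wf_circ A" "nin A = yl + (m + 1 + t)" "nout A = m" "csize A \<le> 100 * csize E"
    "\<And>y v \<tau>. y \<in> bits yl \<Longrightarrow> v \<in> bits m \<Longrightarrow> density t \<tau> \<Longrightarrow>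
       ((\<Sum>r\<in>bits m. prob_out (run E (tensor (yl + (m + 1)) (basis (y @ r @ [\<not> ip r v])) \<tau>)) [True]
          - prob_out (run E (tensor (yl + (m + 1)) (basis (y @ r @ [ip r v])) \<tau>)) [True]) / 2 ^ m)\<^sup>2
       \<le> prob_out (run A (tensor yl (basis y) (tensor (m + 1) (basis (replicate (m + 1) False)) \<tau>))) v"
    unfolding Let_def by blast
  have \<tau>: "density t \<tau>"
  proof -
    have "density (length post + (l + (cl + ez) + st)) (tensor (length post) (basis post) (tensor (l + (cl + ez)) (key_mixture b u) \<phi>))"
      by (rule density_tensor_basis[OF key_mixture_phi_density[OF u \<phi>]])
    then have "density (q + st) (tensor q (tensor (length post) (basis post) (key_mixture b u)) \<phi>)"
      unfolding q_def using it(2) by (simp add: tensor_assoc add.assoc)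
    from density_tensor_basis[OF this, of "dsc @ pre"] show ?thesis
      using it(1) by (simp add: \<tau>_def t_def pl_def)
  qed
  have E_win: "prob_out (run E (tensor (yl + (m + 1)) (basis (ceval F a @ r @ [ip r a \<noteq> \<beta> j])) \<tau>)) [True] = win b u (V1 @ a @ V2) (R1 @ r @ R2) \<beta>"
    if l: "length a = m" "length r = m" and \<beta>: "\<forall>e. e \<noteq> j \<longrightarrow> \<beta> e = (j \<le> e \<and> dead u e)" for a r \<beta>
  proof -
    let ?K = "key_mixture b u" and ?i = "item a r (\<beta> j)"
    have li: "length ?i = dlen" using l by simp
    have sK: "supported (l + (cl + ez)) ?K" by (rule supported_density[OF key_mixture_density[OF u]])
    have sp: "supported q (tensor (length post) (basis post) ?K)"
      unfolding q_def it(2)[symmetric] by (intro supported_tensor supported_basis sK) simp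
    have "run E (tensor (yl + (m + 1)) (basis (ceval F a @ r @ [ip r a \<noteq> \<beta> j])) \<tau>) = run E (tensor dlen (basis ?i) \<tau>)"
      by (simp add: item_def dlen_def)
    also have "\<dots> = run D (tensor (nout Ob) (run Ob (tensor pl (basis (dsc @ pre)) (tensor dlen (basis ?i) (tensor (length post) (basis post) ?K)))) \<phi>)"
      unfolding \<tau>_def using li it(1) sp supported_density[OF \<phi>] by (intro E(5) supported_basis) (auto simp: pl_def)
    also have "tensor pl (basis (dsc @ pre)) (tensor dlen (basis ?i) (tensor (length post) (basis post) ?K)) =
        tensor (length dsc) (basis dsc) (program_state (items (V1 @ a @ V2) (R1 @ r @ R2) \<beta>) ?K)"
    proof -
      have "basis (pre @ ?i @ post) = tensor (j * dlen) (basis pre) (tensor dlen (basis ?i) (basis post))"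
        using basis_append[OF it(1), of "?i @ post"] basis_append[OF li, of post] by simp
      then have "tensor (2 * l * dlen) (basis (pre @ ?i @ post)) ?K = tensor (j * dlen) (basis pre) (tensor dlen (basis ?i) (tensor (length post) (basis post) ?K))"
        unfolding dl it(2)[symmetric] by (simp only: tensor_assoc)
      moreover have "tensor pl (basis (dsc @ pre)) X = tensor (length dsc) (basis dsc) (tensor (j * dlen) (basis pre) X)" for X
        unfolding pl_def using basis_append[of dsc "length dsc" pre] by (simp add: tensor_assoc[symmetric])
      ultimately show ?thesis unfolding program_state_def it(3)[OF l \<beta>] by simp
    qed
    finally show ?thesis
      unfolding win_def x0[OF l(1)] obfuscated_def dsc_def[symmetric] using D(5) by simp
  qed
  \<comment> \<open>Advantage at preimage \<open>a\<close> averaged over the mask \<open>r\<close>;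
    its square is bounded by the probability that the inverter returns \<open>a\<close>.\<close>
  define \<Delta> where "\<Delta> a = (\<Sum>r\<in>bits m. win b u (V1 @ a @ V2) (R1 @ r @ R2) (\<lambda>e. j \<le> e \<and> dead u e)
     - win b u (V1 @ a @ V2) (R1 @ r @ R2) (\<lambda>e. Suc j \<le> e \<and> dead u e)) / 2 ^ m" for a
  have \<Delta>: "(\<Delta> a)\<^sup>2 \<le> prob_out (run A (tensor yl (basis (ceval F a)) (tensor (m + 1) (basis (replicate (m + 1) False)) \<tau>))) a"
    if a: "a \<in> bits m" for a
  proof -
    have "win b u (V1 @ a @ V2) (R1 @ r @ R2) (\<lambda>e. j \<le> e \<and> dead u e)
       = prob_out (run E (tensor (yl + (m + 1)) (basis (ceval F a @ r @ [\<not> ip r a])) \<tau>)) [True]"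
      "win b u (V1 @ a @ V2) (R1 @ r @ R2) (\<lambda>e. Suc j \<le> e \<and> dead u e)
       = prob_out (run E (tensor (yl + (m + 1)) (basis (ceval F a @ r @ [ip r a])) \<tau>)) [True]" if "r \<in> bits m" for r
    proof -
      have c: "\<forall>e. e \<noteq> j \<longrightarrow> (Suc j \<le> e \<and> dead u e) = (j \<le> e \<and> dead u e)" by auto
      show "win b u (V1 @ a @ V2) (R1 @ r @ R2) (\<lambda>e. j \<le> e \<and> dead u e)
       = prob_out (run E (tensor (yl + (m + 1)) (basis (ceval F a @ r @ [\<not> ip r a])) \<tau>)) [True]"
        using E_win[of a r "\<lambda>e. j \<le> e \<and> dead u e"] a that dj by simp
      show "win b u (V1 @ a @ V2) (R1 @ r @ R2) (\<lambda>e. Suc j \<le> e \<and> dead u e)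
       = prob_out (run E (tensor (yl + (m + 1)) (basis (ceval F a @ r @ [ip r a])) \<tau>)) [True]"
        using E_win[OF _ _ c, of a r] a that by simp
    qed
    then have "\<Delta> a = (\<Sum>r\<in>bits m. prob_out (run E (tensor (yl + (m + 1)) (basis (ceval F a @ r @ [\<not> ip r a])) \<tau>)) [True]
          - prob_out (run E (tensor (yl + (m + 1)) (basis (ceval F a @ r @ [ip r a])) \<tau>)) [True]) / 2 ^ m"
      unfolding \<Delta>_def by (intro arg_cong2[of _ _ _ _ "(/)"] sum.cong refl) (simp only:)
    then show ?thesis using A(5)[OF _ a \<tau>, of "ceval F a"] a by simp
  qed
  \<comment> \<open>The zero register that the Goldreich-Levin circuit expects is counted as part of
    the inverter's advice.\<close>
  have "density (m + 1 + t) (tensor (m + 1) (basis (replicate (m + 1) False)) \<tau>)"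
    using density_tensor_basis[OF \<tau>, of "replicate (m + 1) False"] by simp
  moreover have "csize A \<le> 10000000 * (csize Ob + test_size)" using A(4) E(4) D(4) by simp
  ultimately have "(\<Sum>a\<in>bits m. prob_out (run A (tensor yl (basis (ceval F a)) (tensor (m + 1) (basis (replicate (m + 1) False)) \<tau>))) a / 2 ^ m) \<le> \<eta>\<^sup>2"
    using A(1-3) owf[unfolded owf_bound_def] by (simp add: F yl_def)
  then have "(\<Sum>a\<in>bits m. prob_out (run A (tensor yl (basis (ceval F a)) (tensor (m + 1) (basis (replicate (m + 1) False)) \<tau>))) a) \<le> real (card (bits m)) * \<eta>\<^sup>2"
    by (simp add: card_bits field_simps flip: sum_divide_distrib)
  then have "(\<Sum>a\<in>bits m. (\<Delta> a)\<^sup>2) \<le> real (card (bits m)) * \<eta>\<^sup>2"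
    by (rule order_trans[rotated]) (intro sum_mono \<Delta>)
  then have "\<bar>\<Sum>a\<in>bits m. \<Delta> a\<bar> \<le> 2 ^ m * \<eta>"
    using sum_abs_le_sqrt[OF finite_bits _ \<eta>] by (simp add: card_bits)
  then have "2 ^ m * \<bar>\<Sum>a\<in>bits m. \<Delta> a\<bar> \<le> 2 ^ m * (2 ^ m * \<eta>)" by (intro mult_left_mono) auto
  moreover have "2 ^ m * \<bar>\<Sum>a\<in>bits m. \<Delta> a\<bar> = \<bar>2 ^ m * (\<Sum>a\<in>bits m. \<Delta> a)\<bar>" by (simp add: abs_mult)
  moreover have "2 ^ m * (\<Sum>a\<in>bits m. \<Delta> a) = (\<Sum>a\<in>bits m. \<Sum>r\<in>bits m. win b u (V1 @ a @ V2) (R1 @ r @ R2) (\<lambda>e. j \<le> e \<and> dead u e)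
     - win b u (V1 @ a @ V2) (R1 @ r @ R2) (\<lambda>e. Suc j \<le> e \<and> dead u e))"
    unfolding \<Delta>_def sum_distrib_left by simp
  ultimately show ?thesis by (simp only: mult.assoc)
qed

lemma win_cong: "(\<And>e. e < 2 * l \<Longrightarrow> \<beta> e = \<beta>' e) \<Longrightarrow> win b u V R \<beta> = win b u V R \<beta>'"
proof -
  assume "\<And>e. e < 2 * l \<Longrightarrow> \<beta> e = \<beta>' e"
  then have "items V R \<beta> = items V R \<beta>'" unfolding items_def by (intro arg_cong[of _ _ concat] map_cong) auto
  then show ?thesis by (simp add: win_def)
qed

text \<open>Hybrid \<open>T j\<close> keeps flipped only the dead tests from \<open>j\<close> on.
  Passing a live test changes nothing; passing a dead one costs the bound of
  \<open>hybrid_step\<close>, summed over all other blocks and masks.\<close>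

lemma hybrid_all:
  assumes owf: "owf_bound F (10000000 * (csize Ob + test_size)) (\<eta>\<^sup>2)" and \<eta>: "0 \<le> \<eta>"
    and u: "length u = l"
  shows "\<bar>(\<Sum>V\<in>bits (2 * l * m). \<Sum>R\<in>bits (2 * l * m). win b u V R (dead u))
     - (\<Sum>V\<in>bits (2 * l * m). \<Sum>R\<in>bits (2 * l * m). win b u V R (\<lambda>_. False))\<bar> \<le> real (2 * l) * (2 ^ (2 * l * m) * 2 ^ (2 * l * m) * \<eta>)"
proof -
  let ?K = "2 * l * m"
  define T where "T j = (\<Sum>V\<in>bits ?K. \<Sum>R\<in>bits ?K. win b u V R (\<lambda>e. j \<le> e \<and> dead u e))" for j
  have step: "\<bar>T j - T (Suc j)\<bar> \<le> 2 ^ ?K * 2 ^ ?K * \<eta>" if j: "j < 2 * l" for j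
  proof (cases "dead u j")
    case False
    have "(j \<le> e \<and> dead u e) = (Suc j \<le> e \<and> dead u e)" for e
      using False by (auto simp: Suc_le_eq order.order_iff_strict)
    then have "T j = T (Suc j)" unfolding T_def by presburger
    then show ?thesis using \<eta> by simp
  next
    case True
    let ?w = "\<lambda>V R. win b u V R (\<lambda>e. j \<le> e \<and> dead u e) - win b u V R (\<lambda>e. Suc j \<le> e \<and> dead u e)"
    define k where "k = (2 * l - j - 1) * m"
    have K: "?K = j * m + (m + k)"
    proof -
      have "2 * l = j + (1 + (2 * l - j - 1))" using j by simp
      then have "?K = (j + (1 + (2 * l - j - 1))) * m" by simp
      then show ?thesis unfolding k_def by (simp only: distrib_right mult_1)
    qed
    have "T j - T (Suc j) = (\<Sum>V\<in>bits ?K. \<Sum>R\<in>bits ?K. ?w V R)"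
      unfolding T_def by (simp only: sum_subtractf)
    also have "\<dots> = (\<Sum>V1\<in>bits (j * m). \<Sum>a\<in>bits m. \<Sum>V2\<in>bits k. \<Sum>R1\<in>bits (j * m). \<Sum>r\<in>bits m. \<Sum>R2\<in>bits k. ?w (V1 @ a @ V2) (R1 @ r @ R2))"
      unfolding K sum_bits_add ..
    also have "\<dots> = (\<Sum>(V1,a,V2,R1,r,R2)\<in>bits (j * m) \<times> bits m \<times> bits k \<times> bits (j * m) \<times> bits m \<times> bits k. ?w (V1 @ a @ V2) (R1 @ r @ R2))"
      by (simp add: sum.cartesian_product)
    also have "\<dots> = (\<Sum>(V1,V2,R1,R2,a,r)\<in>bits (j * m) \<times> bits k \<times> bits (j * m) \<times> bits k \<times> bits m \<times> bits m. ?w (V1 @ a @ V2) (R1 @ r @ R2))"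
      by (rule sum.reindex_bij_witness[where i = "\<lambda>(V1,V2,R1,R2,a,r). (V1,a,V2,R1,r,R2)" and j = "\<lambda>(V1,a,V2,R1,r,R2). (V1,V2,R1,R2,a,r)"]) auto
    also have "\<dots> = (\<Sum>V1\<in>bits (j * m). \<Sum>V2\<in>bits k. \<Sum>R1\<in>bits (j * m). \<Sum>R2\<in>bits k. \<Sum>a\<in>bits m. \<Sum>r\<in>bits m. ?w (V1 @ a @ V2) (R1 @ r @ R2))"
      by (simp add: sum.cartesian_product)
    finally have eq: "T j - T (Suc j) = \<dots>" .
    have "\<bar>T j - T (Suc j)\<bar> \<le> (\<Sum>V1\<in>bits (j * m). \<Sum>V2\<in>bits k. \<Sum>R1\<in>bits (j * m). \<Sum>R2\<in>bits k. 2 ^ m * 2 ^ m * \<eta>)"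
      unfolding eq
    proof (rule abs_sum_le, rule abs_sum_le, rule abs_sum_le, rule abs_sum_le)
      fix V1 V2 R1 R2 :: "bool list" assume "V1 \<in> bits (j * m)" "R1 \<in> bits (j * m)"
      then show "\<bar>\<Sum>a\<in>bits m. \<Sum>r\<in>bits m. ?w (V1 @ a @ V2) (R1 @ r @ R2)\<bar> \<le> 2 ^ m * 2 ^ m * \<eta>"
        by (intro hybrid_step[OF owf \<eta> u j True]) auto
    qed
    also have "\<dots> = 2 ^ ?K * 2 ^ ?K * \<eta>"
      unfolding K by (simp add: card_bits power_add)
    finally show ?thesis .
  qed
  have "\<bar>T 0 - T k\<bar> \<le> real k * (2 ^ ?K * 2 ^ ?K * \<eta>)" if "k \<le> 2 * l" for k
    using that
  proof (induction k)
    case (Suc k)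
    then have "\<bar>T 0 - T k\<bar> \<le> real k * (2 ^ ?K * 2 ^ ?K * \<eta>)" "\<bar>T k - T (Suc k)\<bar> \<le> 2 ^ ?K * 2 ^ ?K * \<eta>"
      using step[of k] by auto
    then have "\<bar>T 0 - T (Suc k)\<bar> \<le> real k * (2 ^ ?K * 2 ^ ?K * \<eta>) + 2 ^ ?K * 2 ^ ?K * \<eta>" by linarith
    then show ?case by (simp add: distrib_right)
  qed simp
  from this[of "2 * l"] have "\<bar>T 0 - T (2 * l)\<bar> \<le> real (2 * l) * (2 ^ ?K * 2 ^ ?K * \<eta>)" by simp
  moreover have "T 0 = (\<Sum>V\<in>bits ?K. \<Sum>R\<in>bits ?K. win b u V R (dead u))" unfolding T_def by simp
  moreover have "T (2 * l) = (\<Sum>V\<in>bits ?K. \<Sum>R\<in>bits ?K. win b u V R (\<lambda>_. False))"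
    unfolding T_def by (intro sum.cong refl win_cong) auto
  ultimately show ?thesis by simp
qed

text \<open>Without flips the test data do not depend on \<open>u\<close>, so \<open>u\<close>
  occurs only in the mask and in the secret input. For each \<open>sk\<close> the substitution of
  \<open>z\<close> for \<open>sk\<close> xor \<open>u\<close> is a bijection, as for a one-time
  pad.\<close>

lemma sum_win_False:
  "(\<Sum>u\<in>bits l. win b u V R (\<lambda>_. False)) =
   (\<Sum>z\<in>bits l. \<Sum>sk\<in>bits l. pr sk * both_output b (secret_input (xor_list sk z) V) (obfuscated (items V R (\<lambda>_. False)) (key_state b z sk)))"
proof -
  let ?g = "\<lambda>sk u z. pr sk * both_output b (secret_input u V) (obfuscated (items V R (\<lambda>_. False)) (key_state b z sk))"
  have "(\<Sum>u\<in>bits l. win b u V R (\<lambda>_. False)) = (\<Sum>u\<in>bits l. \<Sum>sk\<in>bits l. ?g sk u (xor_list sk u))"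
    unfolding win_def by (intro sum.cong refl both_output_mixture) simp
  also have "\<dots> = (\<Sum>sk\<in>bits l. \<Sum>u\<in>bits l. ?g sk u (xor_list sk u))" by (rule sum.swap)
  also have "\<dots> = (\<Sum>sk\<in>bits l. \<Sum>z\<in>bits l. ?g sk (xor_list sk z) z)"
  proof (rule sum.cong[OF refl])
    fix sk :: "bool list" assume "sk \<in> bits l"
    then show "(\<Sum>u\<in>bits l. ?g sk u (xor_list sk u)) = (\<Sum>z\<in>bits l. ?g sk (xor_list sk z) z)"
      by (intro sum.reindex_bij_witness[where i = "xor_list sk" and j = "xor_list sk"]) (auto simp: xor_list_cancel_left)
  qed
  also have "\<dots> = (\<Sum>z\<in>bits l. \<Sum>sk\<in>bits l. ?g sk (xor_list sk z) z)" by (rule sum.swap)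
  finally show ?thesis .
qed

text \<open>Averages three losses: \<eta>1 for replacing the challenge by the hidden program, \<eta>
  for each of at most \<open>2 * l\<close> removed flips, and \<eta>3 for the encryption game, which
  applies at each fixed \<open>V\<close>, \<open>R\<close> and \<open>z\<close>.\<close>

lemma main_bound:
  assumes owf: "owf_bound F (10000000 * (csize Ob + test_size)) (\<eta>\<^sup>2)" and \<eta>: "0 \<le> \<eta>"
    and obf: "\<And>b u V R. length u = l \<Longrightarrow> V \<in> bits (2 * l * m) \<Longrightarrow> R \<in> bits (2 * l * m) \<Longrightarrow>
       \<bar>both_output b (secret_input u V) (ch b (secret_input u V)) - win b u V R (dead u)\<bar> \<le> \<eta>1"
    and ue: "\<And>V R z. V \<in> bits (2 * l * m) \<Longrightarrow> R \<in> bits (2 * l * m) \<Longrightarrow> z \<in> bits l \<Longrightarrow>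
       (\<Sum>b\<in>UNIV. 1 / 2 * (\<Sum>sk\<in>bits l. pr sk * both_output b (secret_input (xor_list sk z) V) (obfuscated (items V R (\<lambda>_. False)) (key_state b z sk)))) \<le> 1 / 2 + \<eta>3"
  shows "(\<Sum>u\<in>bits l. \<Sum>v\<in>bits (l * m). \<Sum>b\<in>UNIV. 1 / 2 * both_output b (u @ v @ rest) (ch b (u @ v @ rest)))
     \<le> 2 ^ l * 2 ^ (l * m) * (1 / 2 + \<eta>1 + real (2 * l) * \<eta> + \<eta>3)"
proof -
  let ?K = "2 * l * m" and ?g = "\<lambda>x. \<Sum>b\<in>UNIV. 1 / 2 * both_output b x (ch b x)"
  define N Q :: real where "N = 2 ^ (l * m)" and "Q = 2 ^ ?K"
  have "?K = l * m + l * m" by simp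
  then have NQ: "N > 0" "Q > 0" "Q = N * N" by (simp_all only: N_def Q_def power_add) simp_all
  have card: "real (card (bits ?K)) = Q" "real (card (bits l)) = 2 ^ l" by (simp_all add: card_bits Q_def)
  have h2: "(\<Sum>V\<in>bits ?K. \<Sum>R\<in>bits ?K. \<Sum>u\<in>bits l. \<Sum>b\<in>UNIV. 1 / 2 * win b u V R (\<lambda>_. False)) \<le> Q * Q * 2 ^ l * (1 / 2 + \<eta>3)"
  proof -
    have "(\<Sum>u\<in>bits l. \<Sum>b\<in>UNIV. 1 / 2 * win b u V R (\<lambda>_. False)) \<le> 2 ^ l * (1 / 2 + \<eta>3)" if "V \<in> bits ?K" "R \<in> bits ?K" for V R
    proof -
      have "(\<Sum>u\<in>bits l. \<Sum>b\<in>UNIV. 1 / 2 * win b u V R (\<lambda>_. False)) = (\<Sum>b\<in>UNIV. 1 / 2 * (\<Sum>u\<in>bits l. win b u V R (\<lambda>_. False)))"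
        by (subst sum.swap) (simp only: sum_distrib_left)
      also have "\<dots> = (\<Sum>z\<in>bits l. \<Sum>b\<in>UNIV. 1 / 2 * (\<Sum>sk\<in>bits l. pr sk * both_output b (secret_input (xor_list sk z) V) (obfuscated (items V R (\<lambda>_. False)) (key_state b z sk))))"
        unfolding sum_win_False by (subst sum.swap) (simp only: sum_distrib_left)
      also have "\<dots> \<le> (\<Sum>z\<in>bits l. 1 / 2 + \<eta>3)" using that by (intro sum_mono ue) auto
      finally show ?thesis using card by simp
    qed
    then have "(\<Sum>V\<in>bits ?K. \<Sum>R\<in>bits ?K. \<Sum>u\<in>bits l. \<Sum>b\<in>UNIV. 1 / 2 * win b u V R (\<lambda>_. False)) \<le> (\<Sum>V\<in>bits ?K. \<Sum>R\<in>bits ?K. 2 ^ l * (1 / 2 + \<eta>3))"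
      by (intro sum_mono) auto
    then show ?thesis using card by (simp add: mult_ac)
  qed
  have h1: "(\<Sum>V\<in>bits ?K. \<Sum>R\<in>bits ?K. win b u V R (dead u)) \<le> (\<Sum>V\<in>bits ?K. \<Sum>R\<in>bits ?K. win b u V R (\<lambda>_. False)) + real (2 * l) * (Q * Q * \<eta>)"
    if "u \<in> bits l" for u b
  proof -
    have "\<bar>(\<Sum>V\<in>bits ?K. \<Sum>R\<in>bits ?K. win b u V R (dead u)) - (\<Sum>V\<in>bits ?K. \<Sum>R\<in>bits ?K. win b u V R (\<lambda>_. False))\<bar> \<le> real (2 * l) * (Q * Q * \<eta>)"
      unfolding Q_def by (rule hybrid_all[OF owf \<eta>]) (use that in auto)
    then show ?thesis by linarith
  qed
  have h0: "(\<Sum>V\<in>bits ?K. \<Sum>R\<in>bits ?K. both_output b (secret_input u V) (ch b (secret_input u V))) \<le> (\<Sum>V\<in>bits ?K. \<Sum>R\<in>bits ?K. win b u V R (dead u)) + Q * Q * \<eta>1"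
    if "u \<in> bits l" for u b
  proof -
    have "(\<Sum>V\<in>bits ?K. \<Sum>R\<in>bits ?K. both_output b (secret_input u V) (ch b (secret_input u V))) \<le> (\<Sum>V\<in>bits ?K. \<Sum>R\<in>bits ?K. win b u V R (dead u) + \<eta>1)"
      using obf[of u _ _ b] that by (intro sum_mono) (auto simp: abs_le_iff algebra_simps)
    then show ?thesis using card by (simp add: sum.distrib mult_ac)
  qed
  \<comment> \<open>The factor \<open>N\<close> accounts for the dead blocks that extend
    \<open>v\<close> to \<open>V\<close>, the factor \<open>Q\<close> for the masks
    \<open>R\<close>.\<close>
  have "Q * N * (\<Sum>u\<in>bits l. \<Sum>v\<in>bits (l * m). ?g (u @ v @ rest)) = Q * (\<Sum>u\<in>bits l. N * (\<Sum>v\<in>bits (l * m). ?g (u @ v @ rest)))"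
    by (simp only: sum_distrib_left mult.assoc)
  also have "\<dots> = Q * (\<Sum>u\<in>bits l. \<Sum>V\<in>bits ?K. ?g (secret_input u V))"
    unfolding N_def by (intro arg_cong2[of _ _ _ _ "(*)"] sum.cong refl sum_selected[symmetric]) simp
  also have "\<dots> = (\<Sum>u\<in>bits l. \<Sum>V\<in>bits ?K. \<Sum>R\<in>bits ?K. ?g (secret_input u V))"
    using card by (simp add: sum_distrib_left)
  also have "\<dots> = (\<Sum>u\<in>bits l. \<Sum>b\<in>UNIV. 1 / 2 * (\<Sum>V\<in>bits ?K. \<Sum>R\<in>bits ?K. both_output b (secret_input u V) (ch b (secret_input u V))))"
    by (simp add: UNIV_bool sum.distrib sum_distrib_left distrib_left)
  also have "\<dots> \<le> (\<Sum>u\<in>bits l. \<Sum>b\<in>(UNIV :: bool set). 1 / 2 * ((\<Sum>V\<in>bits ?K. \<Sum>R\<in>bits ?K. win b u V R (\<lambda>_. False)) + real (2 * l) * (Q * Q * \<eta>) + Q * Q * \<eta>1))"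
    using order_trans[OF h0 add_right_mono[OF h1]] by (intro sum_mono mult_left_mono) auto
  also have "\<dots> = (\<Sum>u\<in>bits l. (\<Sum>b\<in>UNIV. 1 / 2 * (\<Sum>V\<in>bits ?K. \<Sum>R\<in>bits ?K. win b u V R (\<lambda>_. False))) + (real (2 * l) * (Q * Q * \<eta>) + Q * Q * \<eta>1))"
    by (intro sum.cong refl) (simp add: UNIV_bool add_divide_distrib)
  also have "\<dots> = (\<Sum>u\<in>bits l. \<Sum>b\<in>UNIV. 1 / 2 * (\<Sum>V\<in>bits ?K. \<Sum>R\<in>bits ?K. win b u V R (\<lambda>_. False))) + 2 ^ l * (real (2 * l) * (Q * Q * \<eta>) + Q * Q * \<eta>1)"
    by (simp only: sum.distrib sum_constant card distrib_left)
  also have "(\<Sum>u\<in>bits l. \<Sum>b\<in>UNIV. 1 / 2 * (\<Sum>V\<in>bits ?K. \<Sum>R\<in>bits ?K. win b u V R (\<lambda>_. False))) =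
     (\<Sum>V\<in>bits ?K. \<Sum>R\<in>bits ?K. \<Sum>u\<in>bits l. \<Sum>b\<in>UNIV. 1 / 2 * win b u V R (\<lambda>_. False))"
  proof -
    have "(\<Sum>u\<in>bits l. \<Sum>b\<in>UNIV. 1 / 2 * (\<Sum>V\<in>bits ?K. \<Sum>R\<in>bits ?K. win b u V R (\<lambda>_. False))) =
       (\<Sum>(u,b,V,R)\<in>bits l \<times> UNIV \<times> bits ?K \<times> bits ?K. 1 / 2 * win b u V R (\<lambda>_. False))"
      unfolding sum_distrib_left by (simp add: sum.cartesian_product)
    also have "\<dots> = (\<Sum>(V,R,u,b)\<in>bits ?K \<times> bits ?K \<times> bits l \<times> UNIV. 1 / 2 * win b u V R (\<lambda>_. False))"
      by (rule sum.reindex_bij_witness[where i = "\<lambda>(V,R,u,b). (u,b,V,R)" and j = "\<lambda>(u,b,V,R). (V,R,u,b)"]) auto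
    finally show ?thesis by (simp add: sum.cartesian_product)
  qed
  finally have "Q * N * (\<Sum>u\<in>bits l. \<Sum>v\<in>bits (l * m). ?g (u @ v @ rest)) \<le> Q * Q * 2 ^ l * (1 / 2 + \<eta>3) + 2 ^ l * (real (2 * l) * (Q * Q * \<eta>) + Q * Q * \<eta>1)"
    using h2 by linarith
  also have "\<dots> = Q * N * (2 ^ l * N * (1 / 2 + \<eta>1 + real (2 * l) * \<eta> + \<eta>3))"
    unfolding NQ(3) by (simp add: algebra_simps)
  finally show ?thesis using NQ by (simp add: N_def)
qed

end

section \<open>The reduction to unclonable encryption\<close>

lemma run_zero: "run C (\<lambda>_ _. 0) = (\<lambda>_ _. 0)"
  by (simp add: run_def fun_eq_iff)

lemma tensor_zero: "tensor a \<rho> (\<lambda>_ _. 0) = (\<lambda>_ _. 0)"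
  by (simp add: tensor_def fun_eq_iff)

text \<open>Lets a party that receives the key compute the secret input and continue as \<B> or
  \<C>.\<close>

lemma ex_precompose:
  assumes K: "wf_circ K" "classical K" "nin K = l" "nout K = n" and B: "wf_circ B" "nin B = n + k"
  shows "\<exists>B'. wf_circ B' \<and> nin B' = l + k \<and> nout B' = nout B \<and> csize B' \<le> 100 * (csize K + csize B) \<and>
    (\<forall>x\<in>bits l. \<forall>\<sigma>. run B' (tensor l (basis x) \<sigma>) = run B (tensor n (basis (ceval K x)) \<sigma>))"
proof -
  obtain L where L: "wf_circ L" "nin L = l + k" "nout L = n + k" "csize L \<le> 8 * (csize K + k)"
    "\<forall>\<rho>. \<forall>u\<in>bits n. \<forall>u'\<in>bits n. \<forall>v\<in>bits k. \<forall>v'\<in>bits k.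
        run L \<rho> (u @ v) (u' @ v') = run K (\<lambda>x x'. \<rho> (x @ v) (x' @ v')) u u'"
    using ex_lift[OF K(1), of k] K by auto
  obtain B' where B': "wf_circ B'" "nin B' = l + k" "nout B' = nout B" "csize B' \<le> 4 * (csize L + csize B)" "\<forall>\<rho>. run B' \<rho> = run B (run L \<rho>)"
    using ex_seq[OF L(1) B(1)] L B by auto
  have "run B' (tensor l (basis x) \<sigma>) = run B (tensor n (basis (ceval K x)) \<sigma>)" if x: "x \<in> bits l" for x \<sigma>
    unfolding B'(5)[rule_format]
  proof (rule run_cong_append[OF B(2)])
    fix u v u' v' assume l: "u \<in> bits n" "v \<in> bits k" "u' \<in> bits n" "v' \<in> bits k"
    have "run K (\<lambda>z z'. tensor l (basis x) \<sigma> (z @ v) (z' @ v')) = run K (\<lambda>z z'. \<sigma> v v' * basis x z z')"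
      using K(3) by (intro run_cong) auto
    then have "run L (tensor l (basis x) \<sigma>) (u @ v) (u' @ v') = run K (\<lambda>z z'. \<sigma> v v' * basis x z z') u u'"
      using L(5) l by simp
    also have "\<dots> = \<sigma> v v' * basis (ceval K x) u u'"
      using run_classical_basis[OF K(1,2)] K(3) x by (simp add: run_scale)
    finally show "run L (tensor l (basis x) \<sigma>) (u @ v) (u' @ v') = tensor n (basis (ceval K x)) \<sigma> (u @ v) (u' @ v')"
      using l by simp
  qed
  moreover have "csize B' \<le> 100 * (csize K + csize B)"
    using B'(4) L(4) csize_ge(1)[of B] B(2) by simp
  ultimately show ?thesis using B' by blast
qed

context test_data
begin

text \<open>With \<open>z\<close> and \<open>V\<close> hardwired, each bit of the secret input
  depends on at most one bit of \<open>sk\<close>: a selector bit is \<open>sk\<close> xor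
  \<open>z\<close>, and a block bit is a choice between two constants.\<close>

lemma ex_secret_input_circuit:
  assumes z: "length z = l"
  shows "\<exists>K. wf_circ K \<and> classical K \<and> nin K = l \<and> nout K = n \<and> csize K \<le> 6 * (l + n * 14) \<and>
    (\<forall>sk\<in>bits l. ceval K sk = secret_input (xor_list sk z) V)"
proof -
  have st: "steps l 13 (\<lambda>sk. secret_input (xor_list sk z) V ! j)" if j: "j < n" for j
  proof -
    have c': "steps l 3 (\<lambda>sk. sk ! i \<noteq> z ! i)" if "i < l" for i
      using steps_xor[OF steps_proj[OF that] steps_const[of l "z ! i"]] by (simp add: numeral_3_eq_3)
    consider "j < l" | j' where "j = l + j'" "j' < l * m" | j' where "j = l + l * m + j'" "j' < n - (l + l * m)"
    proof -
      assume a: "j < l \<Longrightarrow> thesis" "\<And>j'. j = l + j' \<Longrightarrow> j' < l * m \<Longrightarrow> thesis" "\<And>j'. j = l + l * m + j' \<Longrightarrow> j' < n - (l + l * m) \<Longrightarrow> thesis"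
      show thesis using a(1) a(2)[of "j - l"] a(3)[of "j - (l + l * m)"] j by linarith
    qed
    then show ?thesis
    proof cases
      case 1
      show ?thesis
        by (rule steps_cong[OF steps_mono[OF c'[OF 1]]]) (use 1 z in \<open>auto simp: secret_input_nth nth_xor_list\<close>)
    next
      case (2 j')
      then have "m > 0" by (cases m) auto
      then obtain i c where ij: "i < l" "c < m" and jj: "j = l + i * m + c"
        using 2 that[of "j' div m" "j' mod m"] by (simp add: less_mult_imp_div_less add.assoc)
      have "steps l (2 * 3 + 1 + 1 + 5) (\<lambda>sk. if sk ! i \<noteq> z ! i then block (2 * i + 1) V ! c else block (2 * i) V ! c)"
        using ij by (intro steps_if c' steps_const)
      then have "steps l 13 (\<lambda>sk. if sk ! i \<noteq> z ! i then block (2 * i + 1) V ! c else block (2 * i) V ! c)"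
        by simp
      moreover have "(if sk ! i \<noteq> z ! i then block (2 * i + 1) V ! c else block (2 * i) V ! c) = secret_input (xor_list sk z) V ! j" if "sk \<in> bits l" for sk
        unfolding jj using secret_input_nth(2)[of "xor_list sk z" i c V] that ij z by (auto simp: nth_xor_list)
      ultimately show ?thesis by (rule steps_cong)
    next
      case (3 j')
      show ?thesis
        by (rule steps_cong[OF steps_mono[OF steps_const[of l "rest ! j'"]]]) (use 3 z in \<open>auto simp: secret_input_nth\<close>)
    qed
  qed
  obtain K where K: "wf_circ K" "classical K" "nin K = l" "nout K = n" "csize K \<le> 6 * (l + n * (13 + 1))"
    "\<forall>sk\<in>bits l. ceval K sk = map (\<lambda>j. secret_input (xor_list sk z) V ! j) [0..<n]"
    using ex_classical[of n l 13 "\<lambda>j sk. secret_input (xor_list sk z) V ! j", OF st] by blast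
  have "ceval K sk = secret_input (xor_list sk z) V" if "sk \<in> bits l" for sk
  proof -
    have len: "length (secret_input (xor_list sk z) V) = n" using that z by simp
    have "ceval K sk = map (\<lambda>j. secret_input (xor_list sk z) V ! j) [0..<length (secret_input (xor_list sk z) V)]"
      unfolding len using K(6) that by blast
    then show ?thesis by (simp only: map_nth)
  qed
  with K show ?thesis by auto
qed

end

context reduction
begin

definition ue_size where "ue_size = 1000000 * (csize Ob + csize S2 + csize B + csize C + l + n + cl + p + st + length (desc padded) + 1)"

text \<open>The ciphertext is the only part of the program state unknown to the reduction. The
  description, the tests, \<open>z\<close> and \<phi> are advice, so \<A> can obfuscate the program
  and run its own second stage before the key is revealed.\<close>

lemma ue_reduction:
  assumes ue: "ue_bound Gen Enc' k ue_size \<eta>"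
    and Gen: "nout (Gen k) = l" "\<And>sk. sk \<in> bits l \<Longrightarrow> pr sk = prob_out (run (Gen k) (basis [])) sk" and Enc': "Enc' k = Enc"
    and z: "z \<in> bits l"
  shows "(\<Sum>b\<in>UNIV. 1 / 2 * (\<Sum>sk\<in>bits l. pr sk * both_output b (secret_input (xor_list sk z) V) (obfuscated (items V R \<beta>) (key_state b z sk)))) \<le> 1 / 2 + \<eta>"
proof -
  define pl where "pl = length (desc padded) + 2 * l * dlen + l"
  define pb where "pb = desc padded @ items V R \<beta> @ z"
  have lpb: "length pb = pl" using z by (simp add: pb_def pl_def)
  define X where "X = tensor pl (basis pb) (tensor ez (basis (replicate ez False)) \<phi>)"
  define k' where "k' = pl + (ez + st)"
  have X: "density k' X"
    unfolding X_def k'_def using density_tensor_basis[OF density_tensor_basis[OF \<phi>, of "replicate ez False"], of pb] lpb by simp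
  \<comment> \<open>The first two advice bits are the message pair 0, 1, so the encrypted bit is the
    challenge bit; the first stage merely passes its advice on.\<close>
  define adv where "adv = tensor 2 (basis [False, True]) X"
  have adv: "density (2 + k') adv" using density_tensor_basis[OF X, of "[False, True]"] by (simp add: adv_def numeral_2_eq_2)
  define s1 where "s1 = Circ (2 + k') 0 (2 + k') []"
  have "nin Ob = pl + cl + ez" using Ob(2) length_desc_padded p_eq by (simp add: pl_def)
  from ex_insert[OF Ob(1) this S2(1,2)]
  obtain s2 where s2: "wf_circ s2" "nin s2 = cl + k'" "nout s2 = rB + rC" "csize s2 \<le> 100000 * (csize Ob + csize S2)"
    "\<And>\<rho> \<pi> \<sigma> \<phi>. supported cl \<rho> \<Longrightarrow> supported pl \<pi> \<Longrightarrow> supported ez \<sigma> \<Longrightarrow> supported st \<phi> \<Longrightarrow>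
      run s2 (tensor cl \<rho> (tensor pl \<pi> (tensor ez \<sigma> \<phi>))) = run S2 (tensor (nout Ob) (run Ob (tensor pl \<pi> (tensor cl \<rho> \<sigma>))) \<phi>)"
    unfolding k'_def S2(3) by blast
  obtain K where K: "wf_circ K" "classical K" "nin K = l" "nout K = n" "csize K \<le> 6 * (l + n * 14)"
    "\<forall>sk\<in>bits l. ceval K sk = secret_input (xor_list sk z) V"
    using ex_secret_input_circuit[of z V] z by auto
  obtain pB where pB: "wf_circ pB" "nin pB = l + rB" "nout pB = 1" "csize pB \<le> 100 * (csize K + csize B)"
    "\<forall>x\<in>bits l. \<forall>\<sigma>. run pB (tensor l (basis x) \<sigma>) = run B (tensor n (basis (ceval K x)) \<sigma>)"
    using ex_precompose[OF K(1-4) B(1,2)] B(3) by auto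
  obtain pC where pC: "wf_circ pC" "nin pC = l + rC" "nout pC = 1" "csize pC \<le> 100 * (csize K + csize C)"
    "\<forall>x\<in>bits l. \<forall>\<sigma>. run pC (tensor l (basis x) \<sigma>) = run C (tensor n (basis (ceval K x)) \<sigma>)"
    using ex_precompose[OF K(1-4) C(1,2)] C(3) by auto
  let ?A = "\<lparr>advice_len = \<lambda>_. 2 + k', advice = \<lambda>_. adv, stage1 = \<lambda>_. s1, stage2 = \<lambda>_. s2, partyB = \<lambda>_. pB, partyC = \<lambda>_. pC\<rparr>"
  have "wf_circ s1" by (simp add: s1_def wf_circ_def wires_def)
  moreover have "csize s1 \<le> ue_size" using p_eq by (simp add: s1_def csize_def ue_size_def k'_def pl_def)
  moreover have "csize s2 \<le> ue_size" "csize pB \<le> ue_size" "csize pC \<le> ue_size"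
    using s2(4) pB(4) pC(4) K(5) by (simp_all add: ue_size_def)
  ultimately have "cloning_adversary_at k ue_size 2 (nout (Enc' k)) (nout (Gen k)) ?A"
    using s2 pB pC adv unfolding cloning_adversary_at_def Enc' Gen(1) Enc(3) by (simp add: s1_def)
  then have win: "ue_win Gen Enc' ?A k \<le> 1 / 2 + \<eta>" using ue unfolding ue_bound_def by blast
  have "run s1 adv = adv" unfolding s1_def by (rule run_identity[OF supported_density[OF adv]])
  then have post: "post_meas [False, True] (run s1 adv) = X"
    and post0: "[m0, m1] \<noteq> [False, True] \<Longrightarrow> post_meas [m0, m1] (run s1 adv) = (\<lambda>_ _. 0)" for m0 m1
    by (auto simp: post_meas_def adv_def tensor_def basis_def fun_eq_iff numeral_2_eq_2)
  \<comment> \<open>Any other message pair has the zero operator as post-measurement state.\<close>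
  have cp0: "cloning_prob ?A k [m0, m1] cl ch sk sk b = 0" if "[m0, m1] \<noteq> [False, True]" for m0 m1 ch sk b
    unfolding cloning_prob_def cloning_adversary.simps post0[OF that] tensor_zero run_zero joint_prob_def by simp
  have cp: "cloning_prob ?A k [False, True] cl (run Enc (basis (sk @ [b]))) sk sk b =
      both_output b (secret_input (xor_list sk z) V) (obfuscated (items V R \<beta>) (key_state b z sk))"
    if sk: "sk \<in> bits l" for sk b
  proof -
    let ?ct = "run Enc (basis (sk @ [b]))"
    have ct: "supported cl ?ct" using supported_run[OF Enc(1)] Enc(3) by simp
    have r: "run s2 (tensor cl ?ct X) = run S2 (tensor (nout Ob) (obfuscated (items V R \<beta>) (key_state b z sk)) \<phi>)"
    proof -
      let ?Z = "tensor cl ?ct (basis (replicate ez False))"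
      have e1: "basis pb = tensor (length (desc padded)) (basis (desc padded)) (tensor (2 * l * dlen) (basis (items V R \<beta>)) (basis z))"
        using basis_append[of "desc padded" _ "items V R \<beta> @ z"] basis_append[of "items V R \<beta>" "2 * l * dlen" z] by (simp add: pb_def)
      have "tensor pl (basis pb) ?Z = tensor (length (desc padded)) (basis (desc padded)) (program_state (items V R \<beta>) (key_state b z sk))"
        unfolding e1 pl_def program_state_def key_state_def by (simp add: tensor_assoc add.assoc)
      then show ?thesis
        unfolding X_def obfuscated_def
        using s2(5)[OF ct, of "basis pb" "basis (replicate ez False)" \<phi>] lpb supported_density[OF \<phi>] by (simp add: supported_basis)
    qed
    have "both_output b (secret_input (xor_list sk z) V) ch =
       joint_prob (\<lambda>\<sigma>. run pB (tensor (length sk) (basis sk) \<sigma>)) (\<lambda>\<sigma>. run pC (tensor (length sk) (basis sk) \<sigma>)) (run S2 (tensor (nout Ob) ch \<phi>)) [b] [b]" for ch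
      unfolding both_output_def using pB(5) pC(5) K(6) sk z by simp
    then show ?thesis using r unfolding cloning_prob_def by (simp add: post)
  qed
  have "ue_win Gen Enc' ?A k = (\<Sum>sk\<in>bits l. pr sk * (\<Sum>b\<in>UNIV. 1 / 2 * both_output b (secret_input (xor_list sk z) V) (obfuscated (items V R \<beta>) (key_state b z sk))))"
    unfolding ue_win_def Enc' Enc(3) Gen(1)
  proof (rule sum.cong[OF refl], rule arg_cong2[of _ _ _ _ "(*)"])
    fix sk :: "bool list" assume sk: "sk \<in> bits l"
    show "prob_out (run (Gen k) (basis [])) sk = pr sk" using Gen(2)[OF sk] by simp
    have "(\<Sum>b\<in>UNIV. 1 / 2 * cloning_prob ?A k [m0, m1] cl (run Enc (basis (sk @ [if b then m1 else m0]))) sk sk b) =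
       (if [m0, m1] = [False, True] then (\<Sum>b\<in>UNIV. 1 / 2 * both_output b (secret_input (xor_list sk z) V) (obfuscated (items V R \<beta>) (key_state b z sk))) else 0)" for m0 m1
    proof (cases "[m0, m1] = [False, True]")
      case True
      then have "(if b then m1 else m0) = b" for b by auto
      then show ?thesis using cp[OF sk] True by simp
    next
      case False
      then have h: "cloning_prob ?A k [m0, m1] cl (run Enc (basis (sk @ [c]))) sk sk b = 0" for c b by (rule cp0)
      show ?thesis unfolding if_not_P[OF False] h by simp
    qed
    then show "(\<Sum>m0\<in>UNIV. \<Sum>m1\<in>UNIV. \<Sum>b\<in>UNIV. 1 / 2 * cloning_prob ?A k [m0, m1] cl (run Enc (basis (sk @ [if b then m1 else m0]))) sk sk b) =
      (\<Sum>b\<in>UNIV. 1 / 2 * both_output b (secret_input (xor_list sk z) V) (obfuscated (items V R \<beta>) (key_state b z sk)))"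
      by (simp only:) (simp add: UNIV_bool)
  qed
  also have "\<dots> = (\<Sum>b\<in>UNIV. 1 / 2 * (\<Sum>sk\<in>bits l. pr sk * both_output b (secret_input (xor_list sk z) V) (obfuscated (items V R \<beta>) (key_state b z sk))))"
    by (simp add: UNIV_bool distrib_left sum.distrib sum_distrib_left mult_ac)
  finally show ?thesis using win by simp
qed

end

section \<open>Descriptions, padding and messages\<close>

lemma onehot_inj: "onehot N i = onehot N j \<Longrightarrow> i \<le> N \<Longrightarrow> j \<le> N \<Longrightarrow> i = j"
proof -
  assume e: "onehot N i = onehot N j" and "i \<le> N" "j \<le> N"
  have "\<forall>k<N. (k = i) = (k = j)"
  proof (intro allI impI)
    fix k assume "k < N"
    then have "onehot N i ! k = (k = i)" "onehot N j ! k = (k = j)" by (simp_all add: onehot_def)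
    with e show "(k = i) = (k = j)" by simp
  qed
  then show "i = j" using \<open>i \<le> N\<close> \<open>j \<le> N\<close> by (metis le_neq_implies_less)
qed

lemma gate_code_eq_iff:
  assumes "t \<le> 6" "t' \<le> 6" "i \<le> N" "i' \<le> N" "j \<le> N" "j' \<le> N" "k \<le> N" "k' \<le> N"
  shows "gate_code N t i j k = gate_code N t' i' j' k' \<longleftrightarrow> t = t' \<and> i = i' \<and> j = j' \<and> k = k'"
proof
  have l: "length (onehot n a) = n" for n a by (simp add: onehot_def)
  assume "gate_code N t i j k = gate_code N t' i' j' k'"
  then have "onehot 6 t = onehot 6 t' \<and> onehot N i = onehot N i' \<and> onehot N j = onehot N j' \<and> onehot N k = onehot N k'"
    unfolding gate_code_def by (simp add: l append_eq_append_conv)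
  then show "t = t' \<and> i = i' \<and> j = j' \<and> k = k'" using assms onehot_inj by blast
qed simp

lemma gate_bits_inj: "gate_bits N g = gate_bits N h \<Longrightarrow> wf_gate N g \<Longrightarrow> wf_gate N h \<Longrightarrow> g = h"
  by (cases g; cases h; simp add: gate_code_eq_iff)

text \<open>Ensures that different triples sent by \<A> are different bit strings, hence disjoint
  measurement outcomes.\<close>

lemma desc_inj:
  assumes "C \<in> classical_circs n a mo g" "C' \<in> classical_circs n a mo g" "desc C = desc C'"
  shows "C = C'"
proof -
  have *: "concat (map (gate_bits N) gs) = concat (map (gate_bits N) hs) \<Longrightarrow> length gs = length hs \<Longrightarrow>
     \<forall>g\<in>set gs. wf_gate N g \<Longrightarrow> \<forall>g\<in>set hs. wf_gate N g \<Longrightarrow> gs = hs" for N gs hs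
  proof (induction gs arbitrary: hs)
    case (Cons g gs)
    then obtain h hs' where hs: "hs = h # hs'" by (cases hs) auto
    then have "gate_bits N g = gate_bits N h" "concat (map (gate_bits N) gs) = concat (map (gate_bits N) hs')"
      using Cons.prems(1) by (auto simp: append_eq_append_conv length_gate_bits)
    then show ?case using Cons hs gate_bits_inj by auto
  qed simp
  have "gates C = gates C'"
    by (rule *[of "n + a"]) (use assms in \<open>auto simp: classical_circs_def desc_def wf_circ_def wires_def\<close>)
  with assms(1,2) show ?thesis unfolding classical_circs_def by (cases C; cases C') simp
qed

lemma length_desc_classical: "C \<in> classical_circs n a mo g \<Longrightarrow> length (desc C) = desc_length (n + a) g"
  by (auto simp: classical_circs_def length_desc wires_def)

lemma finite_classical_circs: "finite (classical_circs n a mo g)"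
proof (rule inj_on_finite)
  show "inj_on desc (classical_circs n a mo g)" using desc_inj by (auto intro: inj_onI)
  show "desc ` classical_circs n a mo g \<subseteq> bits (desc_length (n + a) g)" using length_desc_classical by auto
qed simp

lemma pad_circ:
  assumes C: "wf_circ C" "classical C" "nanc C \<le> p"
  shows "wf_circ (pad_circ p C)" "implementation 0 p (pad_circ p C) (zero_state p) (ceval C)"
proof -
  have pc: "pad_circ p C = Circ (nin C + p) p (nout C) (gates C @ replicate (p - length (gates C)) Idle)"
    by (simp add: pad_circ_def)
  have le: "nanc C \<le> p + p" using C by simp
  show "wf_circ (pad_circ p C)" unfolding pc by (rule run_padded(1)[OF C(1) le])
  show "implementation 0 p (pad_circ p C) (zero_state p) (ceval C)"
    unfolding implementation_def
  proof
    fix x assume "x \<in> bits (nin (pad_circ p C) - p)"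
    then have x: "x \<in> bits (nin C)" by (simp add: pc)
    have "run (pad_circ p C) (tensor (nin C) (basis x) (zero_state p)) = basis (ceval C x)"
      unfolding pc zero_state_def run_padded(2)[OF C(1) le] using run_classical_basis[OF C(1,2) x] .
    then show "1 - 0 \<le> prob_out (run (pad_circ p C) (tensor (nin (pad_circ p C) - p) (basis x) (zero_state p))) (ceval C x)"
      by (simp add: pc prob_out_def basis_def)
  qed
qed

lemma implementation_cong:
  "implementation \<epsilon> q C \<rho> f \<Longrightarrow> (\<And>x. x \<in> bits (nin C - q) \<Longrightarrow> f x = g x) \<Longrightarrow> implementation \<epsilon> q C \<rho> g"
  by (simp add: implementation_def)

lemma implementation_mono: "implementation \<epsilon> q C \<rho> f \<Longrightarrow> \<epsilon> \<le> \<delta> \<Longrightarrow> implementation \<delta> q C \<rho> f"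
  unfolding implementation_def by force

lemma zero_state_density: "density p (zero_state p)"
  by (simp add: zero_state_def density_basis)

section \<open>Operators after a partial measurement\<close>

lemma psd_post_meas:
  assumes "psd (k + n) \<rho>" "length y = k"
  shows "psd n (post_meas y \<rho>)"
  unfolding psd_def
proof (intro conjI allI impI)
  fix u v assume nz: "post_meas y \<rho> u v \<noteq> 0"
  have "y @ u \<in> bits (k + n) \<and> y @ v \<in> bits (k + n)"
  proof (rule ccontr)
    assume "\<not> (y @ u \<in> bits (k + n) \<and> y @ v \<in> bits (k + n))"
    then have "\<rho> (y @ u) (y @ v) = 0" using psd_outside[OF assms(1)] by blast
    with nz show False by (simp add: post_meas_def)
  qed
  then show "u \<in> bits n" "v \<in> bits n" using assms by auto
next
  fix v :: "bool list \<Rightarrow> complex"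
  let ?w = "\<lambda>x. if take k x = y then v (drop k x) else 0"
  have "(\<Sum>x\<in>bits (k + n). \<Sum>x'\<in>bits (k + n). cnj (?w x) * \<rho> x x' * ?w x') =
    (\<Sum>a\<in>bits k. \<Sum>u\<in>bits n. \<Sum>a'\<in>bits k. \<Sum>u'\<in>bits n. of_bool (a = y) * (of_bool (a' = y) * (cnj (v u) * \<rho> (a @ u) (a' @ u') * v u')))"
    unfolding sum_bits_add by (intro sum.cong refl) auto
  also have "\<dots> = (\<Sum>u\<in>bits n. \<Sum>u'\<in>bits n. cnj (v u) * \<rho> (y @ u) (y @ u') * v u')"
    using assms(2) by (simp only: sum_of_bool_pick finite_bits bits_iff flip: sum_distrib_left)
  finally show "(\<Sum>u\<in>bits n. \<Sum>u'\<in>bits n. cnj (v u) * post_meas y \<rho> u u' * v u') \<in> \<real>\<^sub>\<ge>\<^sub>0"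
    using psd_form[OF assms(1), of ?w] unfolding post_meas_def by simp
qed

lemma sum_trace_post_meas: "(\<Sum>y\<in>bits k. op_trace n (post_meas y \<rho>)) = op_trace (k + n) \<rho>"
  by (simp add: op_trace_def post_meas_def sum_bits_add)

lemma psd_trace_real: "psd n \<rho> \<Longrightarrow> op_trace n \<rho> \<in> \<real>\<^sub>\<ge>\<^sub>0"
  unfolding op_trace_def by (intro sum_nonneg_Reals psd_diag)

text \<open>Trace 0 forces a zero diagonal, and then a nonzero entry off the diagonal would make the
  quadratic form negative.\<close>

lemma psd_trace_zero:
  assumes "psd n \<rho>" "op_trace n \<rho> = 0"
  shows "\<rho> = (\<lambda>_ _. 0)"
proof -
  have d: "\<rho> a a = 0" if "a \<in> bits n" for a
  proof -
    have pos: "0 \<le> Re (\<rho> x x)" "Im (\<rho> x x) = 0" for x using psd_diag[OF assms(1), of x] complex_nonneg_Reals_iff by blast+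
    have "(\<Sum>x\<in>bits n. Re (\<rho> x x)) = 0" using arg_cong[OF assms(2), of Re] by (simp add: op_trace_def)
    then have "Re (\<rho> a a) = 0" using that pos by (subst (asm) sum_nonneg_eq_0_iff) auto
    then show ?thesis using pos by (simp add: complex_eq_iff)
  qed
  have "\<rho> a b = 0" for a b
  proof (cases "a \<in> bits n \<and> b \<in> bits n \<and> a \<noteq> b")
    case True
    \<comment> \<open>With zero diagonal the form at the vector with entries 1 and \<open>t\<close>
      is minus twice the squared modulus of \<open>\<rho> a b\<close>.\<close>
    define t where "t = - cnj (\<rho> a b)"
    have "cnj 1 * 1 * \<rho> a a + cnj 1 * t * \<rho> a b + cnj t * 1 * \<rho> b a + cnj t * t * \<rho> b b \<in> \<real>\<^sub>\<ge>\<^sub>0"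
      using psd_form[OF assms(1), of "\<lambda>x. 1 * of_bool (x = a) + t * of_bool (x = b)"] True
      by (subst (asm) form_sparse) auto
    then have "0 \<le> Re (t * \<rho> a b + cnj t * cnj (\<rho> a b))"
      using True d psd_hermitian[OF assms(1), of b a] complex_nonneg_Reals_iff by simp
    moreover have "Re (t * \<rho> a b + cnj t * cnj (\<rho> a b)) = - 2 * (norm (\<rho> a b))\<^sup>2"
      unfolding t_def cmod_power2 by (simp add: power2_eq_square)
    ultimately have "(norm (\<rho> a b))\<^sup>2 \<le> 0" by linarith
    then show ?thesis by simp
  next
    case False
    then show ?thesis using d psd_outside[OF assms(1), of a b] by (cases "a = b") auto
  qed
  then show ?thesis by (simp add: fun_eq_iff)
qed

lemma psd_scale:
  assumes "psd n \<rho>" "0 \<le> c"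
  shows "psd n (\<lambda>x y. complex_of_real c * \<rho> x y)"
  unfolding psd_def
proof (intro conjI allI impI)
  fix x y assume "complex_of_real c * \<rho> x y \<noteq> 0"
  then show "x \<in> bits n" "y \<in> bits n" using psd_outside[OF assms(1), of x y] by fastforce+
next
  fix v
  have "(\<Sum>x\<in>bits n. \<Sum>y\<in>bits n. cnj (v x) * (complex_of_real c * \<rho> x y) * v y) =
     complex_of_real c * (\<Sum>x\<in>bits n. \<Sum>y\<in>bits n. cnj (v x) * \<rho> x y * v y)"
    by (simp add: sum_distrib_left mult_ac)
  also have "\<dots> \<in> \<real>\<^sub>\<ge>\<^sub>0" using assms psd_form by (intro nonneg_Reals_mult_I) auto
  finally show "(\<Sum>x\<in>bits n. \<Sum>y\<in>bits n. cnj (v x) * (complex_of_real c * \<rho> x y) * v y) \<in> \<real>\<^sub>\<ge>\<^sub>0" .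
qed

lemma psd_normalize:
  assumes "psd n \<rho>" "op_trace n \<rho> \<noteq> 0"
  obtains q \<rho>' where "0 < q" "op_trace n \<rho> = complex_of_real q" "density n \<rho>'" "\<rho> = (\<lambda>x y. complex_of_real q * \<rho>' x y)"
proof -
  obtain q where q: "0 \<le> q" "op_trace n \<rho> = complex_of_real q"
    using psd_trace_real[OF assms(1)] unfolding nonneg_Reals_def by auto
  with assms have q0: "0 < q" by (cases "q = 0") auto
  let ?r = "\<lambda>x y. complex_of_real (1 / q) * \<rho> x y"
  have "op_trace n ?r = complex_of_real (1 / q) * op_trace n \<rho>" by (simp add: op_trace_def sum_divide_distrib)
  then have "density n ?r" using psd_scale[OF assms(1), of "1 / q"] q q0 by (simp add: density_iff)
  moreover have "\<rho> = (\<lambda>x y. complex_of_real q * ?r x y)" using q0 by (simp add: fun_eq_iff)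
  ultimately show ?thesis using that q q0 by blast
qed

lemma tensor_scale_right: "tensor a \<rho> (\<lambda>x y. c * \<sigma> x y) = (\<lambda>x y. c * tensor a \<rho> \<sigma> x y)"
  unfolding tensor_def fun_eq_iff by simp

lemma joint_prob_scale:
  "joint_prob (\<lambda>\<sigma>. run B (tensor n (basis x) \<sigma>)) (\<lambda>\<sigma>. run C (tensor n (basis x) \<sigma>)) (run S (tensor a \<rho> (\<lambda>x y. complex_of_real q * \<phi> x y))) y1 y2
   = q * joint_prob (\<lambda>\<sigma>. run B (tensor n (basis x) \<sigma>)) (\<lambda>\<sigma>. run C (tensor n (basis x) \<sigma>)) (run S (tensor a \<rho> \<phi>)) y1 y2"
  unfolding joint_prob_def tensor_scale_right run_scale by simp

text \<open>Correctness of the obfuscator speaks of one family of programs at a time, while one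
  negligible error is wanted for all circuits and inputs. It is obtained from the family of worst
  cases.\<close>

lemma upo_correct_if_qsio_correct:
  assumes W: "keyed_circuit_class W" and cor: "qsio_correct Obf Eval"
    and k: "\<And>\<kappa>. kc_anc W \<kappa> \<le> pad_size k \<kappa>"
  shows "upo_correct W k Obf Eval"
proof -
  define p where "p = pad_size k"
  define e where "e \<kappa> C x = eval_prob Obf Eval \<kappa> (p \<kappa>) (pad_circ (p \<kappa>) C) (zero_state (p \<kappa>)) x (ceval C x)" for \<kappa> C x
  define B where "B \<kappa> = kc_in W \<kappa> + kc_out W \<kappa> + kc_gates W \<kappa> + 3 * p \<kappa>" for \<kappa>
  have shape: "wf_circ C \<and> classical C \<and> nanc C \<le> p \<kappa> \<and> nin C = kc_in W \<kappa> \<and> csize (pad_circ (p \<kappa>) C) \<le> B \<kappa>" if "C \<in> kc_shape W \<kappa>" for C \<kappa>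
    using that k[of \<kappa>] by (auto simp: kc_shape_def classical_circs_def p_def pad_circ_def csize_def B_def)
  \<comment> \<open>For each \<kappa> there are finitely many circuits and inputs, so a least
    success probability is attained. If the shape is empty, a gate-free circuit without output keeps
    the family total.\<close>
  have "\<exists>C. wf_circ C \<and> classical C \<and> nanc C \<le> p \<kappa> \<and> csize (pad_circ (p \<kappa>) C) \<le> B \<kappa> \<and>
    (\<forall>C'\<in>kc_shape W \<kappa>. \<forall>x'\<in>bits (kc_in W \<kappa>). \<exists>x\<in>bits (nin C). e \<kappa> C x \<le> e \<kappa> C' x')" for \<kappa>
  proof (cases "kc_shape W \<kappa> = {}")
    case True
    then show ?thesis
      by (intro exI[of _ "Circ (kc_in W \<kappa>) 0 0 []"]) (auto simp: wf_circ_def classical_def pad_circ_def csize_def B_def)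
  next
    case False
    let ?S = "kc_shape W \<kappa> \<times> bits (kc_in W \<kappa>)"
    have "finite ?S" "?S \<noteq> {}" using False finite_classical_circs bits_nonempty by (auto simp: kc_shape_def)
    then obtain y where "is_arg_min (\<lambda>y. e \<kappa> (fst y) (snd y)) (\<lambda>y. y \<in> ?S) y"
      using ex_is_arg_min_if_finite by blast
    then have "y \<in> ?S" "\<forall>y'\<in>?S. e \<kappa> (fst y) (snd y) \<le> e \<kappa> (fst y') (snd y')"
      unfolding is_arg_min_linorder by blast+
    then show ?thesis using shape[of "fst y" \<kappa>]
      by (intro exI[of _ "fst y"]) (auto intro!: bexI[of _ "snd y"])
  qed
  then obtain C where C: "\<And>\<kappa>. wf_circ (C \<kappa>) \<and> classical (C \<kappa>) \<and> nanc (C \<kappa>) \<le> p \<kappa> \<and> csize (pad_circ (p \<kappa>) (C \<kappa>)) \<le> B \<kappa>"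
    "\<And>\<kappa> C' x'. C' \<in> kc_shape W \<kappa> \<Longrightarrow> x' \<in> bits (kc_in W \<kappa>) \<Longrightarrow> \<exists>x\<in>bits (nin (C \<kappa>)). e \<kappa> (C \<kappa>) x \<le> e \<kappa> C' x'"
    by metis
  have "poly_bounded B"
    unfolding B_def p_def using W by (intro poly_bounded_intros poly_bounded_pad_size) (auto simp: keyed_circuit_class_def)
  then have "negl_implementation p (\<lambda>\<kappa>. pad_circ (p \<kappa>) (C \<kappa>)) (\<lambda>\<kappa>. zero_state (p \<kappa>)) (\<lambda>\<kappa>. ceval (C \<kappa>))"
    unfolding negl_implementation_def program_family_def poly_family_def
    using C(1) pad_circ zero_state_density
    by (auto simp: pad_circ_def negligible_def intro: poly_bounded_mono intro!: exI[of _ "\<lambda>_. 0"])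
  then obtain \<epsilon> where \<epsilon>: "negligible \<epsilon>" "\<And>\<kappa> x. x \<in> bits (nin (pad_circ (p \<kappa>) (C \<kappa>)) - p \<kappa>) \<Longrightarrow> e \<kappa> (C \<kappa>) x \<ge> 1 - \<epsilon> \<kappa>"
    using cor unfolding qsio_correct_def e_def by blast
  have "e \<kappa> C' x' \<ge> 1 - \<epsilon> \<kappa>" if "C' \<in> kc_shape W \<kappa>" "x' \<in> bits (kc_in W \<kappa>)" for \<kappa> C' x'
    using C(2)[OF that] \<epsilon>(2)[of _ \<kappa>] by (force simp: pad_circ_def)
  then show ?thesis unfolding upo_correct_def e_def p_def using \<epsilon>(1) by blast
qed

section \<open>The game for a fixed message\<close>

text \<open>The size bound of \<open>ex_program\<close>, with the lengths of the test data inserted.\<close>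

definition program_size :: "nat \<Rightarrow> nat \<Rightarrow> nat \<Rightarrow> nat \<Rightarrow> nat \<Rightarrow> nat \<Rightarrow> nat \<Rightarrow> nat \<Rightarrow> nat \<Rightarrow> nat" where
  "program_size n l m yl cl mo cF cW cD =
     10000 * (n + 2 * l * (yl + m + 1) + l + cl + mo +
       (n + 1 + l) * (n * 4 + l * (yl * (m + 2 * cF + 13) + m * 12 + 19) + 20 + 4) + mo * (n + cW + 10) + cD)"

text \<open>Once the message of \<A> is fixed, \<open>W\<close> is the keyed circuit,
  \<open>M\<close> the replacement circuit, and \<phi> the normalised state that \<A> keeps. The
  hidden program is built for these, and the size conditions let one bound of each assumption cover
  every adversary that arises.\<close>

lemma fixed_message_bound:
  fixes Gen Enc Dec :: "nat \<Rightarrow> circ"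
  assumes F: "wf_circ F" "classical F" "nin F = m" "inj_on (ceval F) (bits m)"
    and ln: "l + l * m \<le> n"
    and G: "wf_circ (Gen k')" "nin (Gen k') = 0" "nout (Gen k') = l"
    and E: "wf_circ (Enc k')" "nin (Enc k') = l + 1" "nout (Enc k') = cl"
    and D: "wf_circ (Dec k')" "nin (Dec k') = l + cl" "nout (Dec k') = 1"
    and W: "W \<in> classical_circs n wa mo wg" and M: "M \<in> classical_circs n ua mo ug"
    and GP: "\<And>x. x \<in> bits n \<Longrightarrow> GP x \<in> classical_circs n wa mo wg"
      "\<And>x y. x \<in> bits n \<Longrightarrow> y \<in> bits n \<Longrightarrow> ceval (GP x) y = (if y = x then ceval M y else ceval W y)"
    and p: "p = pad_size k \<kappa>" "wa \<le> p" "wg \<le> p"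
      "program_size n l m (nout F) cl mo (csize F) ((n + wa + mo + wg) + (n + ua + mo + ug)) (csize (Dec k')) \<le> p"
    and Ob: "Ob = Obf [\<kappa>, n, p, p, mo, p]" "wf_circ Ob" "nin Ob = desc_length (n + p + p) p + p"
    and S2: "wf_circ S2" "nin S2 = nout Ob + st" "nout S2 = rB + rC"
    and B: "wf_circ B" "nin B = n + rB" "nout B = 1"
    and C: "wf_circ C" "nin C = n + rC" "nout C = 1"
    and \<phi>: "density st \<phi>"
    and dec: "\<And>b. 1 - \<epsilon> \<le> (\<Sum>sk\<in>bits l. prob_out (run (Gen k') (basis [])) sk *
        prob_out (run (Dec k') (tensor l (basis sk) (run (Enc k') (basis (sk @ [b]))))) [b])" and \<epsilon>: "0 \<le> \<epsilon>"
    and owf: "owf_bound F (10000000 * (csize Ob + 10000000 * (csize S2 + csize B + csize C))) (\<eta>\<^sup>2)" and \<eta>: "0 \<le> \<eta>"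
    and ue: "ue_bound Gen Enc k' su \<eta>3"
    and su: "1000000 * (csize Ob + csize S2 + csize B + csize C + l + n + cl + p + st + desc_length (n + p + p) p + 1) \<le> su"
    and qsio: "qsio_bound Obf \<kappa> sq \<epsilon> \<eta>1"
    and sq: "n + mo + 3 * p + 10000000 * (csize S2 + csize B + csize C) \<le> sq"
  shows "(\<Sum>x\<in>bits n. \<Sum>b\<in>UNIV. 1 / 2 * joint_prob (\<lambda>\<sigma>. run B (tensor n (basis x) \<sigma>)) (\<lambda>\<sigma>. run C (tensor n (basis x) \<sigma>))
      (run S2 (tensor (nout Ob) (upo_obf k Obf \<kappa> (if b then GP x else W)) \<phi>)) [b] [b])
    \<le> 2 ^ n * (1 / 2 + (\<eta>1 + real (2 * l) * \<eta> + \<eta>3))"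
proof -
  define pr where "pr = prob_out (run (Gen k') (basis []))"
  have Gd: "density l (run (Gen k') (basis []))" using run_density[OF G(1)] G density_basis[of "[]" 0] by simp
  have pr: "\<And>sk. 0 \<le> pr sk" "(\<Sum>sk\<in>bits l. pr sk) = 1"
    using Gd prob_out_nonneg unfolding pr_def by (auto simp: density_iff sum_prob_out)
  have Wc: "wf_circ W" "classical W" "nin W = n" "nout W = mo" "nanc W = wa" "length (gates W) = wg"
    and Mc: "wf_circ M" "classical M" "nin M = n" "nout M = mo" using W M by (auto simp: classical_circs_def)
  have csz: "csize W + csize M = (n + wa + mo + wg) + (n + ua + mo + ug)" using W M by (auto simp: classical_circs_def csize_def)
  let ?ch = "\<lambda>b x. upo_obf k Obf \<kappa> (if b then GP x else W)"
  let ?J = "\<lambda>b x ch. joint_prob (\<lambda>\<sigma>. run B (tensor (length x) (basis x) \<sigma>)) (\<lambda>\<sigma>. run C (tensor (length x) (basis x) \<sigma>)) (run S2 (tensor (nout Ob) ch \<phi>)) [b] [b]"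
  \<comment> \<open>The tail of the input behind selector bits and blocks is fixed as a constant of
    the program and averaged only at the end.\<close>
  have fixed_rest: "(\<Sum>u\<in>bits l. \<Sum>v\<in>bits (l * m). \<Sum>b\<in>UNIV. 1 / 2 * ?J b (u @ v @ rest) (?ch b (u @ v @ rest)))
     \<le> 2 ^ l * 2 ^ (l * m) * (1 / 2 + \<eta>1 + real (2 * l) * \<eta> + \<eta>3)"
    if rest: "length rest = n - (l + l * m)" for rest
  proof -
    interpret T: test_data l m n F rest using F ln rest by unfold_locales
    let ?dl = "2 * l * T.dlen"
    have ll: "l \<le> n" using ln by simp
    obtain P where P: "wf_circ P" "nin P = n + (?dl + l + cl)" "nout P = mo"
      "csize P \<le> 10000 * (n + ?dl + l + cl + mo + (n + 1 + l) * (T.accept_steps + 4) + mo * (n + csize W + csize M + 10) + csize (Dec k'))"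
      and run_P: "\<And>x d z ct out. x \<in> bits n \<Longrightarrow> d \<in> bits ?dl \<Longrightarrow> z \<in> bits l \<Longrightarrow> supported cl ct \<Longrightarrow> out \<in> bits mo \<Longrightarrow>
       prob_out (run P (tensor n (basis x) (tensor ?dl (basis d) (tensor l (basis z) ct)))) out =
        (\<Sum>c\<in>UNIV. prob_out (run (Dec k') (tensor l (basis (xor_list z (take l x))) ct)) [c] *
         of_bool ((if c \<and> T.accepts (x @ d @ z) then ceval M x else ceval W x) = out))"
      using ex_program[OF D Wc(1-4) Mc T.steps_accepts[of l] ll] by blast
    have "n + csize W + csize M + 10 = n + ((n + wa + mo + wg) + (n + ua + mo + ug)) + 10" using csz by simp
    then have Pp: "csize P \<le> p"
      using P(4) p(4) unfolding program_size_def T.accept_steps_def T.dlen_def T.yl_def by (simp only:)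
    interpret R: reduction l m n F rest W M P "Enc k'" "Dec k'" Ob S2 B C pr \<phi> mo cl p st rB rC
      using Wc Mc E D pr P Pp run_P \<phi> S2 B C Ob by unfold_locales auto
    have bo: "R.both_output b x ch = ?J b x ch" for b x ch by (simp add: R.both_output_def)
    have pad: "nin R.padded = n + p" "nanc R.padded = p" "nout R.padded = mo" "length (gates R.padded) = p"
      using P R.p_eq Pp csize_ge(4)[of P] by (auto simp: R.padded_def)
    have wf_padded: "wf_circ R.padded"
      unfolding R.padded_def using csize_ge(2)[of P] Pp by (intro run_padded(1)[OF P(1)]) simp
    have idx: "Obf (obf_index \<kappa> p R.padded) = Ob" using pad by (simp add: obf_index_def Ob(1))
    have obf: "\<bar>R.both_output b (T.secret_input u V) (?ch b (T.secret_input u V)) - R.win b u V Rr (T.dead u)\<bar> \<le> \<eta>1"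
      if u: "length u = l" and V: "V \<in> bits (2 * l * m)" and Rr: "Rr \<in> bits (2 * l * m)" for b u V Rr
    proof -
      define x0 where "x0 = T.secret_input u V"
      have x0: "x0 \<in> bits n" using u by (simp add: x0_def)
      \<comment> \<open>The real challenge circuit. Padded with zero qubits it implements the same
        function \<open>f\<close> as the hidden program with challenge bit \<open>b\<close>, and in
        the same size.\<close>
      define C0 where "C0 = (if b then GP x0 else W)"
      define f where "f x = (if x = x0 \<and> b then ceval M x else ceval W x)" for x
      have C0: "C0 \<in> classical_circs n wa mo wg" using W GP(1)[OF x0] by (simp add: C0_def)
      then have C0': "wf_circ C0" "classical C0" "nanc C0 \<le> p" "nin C0 = n" "nout C0 = mo" "length (gates C0) \<le> p"
        using p by (auto simp: classical_circs_def)
      obtain Dx where Dx: "wf_circ Dx" "nin Dx = nout Ob + st" "nout Dx = 1" "csize Dx \<le> R.test_size"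
        "\<And>ch. prob_out (run Dx (tensor (nout Ob) ch \<phi>)) [True] = R.both_output b x0 ch"
        using R.ex_both_output[of x0 b] x0 by auto
      have np: "nin (pad_circ p C0) = n + p" "nanc (pad_circ p C0) = p" "nout (pad_circ p C0) = mo" "length (gates (pad_circ p C0)) = p"
        using C0' by (simp_all add: pad_circ_def)
      have "implementation \<epsilon> p (pad_circ p C0) (zero_state p) (ceval C0)"
        using implementation_mono[OF pad_circ(2)[OF C0'(1-3)] \<epsilon>] .
      then have i0: "implementation \<epsilon> p (pad_circ p C0) (zero_state p) f"
        by (rule implementation_cong) (use np x0 GP(2)[OF x0] in \<open>auto simp: f_def C0_def\<close>)
      have i1: "implementation \<epsilon> p R.padded (R.program_state (T.items V Rr (T.dead u)) (R.key_mixture b u)) f"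
        using dec[of b] by (intro R.implementation_padded[OF u V Rr \<epsilon>]) (auto simp: f_def x0_def pr_def)
      have idx0: "Obf (obf_index \<kappa> p (pad_circ p C0)) = Ob" using np by (simp add: obf_index_def Ob(1))
      have "\<bar>prob_out (run Dx (tensor (nout (Obf (obf_index \<kappa> p (pad_circ p C0)))) (obf_state Obf \<kappa> p (pad_circ p C0) (zero_state p)) \<phi>)) [True] -
         prob_out (run Dx (tensor (nout (Obf (obf_index \<kappa> p (pad_circ p C0)))) (obf_state Obf \<kappa> p R.padded (R.program_state (T.items V Rr (T.dead u)) (R.key_mixture b u))) \<phi>)) [True]\<bar> \<le> \<eta>1"
      proof (rule qsio[unfolded qsio_bound_def, rule_format], intro conjI)
        show "csize (pad_circ p C0) \<le> sq" "csize R.padded \<le> sq" "csize Dx \<le> sq"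
          using np pad Dx(4) sq by (simp_all add: csize_def R.test_size_def)
        show "density p (R.program_state (T.items V Rr (T.dead u)) (R.key_mixture b u))" by (rule R.program_state_density[OF u])
        show "same_size (pad_circ p C0) R.padded" using np pad by (simp add: same_size_def)
        show "nin Dx = nout (Obf (obf_index \<kappa> p (pad_circ p C0))) + st" unfolding idx0 by (rule Dx(2))
      qed (use pad_circ(1)[OF C0'(1-3)] wf_padded Dx(1,3) np zero_state_density \<phi> i0 i1 in auto)
      moreover have "obf_state Obf \<kappa> p R.padded \<sigma> = run Ob (tensor (length (desc R.padded)) (basis (desc R.padded)) \<sigma>)" for \<sigma>
        unfolding obf_state_def idx ..
      moreover have "obf_state Obf \<kappa> p (pad_circ p C0) (zero_state p) = ?ch b x0"
        by (simp add: upo_obf_def C0_def p(1))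
      ultimately show ?thesis
        unfolding idx0 Dx(5) R.win_def R.obfuscated_def x0_def[symmetric] by simp
    qed
    have ue': "(\<Sum>b\<in>UNIV. 1 / 2 * (\<Sum>sk\<in>bits l. pr sk * R.both_output b (T.secret_input (xor_list sk z) V) (R.obfuscated (T.items V Rr (\<lambda>_. False)) (R.key_state b z sk)))) \<le> 1 / 2 + \<eta>3"
      if z: "z \<in> bits l" for V Rr z
    proof (rule R.ue_reduction[OF ue_bound_mono[OF ue]])
      show "R.ue_size \<le> su" using su unfolding R.ue_size_def R.length_desc_padded by simp
    qed (use G z in \<open>auto simp: pr_def\<close>)
    have "(\<Sum>u\<in>bits l. \<Sum>v\<in>bits (l * m). \<Sum>b\<in>UNIV. 1 / 2 * R.both_output b (u @ v @ rest) (?ch b (u @ v @ rest)))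
       \<le> 2 ^ l * 2 ^ (l * m) * (1 / 2 + \<eta>1 + real (2 * l) * \<eta> + \<eta>3)"
    proof (rule R.main_bound[OF _ \<eta> obf])
      show "owf_bound F (10000000 * (csize Ob + R.test_size)) (\<eta>\<^sup>2)" unfolding R.test_size_def by (rule owf)
    qed (use ue' in auto)
    then show ?thesis unfolding bo .
  qed
  define h where "h = n - (l + l * m)"
  have n: "n = l + (l * m + h)" using ln by (simp add: h_def)
  have "(\<Sum>x\<in>bits n. \<Sum>b\<in>UNIV. 1 / 2 * joint_prob (\<lambda>\<sigma>. run B (tensor n (basis x) \<sigma>)) (\<lambda>\<sigma>. run C (tensor n (basis x) \<sigma>))
      (run S2 (tensor (nout Ob) (?ch b x) \<phi>)) [b] [b]) = (\<Sum>x\<in>bits n. \<Sum>b\<in>UNIV. 1 / 2 * ?J b x (?ch b x))"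
    by (intro sum.cong refl) simp
  also have "\<dots> = (\<Sum>u\<in>bits l. \<Sum>v\<in>bits (l * m). \<Sum>rest\<in>bits h. \<Sum>b\<in>UNIV. 1 / 2 * ?J b (u @ v @ rest) (?ch b (u @ v @ rest)))"
    by (subst n) (simp only: sum_bits_add)
  also have "\<dots> = (\<Sum>u\<in>bits l. \<Sum>rest\<in>bits h. \<Sum>v\<in>bits (l * m). \<Sum>b\<in>UNIV. 1 / 2 * ?J b (u @ v @ rest) (?ch b (u @ v @ rest)))"
    by (rule sum.cong[OF refl], rule sum.swap)
  also have "\<dots> = (\<Sum>rest\<in>bits h. \<Sum>u\<in>bits l. \<Sum>v\<in>bits (l * m). \<Sum>b\<in>UNIV. 1 / 2 * ?J b (u @ v @ rest) (?ch b (u @ v @ rest)))"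
    by (rule sum.swap)
  also have "\<dots> \<le> (\<Sum>rest\<in>bits h. 2 ^ l * 2 ^ (l * m) * (1 / 2 + \<eta>1 + real (2 * l) * \<eta> + \<eta>3))"
    by (rule sum_mono, rule fixed_rest) (simp add: h_def)
  also have "\<dots> = 2 ^ n * (1 / 2 + (\<eta>1 + real (2 * l) * \<eta> + \<eta>3))"
    by (subst n) (simp add: card_bits power_add algebra_simps)
  finally show ?thesis .
qed

text \<open>Adversaries have size polynomial in \<kappa>, but encryption and one-way function are
  attacked at the root of \<kappa>; this shows that their sizes are polynomial there too.\<close>

lemma poly_bounded_root_nat:
  assumes "0 < d" "poly_bounded S"
  shows "\<exists>B. poly_bounded B \<and> (\<forall>\<kappa>. S \<kappa> \<le> B (nth_root_nat d \<kappa>))"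
proof -
  obtain c k where ck: "\<And>n. S n \<le> c * (n + 1) ^ k" using assms unfolding poly_bounded_iff by blast
  have "S \<kappa> \<le> c * ((nth_root_nat d \<kappa> + 1) ^ d) ^ k" for \<kappa>
    using ck[of \<kappa>] Suc_le_nth_root_nat[OF assms(1), of \<kappa>] by (meson le_trans mult_le_mono2 power_mono zero_le)
  then show ?thesis by (intro exI[of _ "\<lambda>m. c * ((m + 1) ^ d) ^ k"] conjI poly_bounded_intros) auto
qed

lemma nth_root_nat_le: "0 < d \<Longrightarrow> nth_root_nat d n \<le> n"
  using nth_root_nat_power_le[of d n] self_le_power[of "nth_root_nat d n" d] by (cases "nth_root_nat d n") auto

lemma poly_bounded_eventually_le_power:
  assumes "poly_bounded p"
  obtains j where "\<forall>\<^sub>F n in sequentially. p n \<le> n ^ j"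
proof -
  obtain k where k: "\<And>n. p n \<le> n ^ k + k" using assms unfolding poly_bounded_def by blast
  have "p n \<le> n ^ (k + 2)" if "n \<ge> k + 2" for n
  proof -
    have "n ^ k \<le> n ^ (k + 1)" "n ^ 1 \<le> n ^ (k + 1)" using that by (auto intro!: power_increasing)
    then have "p n \<le> 2 * n ^ (k + 1)" using k[of n] that unfolding power_one_right by linarith
    also have "\<dots> \<le> n * n ^ (k + 1)" using that by (intro mult_le_mono1) simp
    finally show ?thesis by simp
  qed
  then show ?thesis using that unfolding eventually_sequentially by blast
qed

text \<open>Here \<open>L m\<close> will be the length of an encryption key together with one preimage for each of its bits.\<close>

lemma ex_root_degree:
  assumes L: "poly_bounded L" and n: "poly_growing n"
  shows "\<exists>d>0. \<forall>\<^sub>F \<kappa> in sequentially. L (nth_root_nat d \<kappa>) \<le> n \<kappa>"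
proof -
  obtain a where a: "\<forall>\<^sub>F m in sequentially. L m \<le> m ^ a" using poly_bounded_eventually_le_power[OF L] .
  obtain c where c: "c > 0" "\<forall>\<^sub>F \<kappa> in sequentially. real (n \<kappa>) \<ge> real \<kappa> powr c" using n unfolding poly_growing_def by blast
  \<comment> \<open>Chosen with \<open>d * c\<close> at least \<open>a\<close>: then
    \<open>m ^ a\<close> is at most the \<open>c\<close>-th power of \<open>m ^ d\<close>, hence at
    most \<kappa> to the \<open>c\<close>, hence at most the input length.\<close>
  define d where "d = nat \<lceil>real a / c\<rceil> + 1"
  have d: "d > 0" "real a \<le> real d * c"
  proof -
    have "real a / c \<le> real d" unfolding d_def by linarith
    then show "real a \<le> real d * c" using c(1) by (simp add: divide_le_eq)
  qed (simp add: d_def)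
  have "\<forall>\<^sub>F m in sequentially. L m \<le> m ^ a \<and> 1 \<le> m" using a eventually_ge_at_top[of 1] by (rule eventually_conj)
  from eventually_root_nat[OF d(1) this] c(2)
  have "\<forall>\<^sub>F \<kappa> in sequentially. L (nth_root_nat d \<kappa>) \<le> n \<kappa>"
  proof eventually_elim
    case (elim \<kappa>)
    let ?m = "nth_root_nat d \<kappa>"
    have m1: "1 \<le> real ?m" "0 < real ?m" using elim(1) by auto
    have "real (L ?m) \<le> real (?m ^ a)" using elim(1) by (simp only: of_nat_le_iff)
    also have "\<dots> = real ?m powr real a" using m1 powr_realpow[of "real ?m" a] by (simp only: of_nat_power)
    also have "\<dots> \<le> real ?m powr (real d * c)" using m1 d(2) by (intro powr_mono) auto
    also have "\<dots> = (real ?m powr real d) powr c" by (simp add: powr_powr)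
    also have "\<dots> = real (?m ^ d) powr c" using m1 by (simp add: powr_realpow)
    also have "\<dots> \<le> real \<kappa> powr c"
      using nth_root_nat_power_le[OF d(1), of \<kappa>] c(1) by (intro powr_mono2) (auto simp del: of_nat_power)
    also have "\<dots> \<le> real (n \<kappa>)" by (rule elim(2))
    finally show ?case by simp
  qed
  with d(1) show ?thesis by blast
qed

section \<open>The game with random messages\<close>

text \<open>The first message is a measurement outcome. Conditioned on it the kept state is a
  density, to which the bound for fixed messages applies; the outcome probabilities of valid
  messages sum to at most 1, so the average obeys the same bound.\<close>

lemma upo_win_le:
  assumes punct: "generalized_puncturable W ua ug GP"
    and S1: "wf_circ (stage1 \<A> \<kappa>)" "density (nin (stage1 \<A> \<kappa>)) (advice \<A> \<kappa>)"
      "nout (stage1 \<A> \<kappa>) = key_len W \<kappa> + 2 * desc_length (kc_in W \<kappa> + ua \<kappa>) (ug \<kappa>) + st"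
    and bound: "\<And>\<phi> V M G. density st \<phi> \<Longrightarrow> V \<in> kc_shape W \<kappa> \<Longrightarrow> M \<in> mu_circs W ua ug \<kappa> \<Longrightarrow>
      (\<And>x. x \<in> bits (kc_in W \<kappa>) \<Longrightarrow> G x \<in> kc_shape W \<kappa>) \<Longrightarrow>
      (\<And>x y. x \<in> bits (kc_in W \<kappa>) \<Longrightarrow> y \<in> bits (kc_in W \<kappa>) \<Longrightarrow> ceval (G x) y = (if y = x then ceval M y else ceval V y)) \<Longrightarrow>
      (\<Sum>x\<in>bits (kc_in W \<kappa>). \<Sum>b\<in>UNIV. 1 / 2 * joint_prob (\<lambda>\<sigma>. run (partyB \<A> \<kappa>) (tensor (kc_in W \<kappa>) (basis x) \<sigma>))
         (\<lambda>\<sigma>. run (partyC \<A> \<kappa>) (tensor (kc_in W \<kappa>) (basis x) \<sigma>))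
         (run (stage2 \<A> \<kappa>) (tensor (upo_len W k Obf \<kappa>) (upo_obf k Obf \<kappa> (if b then G x else V)) \<phi>)) [b] [b])
      \<le> 2 ^ kc_in W \<kappa> * (1 / 2 + \<delta>)"
    and \<delta>: "0 \<le> \<delta>"
  shows "upo_win W ua ug GP (Id_U W) k Obf \<A> \<kappa> \<le> 1 / 2 + \<delta>"
proof -
  define n where "n = kc_in W \<kappa>"
  define U where "U = mu_circs W ua ug \<kappa>"
  define dl where "dl = desc_length (n + ua \<kappa>) (ug \<kappa>)"
  define kl where "kl = key_len W \<kappa>"
  define msg where "msg = (\<lambda>(s, M, M'). s @ desc M @ desc M')"
  define post where "post m = post_meas m (run (stage1 \<A> \<kappa>) (advice \<A> \<kappa>))" for m
  define q where "q m = Re (op_trace st (post m))" for m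
  define J where "J = (\<lambda>b x ch \<phi>. joint_prob (\<lambda>\<sigma>. run (partyB \<A> \<kappa>) (tensor n (basis x) \<sigma>))
         (\<lambda>\<sigma>. run (partyC \<A> \<kappa>) (tensor n (basis x) \<sigma>)) (run (stage2 \<A> \<kappa>) (tensor (upo_len W k Obf \<kappa>) ch \<phi>)) [b] [b])"
  have kc: "keyed_circuit_class W" and pc: "puncture_correct W ua ug GP"
    using punct by (simp_all add: generalized_puncturable_def)
  have K: "keys W \<kappa> \<subseteq> bits kl" "\<And>s. s \<in> keys W \<kappa> \<Longrightarrow> kc_circ W \<kappa> s \<in> kc_shape W \<kappa>"
    using kc by (auto simp: keyed_circuit_class_def kl_def)
  have finK: "finite (keys W \<kappa>)" by (rule finite_subset[OF K(1)]) simp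
  have finU: "finite U" by (simp add: U_def mu_circs_def finite_classical_circs)
  have dU: "length (desc M) = dl" if "M \<in> U" for M
    using that length_desc_classical unfolding U_def mu_circs_def dl_def n_def by blast
  have dens: "density (kl + 2 * dl + st) (run (stage1 \<A> \<kappa>) (advice \<A> \<kappa>))"
    using run_density[OF S1(1,2)] S1(3) by (simp add: kl_def dl_def n_def)
  have psd: "psd st (post m)" if "m \<in> bits (kl + 2 * dl)" for m
    unfolding post_def using dens that by (intro psd_post_meas[of "kl + 2 * dl"]) (auto simp: density_iff)
  have q_nonneg: "0 \<le> q m" if "m \<in> bits (kl + 2 * dl)" for m
    using psd_trace_real[OF psd[OF that]] unfolding q_def by (simp add: complex_nonneg_Reals_iff)
  have q_sum: "(\<Sum>m\<in>bits (kl + 2 * dl). q m) = 1"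
    using arg_cong[OF sum_trace_post_meas[of st "run (stage1 \<A> \<kappa>) (advice \<A> \<kappa>)" "kl + 2 * dl"], of Re] dens
    by (simp add: q_def post_def density_iff)
  have msg_bits: "msg a \<in> bits (kl + 2 * dl)" if "a \<in> keys W \<kappa> \<times> U \<times> U" for a
    using that K(1) dU by (auto simp: msg_def)
  have msg_inj: "inj_on msg (keys W \<kappa> \<times> U \<times> U)"
  proof (rule inj_onI)
    fix a a' assume a: "a \<in> keys W \<kappa> \<times> U \<times> U" "a' \<in> keys W \<kappa> \<times> U \<times> U" "msg a = msg a'"
    obtain s M N s' M' N' where e: "a = (s, M, N)" "a' = (s', M', N')" by (cases a, cases a') blast
    have mem: "s \<in> keys W \<kappa>" "s' \<in> keys W \<kappa>" "M \<in> U" "N \<in> U" "M' \<in> U" "N' \<in> U" using a(1,2) e by auto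
    have "s \<in> bits kl" "s' \<in> bits kl" using mem K(1) by blast+
    then have "length s = length s'" by simp
    then have "s = s' \<and> desc M = desc M' \<and> desc N = desc N'"
      using a(3) dU mem e by (simp add: msg_def append_eq_append_conv)
    then show "a = a'" using mem desc_inj unfolding e U_def mu_circs_def by blast
  qed
  have inner: "measure_pmf.expectation (Id_U W \<kappa>) (\<lambda>(xB, xC). \<Sum>b\<in>UNIV. 1 / 2 *
          cloning_prob \<A> \<kappa> (s @ desc M @ desc M') (upo_len W k Obf \<kappa>)
            (upo_obf k Obf \<kappa> (if b then GP \<kappa> s xB xC M M' else kc_circ W \<kappa> s)) xB xC b) \<le> q (msg (s, M, M')) * (1 / 2 + \<delta>)"
    (is "?E \<le> _")
    if s: "s \<in> keys W \<kappa>" and M: "M \<in> U" "M' \<in> U" for s M M'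
  proof -
    let ?\<phi> = "post (msg (s, M, M'))" and ?ch = "\<lambda>b x. upo_obf k Obf \<kappa> (if b then GP \<kappa> s x x M M' else kc_circ W \<kappa> s)"
    have "?E = (\<Sum>x\<in>bits n. \<Sum>b\<in>UNIV. 1 / 2 * cloning_prob \<A> \<kappa> (s @ desc M @ desc M') (upo_len W k Obf \<kappa>) (?ch b x) x x b) / 2 ^ n"
    proof -
      have ne: "bits n \<noteq> {}" by (metis card_bits card.empty power_not_zero zero_neq_numeral)
      show ?thesis unfolding Id_U_def n_def[symmetric]
        by (simp add: integral_pmf_of_set[OF ne] card_bits)
    qed
    also have "\<dots> = (\<Sum>x\<in>bits n. \<Sum>b\<in>UNIV. 1 / 2 * J b x (?ch b x) ?\<phi>) / 2 ^ n"
      by (intro arg_cong[where f = "\<lambda>z. z / 2 ^ n"] sum.cong refl)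
        (simp add: cloning_prob_def J_def post_def msg_def)
    also have "\<dots> \<le> q (msg (s, M, M')) * (1 / 2 + \<delta>)"
    proof (cases "op_trace st ?\<phi> = 0")
      case True
      have "?\<phi> = (\<lambda>_ _. 0)" using psd_trace_zero[OF psd[OF msg_bits] True] s M by blast
      then have "J b x ch ?\<phi> = 0" for b x ch by (simp only: J_def tensor_zero run_zero joint_prob_def) simp
      then show ?thesis using True by (simp add: q_def)
    next
      case False
      obtain r \<phi> where r: "0 < r" "op_trace st ?\<phi> = complex_of_real r" "density st \<phi>" "?\<phi> = (\<lambda>x y. complex_of_real r * \<phi> x y)"
        using psd_normalize[OF psd[OF msg_bits] False] s M by blast
      have sc: "J b x ch ?\<phi> = r * J b x ch \<phi>" for b x ch unfolding J_def r(4) by (rule joint_prob_scale)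
      have "(\<Sum>x\<in>bits n. \<Sum>b\<in>UNIV. 1 / 2 * J b x (?ch b x) \<phi>) \<le> 2 ^ n * (1 / 2 + \<delta>)"
        unfolding J_def n_def
      proof (rule bound[OF r(3) K(2)[OF s] M(1)[unfolded U_def]])
        fix x assume x: "x \<in> bits (kc_in W \<kappa>)"
        \<comment> \<open>Both challenge points equal \<open>x\<close>, so the punctured circuit
          takes at \<open>x\<close> the value of the first replacement circuit
          \<open>M\<close>.\<close>
        note P = pc[unfolded puncture_correct_def Let_def, rule_format, OF s x x M(1)[unfolded U_def] M(2)[unfolded U_def]]
        show "GP \<kappa> s x x M M' \<in> kc_shape W \<kappa>" using P by blast
        fix y assume "y \<in> bits (kc_in W \<kappa>)"
        then show "ceval (GP \<kappa> s x x M M') y = (if y = x then ceval M y else ceval (kc_circ W \<kappa> s) y)" using P by auto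
      qed
      then have "r * (\<Sum>x\<in>bits n. \<Sum>b\<in>UNIV. 1 / 2 * J b x (?ch b x) \<phi>) \<le> r * (2 ^ n * (1 / 2 + \<delta>))"
        using r(1) by (intro mult_left_mono) auto
      moreover have "(\<Sum>x\<in>bits n. \<Sum>b\<in>UNIV. 1 / 2 * J b x (?ch b x) ?\<phi>) = r * (\<Sum>x\<in>bits n. \<Sum>b\<in>UNIV. 1 / 2 * J b x (?ch b x) \<phi>)"
        unfolding sc sum_distrib_left by (simp add: mult_ac)
      moreover have "q (msg (s, M, M')) = r" using r(2) by (simp add: q_def)
      ultimately show ?thesis by (simp add: divide_le_eq mult_ac)
    qed
    finally show ?thesis .
  qed
  have "upo_win W ua ug GP (Id_U W) k Obf \<A> \<kappa> \<le> (\<Sum>s\<in>keys W \<kappa>. \<Sum>M\<in>U. \<Sum>M'\<in>U. q (msg (s, M, M')) * (1 / 2 + \<delta>))"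
    unfolding upo_win_def U_def[symmetric] by (intro sum_mono inner)
  also have "\<dots> = (\<Sum>a\<in>keys W \<kappa> \<times> U \<times> U. q (msg a) * (1 / 2 + \<delta>))"
    by (simp add: sum.cartesian_product case_prod_unfold)
  also have "\<dots> = (\<Sum>m\<in>msg ` (keys W \<kappa> \<times> U \<times> U). q m) * (1 / 2 + \<delta>)"
    by (simp add: sum.reindex[OF msg_inj] sum_distrib_right)
  also have "\<dots> \<le> (\<Sum>m\<in>bits (kl + 2 * dl). q m) * (1 / 2 + \<delta>)"
    using \<delta> msg_bits q_nonneg by (intro mult_right_mono sum_mono2) auto
  finally show ?thesis by (simp add: q_sum)
qed

text \<open>Encryption and one-way function run at the root \<open>r \<kappa>\<close>, the
  obfuscator at \<kappa>. The concrete bounds hold at almost every parameter and are here combined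
  with explicit exponents.\<close>

lemma upo_win_eventually_le:
  fixes Gen Enc Dec :: "nat \<Rightarrow> circ"
  assumes owf: "pq_injective_owf F" and ue: "unclonable_bit_encryption Gen Enc Dec" and qsio: "qsio_scheme Obf Eval"
    and punct: "generalized_puncturable W ua ug GP"
    and d: "0 < d" "\<forall>\<^sub>F \<kappa> in sequentially. nout (Gen (nth_root_nat d \<kappa>)) + nout (Gen (nth_root_nat d \<kappa>)) * nth_root_nat d \<kappa> \<le> kc_in W \<kappa>"
    and k: "\<And>\<kappa>. kc_anc W \<kappa> \<le> pad_size k \<kappa>" "\<And>\<kappa>. kc_gates W \<kappa> \<le> pad_size k \<kappa>"
      "\<And>\<kappa>. (let m = nth_root_nat d \<kappa> in program_size (kc_in W \<kappa>) (nout (Gen m)) m (nout (F m)) (nout (Enc m)) (kc_out W \<kappa>) (csize (F m))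
         ((kc_in W \<kappa> + kc_anc W \<kappa> + kc_out W \<kappa> + kc_gates W \<kappa>) + (kc_in W \<kappa> + ua \<kappa> + kc_out W \<kappa> + ug \<kappa>)) (csize (Dec m))) \<le> pad_size k \<kappa>"
    and \<A>: "qpt_cloning_adversary (\<lambda>\<kappa>. key_len W \<kappa> + 2 * desc_length (kc_in W \<kappa> + ua \<kappa>) (ug \<kappa>)) (upo_len W k Obf) (kc_in W) \<A>"
  shows "\<forall>\<^sub>F \<kappa> in sequentially. upo_win W ua ug GP (Id_U W) k Obf \<A> \<kappa> \<le> 1 / 2 + 1 / real \<kappa> ^ c"
proof -
  define r where "r = nth_root_nat d"
  define p where "p = pad_size k"
  define n where "n = kc_in W"
  define Ob where "Ob \<kappa> = Obf [\<kappa>, n \<kappa>, p \<kappa>, p \<kappa>, kc_out W \<kappa>, p \<kappa>]" for \<kappa>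
  define l where "l \<kappa> = nout (Gen (r \<kappa>))" for \<kappa>
  define cl where "cl \<kappa> = nout (Enc (r \<kappa>))" for \<kappa>
  have kc: "keyed_circuit_class W" using punct by (simp add: generalized_puncturable_def)
  have ob: "efficient 6 Obf" "obf_interface Obf Eval" "qsio_secure Obf" using qsio by (simp_all add: qsio_scheme_def)
  have eff: "efficient1 Gen" "efficient1 Enc" "efficient1 Dec" "efficient1 F"
    using ue owf by (simp_all add: unclonable_bit_encryption_def pq_injective_owf_def)
  have poly_root: "poly_bounded (\<lambda>\<kappa>. q (r \<kappa>))" if "poly_bounded q" for q
    using that poly_bounded_mono[OF poly_bounded_id nth_root_nat_le[OF d(1)]] unfolding r_def by (rule poly_bounded_compose)
  have poly: "poly_bounded n" "poly_bounded (kc_out W)" "poly_bounded p"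
    using kc poly_bounded_pad_size by (auto simp: n_def p_def keyed_circuit_class_def)
  have poly_l: "poly_bounded l" "poly_bounded cl" unfolding l_def cl_def
    by (rule poly_bounded_mono[OF poly_root[OF efficient1_size[OF eff(1)]] csize_ge(3)],
        rule poly_bounded_mono[OF poly_root[OF efficient1_size[OF eff(2)]] csize_ge(3)])
  have poly_Ob: "poly_bounded (\<lambda>\<kappa>. csize (Ob \<kappa>))" unfolding Ob_def
  proof (rule efficient_size[OF ob(1)])
    fix i :: nat assume "i < 6"
    then have "i \<in> {0, 1, 2, 3, 4, 5}" by auto
    then show "poly_bounded (\<lambda>\<kappa>. [\<kappa>, n \<kappa>, p \<kappa>, p \<kappa>, kc_out W \<kappa>, p \<kappa>] ! i)"
      using poly poly_bounded_id by auto
  qed simp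
  note adv = \<A>[unfolded qpt_cloning_adversary_def poly_family_def]
  have poly_\<A>: "poly_bounded (\<lambda>\<kappa>. csize (stage2 \<A> \<kappa>))" "poly_bounded (\<lambda>\<kappa>. csize (partyB \<A> \<kappa>))" "poly_bounded (\<lambda>\<kappa>. csize (partyC \<A> \<kappa>))"
    using adv by auto
  define S where "S \<kappa> = csize (stage2 \<A> \<kappa>) + csize (partyB \<A> \<kappa>) + csize (partyC \<A> \<kappa>)" for \<kappa>
  \<comment> \<open>The second copy of \<open>S\<close> pays for \<open>st\<close>, the number of
    qubits kept by \<A>, which are inputs of its second stage.\<close>
  define SU where "SU \<kappa> = 1000000 * (csize (Ob \<kappa>) + 2 * S \<kappa> + l \<kappa> + n \<kappa> + cl \<kappa> + p \<kappa> + desc_length (n \<kappa> + p \<kappa> + p \<kappa>) (p \<kappa>) + 1)" for \<kappa>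
  define SA where "SA \<kappa> = 10000000 * (csize (Ob \<kappa>) + 10000000 * S \<kappa>)" for \<kappa>
  define SQ where "SQ \<kappa> = n \<kappa> + kc_out W \<kappa> + 3 * p \<kappa> + 10000000 * S \<kappa>" for \<kappa>
  note intros = poly_bounded_intros poly poly_l poly_Ob poly_\<A>
  have "poly_bounded SU" "poly_bounded SA" and SQ: "poly_bounded SQ"
    unfolding SU_def SA_def SQ_def S_def desc_length_def by (intro intros)+
  then obtain BU BA where BU: "poly_bounded BU" "\<And>\<kappa>. SU \<kappa> \<le> BU (r \<kappa>)" and BA: "poly_bounded BA" "\<And>\<kappa>. SA \<kappa> \<le> BA (r \<kappa>)"
    using poly_bounded_root_nat[OF d(1)] unfolding r_def by metis
  have "poly_bounded (\<lambda>\<kappa>. 2 * l \<kappa>)" by (intro intros)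
  then obtain j where j: "\<forall>\<^sub>F \<kappa> in sequentially. 2 * l \<kappa> \<le> \<kappa> ^ j" using poly_bounded_eventually_le_power by blast
  obtain \<epsilon> where \<epsilon>: "negligible \<epsilon>" "\<And>m b. 1 - \<epsilon> m \<le> (\<Sum>sk\<in>bits (nout (Gen m)). prob_out (run (Gen m) (basis [])) sk *
        prob_out (run (Dec m) (tensor (nout (Gen m)) (basis sk) (run (Enc m) (basis (sk @ [b]))))) [b])"
    using ue unfolding unclonable_bit_encryption_def ue_correct_def by blast
  have "negligible (\<lambda>m. \<bar>\<epsilon> m\<bar>)" using \<epsilon>(1) by (simp add: negligible_def)
  then have \<epsilon>': "negligible (\<lambda>\<kappa>. \<bar>\<epsilon> (r \<kappa>)\<bar>)" unfolding r_def by (rule negligible_root_nat[OF d(1)])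
  have "\<forall>\<^sub>F \<kappa> in sequentially. 2 \<le> r \<kappa>"
    using eventually_root_nat[OF d(1) eventually_ge_at_top[of 2]] unfolding r_def .
  \<comment> \<open>Error budget: obfuscation and encryption may each lose \<kappa>^-(c+1), and so
    may all hybrids together. With \<open>2 * l \<kappa>\<close> at most
    \<open>\<kappa> ^ j\<close>, one hybrid may lose \<kappa>^-(c+1+j), whose square is demanded of
    the one-way function. The factor \<open>2 * d\<close> translates exponents from \<kappa> to the
    root, and three times \<kappa>^-(c+1) is at most \<kappa>^-c once \<kappa> is at least
    3.\<close>
  from this eventually_ge_at_top[of 3] d(2)[folded r_def] j
    qsio_concrete[OF ob(1,3) SQ \<epsilon>' abs_ge_zero, of "c + 1"]
    eventually_root_nat[OF d(1) ue_concrete[OF ue BU(1), of "2 * d * (c + 1)"], folded r_def]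
    eventually_root_nat[OF d(1) owf_concrete[OF owf BA(1), of "2 * d * (2 * (c + 1 + j))"], folded r_def]
  show ?thesis
  proof eventually_elim
    case (elim \<kappa>)
    let ?m = "r \<kappa>" and ?\<eta> = "1 / real \<kappa> ^ (c + 1 + j)" and ?\<eta>1 = "1 / real \<kappa> ^ (c + 1)"
    obtain st rB rC where str: "nout (stage1 \<A> \<kappa>) = key_len W \<kappa> + 2 * desc_length (kc_in W \<kappa> + ua \<kappa>) (ug \<kappa>) + st"
      "nin (stage2 \<A> \<kappa>) = upo_len W k Obf \<kappa> + st" "nout (stage2 \<A> \<kappa>) = rB + rC"
      "nin (partyB \<A> \<kappa>) = n \<kappa> + rB" "nin (partyC \<A> \<kappa>) = n \<kappa> + rC" "nout (partyB \<A> \<kappa>) = 1" "nout (partyC \<A> \<kappa>) = 1"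
      using adv unfolding n_def by blast
    have ul: "upo_len W k Obf \<kappa> = nout (Ob \<kappa>)" by (simp add: upo_len_def Let_def Ob_def n_def p_def)
    have st: "st \<le> csize (stage2 \<A> \<kappa>)" using csize_ge(1)[of "stage2 \<A> \<kappa>"] str(2) by linarith
    have inv: "1 / real ?m ^ (2 * d * e) \<le> 1 / real \<kappa> ^ e" for e
      using root_nat_inverse_power[OF d(1)] elim(1) unfolding r_def by blast
    have "upo_win W ua ug GP (Id_U W) k Obf \<A> \<kappa> \<le> 1 / 2 + (?\<eta>1 + real (2 * l \<kappa>) * ?\<eta> + ?\<eta>1)"
    proof (rule upo_win_le[OF punct _ _ str(1)])
      fix \<phi> V M G
      assume h: "density st \<phi>" "V \<in> kc_shape W \<kappa>" "M \<in> mu_circs W ua ug \<kappa>"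
        "\<And>x. x \<in> bits (kc_in W \<kappa>) \<Longrightarrow> G x \<in> kc_shape W \<kappa>"
        "\<And>x y. x \<in> bits (kc_in W \<kappa>) \<Longrightarrow> y \<in> bits (kc_in W \<kappa>) \<Longrightarrow> ceval (G x) y = (if y = x then ceval M y else ceval V y)"
      note sh = h(2-5)[unfolded kc_shape_def mu_circs_def]
      show "(\<Sum>x\<in>bits (kc_in W \<kappa>). \<Sum>b\<in>UNIV. 1 / 2 * joint_prob (\<lambda>\<sigma>. run (partyB \<A> \<kappa>) (tensor (kc_in W \<kappa>) (basis x) \<sigma>))
         (\<lambda>\<sigma>. run (partyC \<A> \<kappa>) (tensor (kc_in W \<kappa>) (basis x) \<sigma>))
         (run (stage2 \<A> \<kappa>) (tensor (upo_len W k Obf \<kappa>) (upo_obf k Obf \<kappa> (if b then G x else V)) \<phi>)) [b] [b])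
        \<le> 2 ^ kc_in W \<kappa> * (1 / 2 + (?\<eta>1 + real (2 * l \<kappa>) * ?\<eta> + ?\<eta>1))"
        unfolding ul
      proof (rule fixed_message_bound[where Gen = Gen and Enc = Enc and Dec = Dec and k' = ?m and F = "F ?m" and m = ?m
            and M = M and \<epsilon> = "\<bar>\<epsilon> ?m\<bar>" and su = "SU \<kappa>" and sq = "SQ \<kappa>" and p = "p \<kappa>"])
        show "wf_circ (F ?m)" "wf_circ (Gen ?m)" "wf_circ (Enc ?m)" "wf_circ (Dec ?m)" using eff efficient1_wf by blast+
        show "classical (F ?m)" "nin (F ?m) = ?m" "inj_on (ceval (F ?m)) (bits ?m)" using owf by (auto simp: pq_injective_owf_def)
        show "nin (Gen ?m) = 0" "nin (Enc ?m) = l \<kappa> + 1" "nin (Dec ?m) = l \<kappa> + cl \<kappa>" "nout (Dec ?m) = 1"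
          using ue by (auto simp: unclonable_bit_encryption_def l_def cl_def)
        show "l \<kappa> + l \<kappa> * ?m \<le> kc_in W \<kappa>" using elim(3) by (simp add: l_def)
        show "V \<in> classical_circs (kc_in W \<kappa>) (kc_anc W \<kappa>) (kc_out W \<kappa>) (kc_gates W \<kappa>)"
          "M \<in> classical_circs (kc_in W \<kappa>) (ua \<kappa>) (kc_out W \<kappa>) (ug \<kappa>)" by (rule sh)+
        show "G x \<in> classical_circs (kc_in W \<kappa>) (kc_anc W \<kappa>) (kc_out W \<kappa>) (kc_gates W \<kappa>)" if "x \<in> bits (kc_in W \<kappa>)" for x
          using sh(3)[OF that] .
        show "program_size (kc_in W \<kappa>) (l \<kappa>) ?m (nout (F ?m)) (cl \<kappa>) (kc_out W \<kappa>) (csize (F ?m))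
         ((kc_in W \<kappa> + kc_anc W \<kappa> + kc_out W \<kappa> + kc_gates W \<kappa>) + (kc_in W \<kappa> + ua \<kappa> + kc_out W \<kappa> + ug \<kappa>)) (csize (Dec ?m)) \<le> p \<kappa>"
          using k(3)[of \<kappa>] unfolding Let_def l_def cl_def p_def r_def .
        show "kc_anc W \<kappa> \<le> p \<kappa>" "kc_gates W \<kappa> \<le> p \<kappa>" using k by (simp_all add: p_def)
        show "wf_circ (Ob \<kappa>)" unfolding Ob_def by (rule efficient_wf[OF ob(1)]) simp
        show "nin (Ob \<kappa>) = desc_length (kc_in W \<kappa> + p \<kappa> + p \<kappa>) (p \<kappa>) + p \<kappa>"
          using ob(2) by (simp add: obf_interface_def Ob_def n_def)
        show "wf_circ (stage2 \<A> \<kappa>)" "wf_circ (partyB \<A> \<kappa>)" "wf_circ (partyC \<A> \<kappa>)" using adv by auto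
        show "1 - \<bar>\<epsilon> ?m\<bar> \<le> (\<Sum>sk\<in>bits (l \<kappa>). prob_out (run (Gen ?m) (basis [])) sk *
            prob_out (run (Dec ?m) (tensor (l \<kappa>) (basis sk) (run (Enc ?m) (basis (sk @ [b]))))) [b])" for b
          using \<epsilon>(2)[of ?m b] unfolding l_def by linarith
        show "owf_bound (F ?m) (10000000 * (csize (Ob \<kappa>) + 10000000 * (csize (stage2 \<A> \<kappa>) + csize (partyB \<A> \<kappa>) + csize (partyC \<A> \<kappa>)))) (?\<eta>\<^sup>2)"
        proof (rule owf_bound_mono[OF elim(7)])
          have "1 / real ?m ^ (2 * d * (2 * (c + 1 + j))) \<le> 1 / real \<kappa> ^ (2 * (c + 1 + j))" by (rule inv)
          also have "\<dots> = ?\<eta>\<^sup>2" by (simp only: power_one_over[symmetric] power_mult[symmetric] mult.commute)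
          finally show "1 / real ?m ^ (2 * d * (2 * (c + 1 + j))) \<le> ?\<eta>\<^sup>2" .
        qed (use BA(2)[of \<kappa>] in \<open>simp add: SA_def S_def\<close>)
        show "ue_bound Gen Enc ?m (SU \<kappa>) ?\<eta>1" by (rule ue_bound_mono[OF elim(6) BU(2) inv])
        show "qsio_bound Obf \<kappa> (SQ \<kappa>) \<bar>\<epsilon> ?m\<bar> ?\<eta>1" by (rule elim(5))
        show "nin (stage2 \<A> \<kappa>) = nout (Ob \<kappa>) + st" using str(2) ul by simp
        show "1000000 * (csize (Ob \<kappa>) + csize (stage2 \<A> \<kappa>) + csize (partyB \<A> \<kappa>) + csize (partyC \<A> \<kappa>) + l \<kappa> + kc_in W \<kappa> + cl \<kappa> + p \<kappa> + st
            + desc_length (kc_in W \<kappa> + p \<kappa> + p \<kappa>) (p \<kappa>) + 1) \<le> SU \<kappa>"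
          using st unfolding SU_def S_def n_def by (intro mult_le_mono2) simp
      qed (use h str sh(4) in \<open>auto simp: l_def cl_def Ob_def n_def p_def SQ_def S_def\<close>)
    qed (use adv in auto)
    also have "\<dots> \<le> 1 / 2 + 1 / real \<kappa> ^ c"
    proof -
      have "real (2 * l \<kappa>) * ?\<eta> \<le> real (\<kappa> ^ j) * ?\<eta>"
        using elim(4) by (intro mult_right_mono) (auto simp del: of_nat_power of_nat_mult)
      also have "\<dots> = ?\<eta>1" using elim(2) by (simp add: power_add)
      finally have "?\<eta>1 + real (2 * l \<kappa>) * ?\<eta> + ?\<eta>1 \<le> 3 * ?\<eta>1" by linarith
      also have "\<dots> \<le> real \<kappa> * ?\<eta>1" using elim(2) by (intro mult_right_mono) auto
      also have "\<dots> = 1 / real \<kappa> ^ c" using elim(2) by simp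
      finally show ?thesis by simp
    qed
    finally show ?case .
  qed
qed

theorem corollary52:
  fixes Obf Eval :: "nat list \<Rightarrow> circ"
    and W :: keyed_class and ua ug :: "nat \<Rightarrow> nat" and GP :: puncture_alg
  assumes owf: "\<exists>F. pq_injective_owf F"
    and ue: "\<exists>Gen Enc Dec. unclonable_bit_encryption Gen Enc Dec"
    and qsio: "qsio_scheme Obf Eval"
    and puncturable: "generalized_puncturable W ua ug GP"
    and input_length: "poly_growing (kc_in W)"
  shows "\<exists>k0. \<forall>k\<ge>k0. upo_scheme W k Obf Eval \<and> generalized_upo_secure W ua ug GP (Id_U W) k Obf"
proof -
  obtain F Gen Enc Dec where F: "pq_injective_owf F" and E: "unclonable_bit_encryption Gen Enc Dec" using owf ue by blast
  have eff: "efficient1 Gen" "efficient1 Enc" "efficient1 Dec" "efficient1 F"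
    using E F by (simp_all add: unclonable_bit_encryption_def pq_injective_owf_def)
  have poly: "poly_bounded (kc_in W)" "poly_bounded (kc_out W)" "poly_bounded (kc_anc W)" "poly_bounded (kc_gates W)"
      "poly_bounded ua" "poly_bounded ug" and kc: "keyed_circuit_class W"
    using puncturable by (auto simp: generalized_puncturable_def keyed_circuit_class_def)
  have nout: "poly_bounded (\<lambda>m. nout (C m))" if "efficient1 C" for C
    by (rule poly_bounded_mono[OF efficient1_size[OF that] csize_ge(3)])
  have "poly_bounded (\<lambda>m. nout (Gen m) + nout (Gen m) * m)" by (intro poly_bounded_intros nout eff)
  then obtain d where d: "0 < d" "\<forall>\<^sub>F \<kappa> in sequentially. nout (Gen (nth_root_nat d \<kappa>)) + nout (Gen (nth_root_nat d \<kappa>)) * nth_root_nat d \<kappa> \<le> kc_in W \<kappa>"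
    using ex_root_degree[OF _ input_length] by blast
  have poly_root: "poly_bounded (\<lambda>\<kappa>. q (nth_root_nat d \<kappa>))" if "poly_bounded q" for q
    using that poly_bounded_mono[OF poly_bounded_id nth_root_nat_le[OF d(1)]] by (rule poly_bounded_compose)
  define PS where "PS \<kappa> = (let m = nth_root_nat d \<kappa> in program_size (kc_in W \<kappa>) (nout (Gen m)) m (nout (F m)) (nout (Enc m)) (kc_out W \<kappa>) (csize (F m))
         ((kc_in W \<kappa> + kc_anc W \<kappa> + kc_out W \<kappa> + kc_gates W \<kappa>) + (kc_in W \<kappa> + ua \<kappa> + kc_out W \<kappa> + ug \<kappa>)) (csize (Dec m)))" for \<kappa>
  have "poly_bounded (\<lambda>\<kappa>. PS \<kappa> + kc_anc W \<kappa> + kc_gates W \<kappa>)"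
    unfolding PS_def Let_def program_size_def
    by (intro poly_bounded_intros poly poly_root[OF nout[OF eff(1)]] poly_root[OF nout[OF eff(2)]] poly_root[OF nout[OF eff(4)]]
        poly_root[OF efficient1_size[OF eff(3)]] poly_root[OF efficient1_size[OF eff(4)]] poly_root[OF poly_bounded_id])
  \<comment> \<open>The padding must hold the hidden program and is fixed before any adversary; this
    works because \<open>PS\<close> depends only on the encryption scheme, the one-way function, the
    class and \<open>d\<close>.\<close>
  then obtain k0 where k0: "\<And>k \<kappa>. k \<ge> k0 \<Longrightarrow> PS \<kappa> + kc_anc W \<kappa> + kc_gates W \<kappa> \<le> pad_size k \<kappa>"
    using poly_bounded_pad_size_ge by blast
  have "upo_scheme W k Obf Eval \<and> generalized_upo_secure W ua ug GP (Id_U W) k Obf" if "k \<ge> k0" for k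
  proof
    have k: "PS \<kappa> \<le> pad_size k \<kappa>" "kc_anc W \<kappa> \<le> pad_size k \<kappa>" "kc_gates W \<kappa> \<le> pad_size k \<kappa>" for \<kappa>
      using k0[OF that, of \<kappa>] by linarith+
    show "upo_scheme W k Obf Eval"
      using qsio upo_correct_if_qsio_correct[OF kc _ k(2)] by (simp add: upo_scheme_def qsio_scheme_def)
    show "generalized_upo_secure W ua ug GP (Id_U W) k Obf"
      unfolding generalized_upo_secure_def
    proof (intro allI impI)
      fix \<A> assume \<A>: "qpt_cloning_adversary (\<lambda>\<kappa>. key_len W \<kappa> + 2 * desc_length (kc_in W \<kappa> + ua \<kappa>) (ug \<kappa>)) (upo_len W k Obf) (kc_in W) \<A>"
      let ?w = "upo_win W ua ug GP (Id_U W) k Obf \<A>"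
      \<comment> \<open>The excess over 1/2, cut off at 0: the game value may lie far below 1/2,
        whereas \<open>negligible\<close> bounds absolute values.\<close>
      define \<epsilon> where "\<epsilon> \<kappa> = max 0 (?w \<kappa> - 1 / 2)" for \<kappa>
      have ev: "\<forall>\<^sub>F \<kappa> in sequentially. ?w \<kappa> \<le> 1 / 2 + 1 / real \<kappa> ^ c" for c
        by (rule upo_win_eventually_le[OF F E qsio puncturable d k(2,3) k(1)[unfolded PS_def] \<A>])
      have "\<forall>\<^sub>F \<kappa> in sequentially. \<bar>\<epsilon> \<kappa>\<bar> \<le> 1 / real \<kappa> ^ c" for c
        using ev[of c] by (rule eventually_mono) (simp add: \<epsilon>_def)
      then have "negligible \<epsilon>" unfolding negligible_def by blast
      moreover have "?w \<kappa> \<le> 1 / 2 + \<epsilon> \<kappa>" for \<kappa> by (simp add: \<epsilon>_def)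
      ultimately show "\<exists>\<epsilon>. negligible \<epsilon> \<and> (\<forall>\<kappa>. ?w \<kappa> \<le> 1 / 2 + \<epsilon> \<kappa>)" by blast
    qed
  qed
  then show ?thesis by blast
qed

end
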